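(* Let $\Omega\subseteq\mathbb{R}^3$ be a bounded domain and let $\rho:\Omega\times[0,\infty)\to\mathbb{R}$ and $\vec\jmath:\Omega\times[0,\infty)\to\mathbb{R}^3$ be continuously differentiable. Suppose that $\operatorname{div}\vec\jmath+\partial_t\rho=0$. Let $h_1,h_2$ be harmonic functions on $\Omega$ independent of time, and let $$u_0:=\operatorname{Sc}\,T_{\mathscr{C},-}\left[-4\pi i(\rho-i\vec\jmath)\right].$$ Define $$\begin{aligned}\vec E(x,t)&=\operatorname{Re}\left(\operatorname{Vec}\left(\int_0^t\int_{\mathbb{R}^3}\exp(2\pi i\langle x,k\rangle)\exp(2\pi(t-s)k)\,\mathcal{F}\left(-4\pi i(\rho-i\vec\jmath)\right)(k,s)\,dk\,ds\right)\right)\\&\quad-\operatorname{Im}\left\{\int_0^t\nabla_xu_0(x,s)\,ds-T_\Omega[\partial_tu_0](x,0)\right\}+\nabla h_1(x),\end{aligned}$$ $$\begin{aligned}\vec B(x,t)&=\operatorname{Im}\left(\operatorname{Vec}\left(\int_0^t\int_{\mathbb{R}^3}\exp(2\pi i\langle x,k\rangle)\exp(2\pi(t-s)k)\,\mathcal{F}\left(-4\pi i(\rho-i\vec\jmath)\right)(k,s)\,dk\,ds\right)\right)\\&\quad+\operatorname{Re}\left\{\int_0^t\nabla_xu_0(x,s)\,ds-T_\Omega[\partial_tu_0](x,0)\right\}+\nabla h_2(x).\end{aligned}$$ Then $(\vec E,\vec B)$ is a solution of Maxwell's system $$\operatorname{div}\vec E=4\pi\rho,\qquad\operatorname{div}\vec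 B=0,\qquad\operatorname{curl}\vec E=-\partial_t\vec B,\qquad\operatorname{curl}\vec B=4\pi\vec\jmath+\partial_t\vec E .$$
   Context: $\mathscr{C}=\Omega\times(0,\infty)$. $\mathbb{B}=\mathbb{H}+i\mathbb{H}$ denotes the biquaternions, where $\mathbb{H}$ is the real quaternions with units $1,e_1,e_2,e_3$ and the complex imaginary unit $i$ commutes with $e_1,e_2,e_3$. For $w=u+iv=(u_0+\vec u)+i(v_0+\vec v)$ with $u,v\in\mathbb{H}$: $\operatorname{Re}w=u$, $\operatorname{Im}w=v$, $\operatorname{Sc}w=u_0+iv_0$, $\operatorname{Vec}w=\vec u+i\vec v$. Vectors in $\mathbb{R}^3$ or $\mathbb{C}^3$ are identified with $\sum_{j=1}^3x_je_j$; in particular $\rho-i\vec\jmath$ is the biquaternion with scalar part $\rho$ and vector part $-i\vec\jmath$. Functions on $\mathscr{C}$ are extended by zero for $x\in\mathbb{R}^3\setminus\overline\Omega$. The Fourier transform is taken in the spatial variable only, componentwise: $\mathcal{F}(w)(k,s)=\int_{\mathbb{R}^3}\exp(-2\pi i\langle k,x\rangle)w(x,s)\,dx$, with $\langle k,x\rangle=\sum_{j=1}^3k_jx_j$, extended to $L^2(\mathbb{R}^3)$ as usual, with inverse $\mathcal{F}^{-1}(f)(x)=\mathcal{F}(f)(-x)$; integrals $\int_{\mathbb{R}^3}\exp(2\pi i\langle x,k\rangle)g(k)\,dk$ with $g\in L^2(\mathbb{R}^3)$ stand for $\mathcal{F}^{-1}(g)(x)$. The parabolic Teodorescu transform with lower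 sign is $$T_{\mathscr{C},-}[w](x,t)=\int_0^t\int_{\mathbb{R}^3}\exp(2\pi i\langle x,k\rangle)\exp(2\pi k(t-s))\,\mathcal{F}(w)(k,s)\,dk\,ds,$$ where in the quaternionic exponential $k$ is identified with $\sum_{j=1}^3k_je_j$ and $\exp(2\pi k\tau)=\cos(2\pi|k|\tau)+\frac{k}{|k|}\sin(2\pi|k|\tau)$. The Cauchy kernel is $E(x)=\dfrac{-x}{4\pi|x|^3}$ (not to be confused with the electric field $\vec E$), and the Teodorescu transform is $T_\Omega[w](x)=-\int_\Omega E(y-x)w(y)\,dy$; $T_\Omega[\partial_tu_0](x,0)$ denotes $T_\Omega$ applied to $y\mapsto\partial_tu_0(y,0)$, evaluated at $x$.
   Formalization: Maxwell's system and the derivatives of u_0 hold in the sense of distributions on Ω at each t>0 (E, B need not be differentiable), and ρ-ij, extended by zero, is assumed square-integrable in x for each time with L² norm locally integrable in time, so that the transform is defined. *)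

theory Defs
  imports "HOL-Analysis.Analysis"
begin

text \<open>
  A biquaternion \<open>w = (u\<^sub>0 + v\<^sub>0 i) + (u + i v)\<close> is stored as its complex scalar part and its complex
  vector part, the latter with coordinates with respect to \<open>e\<^sub>1, e\<^sub>2, e\<^sub>3\<close>. The product type supplies the
  Euclidean norm and componentwise integration.
\<close>

type_synonym biquat = "complex \<times> (complex^3)"

abbreviation Sc :: "biquat \<Rightarrow> complex" where "Sc \<equiv> fst"
abbreviation Vec :: "biquat \<Rightarrow> complex^3" where "Vec \<equiv> snd"

definition Re_vec :: "complex^3 \<Rightarrow> real^3" where
  "Re_vec v = (\<chi> m. Re (v $ m))"

definition Im_vec :: "complex^3 \<Rightarrow> real^3" where
  "Im_vec v = (\<chi> m. Im (v $ m))"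

definition cvec :: "real^3 \<Rightarrow> complex^3" where
  "cvec v = (\<chi> m. complex_of_real (v $ m))"

definition ccross :: "complex^3 \<Rightarrow> complex^3 \<Rightarrow> complex^3" where
  "ccross a b = vector [a $ 2 * b $ 3 - a $ 3 * b $ 2,
                        a $ 3 * b $ 1 - a $ 1 * b $ 3,
                        a $ 1 * b $ 2 - a $ 2 * b $ 1]"

text \<open>The complex-bilinear extension of the Hamilton product.\<close>

definition bmult :: "biquat \<Rightarrow> biquat \<Rightarrow> biquat" (infixl "\<star>" 70) where
  "p \<star> q = (Sc p * Sc q - (\<Sum>m\<in>UNIV. Vec p $ m * Vec q $ m),
            Sc p *s Vec q + Sc q *s Vec p + ccross (Vec p) (Vec q))"

definition cscale :: "complex \<Rightarrow> biquat \<Rightarrow> biquat" (infixr "*\<^sub>B" 75) where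
  "c *\<^sub>B p = (c * Sc p, c *s Vec p)"

text \<open>\<open>qexp k \<tau>\<close> is \<open>exp (2 \<pi> k \<tau>)\<close>; at \<open>k = 0\<close> division by zero gives the correct value \<open>1\<close>.\<close>

definition qexp :: "real^3 \<Rightarrow> real \<Rightarrow> biquat" where
  "qexp k \<tau> = (complex_of_real (cos (2 * pi * norm k * \<tau>)),
               cvec ((sin (2 * pi * norm k * \<tau>) / norm k) *\<^sub>R k))"


definition L2 :: "(real^3 \<Rightarrow> 'b::euclidean_space) \<Rightarrow> bool" where
  "L2 f \<longleftrightarrow> f \<in> borel_measurable lborel \<and> integrable lborel (\<lambda>x. (norm (f x))\<^sup>2)"

definition fourier_integral :: "(real^3 \<Rightarrow> biquat) \<Rightarrow> real^3 \<Rightarrow> biquat" where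
  "fourier_integral f k = (LINT x|lborel. exp (- 2 * pi * \<i> * complex_of_real (k \<bullet> x)) *\<^sub>B f x)"

text \<open>
  On integrable functions the transform is given by the integral; on the remaining functions of
  \<open>L\<^sup>2\<close> it is (a representative of) the \<open>L\<^sup>2\<close>-limit of the transforms of the truncations to balls.
\<close>

definition fourier :: "(real^3 \<Rightarrow> biquat) \<Rightarrow> real^3 \<Rightarrow> biquat" where
  "fourier f =
    (if integrable lborel f then fourier_integral f
     else (SOME g. L2 g \<and>
       (\<lambda>n. \<integral>\<^sup>+k. ennreal ((norm (g k -
              fourier_integral (\<lambda>x. indicator (ball 0 (real n)) x *\<^sub>R f x) k))\<^sup>2) \<partial>lborel)
         \<longlonglongrightarrow> 0))"

definition inv_fourier :: "(real^3 \<Rightarrow> biquat) \<Rightarrow> real^3 \<Rightarrow> biquat" where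
  "inv_fourier f x = fourier f (- x)"


text \<open>
  Inverse transforms of \<open>L\<^sup>2\<close>-functions are only determined almost everywhere, separately for each
  time, so the time integral is that of an \<open>L\<^sup>2\<close>-valued function. It is characterised by
  testing against scalar \<open>L\<^sup>2\<close>-functions and does not depend on the choice of representatives.
\<close>

definition has_L2_integral ::
  "(real \<Rightarrow> real^3 \<Rightarrow> biquat) \<Rightarrow> (real^3 \<Rightarrow> biquat) \<Rightarrow> real \<Rightarrow> bool" where
  "has_L2_integral V U t \<longleftrightarrow>
     L2 U \<and> (AE s in lborel. s \<in> {0..t} \<longrightarrow> L2 (V s)) \<and>
     (\<forall>\<phi> :: real^3 \<Rightarrow> complex. L2 \<phi> \<longrightarrow>
        set_integrable lborel {0..t} (\<lambda>s. LINT x|lborel. \<phi> x *\<^sub>B V s x) \<and>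
        (LINT x|lborel. \<phi> x *\<^sub>B U x) = (LINT s:{0..t}|lborel. (LINT x|lborel. \<phi> x *\<^sub>B V s x)))"

definition L2_integral :: "(real \<Rightarrow> real^3 \<Rightarrow> biquat) \<Rightarrow> real \<Rightarrow> real^3 \<Rightarrow> biquat" where
  "L2_integral V t = (SOME U. has_L2_integral V U t)"

definition parabolic_teodorescu :: "(real^3 \<Rightarrow> real \<Rightarrow> biquat) \<Rightarrow> real^3 \<Rightarrow> real \<Rightarrow> biquat" where
  "parabolic_teodorescu w x t =
     L2_integral (\<lambda>s. inv_fourier (\<lambda>k. qexp k (t - s) \<star> fourier (\<lambda>y. w y s) k)) t x"

text \<open>
  The domain of the transform: \<open>w(\<cdot>, s)\<close> lies in \<open>L\<^sup>2\<close>, and its norm is locally integrable in \<open>s\<close>.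
\<close>

definition L1loc_L2 :: "(real^3 \<Rightarrow> real \<Rightarrow> biquat) \<Rightarrow> bool" where
  "L1loc_L2 w \<longleftrightarrow>
     (\<forall>s\<ge>0. L2 (\<lambda>x. w x s)) \<and>
     (\<forall>t>0. set_integrable lborel {0..t} (\<lambda>s. sqrt (LINT x|lborel. (norm (w x s))\<^sup>2)))"


definition cauchy_kernel :: "real^3 \<Rightarrow> biquat" where
  "cauchy_kernel x = (0, cvec ((- 1 / (4 * pi * norm x ^ 3)) *\<^sub>R x))"

definition teodorescu :: "(real^3) set \<Rightarrow> (real^3 \<Rightarrow> biquat) \<Rightarrow> real^3 \<Rightarrow> biquat" where
  "teodorescu \<Omega> w x = - (LINT y:\<Omega>|lborel. cauchy_kernel (y - x) \<star> w y)"


text \<open>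
  The derivative is taken within the set, so that \<open>\<Omega> \<times> {0..}\<close> has one-sided time derivatives at
  time \<open>0\<close>.
\<close>

definition C1_on :: "'a::real_normed_vector set \<Rightarrow> ('a \<Rightarrow> 'b::real_normed_vector) \<Rightarrow> bool" where
  "C1_on S f \<longleftrightarrow>
     (\<exists>f' :: 'a \<Rightarrow> 'a \<Rightarrow>\<^sub>L 'b.
        (\<forall>p\<in>S. (f has_derivative blinfun_apply (f' p)) (at p within S)) \<and> continuous_on S f')"

definition partial_deriv :: "3 \<Rightarrow> (real^3 \<Rightarrow> real) \<Rightarrow> real^3 \<Rightarrow> real" where
  "partial_deriv m f x = frechet_derivative f (at x) (axis m 1)"

definition grad :: "(real^3 \<Rightarrow> real) \<Rightarrow> real^3 \<Rightarrow> real^3" where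
  "grad f x = (\<chi> m. partial_deriv m f x)"

definition divergence :: "(real^3 \<Rightarrow> real^3) \<Rightarrow> real^3 \<Rightarrow> real" where
  "divergence F x = (\<Sum>m\<in>UNIV. partial_deriv m (\<lambda>y. F y $ m) x)"

definition harmonic_on :: "(real^3) set \<Rightarrow> (real^3 \<Rightarrow> real) \<Rightarrow> bool" where
  "harmonic_on \<Omega> h \<longleftrightarrow>
     C1_on \<Omega> h \<and> (\<forall>m. C1_on \<Omega> (partial_deriv m h)) \<and>
     (\<forall>x\<in>\<Omega>. (\<Sum>m\<in>UNIV. partial_deriv m (partial_deriv m h) x) = 0)"


primrec Ck :: "nat \<Rightarrow> (real^3 \<Rightarrow> real) \<Rightarrow> bool" where
  "Ck 0 f \<longleftrightarrow> continuous_on UNIV f"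
| "Ck (Suc n) f \<longleftrightarrow> f differentiable_on UNIV \<and> (\<forall>m. Ck n (partial_deriv m f))"

definition test_fun :: "(real^3) set \<Rightarrow> (real^3 \<Rightarrow> real) \<Rightarrow> bool" where
  "test_fun \<Omega> \<phi> \<longleftrightarrow>
     (\<forall>n. Ck n \<phi>) \<and> compact (closure {x. \<phi> x \<noteq> 0}) \<and> closure {x. \<phi> x \<noteq> 0} \<subseteq> \<Omega>"

definition loc_integrable :: "(real^3) set \<Rightarrow> (real^3 \<Rightarrow> 'b::euclidean_space) \<Rightarrow> bool" where
  "loc_integrable \<Omega> f \<longleftrightarrow> (\<forall>K. compact K \<and> K \<subseteq> \<Omega> \<longrightarrow> set_integrable lborel K f)"

text \<open>
  A distribution on \<open>\<Omega>\<close> is represented by its values on test functions: \<open>dist_of \<Omega> f\<close> is the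
  distribution given by a locally integrable function, and \<open>wpartial\<close>, \<open>wgrad\<close>, \<open>wdiv\<close>, \<open>wcurl\<close> are its
  distributional derivatives.
\<close>

definition dist_of ::
  "(real^3) set \<Rightarrow> (real^3 \<Rightarrow> 'b::euclidean_space) \<Rightarrow> (real^3 \<Rightarrow> real) \<Rightarrow> 'b" where
  "dist_of \<Omega> f \<phi> = (LINT x:\<Omega>|lborel. \<phi> x *\<^sub>R f x)"

definition wpartial ::
  "(real^3) set \<Rightarrow> 3 \<Rightarrow> (real^3 \<Rightarrow> 'b::euclidean_space) \<Rightarrow> (real^3 \<Rightarrow> real) \<Rightarrow> 'b" where
  "wpartial \<Omega> m f \<phi> = - dist_of \<Omega> f (partial_deriv m \<phi>)"

definition wgrad ::
  "(real^3) set \<Rightarrow> (real^3 \<Rightarrow> complex) \<Rightarrow> (real^3 \<Rightarrow> real) \<Rightarrow> complex^3" where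
  "wgrad \<Omega> f \<phi> = (\<chi> m. wpartial \<Omega> m f \<phi>)"

definition wdiv ::
  "(real^3) set \<Rightarrow> (real^3 \<Rightarrow> real^3) \<Rightarrow> (real^3 \<Rightarrow> real) \<Rightarrow> real" where
  "wdiv \<Omega> F \<phi> = (\<Sum>m\<in>UNIV. wpartial \<Omega> m (\<lambda>x. F x $ m) \<phi>)"

definition wcurl ::
  "(real^3) set \<Rightarrow> (real^3 \<Rightarrow> real^3) \<Rightarrow> (real^3 \<Rightarrow> real) \<Rightarrow> real^3" where
  "wcurl \<Omega> F \<phi> =
     vector [wpartial \<Omega> 2 (\<lambda>x. F x $ 3) \<phi> - wpartial \<Omega> 3 (\<lambda>x. F x $ 2) \<phi>,
             wpartial \<Omega> 3 (\<lambda>x. F x $ 1) \<phi> - wpartial \<Omega> 1 (\<lambda>x. F x $ 3) \<phi>,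
             wpartial \<Omega> 1 (\<lambda>x. F x $ 2) \<phi> - wpartial \<Omega> 2 (\<lambda>x. F x $ 1) \<phi>]"

text \<open>
  The distribution \<open>L\<close> on \<open>\<Omega>\<close> is the time derivative at \<open>t \<ge> 0\<close> of the distribution-valued function
  \<open>s \<mapsto> F(\<cdot>, s)\<close> on \<open>{0..}\<close>; at \<open>t = 0\<close> the derivative is one-sided.
\<close>

definition has_wtime_deriv ::
  "(real^3) set \<Rightarrow> (real^3 \<Rightarrow> real \<Rightarrow> 'b::euclidean_space) \<Rightarrow> ((real^3 \<Rightarrow> real) \<Rightarrow> 'b) \<Rightarrow> real \<Rightarrow> bool" where
  "has_wtime_deriv \<Omega> F L t \<longleftrightarrow>
     (\<forall>\<phi>. test_fun \<Omega> \<phi> \<longrightarrow>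
        ((\<lambda>s. dist_of \<Omega> (\<lambda>x. F x s) \<phi>) has_vector_derivative L \<phi>) (at t within {0..}))"

text \<open>
  The functions \<open>\<partial>\<^sub>t u(\<cdot>, t)\<close> and \<open>\<integral>\<^sub>0\<^sup>t \<nabla>\<^sub>x u(\<cdot>, s) ds\<close>, which are unique up to null sets. In the latter
  the individual \<open>\<nabla>\<^sub>x u(\<cdot>, s)\<close> are distributions, integrated over time as such.
\<close>

definition time_deriv ::
  "(real^3) set \<Rightarrow> (real^3 \<Rightarrow> real \<Rightarrow> complex) \<Rightarrow> real^3 \<Rightarrow> real \<Rightarrow> complex" where
  "time_deriv \<Omega> u x t =
     (SOME g. loc_integrable \<Omega> g \<and> has_wtime_deriv \<Omega> u (dist_of \<Omega> g) t) x"

definition integral_grad ::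
  "(real^3) set \<Rightarrow> (real^3 \<Rightarrow> real \<Rightarrow> complex) \<Rightarrow> real^3 \<Rightarrow> real \<Rightarrow> complex^3" where
  "integral_grad \<Omega> u x t =
     (SOME G. loc_integrable \<Omega> G \<and>
        (\<forall>\<phi>. test_fun \<Omega> \<phi> \<longrightarrow>
           set_integrable lborel {0..t} (\<lambda>s. wgrad \<Omega> (\<lambda>y. u y s) \<phi>) \<and>
           dist_of \<Omega> G \<phi> = (LINT s:{0..t}|lborel. wgrad \<Omega> (\<lambda>y. u y s) \<phi>))) x"


text \<open>
  For every \<open>t > 0\<close> the equations hold as equalities of distributions on \<open>\<Omega>\<close>, the last two being
  solved for the time derivatives. Jumps of the zero extension of \<open>j\<close> across the boundary travel
  into \<open>\<Omega>\<close> at unit speed, so that in general \<open>E\<close> and \<open>B\<close> are not classically differentiable.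
\<close>

definition maxwell_solution ::
  "(real^3) set \<Rightarrow> (real^3 \<Rightarrow> real \<Rightarrow> real) \<Rightarrow> (real^3 \<Rightarrow> real \<Rightarrow> real^3) \<Rightarrow>
   (real^3 \<Rightarrow> real \<Rightarrow> real^3) \<Rightarrow> (real^3 \<Rightarrow> real \<Rightarrow> real^3) \<Rightarrow> bool" where
  "maxwell_solution \<Omega> \<rho> j E B \<longleftrightarrow>
     (\<forall>t>0.
        loc_integrable \<Omega> (\<lambda>x. E x t) \<and> loc_integrable \<Omega> (\<lambda>x. B x t) \<and>
        (\<forall>\<phi>. test_fun \<Omega> \<phi> \<longrightarrow>
           wdiv \<Omega> (\<lambda>x. E x t) \<phi> = dist_of \<Omega> (\<lambda>x. 4 * pi * \<rho> x t) \<phi> \<and>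
           wdiv \<Omega> (\<lambda>x. B x t) \<phi> = 0) \<and>
        has_wtime_deriv \<Omega> B (\<lambda>\<phi>. - wcurl \<Omega> (\<lambda>x. E x t) \<phi>) t \<and>
        has_wtime_deriv \<Omega> E
          (\<lambda>\<phi>. wcurl \<Omega> (\<lambda>x. B x t) \<phi> - dist_of \<Omega> (\<lambda>x. (4 * pi) *\<^sub>R j x t) \<phi>) t)"

end

theory Submission
  imports Defs "HOL-Probability.Probability"
begin

text \<open>Let \<open>w = - 4 \<pi> i (\<rho> - i j)\<close>, let \<open>U = u\<^sub>0 + V\<close> be its parabolic Teodorescu transform, with scalar part
  \<open>u\<^sub>0\<close> and vector part \<open>V\<close>, and let \<open>D = \<Sum>\<^sub>m e\<^sub>m \<partial>\<^sub>m\<close> be the Dirac operator. On the Fourier side \<open>i D\<close> is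
  multiplication by \<open>- 2 \<pi> k\<close>, and \<open>exp (2 \<pi> k \<tau>)\<close> is the one-parameter group generated by \<open>2 \<pi> k\<close>. Hence \<open>U\<close>
  is given by Duhamel's formula and solves \<open>(\<partial>\<^sub>t + i D) U = w\<close> with \<open>U = 0\<close> at time \<open>0\<close>. Since
  \<open>D U = - div V + \<nabla> u\<^sub>0 + curl V\<close>, the scalar and the vector part of this equation are

    \<open>\<partial>\<^sub>t u\<^sub>0 - i div V = - 4 \<pi> i \<rho>\<close>  and  \<open>\<partial>\<^sub>t V + i \<nabla> u\<^sub>0 + i curl V = - 4 \<pi> j\<close>.

  Put \<open>G = \<integral>\<^sub>0\<^sup>t \<nabla> u\<^sub>0\<close> and \<open>S = T\<^sub>\<Omega>[\<partial>\<^sub>t u\<^sub>0](\<cdot>, 0)\<close>. The two fields are the real and the imaginary part of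
  \<open>M = V + i (G - S) + \<nabla> h\<^sub>1 + i \<nabla> h\<^sub>2\<close>. Everything but \<open>V\<close> is curl free, and \<open>S\<close>, \<open>h\<^sub>1\<close>, \<open>h\<^sub>2\<close> do not depend on
  time, so that the vector equation becomes \<open>\<partial>\<^sub>t M = - 4 \<pi> j - i curl M\<close>; these are the two evolution
  equations of Maxwell's system. Taking the divergence of the vector equation and using
  \<open>div j = - \<partial>\<^sub>t \<rho>\<close> gives \<open>div (V + i G) = 4 \<pi> (\<rho>(t) - \<rho>(0))\<close>. The remaining initial value is supplied by
  the Teodorescu term: it satisfies \<open>div S = - \<partial>\<^sub>t u\<^sub>0(0)\<close>, and \<open>\<partial>\<^sub>t u\<^sub>0(0) = - 4 \<pi> i \<rho>(0)\<close> by the scalar equation.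
  So \<open>div M = 4 \<pi> \<rho>\<close>, whose real and imaginary parts are the two divergence equations.

  All of this holds in the sense of distributions, so every object is paired with a test function and
  moved to the Fourier side by \<open>fourier_multiplication\<close>. That formula rests on Plancherel's inequality
  \<open>N2_ft_le\<close> and on the completeness of \<open>L\<^sup>2\<close>; the source term returns from the Fourier side by
  \<open>parseval\<close>. The evolution equation is \<open>pairing_evolution\<close> in integrated and
  \<open>pairing_has_vector_derivative\<close> in differentiated form.

  Two of the objects have to be shown to be functions. That \<open>G\<close> is one, although \<open>\<nabla> u\<^sub>0\<close> at a fixed time is
  only a distribution, is \<open>integral_grad_exists\<close>: integration over time gains one derivative. The
  function \<open>\<partial>\<^sub>t u\<^sub>0(0)\<close> is determined only as a distribution, and the fundamental lemma of the calculus of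
  variations, \<open>dist_of_zero_imp_AE\<close>, identifies it almost everywhere.

  The curl and the divergence of the Teodorescu transform, \<open>teodorescu_curl\<close> and \<open>teodorescu_div\<close>, come
  from writing the singular kernel \<open>z / \<bar>z\<bar>\<^sup>3\<close> as an integral of smooth fields
  \<open>l\<^sup>2 z exp (- l\<^sup>2 \<bar>z\<bar>\<^sup>2)\<close> over \<open>l\<close> (\<open>kernel_moment_subordination\<close>).\<close>

section \<open>Integration on Euclidean spaces\<close>

lemma integral_prod_Basis:
  fixes f :: "'a::euclidean_space \<Rightarrow> real \<Rightarrow> 'c::{real_normed_field,banach,second_countable_topology}"
  assumes f: "\<And>b. b \<in> Basis \<Longrightarrow> integrable lborel (f b)"
  shows integrable_prod_Basis: "integrable lborel (\<lambda>x::'a. \<Prod>b\<in>Basis. f b (x \<bullet> b))"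
    and "(LINT x|lborel. (\<Prod>b\<in>Basis. f b ((x::'a) \<bullet> b))) = (\<Prod>b\<in>Basis. LINT t|lborel. f b t)"
proof -
  interpret product_sigma_finite "\<lambda>_::'a. lborel :: real measure" ..
  have [measurable]: "f b \<in> borel_measurable borel" if "b \<in> Basis" for b
    using borel_measurable_integrable[OF f[OF that]] by simp
  have m: "(\<lambda>g. \<Sum>b\<in>Basis. g b *\<^sub>R b) \<in> (\<Pi>\<^sub>M b\<in>(Basis::'a set). lborel :: real measure) \<rightarrow>\<^sub>M borel"
    by simp
  have P: "(\<lambda>x::'a. \<Prod>b\<in>Basis. f b (x \<bullet> b)) \<in> borel_measurable borel"
    by measurable
  have s: "(\<Prod>b\<in>Basis. f b ((\<Sum>b\<in>Basis. g b *\<^sub>R b) \<bullet> b)) = (\<Prod>b\<in>(Basis::'a set). f b (g b))" for g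
    by (intro prod.cong) simp_all
  show "integrable lborel (\<lambda>x::'a. \<Prod>b\<in>Basis. f b (x \<bullet> b))"
    by (subst lborel_eq, subst integrable_distr_eq[OF m P])
      (unfold s, rule product_integrable_prod[OF finite_Basis f])
  show "(LINT x|lborel. (\<Prod>b\<in>Basis. f b ((x::'a) \<bullet> b))) = (\<Prod>b\<in>Basis. LINT t|lborel. f b t)"
    by (subst lborel_eq, subst integral_distr[OF m P])
      (unfold s, rule product_integral_prod[OF finite_Basis f])
qed

lemma integrable_scaleR_iff:
  fixes f :: "'a \<Rightarrow> 'b::{banach,second_countable_topology}"
  assumes "c \<noteq> 0" shows "integrable M (\<lambda>x. c *\<^sub>R f x) \<longleftrightarrow> integrable M f"
  using assms integrable_scaleR_right[of "inverse c" M "\<lambda>x. c *\<^sub>R f x"] by auto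

lemma lborel_has_integral_affine:
  fixes f :: "'a::euclidean_space \<Rightarrow> 'b::{banach,second_countable_topology}"
  assumes c: "c \<noteq> 0" and [measurable]: "f \<in> borel_measurable borel"
  shows lborel_integrable_affine: "integrable lborel (\<lambda>x. f (t + c *\<^sub>R x)) \<longleftrightarrow> integrable lborel f"
    and lborel_integral_affine: "(LINT x|lborel. f x) = \<bar>c\<bar> ^ DIM('a) *\<^sub>R (LINT x|lborel. f (t + c *\<^sub>R x))"
proof -
  have T: "(\<lambda>x. t + c *\<^sub>R x) \<in> lborel \<rightarrow>\<^sub>M borel" by simp
  have eq: "lborel = density (distr lborel borel (\<lambda>x. t + c *\<^sub>R x)) (\<lambda>_. ennreal (\<bar>c\<bar> ^ DIM('a)))"
    using lborel_affine[OF c, of t] by simp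
  have "integrable lborel f \<longleftrightarrow> integrable (density (distr lborel borel (\<lambda>x. t + c *\<^sub>R x)) (\<lambda>_. ennreal (\<bar>c\<bar> ^ DIM('a)))) f"
    by (subst eq) (rule refl)
  also have "\<dots> \<longleftrightarrow> integrable lborel (\<lambda>x. f (t + c *\<^sub>R x))"
    using c by (subst integrable_density) (auto simp: integrable_distr_eq integrable_scaleR_iff)
  finally show "integrable lborel (\<lambda>x. f (t + c *\<^sub>R x)) \<longleftrightarrow> integrable lborel f" by simp
  have "(LINT x|lborel. f x) = (LINT x|density (distr lborel borel (\<lambda>x. t + c *\<^sub>R x)) (\<lambda>_. ennreal (\<bar>c\<bar> ^ DIM('a))). f x)"
    by (subst eq) (rule refl)
  also have "\<dots> = \<bar>c\<bar> ^ DIM('a) *\<^sub>R (LINT x|lborel. f (t + c *\<^sub>R x))"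
    by (subst integral_density) (auto simp: integral_distr)
  finally show "(LINT x|lborel. f x) = \<bar>c\<bar> ^ DIM('a) *\<^sub>R (LINT x|lborel. f (t + c *\<^sub>R x))" .
qed

lemma integrable_compact_support:
  fixes g :: "'a::euclidean_space \<Rightarrow> 'b::{banach,second_countable_topology}"
  assumes "compact K" "continuous_on K g" "\<And>x. x \<notin> K \<Longrightarrow> g x = 0"
  shows "integrable lborel g"
proof -
  have "(\<lambda>x. indicator K x *\<^sub>R g x) = g"
    using assms(3) by (auto simp: indicator_def)
  then show ?thesis using borel_integrable_compact[OF assms(1,2)] by simp
qed

text \<open>For each \<open>x\<close> the integral of \<open>g' (x + t v)\<close> over \<open>t \<in> {0..1}\<close> is \<open>g (x + v) - g x\<close>, whose integral over \<open>x\<close> vanishes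
  by translation invariance; integrating over \<open>x\<close> first gives the integral of \<open>g'\<close>. All integrations by
  parts below are instances of this lemma.\<close>

lemma integral_directional_derivative:
  fixes g g' :: "'a::euclidean_space \<Rightarrow> 'b::euclidean_space"
  assumes d: "\<And>x. ((\<lambda>t. g (x + t *\<^sub>R v)) has_vector_derivative g' x) (at 0)"
    and c: "continuous_on UNIV g" and c': "continuous_on UNIV g'"
    and K: "compact K" and z: "\<And>x. x \<notin> K \<Longrightarrow> g x = 0"
  shows "integrable lborel g'" and "integral\<^sup>L lborel g' = 0"
proof -
  have z': "g' x = 0" if "x \<notin> K" for x
  proof -
    have o: "open ((\<lambda>t. x + t *\<^sub>R v) -` (- K))"
      by (intro open_vimage continuous_intros) (use K in \<open>auto intro: compact_imp_closed\<close>)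
    have "((\<lambda>t. 0) has_vector_derivative g' x) (at (0::real))"
      by (rule has_vector_derivative_transform_within_open[OF d[of x] o])
        (use that z in auto)
    from vector_derivative_unique_at[OF this has_vector_derivative_const] show ?thesis .
  qed
  show i': "integrable lborel g'"
    by (rule integrable_compact_support[OF K]) (use c' z' in \<open>auto intro: continuous_on_subset\<close>)
  have i: "integrable lborel g"
    by (rule integrable_compact_support[OF K]) (use c z in \<open>auto intro: continuous_on_subset\<close>)
  have [measurable]: "g \<in> borel_measurable borel" "g' \<in> borel_measurable borel"
    using c c' by (auto intro: borel_measurable_continuous_onI)
  have t: "integrable lborel (\<lambda>x. g (x + y))" "(LINT x|lborel. g (x + y)) = integral\<^sup>L lborel g" for y
    using i lborel_integrable_affine[of 1 g y] lborel_integral_affine[of 1 g y] by (simp_all add: add.commute)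
  have t': "integrable lborel (\<lambda>x. g' (x + y))" "(LINT x|lborel. g' (x + y)) = integral\<^sup>L lborel g'" for y
    using i' lborel_integrable_affine[of 1 g' y] lborel_integral_affine[of 1 g' y] by (simp_all add: add.commute)
  have tn: "(LINT x|lborel. norm (g' (x + y))) = (LINT x|lborel. norm (g' x))" for y
    using lborel_integral_affine[of 1 "\<lambda>x. norm (g' x)" y] by (simp add: add.commute)
  define F where "F = (\<lambda>(t::real) (x::'a). indicator {0..1} t *\<^sub>R g' (x + t *\<^sub>R v))"
  have F: "integrable (lborel \<Otimes>\<^sub>M lborel) (case_prod F)"
  proof (rule lborel_pair.Fubini_integrable)
    show "case_prod F \<in> borel_measurable (lborel \<Otimes>\<^sub>M lborel)"
      unfolding F_def by measurable
    have "(\<lambda>t. LINT x|lborel. norm (case (t, x) of (t, x) \<Rightarrow> F t x)) =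
      (\<lambda>t. indicator {0..1} t *\<^sub>R (LINT x|lborel. norm (g' x)))"
      by (auto simp: F_def tn)
    then show "integrable lborel (\<lambda>t. LINT x|lborel. norm (case (t, x) of (t, x) \<Rightarrow> F t x))"
      by (simp only:) (rule integrable_scaleR_left, auto)
    show "AE t in lborel. integrable lborel (\<lambda>x. case (t, x) of (t, x) \<Rightarrow> F t x)"
      using t' by (auto simp: F_def)
  qed
  have ft: "(LINT t|lborel. F t x) = g (x + v) - g x" for x
  proof -
    have "(LINT t|lborel. indicator {0..1} t *\<^sub>R g' (x + t *\<^sub>R v)) = g (x + 1 *\<^sub>R v) - g (x + 0 *\<^sub>R v)"
    proof (rule integral_FTC_atLeastAtMost)
      show "((\<lambda>t. g (x + t *\<^sub>R v)) has_vector_derivative g' (x + t *\<^sub>R v)) (at t within {0..1})" for t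
      proof -
        have 1: "((\<lambda>s. s - t) has_vector_derivative 1) (at t)"
          by (auto intro!: derivative_eq_intros)
        have 2: "((\<lambda>s. g ((x + t *\<^sub>R v) + s *\<^sub>R v)) has_vector_derivative g' (x + t *\<^sub>R v)) (at (t - t))"
          using d[of "x + t *\<^sub>R v"] by simp
        have "((\<lambda>s. g ((x + t *\<^sub>R v) + (s - t) *\<^sub>R v)) has_vector_derivative g' (x + t *\<^sub>R v)) (at t)"
          using vector_diff_chain_at[OF 1 2] by (simp add: o_def)
        then show ?thesis by (simp add: algebra_simps has_vector_derivative_at_within)
      qed
      show "continuous_on {0..1} (\<lambda>t. g' (x + t *\<^sub>R v))"
        by (intro continuous_on_compose2[OF c'] continuous_intros) auto
    qed simp
    then show ?thesis by (simp add: F_def)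
  qed
  have "(LINT t|lborel. (LINT x|lborel. F t x)) = (LINT x|lborel. (LINT t|lborel. F t x))"
    using lborel_pair.Fubini_integral[OF F] by simp
  also have "\<dots> = 0"
    using t[of v] i by (simp add: ft)
  also have "(LINT t|lborel. (LINT x|lborel. F t x)) = (LINT t|lborel. indicator {0..1::real} t *\<^sub>R integral\<^sup>L lborel g')"
    by (auto simp: F_def t')
  also have "\<dots> = integral\<^sup>L lborel g'"
    by simp
  finally show "integral\<^sup>L lborel g' = 0" .
qed

section \<open>Gaussians\<close>

text \<open>The density of independent normal variables with standard deviation \<open>1 / \<beta>\<close>. The product form reduces its
  transform to the characteristic function of the standard normal distribution.\<close>

definition gauss :: "real \<Rightarrow> 'a::euclidean_space \<Rightarrow> real" where
  "gauss \<beta> z = (\<Prod>b\<in>Basis. \<beta> * std_normal_density (\<beta> * (z \<bullet> b)))"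

lemma gauss_nonneg: "\<beta> \<ge> 0 \<Longrightarrow> gauss \<beta> z \<ge> 0"
  unfolding gauss_def by (intro prod_nonneg) auto

lemma gauss_measurable[measurable]: "gauss \<beta> \<in> borel_measurable borel"
  unfolding gauss_def by measurable

lemma gauss_scale: "gauss \<beta> ((1 / \<beta>) *\<^sub>R z) = \<beta> ^ DIM('a) * gauss 1 (z::'a::euclidean_space)" if "\<beta> \<noteq> 0"
  using that unfolding gauss_def by (simp add: prod.distrib)

lemma gauss_1: "has_bochner_integral lborel (gauss 1 :: 'a::euclidean_space \<Rightarrow> real) 1"
proof -
  have "integrable lborel (std_normal_density)" "(LINT t|lborel. std_normal_density t) = 1" by auto
  then show ?thesis
    using integral_prod_Basis[of "\<lambda>b::'a. std_normal_density"]
    unfolding gauss_def by (simp add: has_bochner_integral_iff)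
qed

lemma gauss_integral:
  assumes "\<beta> > 0" shows "has_bochner_integral lborel (gauss \<beta> :: 'a::euclidean_space \<Rightarrow> real) 1"
proof -
  have "integrable lborel (\<lambda>z::'a. gauss \<beta> ((1 / \<beta>) *\<^sub>R z))"
    using assms gauss_1[where 'a='a] by (simp add: gauss_scale has_bochner_integral_iff)
  then have i: "integrable lborel (gauss \<beta> :: 'a \<Rightarrow> real)"
    using lborel_integrable_affine[of "1/\<beta>" "gauss \<beta> :: 'a \<Rightarrow> real" 0] assms by simp
  have "(LINT x|lborel. gauss \<beta> (x::'a)) = 1"
    using lborel_integral_affine[of "1/\<beta>" "gauss \<beta> :: 'a \<Rightarrow> real" 0] assms gauss_1[where 'a='a]
    by (simp add: gauss_scale has_bochner_integral_iff power_divide)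
  with i show ?thesis by (simp add: has_bochner_integral_iff)
qed

lemma gauss_fourier_1:
  fixes z \<beta> :: real
  assumes "\<beta> > 0"
  shows "integrable lborel (\<lambda>k. exp (2 * pi * \<i> * of_real (k * z)) * of_real (exp (- (2 * pi * k / \<beta>)\<^sup>2 / 2)))" (is "integrable _ ?f")
    and "(LINT k|lborel. exp (2 * pi * \<i> * of_real (k * z)) * of_real (exp (- (2 * pi * k / \<beta>)\<^sup>2 / 2)))
        = of_real (\<beta> * std_normal_density (\<beta> * z))"
proof -
  define g where "g u = sqrt (2*pi) *\<^sub>R (std_normal_density u *\<^sub>R iexp ((\<beta> * z) * u))" for u
  have [measurable]: "g \<in> borel_measurable borel"
    unfolding g_def by measurable
  have gi: "integrable lborel (\<lambda>u. std_normal_density u *\<^sub>R iexp ((\<beta> * z) * u))"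
    by (rule Bochner_Integration.integrable_bound[OF integrable_normal_density[OF zero_less_one, of 0]]) (auto intro!: AE_I2)
  have "char std_normal_distribution (\<beta> * z) = (LINT u|lborel. std_normal_density u *\<^sub>R iexp ((\<beta> * z) * u))"
    unfolding char_def by (subst integral_density) auto
  then have gI: "(LINT u|lborel. std_normal_density u *\<^sub>R iexp ((\<beta> * z) * u)) = of_real (exp (- (\<beta> * z)\<^sup>2 / 2))"
    by (simp add: char_std_normal_distribution)
  have f: "?f ((\<beta>/(2*pi)) * u) = g u" for u
  proof -
    have "sqrt (2*pi) * std_normal_density u = exp (- u\<^sup>2 / 2)"
      by (simp add: normal_density_def)
    then have "g u = of_real (exp (- u\<^sup>2 / 2)) * iexp (\<beta> * z * u)"
      unfolding g_def by (simp only: scaleR_scaleR) (simp add: scaleR_conv_of_real)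
    then show ?thesis using assms by (simp add: field_simps)
  qed
  have c: "\<beta>/(2*pi) \<noteq> 0" using assms by simp
  have "integrable lborel (\<lambda>u. ?f (0 + (\<beta>/(2*pi)) * u))"
    unfolding add_0 f g_def by (rule integrable_scaleR_right[OF gi])
  then show "integrable lborel ?f"
    using lborel_integrable_real_affine_iff[OF c, of ?f 0] by blast
  have "(LINT k|lborel. ?f k) = \<bar>\<beta>/(2*pi)\<bar> *\<^sub>R (LINT u|lborel. ?f (0 + (\<beta>/(2*pi)) * u))"
    by (rule lborel_integral_real_affine[OF c])
  also have "\<dots> = \<bar>\<beta>/(2*pi)\<bar> *\<^sub>R (LINT u|lborel. g u)"
    unfolding add_0 f ..
  also have "\<dots> = of_real (\<beta>/(2*pi) * sqrt (2*pi) * exp (- (\<beta> * z)\<^sup>2 / 2))"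
    using assms gi gI unfolding g_def by (simp add: scaleR_conv_of_real)
  also have "\<beta>/(2*pi) * sqrt (2*pi) * exp (- (\<beta> * z)\<^sup>2 / 2) = \<beta> * std_normal_density (\<beta> * z)"
  proof -
    have "sqrt (2*pi) / (2*pi) = 1 / sqrt (2*pi)"
      by (simp add: real_div_sqrt field_simps)
    then show ?thesis by (simp add: normal_density_def field_simps)
  qed
  finally show "(LINT k|lborel. ?f k) = of_real (\<beta> * std_normal_density (\<beta> * z))" .
qed

lemma gauss_fourier:
  fixes z :: "'a::euclidean_space"
  assumes "\<beta> > 0"
  shows "(LINT k|lborel. exp (2 * pi * \<i> * of_real (k \<bullet> z)) * of_real (exp (- (norm ((2 * pi / \<beta>) *\<^sub>R k))\<^sup>2 / 2)))
     = of_real (gauss \<beta> z)"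
proof -
  let ?f = "\<lambda>b k. exp (2 * pi * \<i> * of_real (k * (z \<bullet> b))) * complex_of_real (exp (- (2 * pi * k / \<beta>)\<^sup>2 / 2))"
  have eq: "exp (2 * pi * \<i> * of_real (k \<bullet> z)) * of_real (exp (- (norm ((2 * pi / \<beta>) *\<^sub>R k))\<^sup>2 / 2))
      = (\<Prod>b\<in>Basis. ?f b (k \<bullet> b))" for k
  proof -
    have 1: "2 * pi * \<i> * of_real (k \<bullet> z) = (\<Sum>b\<in>Basis. 2 * pi * \<i> * of_real ((k \<bullet> b) * (z \<bullet> b)))"
      by (subst euclidean_inner) (simp add: sum_distrib_left)
    have "(norm ((2 * pi / \<beta>) *\<^sub>R k))\<^sup>2 = (\<Sum>b\<in>Basis. (2 * pi * (k \<bullet> b) / \<beta>)\<^sup>2)"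
      unfolding power2_norm_eq_inner by (subst euclidean_inner) (simp add: power2_eq_square field_simps)
    then have 2: "- (norm ((2 * pi / \<beta>) *\<^sub>R k))\<^sup>2 / 2 = (\<Sum>b\<in>Basis. - (2 * pi * (k \<bullet> b) / \<beta>)\<^sup>2 / 2)"
      by (simp add: sum_negf sum_divide_distrib)
    show ?thesis
      unfolding 1 2 by (simp add: exp_sum prod.distrib)
  qed
  have "(LINT k|lborel. (\<Prod>b\<in>Basis. ?f b (k \<bullet> b))) = (\<Prod>b\<in>Basis. LINT t|lborel. ?f b t)"
    by (rule integral_prod_Basis(2)) (rule gauss_fourier_1[OF assms])
  also have "\<dots> = (\<Prod>b\<in>Basis. of_real (\<beta> * std_normal_density (\<beta> * (z \<bullet> b))))"
    by (intro prod.cong refl gauss_fourier_1(2)[OF assms])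
  finally show ?thesis unfolding eq gauss_def by simp
qed

lemma gauss_weight_integrable:
  assumes "\<beta> > 0"
  shows "integrable lborel (\<lambda>k::'a::euclidean_space. exp (- (norm ((2 * pi / \<beta>) *\<^sub>R k))\<^sup>2 / 2))"
proof -
  let ?f = "\<lambda>t. exp (- (2 * pi * t / \<beta>)\<^sup>2 / 2)"
  have "integrable lborel ?f"
    using integrable_norm[OF gauss_fourier_1(1)[OF assms, of 0]] by (simp add: norm_mult)
  then have "integrable lborel (\<lambda>k::'a. \<Prod>b\<in>Basis. ?f (k \<bullet> b))"
    by (intro integrable_prod_Basis)
  also have "(\<lambda>k::'a. \<Prod>b\<in>Basis. ?f (k \<bullet> b)) = (\<lambda>k. exp (- (norm ((2 * pi / \<beta>) *\<^sub>R k))\<^sup>2 / 2))"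
  proof
    fix k :: 'a
    have "(norm ((2 * pi / \<beta>) *\<^sub>R k))\<^sup>2 = (\<Sum>b\<in>Basis. (2 * pi * (k \<bullet> b) / \<beta>)\<^sup>2)"
      unfolding power2_norm_eq_inner by (subst euclidean_inner) (simp add: power2_eq_square field_simps)
    then have 2: "- (norm ((2 * pi / \<beta>) *\<^sub>R k))\<^sup>2 / 2 = (\<Sum>b\<in>Basis. - (2 * pi * (k \<bullet> b) / \<beta>)\<^sup>2 / 2)"
      by (simp add: sum_negf sum_divide_distrib)
    show "(\<Prod>b\<in>Basis. ?f (k \<bullet> b)) = exp (- (norm ((2 * pi / \<beta>) *\<^sub>R k))\<^sup>2 / 2)"
      unfolding 2 by (simp add: exp_sum)
  qed
  finally show ?thesis .
qed

text \<open>Rescaling moves the parameter from the density into the argument of \<open>\<phi>\<close>, where continuity applies.\<close>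

lemma gauss_approximate_identity:
  fixes \<phi> :: "'a::euclidean_space \<Rightarrow> 'b::euclidean_space"
  assumes c: "continuous_on UNIV \<phi>" and b: "\<And>x. norm (\<phi> x) \<le> M"
  shows "(\<lambda>n. LINT z|lborel. gauss (real (Suc n)) z *\<^sub>R \<phi> (x + z)) \<longlonglongrightarrow> \<phi> x"
proof -
  have [measurable]: "\<phi> \<in> borel_measurable borel"
    using c by (rule borel_measurable_continuous_onI)
  have M: "M \<ge> 0" using b[of 0] norm_ge_zero order_trans by blast
  have eq: "(LINT z|lborel. gauss (real (Suc n)) z *\<^sub>R \<phi> (x + z)) = (LINT u|lborel. gauss 1 u *\<^sub>R \<phi> (x + (1 / real (Suc n)) *\<^sub>R u))" for n
  proof -
    define \<beta> where "\<beta> = real (Suc n)"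
    have \<beta>: "\<beta> > 0" by (simp add: \<beta>_def)
    have "(LINT z|lborel. gauss \<beta> z *\<^sub>R \<phi> (x + z)) =
       \<bar>1/\<beta>\<bar> ^ DIM('a) *\<^sub>R (LINT u|lborel. gauss \<beta> (0 + (1/\<beta>) *\<^sub>R u) *\<^sub>R \<phi> (x + (0 + (1/\<beta>) *\<^sub>R u)))"
      using \<beta> by (intro lborel_integral_affine) auto
    also have "\<dots> = (LINT u|lborel. gauss 1 u *\<^sub>R \<phi> (x + (1 / \<beta>) *\<^sub>R u))"
      unfolding add_0 using \<beta> by (simp add: gauss_scale power_divide flip: scaleR_scaleR) simp
    finally show ?thesis by (simp add: \<beta>_def)
  qed
  have "(\<lambda>n. LINT u|lborel. gauss 1 u *\<^sub>R \<phi> (x + (1 / real (Suc n)) *\<^sub>R u)) \<longlonglongrightarrow> (LINT u|lborel. gauss 1 (u::'a) *\<^sub>R \<phi> x)"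
  proof (rule integral_dominated_convergence[where w = "\<lambda>u::'a. gauss 1 u * M"])
    show "integrable lborel (\<lambda>u::'a. gauss 1 u * M)"
      using gauss_1[where 'a='a] by (simp add: has_bochner_integral_iff)
    have "(\<lambda>n. x + (1 / real (Suc n)) *\<^sub>R u) \<longlonglongrightarrow> x" for u
    proof -
      have "(\<lambda>n. x + (1 / real (Suc n)) *\<^sub>R u) \<longlonglongrightarrow> x + 0 *\<^sub>R u"
        using LIMSEQ_inverse_real_of_nat by (intro tendsto_intros) (simp add: inverse_eq_divide)
      then show ?thesis by simp
    qed
    then have "(\<lambda>n. \<phi> (x + (1 / real (Suc n)) *\<^sub>R u)) \<longlonglongrightarrow> \<phi> x" for u
      using c by (auto intro: continuous_on_tendsto_compose)
    then show "AE u in lborel. (\<lambda>n. gauss 1 u *\<^sub>R \<phi> (x + (1 / real (Suc n)) *\<^sub>R u)) \<longlonglongrightarrow> gauss 1 u *\<^sub>R \<phi> x"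
      by (auto intro!: tendsto_intros)
    show "AE u in lborel. norm (gauss 1 u *\<^sub>R \<phi> (x + (1 / real (Suc n)) *\<^sub>R u)) \<le> gauss 1 u * M" for n
      using b gauss_nonneg[of 1, where 'a='a] by (intro AE_I2) (auto intro!: mult_mono)
  qed auto
  also have "(LINT u|lborel. gauss 1 (u::'a) *\<^sub>R \<phi> x) = \<phi> x"
    using gauss_1[where 'a='a] by (simp add: has_bochner_integral_iff)
  finally show ?thesis unfolding eq .
qed

section \<open>Square-integrable functions\<close>

text \<open>The square of the \<open>L\<^sup>2\<close>-norm, with values in the extended nonnegative reals, so that limits and sums can
  be formed without integrability conditions.\<close>

definition N2 :: "('a::euclidean_space \<Rightarrow> 'b::real_normed_vector) \<Rightarrow> ennreal" where
  "N2 f = (\<integral>\<^sup>+x. ennreal ((norm (f x))\<^sup>2) \<partial>lborel)"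

lemma L2_iff: "L2 f \<longleftrightarrow> f \<in> borel_measurable borel \<and> N2 f < \<infinity>"
  unfolding L2_def N2_def by (auto simp: integrable_iff_bounded)

lemma L2_measurable[measurable_dest]: "L2 f \<Longrightarrow> f \<in> borel_measurable borel"
  by (simp add: L2_iff)

lemma N2_mono:
  assumes "\<And>x. norm (f x) \<le> norm (g x)" shows "N2 f \<le> N2 g"
  unfolding N2_def using assms by (intro nn_integral_mono ennreal_leI power_mono) auto

lemma N2_add:
  fixes f g :: "'a::euclidean_space \<Rightarrow> 'b::euclidean_space"
  assumes [measurable]: "f \<in> borel_measurable borel" "g \<in> borel_measurable borel"
  shows "N2 (\<lambda>x. f x + g x) \<le> 2 * N2 f + 2 * N2 g"
proof -
  have "(norm (f x + g x))\<^sup>2 \<le> 2 * (norm (f x))\<^sup>2 + 2 * (norm (g x))\<^sup>2" for x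
  proof -
    have "(norm (f x + g x))\<^sup>2 \<le> (norm (f x) + norm (g x))\<^sup>2"
      by (intro power_mono norm_triangle_ineq) auto
    also have "\<dots> \<le> 2 * (norm (f x))\<^sup>2 + 2 * (norm (g x))\<^sup>2"
      using sum_squares_bound[of "norm (f x)" "norm (g x)"] by (simp add: power2_sum)
    finally show ?thesis .
  qed
  then have "N2 (\<lambda>x. f x + g x) \<le> (\<integral>\<^sup>+x. 2 * ennreal ((norm (f x))\<^sup>2) + 2 * ennreal ((norm (g x))\<^sup>2) \<partial>lborel)"
    unfolding N2_def
    by (intro nn_integral_mono) (auto simp flip: ennreal_plus ennreal_mult' ennreal_numeral intro!: ennreal_leI)
  also have "\<dots> = 2 * N2 f + 2 * N2 g"
    unfolding N2_def by (simp add: nn_integral_add nn_integral_cmult)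
  finally show ?thesis .
qed

lemma N2_diff:
  fixes f g :: "'a::euclidean_space \<Rightarrow> 'b::euclidean_space"
  assumes [measurable]: "f \<in> borel_measurable borel" "g \<in> borel_measurable borel"
  shows "N2 (\<lambda>x. f x - g x) \<le> 2 * N2 f + 2 * N2 g"
  using N2_add[of f "\<lambda>x. - g x"] by (simp add: N2_def)

lemma L2_add: "L2 f \<Longrightarrow> L2 g \<Longrightarrow> L2 (\<lambda>x. f x + g x)"
  using N2_add[of f g] by (auto simp: L2_iff ennreal_mult_less_top intro: le_less_trans)

lemma L2_diff: "L2 f \<Longrightarrow> L2 g \<Longrightarrow> L2 (\<lambda>x. f x - g x)"
  using N2_diff[of f g] by (auto simp: L2_iff ennreal_mult_less_top intro: le_less_trans)

lemma L2_bound: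
  assumes "L2 g" "f \<in> borel_measurable borel" "\<And>x. norm (f x) \<le> norm (g x)"
  shows "L2 f"
  using assms N2_mono[of f g] by (auto simp: L2_iff)

lemma L2_cmult:
  fixes f :: "real^3 \<Rightarrow> 'b::euclidean_space"
  assumes "L2 f" shows "L2 (\<lambda>x. (c::real) *\<^sub>R f x)"
  using assms unfolding L2_def by (auto simp: power_mult_distrib)

lemma L2_indicator: "L2 f \<Longrightarrow> A \<in> sets borel \<Longrightarrow> L2 (\<lambda>x. indicator A x *\<^sub>R f x)"
  by (rule L2_bound[of f]) (auto simp: indicator_def)

lemma N2_Cauchy_Schwarz:
  fixes f :: "'a::euclidean_space \<Rightarrow> 'b::euclidean_space" and g :: "'a \<Rightarrow> 'c::euclidean_space"
  assumes [measurable]: "f \<in> borel_measurable borel" "g \<in> borel_measurable borel"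
  shows "(\<integral>\<^sup>+x. ennreal (norm (f x) * norm (g x)) \<partial>lborel)\<^sup>2 \<le> N2 f * N2 g"
  using Cauchy_Schwarz_nn_integral[of "\<lambda>x. ennreal (norm (f x))" lborel "\<lambda>x. ennreal (norm (g x))"]
  by (simp add: N2_def ennreal_mult' ennreal_power)

lemma L2_mult_integrable:
  fixes f :: "real^3 \<Rightarrow> 'a::euclidean_space" and g :: "real^3 \<Rightarrow> 'b::euclidean_space"
    and h :: "real^3 \<Rightarrow> 'c::euclidean_space"
  assumes [measurable]: "L2 f" "L2 g" "h \<in> borel_measurable borel"
    and b: "\<And>x. norm (h x) \<le> norm (f x) * norm (g x)"
  shows "integrable lborel h"
proof (rule Bochner_Integration.integrable_bound)
  show "integrable lborel (\<lambda>x. (norm (f x))\<^sup>2 + (norm (g x))\<^sup>2)"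
    using assms by (simp add: L2_def)
  show "AE x in lborel. norm (h x) \<le> norm ((norm (f x))\<^sup>2 + (norm (g x))\<^sup>2)"
  proof (intro AE_I2)
    fix x
    have "norm (h x) \<le> norm (f x) * norm (g x)" by (rule b)
    also have "\<dots> \<le> (norm (f x))\<^sup>2 + (norm (g x))\<^sup>2"
      using sum_squares_bound[of "norm (f x)" "norm (g x)"] mult_nonneg_nonneg[OF norm_ge_zero[of "f x"] norm_ge_zero[of "g x"]] by linarith
    finally show "norm (h x) \<le> norm ((norm (f x))\<^sup>2 + (norm (g x))\<^sup>2)" by simp
  qed
qed simp

lemma ennreal_power2_tendsto_0:
  assumes "(\<lambda>n. (a n)\<^sup>2 :: ennreal) \<longlonglongrightarrow> 0" shows "a \<longlonglongrightarrow> 0"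
proof (rule order_tendstoI)
  fix e :: ennreal assume e: "0 < e"
  define d where "d = min e 1"
  have d: "0 < d" "d \<le> e" "d \<noteq> \<top>" using e by (auto simp: d_def min_def top_unique)
  then have "0 < d\<^sup>2" by (simp add: zero_less_iff_neq_zero)
  then have "\<forall>\<^sub>F n in sequentially. (a n)\<^sup>2 < d\<^sup>2"
    using assms order_tendstoD(2) by blast
  then show "\<forall>\<^sub>F n in sequentially. a n < e"
  proof eventually_elim
    case (elim n)
    have "a n < d"
      using elim by (meson not_le power_mono zero_le)
    then show ?case using d by simp
  qed
qed simp

text \<open>The Cauchy--Schwarz inequality, for integrands that are bounded by products; bilinear expressions such as
  a scalar multiple of a biquaternion are of this kind.\<close>

lemma integral_mult_tendsto_0:
  fixes F :: "nat \<Rightarrow> 'a::euclidean_space \<Rightarrow> 'b::euclidean_space"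
  assumes [measurable]: "\<And>n. f n \<in> borel_measurable borel" "\<And>n. g n \<in> borel_measurable borel"
    and b: "\<And>n x. norm (F n x) \<le> norm (f n x :: 'c::euclidean_space) * norm (g n x :: 'd::euclidean_space)"
    and l: "(\<lambda>n. N2 (f n) * N2 (g n)) \<longlonglongrightarrow> 0"
  shows "(\<lambda>n. integral\<^sup>L lborel (F n)) \<longlonglongrightarrow> 0"
proof -
  have "(\<lambda>n. (\<integral>\<^sup>+x. ennreal (norm (f n x) * norm (g n x)) \<partial>lborel)\<^sup>2) \<longlonglongrightarrow> 0"
    by (rule tendsto_sandwich[OF _ _ tendsto_const l]) (auto intro!: always_eventually N2_Cauchy_Schwarz)
  then have s: "(\<lambda>n. \<integral>\<^sup>+x. ennreal (norm (f n x) * norm (g n x)) \<partial>lborel) \<longlonglongrightarrow> 0"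
    by (rule ennreal_power2_tendsto_0)
  have n: "ennreal (norm (integral\<^sup>L lborel (F n))) \<le> (\<integral>\<^sup>+x. ennreal (norm (f n x) * norm (g n x)) \<partial>lborel)" for n
  proof (cases "integrable lborel (F n)")
    case True
    then have "ennreal (norm (integral\<^sup>L lborel (F n))) \<le> (\<integral>\<^sup>+x. ennreal (norm (F n x)) \<partial>lborel)"
      by (rule integral_norm_bound_ennreal)
    also have "\<dots> \<le> (\<integral>\<^sup>+x. ennreal (norm (f n x) * norm (g n x)) \<partial>lborel)"
      by (intro nn_integral_mono ennreal_leI b)
    finally show ?thesis .
  qed (simp add: not_integrable_integral_eq)
  have "(\<lambda>n. ennreal (norm (integral\<^sup>L lborel (F n)))) \<longlonglongrightarrow> ennreal 0"
    using tendsto_sandwich[OF _ _ tendsto_const s] n by (simp add: always_eventually)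
  then have "(\<lambda>n. norm (integral\<^sup>L lborel (F n))) \<longlonglongrightarrow> 0"
    by (subst (asm) tendsto_ennreal_iff) auto
  then show ?thesis by (rule tendsto_norm_zero_cancel)
qed

lemma tendsto_0_mult_bounded_ennreal:
  assumes "(\<lambda>n. a n :: ennreal) \<longlonglongrightarrow> 0" "c < \<infinity>"
  shows "(\<lambda>n. a n * c) \<longlonglongrightarrow> 0"
  using ennreal_tendsto_cmult[of c a 0 sequentially] assms by (simp add: mult.commute)

text \<open>Completeness of \<open>L\<^sup>2\<close>: along a fast subsequence the increments decay geometrically almost
  everywhere, and Fatou's lemma transfers the Cauchy estimate to the limit.\<close>

lemma L2_complete:
  fixes f :: "nat \<Rightarrow> 'a::euclidean_space \<Rightarrow> 'b::euclidean_space"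
  assumes [measurable]: "\<And>n. f n \<in> borel_measurable borel"
    and C: "\<And>e. e > 0 \<Longrightarrow> \<exists>N. \<forall>m\<ge>N. \<forall>n\<ge>N. N2 (\<lambda>x. f m x - f n x) \<le> ennreal e"
  shows "\<exists>g. g \<in> borel_measurable borel \<and> (\<lambda>n. N2 (\<lambda>x. g x - f n x)) \<longlonglongrightarrow> 0"
proof -
  \<comment> \<open>the rate \<open>8\<^sup>-\<^sup>i\<close> for squared norms leaves room for the weight \<open>4\<^sup>i\<close> in \<open>D\<close>, whose finiteness then yields
    increments of order \<open>2\<^sup>-\<^sup>i\<close>\<close>
  have "\<exists>N. \<forall>m\<ge>N. \<forall>n\<ge>N. N2 (\<lambda>x. f m x - f n x) \<le> ennreal ((1/8)^i)" for i :: nat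
    by (rule C) simp
  then obtain N where N: "\<And>i m n. m \<ge> N i \<Longrightarrow> n \<ge> N i \<Longrightarrow> N2 (\<lambda>x. f m x - f n x) \<le> ennreal ((1/8)^i)"
    by metis
  define r where "r i = i + (\<Sum>l\<le>i. N l)" for i
  have "N i \<le> (\<Sum>l\<le>i. N l)" for i
    by (rule member_le_sum) auto
  then have rN: "r i \<ge> N i" and rS: "r (Suc i) \<ge> N i" and ri: "r i \<ge> i" for i
    by (auto simp: r_def intro: le_trans[OF _ trans_le_add2] le_SucI trans_le_add1 trans_le_add2)
  define D where "D x = (\<Sum>i. ennreal (4^i * (norm (f (r (Suc i)) x - f (r i) x))\<^sup>2))" for x
  have "(\<integral>\<^sup>+x. D x \<partial>lborel) = (\<Sum>i. \<integral>\<^sup>+x. ennreal (4^i * (norm (f (r (Suc i)) x - f (r i) x))\<^sup>2) \<partial>lborel)"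
    unfolding D_def by (rule nn_integral_suminf) measurable
  also have "\<dots> = (\<Sum>i. ennreal (4^i) * N2 (\<lambda>x. f (r (Suc i)) x - f (r i) x))"
    unfolding N2_def by (intro suminf_cong) (simp add: ennreal_mult' nn_integral_cmult)
  also have "\<dots> \<le> (\<Sum>i. ennreal ((1/2)^i))"
  proof (rule suminf_le)
    fix i
    have "ennreal (4^i) * N2 (\<lambda>x. f (r (Suc i)) x - f (r i) x) \<le> ennreal (4^i) * ennreal ((1/8)^i)"
      by (intro mult_left_mono N rN rS) auto
    also have "\<dots> = ennreal ((1/2)^i)"
      by (simp flip: ennreal_mult' power_mult_distrib)
    finally show "ennreal (4^i) * N2 (\<lambda>x. f (r (Suc i)) x - f (r i) x) \<le> ennreal ((1/2)^i)" .
  qed auto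
  also have "\<dots> = ennreal (\<Sum>i. (1/2)^i)"
    by (intro suminf_ennreal2) (auto intro: summable_geometric)
  finally have "(\<integral>\<^sup>+x. D x \<partial>lborel) \<noteq> \<infinity>"
    by (auto simp: top_unique)
  then have "AE x in lborel. D x \<noteq> \<infinity>"
    by (intro nn_integral_noteq_infinite) (auto simp: D_def)
  then have ae: "AE x in lborel. convergent (\<lambda>i. f (r i) x)"
  proof eventually_elim
    case (elim x)
    define d where "d i = norm (f (r (Suc i)) x - f (r i) x)" for i
    obtain M where M: "D x = ennreal M" "M \<ge> 0"
      using elim by (cases "D x") auto
    have "ennreal (4^i * (d i)\<^sup>2) \<le> D x" for i
    proof -
      define c where "c i = ennreal (4^i * (d i)\<^sup>2)" for i
      have "sum c {i} \<le> suminf c" by (rule sum_le_suminf) auto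
      moreover have "D x = suminf c" unfolding D_def c_def d_def ..
      ultimately show ?thesis unfolding c_def[symmetric] by simp
    qed
    then have "4^i * (d i)\<^sup>2 \<le> M" for i
      using M by (simp add: ennreal_le_iff)
    moreover have "(2^i * d i)\<^sup>2 = 4^i * (d i)\<^sup>2" for i
    proof -
      have "(2^i)\<^sup>2 = (2\<^sup>2 :: real)^i" by (simp only: power_mult[symmetric] mult.commute)
      then show ?thesis by (simp add: power_mult_distrib)
    qed
    ultimately have "2^i * d i \<le> sqrt M" for i
      by (metis real_le_rsqrt)
    then have b: "norm (d i) \<le> sqrt M * (1/2)^i" for i
      by (simp add: d_def power_divide field_simps)
    have "summable d"
      by (rule summable_comparison_test'[where N=0 and g="\<lambda>i. sqrt M * (1/2)^i"]) (rule summable_mult, rule summable_geometric, simp, rule b)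
    then have "summable (\<lambda>i. f (r (Suc i)) x - f (r i) x)"
      unfolding d_def by (rule summable_norm_cancel)
    then have "convergent (\<lambda>n. \<Sum>i<n. f (r (Suc i)) x - f (r i) x)"
      by (simp add: summable_iff_convergent)
    then have "convergent (\<lambda>n. (f (r n) x - f (r 0) x) + f (r 0) x)"
      unfolding sum_lessThan_telescope[of "\<lambda>i. f (r i) x"] by (intro convergent_add convergent_const)
    then show ?case by simp
  qed
  define g where "g x = lim (\<lambda>i. f (r i) x)" for x
  have [measurable]: "g \<in> borel_measurable borel"
    unfolding g_def by measurable
  have F: "N2 (\<lambda>x. g x - f n x) \<le> ennreal e" if n: "\<And>m. m \<ge> n \<Longrightarrow> N2 (\<lambda>x. f m x - f n x) \<le> ennreal e" for n e
  proof -
    have "N2 (\<lambda>x. g x - f n x) = (\<integral>\<^sup>+x. liminf (\<lambda>i. ennreal ((norm (f (r i) x - f n x))\<^sup>2)) \<partial>lborel)"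
      unfolding N2_def
    proof (rule nn_integral_cong_AE)
      show "AE x in lborel. ennreal ((norm (g x - f n x))\<^sup>2) = liminf (\<lambda>i. ennreal ((norm (f (r i) x - f n x))\<^sup>2))"
        using ae
      proof eventually_elim
        case (elim x)
        then have "(\<lambda>i. f (r i) x) \<longlonglongrightarrow> g x" by (simp add: g_def convergent_LIMSEQ_iff)
        then have "(\<lambda>i. ennreal ((norm (f (r i) x - f n x))\<^sup>2)) \<longlonglongrightarrow> ennreal ((norm (g x - f n x))\<^sup>2)"
          by (intro tendsto_intros tendsto_ennrealI)
        from lim_imp_Liminf[OF _ this] show ?case by simp
      qed
    qed
    also have "\<dots> \<le> liminf (\<lambda>i. \<integral>\<^sup>+x. ennreal ((norm (f (r i) x - f n x))\<^sup>2) \<partial>lborel)"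
      by (rule nn_integral_liminf) measurable
    also have "\<dots> \<le> liminf (\<lambda>i. ennreal e)"
    proof (rule Liminf_mono)
      show "\<forall>\<^sub>F i in sequentially. (\<integral>\<^sup>+x. ennreal ((norm (f (r i) x - f n x))\<^sup>2) \<partial>lborel) \<le> ennreal e"
        using eventually_ge_at_top[of n]
      proof eventually_elim
        case (elim i)
        then have "n \<le> r i" using ri order_trans by blast
        then show ?case using n[of "r i"] by (simp add: N2_def)
      qed
    qed
    also have "\<dots> = ennreal e" by (simp add: Liminf_const)
    finally show ?thesis .
  qed
  have "(\<lambda>n. N2 (\<lambda>x. g x - f n x)) \<longlonglongrightarrow> 0"
  proof (rule order_tendstoI)
    fix e :: ennreal assume "0 < e"
    then obtain y where y: "0 < y" "y < e" using dense by blast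
    obtain e' where e': "0 < e'" "ennreal e' < e"
      using y by (cases y) auto
    obtain M where M: "\<forall>m\<ge>M. \<forall>n\<ge>M. N2 (\<lambda>x. f m x - f n x) \<le> ennreal e'"
      using C[OF e'(1)] by blast
    show "\<forall>\<^sub>F n in sequentially. N2 (\<lambda>x. g x - f n x) < e"
      using eventually_ge_at_top[of M]
    proof eventually_elim
      case (elim n)
      have "N2 (\<lambda>x. g x - f n x) \<le> ennreal e'"
        by (rule F) (use M elim in auto)
      then show ?case using e' by simp
    qed
  qed simp
  then show ?thesis by (intro exI[of _ g]) simp
qed

lemma N2_truncation_tendsto_0:
  fixes f :: "'a::euclidean_space \<Rightarrow> 'b::euclidean_space"
  assumes [measurable]: "f \<in> borel_measurable borel" and "N2 f < \<infinity>"
  shows "(\<lambda>n. N2 (\<lambda>x. indicator (- ball 0 (real n)) x *\<^sub>R f x)) \<longlonglongrightarrow> 0"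
proof -
  have "(\<lambda>n. \<integral>\<^sup>+x. ennreal ((norm (indicator (- ball 0 (real n)) x *\<^sub>R f x))\<^sup>2) \<partial>lborel) \<longlonglongrightarrow> (\<integral>\<^sup>+x. 0 \<partial>(lborel :: 'a measure))"
  proof (rule nn_integral_dominated_convergence[where w = "\<lambda>x. ennreal ((norm (f x))\<^sup>2)"])
    show "AE x in lborel. (\<lambda>n. ennreal ((norm (indicator (- ball 0 (real n)) x *\<^sub>R f x))\<^sup>2)) \<longlonglongrightarrow> 0"
    proof (intro AE_I2 tendsto_eventually)
      fix x :: 'a
      obtain n where "norm x < real n" using reals_Archimedean2 by blast
      then have "\<forall>m\<ge>n. ennreal ((norm (indicator (- ball 0 (real m)) x *\<^sub>R f x))\<^sup>2) = 0"
        by (auto simp: indicator_def)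
      then show "\<forall>\<^sub>F n in sequentially. ennreal ((norm (indicator (- ball 0 (real n)) x *\<^sub>R f x))\<^sup>2) = 0"
        using eventually_sequentially by blast
    qed
  qed (use assms in \<open>auto simp: N2_def indicator_def\<close>)
  then show ?thesis by (simp add: N2_def)
qed

section \<open>The Fourier transform on square-integrable functions\<close>

lemma norm_cscale: "norm (c *\<^sub>B p) = norm c * norm p"
proof -
  have "norm (c *s v) = norm c * norm v" for v :: "complex^3"
    by (simp add: norm_vec_def L2_set_def norm_mult power_mult_distrib real_sqrt_mult flip: sum_distrib_left)
  then show ?thesis
    by (cases p) (simp add: cscale_def norm_Pair norm_mult power_mult_distrib real_sqrt_mult flip: distrib_left)
qed

lemma bounded_bilinear_cscale: "bounded_bilinear cscale"
proof
  show "\<exists>K. \<forall>a b. norm (a *\<^sub>B b) \<le> norm a * norm b * K"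
    by (rule exI[of _ 1]) (simp add: norm_cscale)
qed (auto simp: cscale_def vec_eq_iff algebra_simps)

interpretation cscale: bounded_bilinear cscale by (rule bounded_bilinear_cscale)

lemma cscale_measurable[measurable (raw)]:
  assumes "f \<in> borel_measurable M" "g \<in> borel_measurable M"
  shows "(\<lambda>x. f x *\<^sub>B g x) \<in> borel_measurable M"
  using assms by (rule borel_measurable_continuous_Pair) (intro continuous_intros cscale.continuous_on)

lemma cscale_cscale: "a *\<^sub>B b *\<^sub>B p = (a * b) *\<^sub>B p"
  by (simp add: cscale_def vec_eq_iff)

lemma vec_nth_measurable[measurable (raw)]:
  fixes f :: "'a \<Rightarrow> ('b::euclidean_space)^3"
  assumes "f \<in> borel_measurable M"
  shows "(\<lambda>x. f x $ m) \<in> borel_measurable M"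
  using assms by (rule borel_measurable_continuous_on[rotated]) (intro continuous_intros)

definition wave :: "real^3 \<Rightarrow> real^3 \<Rightarrow> complex" where
  "wave k x = exp (2 * pi * \<i> * of_real (k \<bullet> x))"

lemma norm_wave[simp]: "norm (wave k x) = 1"
  by (simp add: wave_def)

lemma wave_measurable[measurable (raw)]:
  "f \<in> borel_measurable M \<Longrightarrow> g \<in> borel_measurable M \<Longrightarrow> (\<lambda>x. wave (f x) (g x)) \<in> borel_measurable M"
  unfolding wave_def by measurable

lemma wave_commute: "wave k x = wave x k"
  by (simp add: wave_def inner_commute)

lemma cnj_wave: "cnj (wave k x) = wave (- k) x"
  by (simp add: wave_def exp_cnj)

text \<open>The sign of the exponent is opposite to that of \<open>fourier_integral\<close>: this is the transform that acts on the
  test function when an inverse transform is moved to it.\<close>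

definition ft :: "(real^3 \<Rightarrow> complex) \<Rightarrow> real^3 \<Rightarrow> complex" where
  "ft f k = (LINT x|lborel. wave k x * f x)"

lemma fourier_integral_eq: "fourier_integral f k = (LINT x|lborel. wave (- k) x *\<^sub>B f x)"
  by (simp add: fourier_integral_def wave_def)

lemma ft_measurable[measurable]:
  assumes [measurable]: "f \<in> borel_measurable borel"
  shows "ft f \<in> borel_measurable borel"
  unfolding ft_def by measurable

lemma fourier_integral_measurable[measurable]:
  assumes [measurable]: "f \<in> borel_measurable borel"
  shows "fourier_integral f \<in> borel_measurable borel"
  unfolding fourier_integral_eq[abs_def] by measurable

lemma integrable_wave:
  assumes f: "integrable lborel f" shows "integrable lborel (\<lambda>x. wave k x * f x)"
proof -
  have [measurable]: "f \<in> borel_measurable borel" using f by auto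
  show ?thesis by (rule Bochner_Integration.integrable_bound[OF f]) (auto simp: norm_mult)
qed

lemma integrable_wave_cscale:
  assumes f: "integrable lborel f" shows "integrable lborel (\<lambda>x. wave k x *\<^sub>B f x)"
proof -
  have [measurable]: "f \<in> borel_measurable borel" using f by auto
  show ?thesis by (rule Bochner_Integration.integrable_bound[OF f]) (auto simp: norm_cscale)
qed

lemma norm_fourier_integral_le:
  "norm (fourier_integral f k) \<le> (LINT x|lborel. norm (f x))"
  unfolding fourier_integral_eq
  by (rule order_trans[OF integral_norm_bound]) (simp add: norm_cscale)

lemma integrable_pair_mult:
  fixes f :: "'a \<Rightarrow> complex" and g :: "'b \<Rightarrow> complex"
  assumes "sigma_finite_measure M" "sigma_finite_measure N"
  assumes f: "integrable M f" and g: "integrable N g"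
  shows "integrable (M \<Otimes>\<^sub>M N) (\<lambda>p. f (fst p) * g (snd p))"
proof -
  interpret pair_sigma_finite M N using assms by (simp add: pair_sigma_finite_def)
  have [measurable]: "f \<in> borel_measurable M" "g \<in> borel_measurable N" using f g by auto
  show ?thesis
    by (rule Fubini_integrable) (use f g in \<open>auto simp: norm_mult\<close>)
qed

abbreviation gweight :: "real \<Rightarrow> real^3 \<Rightarrow> real" where
  "gweight \<beta> k \<equiv> exp (- (norm ((2 * pi / \<beta>) *\<^sub>R k))\<^sup>2 / 2)"

text \<open>The Gaussian weight makes the triple integral over \<open>(k, x, y)\<close> absolutely convergent, so that the
  integration over \<open>k\<close> can be carried out first.\<close>

lemma ft_mult_gweight:
  assumes f: "integrable lborel f" and g: "integrable lborel g" and \<beta>: "\<beta> > 0"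
  shows "(LINT k|lborel. (ft f (- k) * ft g k) * gweight \<beta> k)
    = (LINT p|(lborel \<Otimes>\<^sub>M lborel). (f (fst p) * g (snd p)) * gauss \<beta> (snd p - fst p))"
proof -
  interpret Q: pair_sigma_finite "lborel :: (real^3) measure" "lborel \<Otimes>\<^sub>M lborel :: ((real^3) \<times> (real^3)) measure" ..
  have [measurable]: "f \<in> borel_measurable borel" "g \<in> borel_measurable borel" using f g by auto
  have fg: "integrable (lborel \<Otimes>\<^sub>M lborel) (\<lambda>p. f (fst p) * g (snd p))"
    by (intro integrable_pair_mult f g) (auto intro: lborel.sigma_finite_measure_axioms)
  have w: "integrable lborel (\<lambda>k::real^3. complex_of_real (gweight \<beta> k))"
    by (intro integrable_of_real gauss_weight_integrable \<beta>)
  have gk: "(LINT k|lborel. wave k z * gweight \<beta> k) = gauss \<beta> z" for z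
    unfolding wave_def by (rule gauss_fourier[OF \<beta>])
  have "integrable (lborel \<Otimes>\<^sub>M (lborel \<Otimes>\<^sub>M lborel)) (\<lambda>q. complex_of_real (gweight \<beta> (fst q)) * (f (fst (snd q)) * g (snd (snd q))))"
    using integrable_pair_mult[OF _ _ w fg] lborel.sigma_finite_measure_axioms lborel_pair.sigma_finite_measure_axioms by blast
  then have I: "integrable (lborel \<Otimes>\<^sub>M (lborel \<Otimes>\<^sub>M lborel))
     (\<lambda>(k,p). (wave k (snd p - fst p) * gweight \<beta> k) * (f (fst p) * g (snd p)))"
    by (rule Bochner_Integration.integrable_bound) (auto simp: norm_mult split_beta)
  have 1: "ft f (- k) * ft g k = (LINT p|(lborel \<Otimes>\<^sub>M lborel). wave k (snd p - fst p) * (f (fst p) * g (snd p)))" for k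
  proof -
    have "integrable (lborel \<Otimes>\<^sub>M lborel) (\<lambda>p. (wave (- k) (fst p) * f (fst p)) * (wave k (snd p) * g (snd p)))"
      by (intro integrable_pair_mult[where f = "\<lambda>x. wave (- k) x * f x" and g = "\<lambda>x. wave k x * g x"] integrable_wave f g) (auto intro: lborel.sigma_finite_measure_axioms)
    from lborel_pair.integral_fst'[OF this]
    have "(LINT p|(lborel \<Otimes>\<^sub>M lborel). (wave (- k) (fst p) * f (fst p)) * (wave k (snd p) * g (snd p))) = ft f (- k) * ft g k"
      by (simp add: ft_def)
    moreover have "(wave (- k) x * f x) * (wave k y * g y) = wave k (y - x) * (f x * g y)" for x y
      by (simp add: wave_def inner_diff_right exp_diff exp_minus algebra_simps divide_inverse)
    ultimately show ?thesis by simp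
  qed
  have "(LINT k|lborel. (ft f (- k) * ft g k) * gweight \<beta> k)
    = (LINT k|lborel. (LINT p|(lborel \<Otimes>\<^sub>M lborel). (wave k (snd p - fst p) * gweight \<beta> k) * (f (fst p) * g (snd p))))"
    unfolding 1 by (simp add: mult_ac flip: integral_mult_left_zero)
  also have "\<dots> = (LINT p|(lborel \<Otimes>\<^sub>M lborel). (LINT k|lborel. (wave k (snd p - fst p) * gweight \<beta> k) * (f (fst p) * g (snd p))))"
    by (rule Q.Fubini_integral[OF I, symmetric])
  also have "\<dots> = (LINT p|(lborel \<Otimes>\<^sub>M lborel). gauss \<beta> (snd p - fst p) * (f (fst p) * g (snd p)))"
    by (simp only: integral_mult_left_zero gk)
  finally show ?thesis by (simp add: mult_ac)
qed

lemma gweight_tendsto: "(\<lambda>n. gweight (real (Suc n)) k) \<longlonglongrightarrow> 1"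
proof -
  define h where "h s = exp (- (norm ((2 * pi * s) *\<^sub>R k))\<^sup>2 / 2)" for s :: real
  have "isCont h 0" unfolding h_def by (intro continuous_intros) auto
  from isCont_tendsto_compose[OF this LIMSEQ_inverse_real_of_nat]
  have "(\<lambda>n. h (inverse (real (Suc n)))) \<longlonglongrightarrow> h 0" .
  moreover have "h 0 = 1" by (simp add: h_def)
  moreover have "h (inverse (real (Suc n))) = gweight (real (Suc n)) k" for n
    unfolding h_def divide_inverse ..
  ultimately show ?thesis by simp
qed

lemma nn_integral_lborel_minus:
  fixes f :: "'a::euclidean_space \<Rightarrow> ennreal"
  assumes [measurable]: "f \<in> borel_measurable borel"
  shows "(\<integral>\<^sup>+x. f (- x) \<partial>lborel) = (\<integral>\<^sup>+x. f x \<partial>lborel)"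
proof -
  have "(\<integral>\<^sup>+x. f x \<partial>lborel) = (\<integral>\<^sup>+x. f x \<partial>(density (distr lborel borel (\<lambda>x. 0 + (-1) *\<^sub>R x)) (\<lambda>_. ennreal (\<bar>-1\<bar> ^ DIM('a)))))"
    by (subst lborel_affine[of "-1" 0, symmetric]) auto
  also have "\<dots> = (\<integral>\<^sup>+x. f (- x) \<partial>lborel)"
    by (subst nn_integral_density) (auto simp: nn_integral_distr)
  finally show ?thesis ..
qed

text \<open>Plancherel's inequality. With a Gaussian weight, the integral of \<open>\<bar>ft f\<bar>\<^sup>2\<close> is that of \<open>f x\<close> times the
  conjugate of \<open>f y\<close> against a probability density in \<open>y - x\<close>, and \<open>\<bar>f x\<bar> \<bar>f y\<bar>\<close> is at most the mean of the two
  squares. Fatou's lemma removes the weight.\<close>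

lemma N2_ft_le:
  assumes f: "integrable lborel f"
  shows "N2 (ft f) \<le> N2 f"
proof -
  have [measurable]: "f \<in> borel_measurable borel" using f by auto
  have c: "ft (\<lambda>x. cnj (f x)) k = cnj (ft f (- k))" for k
  proof -
    have "ft (\<lambda>x. cnj (f x)) k = (LINT x|lborel. cnj (wave (- k) x * f x))"
      by (simp add: ft_def cnj_wave)
    then show ?thesis by (simp only: Bochner_Integration.integral_cnj ft_def)
  qed
  have cf: "integrable lborel (\<lambda>x. cnj (f x))" using f by simp
  have *: "(\<integral>\<^sup>+k. ennreal ((norm (ft f (- k)))\<^sup>2 * gweight \<beta> k) \<partial>lborel) \<le> N2 f" if \<beta>: "\<beta> > 0" for \<beta>
  proof -
    have "(ft f (- k) * ft (\<lambda>x. cnj (f x)) k) * gweight \<beta> k = complex_of_real ((norm (ft f (- k)))\<^sup>2 * gweight \<beta> k)" for k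
      using complex_norm_square[of "ft f (- k)"] by (simp add: c)
    note sq = this
    have 1: "complex_of_real (LINT k|lborel. (norm (ft f (- k)))\<^sup>2 * gweight \<beta> k) =
      (LINT p|(lborel \<Otimes>\<^sub>M lborel). (f (fst p) * cnj (f (snd p))) * gauss \<beta> (snd p - fst p))"
      using ft_mult_gweight[OF f cf \<beta>] by (simp only: sq integral_complex_of_real)
    have bd: "norm (ft f k) \<le> (LINT x|lborel. norm (f x))" for k
      unfolding ft_def by (rule order_trans[OF integral_norm_bound]) (simp add: norm_mult)
    have i: "integrable lborel (\<lambda>k. (norm (ft f (- k)))\<^sup>2 * gweight \<beta> k)"
    proof (rule Bochner_Integration.integrable_bound)
      show "integrable lborel (\<lambda>k::real^3. (LINT x|lborel. norm (f x))\<^sup>2 * gweight \<beta> k)"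
        by (intro integrable_mult_right gauss_weight_integrable \<beta>)
    qed (auto intro!: AE_I2 mult_right_mono power_mono bd)
    have gx: "(\<integral>\<^sup>+y. ennreal (gauss \<beta> (y - x)) \<partial>lborel) = 1" for x :: "real^3"
    proof -
      have "integrable lborel (\<lambda>y. gauss \<beta> (y - x))" "(LINT y|lborel. gauss \<beta> (y - x)) = 1"
        using gauss_integral[OF \<beta>, where 'a="real^3"] lborel_integrable_affine[of 1 "gauss \<beta>" "- x"] lborel_integral_affine[of 1 "gauss \<beta>" "- x"]
        by (auto simp: has_bochner_integral_iff)
      then show ?thesis using nn_integral_eq_integral[of lborel "\<lambda>y. gauss \<beta> (y - x)"] gauss_nonneg[of \<beta>, where 'a="real^3"] \<beta> by simp
    qed
    have gy: "(\<integral>\<^sup>+x. ennreal (gauss \<beta> (y - x)) \<partial>lborel) = 1" for y :: "real^3"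
    proof -
      have "integrable lborel (\<lambda>x. gauss \<beta> (y - x))" "(LINT x|lborel. gauss \<beta> (y - x)) = 1"
        using gauss_integral[OF \<beta>, where 'a="real^3"] lborel_integrable_affine[of "-1" "gauss \<beta>" "y"] lborel_integral_affine[of "-1" "gauss \<beta>" "y"]
        by (auto simp: has_bochner_integral_iff)
      then show ?thesis using nn_integral_eq_integral[of lborel "\<lambda>x. gauss \<beta> (y - x)"] gauss_nonneg[of \<beta>, where 'a="real^3"] \<beta> by simp
    qed
    have "(\<integral>\<^sup>+k. ennreal ((norm (ft f (- k)))\<^sup>2 * gweight \<beta> k) \<partial>lborel) = ennreal (LINT k|lborel. (norm (ft f (- k)))\<^sup>2 * gweight \<beta> k)"
      by (rule nn_integral_eq_integral[OF i]) auto
    also have "\<dots> \<le> ennreal (norm (LINT p|(lborel \<Otimes>\<^sub>M lborel). (f (fst p) * cnj (f (snd p))) * gauss \<beta> (snd p - fst p)))"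
      unfolding 1[symmetric] by (intro ennreal_leI) (simp only: norm_of_real abs_ge_self)
    also have "\<dots> \<le> (\<integral>\<^sup>+p. ennreal (norm ((f (fst p) * cnj (f (snd p))) * gauss \<beta> (snd p - fst p))) \<partial>(lborel \<Otimes>\<^sub>M lborel))"
      by (cases "integrable (lborel \<Otimes>\<^sub>M lborel) (\<lambda>p. (f (fst p) * cnj (f (snd p))) * complex_of_real (gauss \<beta> (snd p - fst p)))")
        (auto intro!: integral_norm_bound_ennreal simp: not_integrable_integral_eq)
    also have "\<dots> \<le> (\<integral>\<^sup>+p. ennreal ((norm (f (fst p)))\<^sup>2 / 2) * ennreal (gauss \<beta> (snd p - fst p)) + ennreal ((norm (f (snd p)))\<^sup>2 / 2) * ennreal (gauss \<beta> (snd p - fst p)) \<partial>(lborel \<Otimes>\<^sub>M lborel))"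
    proof (rule nn_integral_mono)
      fix p :: "(real^3) \<times> (real^3)"
      have g: "gauss \<beta> (snd p - fst p) \<ge> 0" using \<beta> by (intro gauss_nonneg) auto
      have "norm ((f (fst p) * cnj (f (snd p))) * gauss \<beta> (snd p - fst p)) = (norm (f (fst p)) * norm (f (snd p))) * gauss \<beta> (snd p - fst p)"
        using g by (simp add: norm_mult)
      also have "\<dots> \<le> ((norm (f (fst p)))\<^sup>2 / 2 + (norm (f (snd p)))\<^sup>2 / 2) * gauss \<beta> (snd p - fst p)"
        using sum_squares_bound[of "norm (f (fst p))" "norm (f (snd p))"] g by (intro mult_right_mono) auto
      finally have "ennreal (norm ((f (fst p) * cnj (f (snd p))) * gauss \<beta> (snd p - fst p))) \<le> ennreal (((norm (f (fst p)))\<^sup>2 / 2 + (norm (f (snd p)))\<^sup>2 / 2) * gauss \<beta> (snd p - fst p))"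
        by (rule ennreal_leI)
      also have "\<dots> = ennreal ((norm (f (fst p)))\<^sup>2 / 2) * ennreal (gauss \<beta> (snd p - fst p)) + ennreal ((norm (f (snd p)))\<^sup>2 / 2) * ennreal (gauss \<beta> (snd p - fst p))"
        using g by (simp only: ennreal_mult'' ennreal_plus zero_le_divide_iff zero_le_power2 zero_le_numeral simp_thms distrib_right[of "ennreal _"])
      finally show "ennreal (norm ((f (fst p) * cnj (f (snd p))) * gauss \<beta> (snd p - fst p))) \<le> ennreal ((norm (f (fst p)))\<^sup>2 / 2) * ennreal (gauss \<beta> (snd p - fst p)) + ennreal ((norm (f (snd p)))\<^sup>2 / 2) * ennreal (gauss \<beta> (snd p - fst p))" .
    qed
    also have "\<dots> = (\<integral>\<^sup>+p. ennreal ((norm (f (fst p)))\<^sup>2 / 2) * ennreal (gauss \<beta> (snd p - fst p)) \<partial>(lborel \<Otimes>\<^sub>M lborel)) + (\<integral>\<^sup>+p. ennreal ((norm (f (snd p)))\<^sup>2 / 2) * ennreal (gauss \<beta> (snd p - fst p)) \<partial>(lborel \<Otimes>\<^sub>M lborel))"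
      by (rule nn_integral_add) measurable
    also have "(\<integral>\<^sup>+p. ennreal ((norm (f (fst p)))\<^sup>2 / 2) * ennreal (gauss \<beta> (snd p - fst p)) \<partial>(lborel \<Otimes>\<^sub>M lborel)) = (\<integral>\<^sup>+x. ennreal ((norm (f x))\<^sup>2 / 2) * (\<integral>\<^sup>+y. ennreal (gauss \<beta> (y - x)) \<partial>lborel) \<partial>lborel)"
      by (subst lborel.nn_integral_fst[symmetric]) (auto simp: nn_integral_cmult)
    also have "(\<integral>\<^sup>+p. ennreal ((norm (f (snd p)))\<^sup>2 / 2) * ennreal (gauss \<beta> (snd p - fst p)) \<partial>(lborel \<Otimes>\<^sub>M lborel)) = (\<integral>\<^sup>+y. ennreal ((norm (f y))\<^sup>2 / 2) * (\<integral>\<^sup>+x. ennreal (gauss \<beta> (y - x)) \<partial>lborel) \<partial>lborel)"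
      by (subst lborel_pair.nn_integral_snd[symmetric]) (auto simp: nn_integral_cmult)
    also have "(\<integral>\<^sup>+x. ennreal ((norm (f x))\<^sup>2 / 2) * (\<integral>\<^sup>+y. ennreal (gauss \<beta> (y - x)) \<partial>lborel) \<partial>lborel) + (\<integral>\<^sup>+y. ennreal ((norm (f y))\<^sup>2 / 2) * (\<integral>\<^sup>+x. ennreal (gauss \<beta> (y - x)) \<partial>lborel) \<partial>lborel) = N2 f"
      unfolding N2_def gx gy mult_1_right by (subst nn_integral_add[symmetric]) (auto simp flip: ennreal_plus)
    finally show ?thesis .
  qed
  have "N2 (ft f) = (\<integral>\<^sup>+k. ennreal ((norm (ft f (- k)))\<^sup>2) \<partial>lborel)"
    unfolding N2_def by (rule nn_integral_lborel_minus[symmetric]) measurable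
  also have "\<dots> = (\<integral>\<^sup>+k. liminf (\<lambda>n. ennreal ((norm (ft f (- k)))\<^sup>2 * gweight (real (Suc n)) k)) \<partial>lborel)"
  proof (intro nn_integral_cong lim_imp_Liminf[symmetric] tendsto_ennrealI)
    show "(\<lambda>n. (norm (ft f (- k)))\<^sup>2 * gweight (real (Suc n)) k) \<longlonglongrightarrow> (norm (ft f (- k)))\<^sup>2" for k
      using tendsto_mult_left[OF gweight_tendsto, of "(norm (ft f (- k)))\<^sup>2" k] unfolding mult_1_right .
  qed simp
  also have "\<dots> \<le> liminf (\<lambda>n. \<integral>\<^sup>+k. ennreal ((norm (ft f (- k)))\<^sup>2 * gweight (real (Suc n)) k) \<partial>lborel)"
    by (rule nn_integral_liminf) measurable
  also have "\<dots> \<le> liminf (\<lambda>n. N2 f)"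
    by (intro Liminf_mono always_eventually allI *) auto
  also have "\<dots> = N2 f" by (simp add: Liminf_const)
  finally show ?thesis .
qed

lemma N2_reflect:
  assumes [measurable]: "f \<in> borel_measurable borel"
  shows "N2 (\<lambda>x. f (- x)) = N2 f"
  unfolding N2_def by (rule nn_integral_lborel_minus) measurable

lemma L2_reflect: "L2 f \<Longrightarrow> L2 (\<lambda>x. f (- x))"
  by (auto simp: L2_iff N2_reflect)

text \<open>Parseval's identity, for a continuous second factor: the Gaussian weights on the Fourier side turn
  into convolutions with an approximate identity.\<close>

lemma parseval:
  assumes f: "integrable lborel f" "L2 f"
    and g: "integrable lborel g" "L2 g" "continuous_on UNIV g" and b: "\<And>x. norm (g x) \<le> M"
  shows "(LINT k|lborel. ft f (- k) * ft g k) = (LINT x|lborel. f x * g x)"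
proof -
  have [measurable]: "f \<in> borel_measurable borel" "g \<in> borel_measurable borel" using f g by auto
  have "L2 (\<lambda>k. ft f (- k))"
    using N2_ft_le[OF f(1)] f(2) by (intro L2_reflect) (auto simp: L2_iff)
  moreover have "L2 (ft g)"
    using N2_ft_le[OF g(1)] g(2) by (auto simp: L2_iff)
  ultimately have i: "integrable lborel (\<lambda>k. ft f (- k) * ft g k)"
    by (rule L2_mult_integrable) (auto simp: norm_mult)
  have l1: "(\<lambda>n. LINT k|lborel. (ft f (- k) * ft g k) * gweight (real (Suc n)) k) \<longlonglongrightarrow> (LINT k|lborel. ft f (- k) * ft g k)"
  proof (rule integral_dominated_convergence[where w = "\<lambda>k. norm (ft f (- k) * ft g k)"])
    show "AE k in lborel. (\<lambda>n. (ft f (- k) * ft g k) * gweight (real (Suc n)) k) \<longlonglongrightarrow> ft f (- k) * ft g k"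
    proof (intro AE_I2)
      fix k
      have "(\<lambda>n. (ft f (- k) * ft g k) * gweight (real (Suc n)) k) \<longlonglongrightarrow> (ft f (- k) * ft g k) * of_real 1"
        by (intro tendsto_intros gweight_tendsto)
      then show "(\<lambda>n. (ft f (- k) * ft g k) * gweight (real (Suc n)) k) \<longlonglongrightarrow> ft f (- k) * ft g k" by simp
    qed
  qed (use integrable_norm[OF i] in \<open>auto simp: norm_mult mult_left_le\<close>)
  have l2: "(\<lambda>n. LINT x|lborel. f x * (LINT z|lborel. gauss (real (Suc n)) z *\<^sub>R g (x + z))) \<longlonglongrightarrow> (LINT x|lborel. f x * g x)"
  proof (rule integral_dominated_convergence[where w = "\<lambda>x. norm (f x) * M"])
    show "integrable lborel (\<lambda>x. norm (f x) * M)" using f by simp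
    show "AE x in lborel. (\<lambda>n. f x * (LINT z|lborel. gauss (real (Suc n)) z *\<^sub>R g (x + z))) \<longlonglongrightarrow> f x * g x"
      by (intro AE_I2 tendsto_intros gauss_approximate_identity[OF g(3) b])
    have "norm (LINT z|lborel. gauss (real (Suc n)) z *\<^sub>R g (x + z)) \<le> M" for n x
    proof -
      have gi: "has_bochner_integral lborel (gauss (real (Suc n)) :: real^3 \<Rightarrow> real) 1" by (rule gauss_integral) simp
      have "norm (LINT z|lborel. gauss (real (Suc n)) z *\<^sub>R g (x + z)) \<le> (LINT z|lborel. gauss (real (Suc n)) (z :: real^3) * M)"
      proof (rule Bochner_Integration.integral_norm_bound_integral)
        show i: "integrable lborel (\<lambda>z. gauss (real (Suc n)) (z :: real^3) * M)"
          using gi by (simp add: has_bochner_integral_iff)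
        show n: "norm (gauss (real (Suc n)) z *\<^sub>R g (x + z)) \<le> gauss (real (Suc n)) z * M" for z :: "real^3"
          using gauss_nonneg[of "real (Suc n)" z] b by (auto intro!: mult_mono)
        show "integrable lborel (\<lambda>z. gauss (real (Suc n)) z *\<^sub>R g (x + z))"
          by (rule Bochner_Integration.integrable_bound[OF i]) (use n in \<open>auto intro!: AE_I2 intro: order_trans[OF _ abs_ge_self]\<close>)
      qed
      also have "\<dots> = M" using gi by (simp add: has_bochner_integral_iff)
      finally show ?thesis .
    qed
    then show "AE x in lborel. norm (f x * (LINT z|lborel. gauss (real (Suc n)) z *\<^sub>R g (x + z))) \<le> norm (f x) * M" for n
      by (intro AE_I2) (auto simp: norm_mult intro!: mult_left_mono)
  qed auto
  have eq: "(LINT k|lborel. (ft f (- k) * ft g k) * gweight (real (Suc n)) k) = (LINT x|lborel. f x * (LINT z|lborel. gauss (real (Suc n)) z *\<^sub>R g (x + z)))" for n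
  proof -
    have "integrable (lborel \<Otimes>\<^sub>M lborel) (\<lambda>p. f (fst p) * complex_of_real (gauss (real (Suc n)) (snd p :: real^3)))"
      using gauss_integral[of "real (Suc n)", where 'a="real^3"] f
      by (intro integrable_pair_mult[where g="\<lambda>z. complex_of_real (gauss (real (Suc n)) z)"]) (auto simp: has_bochner_integral_iff intro: lborel.sigma_finite_measure_axioms)
    then have "integrable (lborel \<Otimes>\<^sub>M lborel) (\<lambda>p. (f (fst p) * complex_of_real (gauss (real (Suc n)) (snd p :: real^3))) * M)"
      by simp
    then have I: "integrable (lborel \<Otimes>\<^sub>M lborel) (\<lambda>p. f (fst p) * (gauss (real (Suc n)) (snd p) *\<^sub>R g (fst p + snd p)))"
      by (rule Bochner_Integration.integrable_bound)
        (auto intro!: AE_I2 mult_left_mono order_trans[OF b abs_ge_self] simp: norm_mult mult.assoc mult.left_commute[of "norm (f _)"])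
    have sh: "(LINT y|lborel. (f x * g y) * gauss (real (Suc n)) (y - x)) = (LINT z|lborel. f x * (gauss (real (Suc n)) z *\<^sub>R g (x + z)))" for x
      using lborel_integral_affine[of 1 "\<lambda>y. (f x * g y) * gauss (real (Suc n)) (y - x)" x] by (simp add: scaleR_conv_of_real mult_ac)
    have J: "integrable (lborel \<Otimes>\<^sub>M lborel) (\<lambda>p. (f (fst p) * g (snd p)) * gauss (real (Suc n)) (snd p - fst p))"
    proof (rule lborel_pair.Fubini_integrable)
      have sn: "(LINT y|lborel. norm ((f x * g y) * gauss (real (Suc n)) (y - x))) = (LINT z|lborel. norm (f x * (gauss (real (Suc n)) z *\<^sub>R g (x + z))))" for x
        using lborel_integral_affine[of 1 "\<lambda>y. norm ((f x * g y) * gauss (real (Suc n)) (y - x))" x] by (simp add: norm_mult mult_ac)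
      show "integrable lborel (\<lambda>x. LINT y|lborel. norm ((f (fst (x, y)) * g (snd (x, y))) * gauss (real (Suc n)) (snd (x, y) - fst (x, y))))"
        using lborel_pair.integrable_fst'[OF integrable_norm[OF I]] by (simp only: sn fst_conv snd_conv)
      have si: "integrable lborel (\<lambda>y. (f x * g y) * gauss (real (Suc n)) (y - x)) \<longleftrightarrow> integrable lborel (\<lambda>z. f x * (gauss (real (Suc n)) z *\<^sub>R g (x + z)))" for x
        using lborel_integrable_affine[of 1 "\<lambda>y. (f x * g y) * gauss (real (Suc n)) (y - x)" x] by (simp add: scaleR_conv_of_real mult_ac)
      show "AE x in lborel. integrable lborel (\<lambda>y. (f (fst (x, y)) * g (snd (x, y))) * gauss (real (Suc n)) (snd (x, y) - fst (x, y)))"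
        using lborel_pair.AE_integrable_fst'[OF I] by (simp only: si fst_conv snd_conv)
    qed measurable
    have "(LINT k|lborel. (ft f (- k) * ft g k) * gweight (real (Suc n)) k) = (LINT p|(lborel \<Otimes>\<^sub>M lborel). (f (fst p) * g (snd p)) * gauss (real (Suc n)) (snd p - fst p))"
      by (rule ft_mult_gweight[OF f(1) g(1)]) simp
    also have "\<dots> = (LINT x|lborel. (LINT y|lborel. (f x * g y) * gauss (real (Suc n)) (y - x)))"
      using lborel_pair.integral_fst'[OF J] by simp
    also have "\<dots> = (LINT x|lborel. f x * (LINT z|lborel. gauss (real (Suc n)) z *\<^sub>R g (x + z)))"
      unfolding sh by (simp only: integral_mult_right_zero)
    finally show ?thesis .
  qed
  show ?thesis
    using LIMSEQ_unique[OF l1] l2 unfolding eq by blast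
qed

lemma integral_component:
  fixes f :: "'a \<Rightarrow> biquat"
  assumes "integrable M f"
  shows integral_Sc: "Sc (integral\<^sup>L M f) = (LINT x|M. Sc (f x))"
    and integral_Vec: "Vec (integral\<^sup>L M f) $ m = (LINT x|M. Vec (f x) $ m)"
    and integrable_Sc: "integrable M (\<lambda>x. Sc (f x))"
    and integrable_Vec: "integrable M (\<lambda>x. Vec (f x) $ m)"
proof -
  have b: "bounded_linear (\<lambda>p::biquat. Vec p $ m)"
    by (rule bounded_linear_compose[OF bounded_linear_vec_nth bounded_linear_snd])
  show "Sc (integral\<^sup>L M f) = (LINT x|M. Sc (f x))" "Vec (integral\<^sup>L M f) $ m = (LINT x|M. Vec (f x) $ m)"
    using integral_bounded_linear[OF bounded_linear_fst assms] integral_bounded_linear[OF b assms] by simp_all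
  show "integrable M (\<lambda>x. Sc (f x))" "integrable M (\<lambda>x. Vec (f x) $ m)"
    using integrable_bounded_linear[OF bounded_linear_fst assms] integrable_bounded_linear[OF b assms] by simp_all
qed

lemma Sc_cscale[simp]: "Sc (c *\<^sub>B p) = c * Sc p"
  and Vec_cscale[simp]: "Vec (c *\<^sub>B p) = c *s Vec p"
  by (simp_all add: cscale_def)

lemma norm_biquat: "(norm p)\<^sup>2 = (norm (Sc p))\<^sup>2 + (\<Sum>m\<in>UNIV. (norm (Vec p $ m))\<^sup>2)" for p :: biquat
proof -
  have "(norm (Vec p))\<^sup>2 = (\<Sum>m\<in>UNIV. (norm (Vec p $ m))\<^sup>2)"
    by (simp add: norm_vec_def L2_set_def sum_nonneg)
  moreover have "0 \<le> (norm (Sc p))\<^sup>2 + (norm (Vec p))\<^sup>2" by simp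
  ultimately show ?thesis by (cases p) (simp add: norm_Pair)
qed

lemma norm_Sc_le: "norm (Sc p) \<le> norm p" for p :: biquat
  using norm_fst_le[of "Sc p" "Vec p"] by simp

lemma norm_Vec_le: "norm (Vec p $ m) \<le> norm p" for p :: biquat
  using Finite_Cartesian_Product.norm_nth_le[of "Vec p" m] norm_snd_le[of "Vec p" "Sc p"] by simp

lemma measurable_Sc_Vec[measurable (raw)]:
  fixes f :: "'a \<Rightarrow> biquat"
  assumes "f \<in> borel_measurable M"
  shows "(\<lambda>x. Sc (f x)) \<in> borel_measurable M" "(\<lambda>x. Vec (f x)) \<in> borel_measurable M"
  using assms by (rule borel_measurable_continuous_on[rotated], intro continuous_intros)+

lemma N2_components:
  fixes f :: "real^3 \<Rightarrow> biquat"
  assumes [measurable]: "f \<in> borel_measurable borel"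
  shows "N2 f = N2 (\<lambda>x. Sc (f x)) + (\<Sum>m\<in>UNIV. N2 (\<lambda>x. Vec (f x) $ m))"
proof -
  have e: "ennreal ((norm (f x))\<^sup>2) = ennreal ((norm (Sc (f x)))\<^sup>2) + (\<Sum>m\<in>UNIV. ennreal ((norm (Vec (f x) $ m))\<^sup>2))" for x
    unfolding norm_biquat by (simp add: ennreal_plus sum_nonneg sum_ennreal)
  show ?thesis
    unfolding N2_def e by (subst nn_integral_add) (auto simp: nn_integral_sum simp del: sum_ennreal)
qed

lemma N2_fourier_integral_le:
  assumes f: "integrable lborel f"
  shows "N2 (fourier_integral f) \<le> N2 f"
proof -
  have [measurable]: "f \<in> borel_measurable borel" using f by auto
  have S: "Sc (fourier_integral f k) = ft (\<lambda>x. Sc (f x)) (- k)" for k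
    unfolding fourier_integral_eq ft_def by (subst integral_Sc[OF integrable_wave_cscale[OF f]]) simp
  have V: "Vec (fourier_integral f k) $ m = ft (\<lambda>x. Vec (f x) $ m) (- k)" for k m
    unfolding fourier_integral_eq ft_def by (subst integral_Vec[OF integrable_wave_cscale[OF f]]) simp
  have "N2 (\<lambda>k. Sc (fourier_integral f k)) \<le> N2 (\<lambda>x. Sc (f x))"
    unfolding S by (subst N2_reflect) (auto intro: N2_ft_le integrable_Sc f)
  moreover have "N2 (\<lambda>k. Vec (fourier_integral f k) $ m) \<le> N2 (\<lambda>x. Vec (f x) $ m)" for m
    unfolding V by (subst N2_reflect) (auto intro: N2_ft_le integrable_Vec f)
  ultimately show ?thesis
    by (simp only: N2_components[of f] N2_components[of "fourier_integral f"] \<open>f \<in> _\<close> fourier_integral_measurable)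
      (intro add_mono sum_mono)
qed

lemma fourier_integral_diff:
  assumes "integrable lborel f" "integrable lborel g"
  shows "fourier_integral f k - fourier_integral g k = fourier_integral (\<lambda>x. f x - g x) k"
  unfolding fourier_integral_eq
  by (subst Bochner_Integration.integral_diff[symmetric]) (auto intro: integrable_wave_cscale assms simp: cscale.diff_right)

lemma L2_indicator_bounded:
  fixes c :: "'b::euclidean_space"
  assumes "A \<in> sets borel" "bounded A"
  shows "L2 (\<lambda>x. indicator A x *\<^sub>R c)"
proof -
  have "emeasure lborel A < \<infinity>" by (rule emeasure_bounded_finite) fact
  then have "integrable lborel (\<lambda>x. indicator A x * (norm c)\<^sup>2)"
    using assms by (intro integrable_mult_left integrable_real_indicator) auto
  also have "(\<lambda>x. indicator A x * (norm c)\<^sup>2) = (\<lambda>x. (norm (indicator A x *\<^sub>R c))\<^sup>2)"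
    by (auto simp: indicator_def)
  finally show ?thesis using assms by (auto simp: L2_def)
qed

lemma L2_truncation_integrable:
  fixes f :: "real^3 \<Rightarrow> 'b::euclidean_space"
  assumes f: "L2 f" and A: "A \<in> sets borel" "bounded A"
  shows "integrable lborel (\<lambda>x. indicator A x *\<^sub>R f x)"
  by (rule L2_mult_integrable[OF L2_indicator_bounded[OF A, of "1::real"] f]) (use f A in \<open>auto dest: L2_measurable\<close>)

abbreviation trunc :: "nat \<Rightarrow> (real^3 \<Rightarrow> 'b::real_vector) \<Rightarrow> real^3 \<Rightarrow> 'b" where
  "trunc n f \<equiv> (\<lambda>x. indicator (ball 0 (real n)) x *\<^sub>R f x)"

lemma trunc_measurable[measurable]:
  fixes f :: "real^3 \<Rightarrow> 'b::euclidean_space"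
  shows "f \<in> borel_measurable borel \<Longrightarrow> trunc n f \<in> borel_measurable borel"
  by (intro borel_measurable_scaleR borel_measurable_indicator) auto

lemma trunc_integrable: "L2 f \<Longrightarrow> integrable lborel (trunc n f)" for f :: "real^3 \<Rightarrow> 'b::euclidean_space"
  by (rule L2_truncation_integrable) auto

text \<open>Both on integrable functions and on the other functions of \<open>L\<^sup>2\<close> the transform is the \<open>L\<^sup>2\<close>-limit of the
  transforms of the truncations. In the second case the limit exists by completeness, because
  Plancherel's inequality makes these transforms a Cauchy sequence.\<close>

lemma fourier_L2:
  assumes f: "L2 f"
  shows "L2 (fourier f)" and "(\<lambda>n. N2 (\<lambda>k. fourier f k - fourier_integral (trunc n f) k)) \<longlonglongrightarrow> 0"
proof -
  have [measurable]: "f \<in> borel_measurable borel" and fin: "N2 f < \<infinity>" using f by (auto simp: L2_iff)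
  let ?F = "\<lambda>n. fourier_integral (trunc n f)"
  have tail: "(\<lambda>n. N2 (\<lambda>x. indicator (- ball 0 (real n)) x *\<^sub>R f x)) \<longlonglongrightarrow> 0"
    by (rule N2_truncation_tendsto_0) fact+
  have key: "L2 (fourier f) \<and> (\<lambda>n. N2 (\<lambda>k. fourier f k - ?F n k)) \<longlonglongrightarrow> 0"
  proof (cases "integrable lborel f")
    case True
    have "N2 (\<lambda>k. fourier f k - ?F n k) \<le> N2 (\<lambda>x. indicator (- ball 0 (real n)) x *\<^sub>R f x)" for n
    proof -
      have eq: "(\<lambda>k. fourier f k - ?F n k) = fourier_integral (\<lambda>x. f x - trunc n f x)"
        using True by (auto simp: fourier_def fourier_integral_diff trunc_integrable[OF f])
      have "N2 (\<lambda>k. fourier f k - ?F n k) \<le> N2 (\<lambda>x. f x - trunc n f x)"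
        unfolding eq by (intro N2_fourier_integral_le Bochner_Integration.integrable_diff True trunc_integrable f)
      also have "\<dots> \<le> N2 (\<lambda>x. indicator (- ball 0 (real n)) x *\<^sub>R f x)"
        by (rule N2_mono) (auto simp: indicator_def)
      finally show ?thesis .
    qed
    then have "(\<lambda>n. N2 (\<lambda>k. fourier f k - ?F n k)) \<longlonglongrightarrow> 0"
      using tendsto_sandwich[OF _ _ tendsto_const tail] by (simp add: always_eventually)
    moreover have "L2 (fourier f)"
      using True N2_fourier_integral_le[OF True] fin by (auto simp: fourier_def L2_iff)
    ultimately show ?thesis by blast
  next
    case False
    have "\<exists>g. g \<in> borel_measurable borel \<and> (\<lambda>n. N2 (\<lambda>x. g x - ?F n x)) \<longlonglongrightarrow> 0"
    proof (rule L2_complete)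
      fix e :: real assume "e > 0"
      then have "\<forall>\<^sub>F n in sequentially. N2 (\<lambda>x. indicator (- ball 0 (real n)) x *\<^sub>R f x) < ennreal e"
        using order_tendstoD(2)[OF tail] by simp
      then obtain N where N: "N2 (\<lambda>x. indicator (- ball 0 (real N)) x *\<^sub>R f x) < ennreal e"
        by (auto simp: eventually_sequentially)
      have "N2 (\<lambda>x. ?F m x - ?F n x) \<le> ennreal e" if "m \<ge> N" "n \<ge> N" for m n
      proof -
        have eq: "(\<lambda>k. ?F m k - ?F n k) = fourier_integral (\<lambda>x. trunc m f x - trunc n f x)"
          by (auto simp: fourier_integral_diff trunc_integrable[OF f])
        have "N2 (\<lambda>k. ?F m k - ?F n k) \<le> N2 (\<lambda>x. trunc m f x - trunc n f x)"
          unfolding eq by (intro N2_fourier_integral_le Bochner_Integration.integrable_diff trunc_integrable f)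
        also have "\<dots> \<le> N2 (\<lambda>x. indicator (- ball 0 (real N)) x *\<^sub>R f x)"
          by (rule N2_mono) (use that in \<open>auto simp: indicator_def\<close>)
        finally show ?thesis using N by simp
      qed
      then show "\<exists>N. \<forall>m\<ge>N. \<forall>n\<ge>N. N2 (\<lambda>x. ?F m x - ?F n x) \<le> ennreal e" by blast
    qed (intro fourier_integral_measurable trunc_measurable, measurable)
    then obtain g where [measurable]: "g \<in> borel_measurable borel" and g: "(\<lambda>n. N2 (\<lambda>x. g x - ?F n x)) \<longlonglongrightarrow> 0"
      by blast
    obtain n where n: "N2 (\<lambda>x. g x - ?F n x) < 1"
      using order_tendstoD(2)[OF g, of 1] by (auto simp: eventually_sequentially)
    have "L2 (\<lambda>x. g x - ?F n x)" using n by (auto simp: L2_iff intro: less_trans)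
    moreover have "L2 (?F n)"
      using N2_fourier_integral_le[OF trunc_integrable[OF f, of n]] L2_indicator[OF f, of "ball 0 (real n)"]
      by (auto simp: L2_iff)
    ultimately have "L2 (\<lambda>x. (g x - ?F n x) + ?F n x)" by (rule L2_add)
    then have "L2 g" by simp
    then have "\<exists>g. L2 g \<and> (\<lambda>n. \<integral>\<^sup>+k. ennreal ((norm (g k - ?F n k))\<^sup>2) \<partial>lborel) \<longlonglongrightarrow> 0"
      using g by (auto simp: N2_def)
    from someI_ex[OF this] False show ?thesis
      unfolding fourier_def N2_def by simp
  qed
  show "L2 (fourier f)" "(\<lambda>n. N2 (\<lambda>k. fourier f k - ?F n k)) \<longlonglongrightarrow> 0" using key by auto
qed

lemma inv_fourier_L2:
  assumes "L2 f"
  shows "L2 (inv_fourier f)"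
  unfolding inv_fourier_def by (intro L2_reflect fourier_L2 assms)

lemma inv_fourier_truncation:
  assumes f: "L2 f"
  shows "(\<lambda>n. N2 (\<lambda>x. inv_fourier f x - fourier_integral (trunc n f) (- x))) \<longlonglongrightarrow> 0"
proof -
  have [measurable]: "f \<in> borel_measurable borel" "fourier f \<in> borel_measurable borel"
    using f fourier_L2(1)[OF f] by (auto simp: L2_iff)
  have "N2 (\<lambda>x. inv_fourier f x - fourier_integral (trunc n f) (- x)) = N2 (\<lambda>k. fourier f k - fourier_integral (trunc n f) k)" for n
  proof -
    have "trunc n f \<in> borel_measurable borel" by (rule trunc_measurable) measurable
    then have [measurable]: "fourier_integral (trunc n f) \<in> borel_measurable borel"
      by (rule fourier_integral_measurable)
    show ?thesis
      unfolding inv_fourier_def by (rule N2_reflect[of "\<lambda>k. fourier f k - fourier_integral (trunc n f) k"]) measurable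
  qed
  then show ?thesis using fourier_L2(2)[OF f] by simp
qed

text \<open>The extension of \<open>ft\<close> to scalar functions in \<open>L\<^sup>2\<close>. Regarding scalars as biquaternions lets it inherit the
  approximation by truncations from \<open>inv_fourier\<close>.\<close>

definition dual_ft :: "(real^3 \<Rightarrow> complex) \<Rightarrow> real^3 \<Rightarrow> complex" where
  "dual_ft \<phi> k = Sc (inv_fourier (\<lambda>x. (\<phi> x, 0)) k)"

lemma fourier_integral_scalar:
  assumes "integrable lborel \<phi>"
  shows "Sc (fourier_integral (\<lambda>x. (\<phi> x, 0)) (- k)) = ft \<phi> k"
proof -
  have "integrable lborel (\<lambda>x. (\<phi> x, 0) :: biquat)"
    using integrable_bounded_linear[OF bounded_linear_Pair[OF bounded_linear_ident bounded_linear_zero] assms] by simp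
  from integral_Sc[OF integrable_wave_cscale[OF this, of k]] show ?thesis
    by (simp add: fourier_integral_eq ft_def)
qed

lemma dual_ft_integrable:
  assumes "integrable lborel \<phi>"
  shows "dual_ft \<phi> = ft \<phi>"
proof -
  have "integrable lborel (\<lambda>x. (\<phi> x, 0) :: biquat)"
    using integrable_bounded_linear[OF bounded_linear_Pair[OF bounded_linear_ident bounded_linear_zero] assms] by simp
  then show ?thesis
    by (auto simp: dual_ft_def inv_fourier_def fourier_def fourier_integral_scalar[OF assms])
qed

lemma dual_ft_L2:
  assumes \<phi>: "L2 \<phi>"
  shows "L2 (dual_ft \<phi>)" and "(\<lambda>n. N2 (\<lambda>k. dual_ft \<phi> k - ft (trunc n \<phi>) k)) \<longlonglongrightarrow> 0"
proof -
  have [measurable]: "\<phi> \<in> borel_measurable borel" using \<phi> by (simp add: L2_iff)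
  let ?f = "\<lambda>x. (\<phi> x, 0) :: biquat"
  have f: "L2 ?f"
    by (rule L2_bound[OF \<phi>]) (auto simp: norm_Pair)
  have i: "L2 (inv_fourier ?f)" by (rule inv_fourier_L2[OF f])
  then have [measurable]: "inv_fourier ?f \<in> borel_measurable borel" by (simp add: L2_iff)
  show "L2 (dual_ft \<phi>)"
    unfolding dual_ft_def[abs_def] by (rule L2_bound[OF i]) (auto simp: norm_Sc_le)
  have t: "Sc (fourier_integral (trunc n ?f) (- k)) = ft (trunc n \<phi>) k" for n k
    using fourier_integral_scalar[OF trunc_integrable[OF \<phi>, of n]] by simp
  have "N2 (\<lambda>k. dual_ft \<phi> k - ft (trunc n \<phi>) k) \<le> N2 (\<lambda>x. inv_fourier ?f x - fourier_integral (trunc n ?f) (- x))" for n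
    unfolding dual_ft_def t[symmetric] fst_diff[symmetric] by (rule N2_mono) (rule norm_Sc_le)
  then show "(\<lambda>n. N2 (\<lambda>k. dual_ft \<phi> k - ft (trunc n \<phi>) k)) \<longlonglongrightarrow> 0"
    using tendsto_sandwich[OF _ _ tendsto_const inv_fourier_truncation[OF f]] by (simp add: always_eventually)
qed

lemma fourier_multiplication_integrable:
  assumes \<phi>: "integrable lborel \<phi>" and g: "integrable lborel g"
  shows "(LINT x|lborel. \<phi> x *\<^sub>B fourier_integral g (- x)) = (LINT k|lborel. ft \<phi> k *\<^sub>B g k)"
proof -
  have [measurable]: "\<phi> \<in> borel_measurable borel" "g \<in> borel_measurable borel" using \<phi> g by auto
  have gi: "integrable lborel (\<lambda>k. \<phi> x *\<^sub>B (wave x k *\<^sub>B g k))" for x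
    by (rule integrable_bounded_linear[OF cscale.bounded_linear_right integrable_wave_cscale[OF g]])
  have I: "integrable (lborel \<Otimes>\<^sub>M lborel) (\<lambda>(x,k). \<phi> x *\<^sub>B (wave x k *\<^sub>B g k))"
    by (rule lborel_pair.Fubini_integrable) (use \<phi> g in \<open>auto simp: norm_cscale gi\<close>)
  have 1: "(LINT k|lborel. \<phi> x *\<^sub>B (wave x k *\<^sub>B g k)) = \<phi> x *\<^sub>B fourier_integral g (- x)" for x
    unfolding fourier_integral_eq using integral_bounded_linear[OF cscale.bounded_linear_right integrable_wave_cscale[OF g]] by simp
  have 2: "(LINT x|lborel. \<phi> x *\<^sub>B (wave x k *\<^sub>B g k)) = ft \<phi> k *\<^sub>B g k" for k
    unfolding ft_def cscale_cscale
    using integral_bounded_linear[OF cscale.bounded_linear_left integrable_wave[OF \<phi>, of k]] by (simp add: wave_commute mult.commute)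
  show ?thesis
    using lborel_pair.Fubini_integral[OF I] by (simp add: 1 2)
qed

lemma integral_cscale_tendsto:
  fixes f :: "real^3 \<Rightarrow> complex" and g :: "real^3 \<Rightarrow> biquat"
  assumes L: "L2 f" "L2 g" "\<And>n. L2 (F n)" "\<And>n. L2 (G n)"
    and F: "(\<lambda>n. N2 (\<lambda>x. f x - F n x)) \<longlonglongrightarrow> 0" and G: "(\<lambda>n. N2 (\<lambda>x. g x - G n x)) \<longlonglongrightarrow> 0"
  shows "(\<lambda>n. LINT x|lborel. F n x *\<^sub>B G n x) \<longlonglongrightarrow> (LINT x|lborel. f x *\<^sub>B g x)"
proof -
  note [measurable] = L[THEN L2_measurable]
  have i: "integrable lborel (\<lambda>x. a x *\<^sub>B b x)" if "L2 a" "L2 b" for a b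
    using that by (rule L2_mult_integrable) (use that[THEN L2_measurable] in \<open>auto simp: norm_cscale\<close>)
  have fin: "N2 f < \<infinity>" "N2 g < \<infinity>" using L by (auto simp: L2_iff)
  have "(\<lambda>n. N2 (\<lambda>x. f x - F n x) * N2 g) \<longlonglongrightarrow> 0"
    by (rule tendsto_0_mult_bounded_ennreal[OF F fin(2)])
  then have 1: "(\<lambda>n. LINT x|lborel. (f x - F n x) *\<^sub>B g x) \<longlonglongrightarrow> 0"
    by (rule integral_mult_tendsto_0[rotated 3]) (auto simp: norm_cscale)
  have "(\<lambda>n. N2 f * N2 (\<lambda>x. g x - G n x)) \<longlonglongrightarrow> 0"
    using tendsto_0_mult_bounded_ennreal[OF G fin(1)] by (simp add: mult.commute)
  then have 2: "(\<lambda>n. LINT x|lborel. f x *\<^sub>B (g x - G n x)) \<longlonglongrightarrow> 0"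
    by (rule integral_mult_tendsto_0[rotated 3]) (auto simp: norm_cscale)
  have "(\<lambda>n. N2 (\<lambda>x. f x - F n x) * N2 (\<lambda>x. g x - G n x)) \<longlonglongrightarrow> 0"
  proof (rule tendsto_sandwich[OF _ _ tendsto_const])
    show "(\<lambda>n. N2 (\<lambda>x. f x - F n x) * 1) \<longlonglongrightarrow> 0" using F by simp
    have "\<forall>\<^sub>F n in sequentially. N2 (\<lambda>x. g x - G n x) < 1"
      using order_tendstoD(2)[OF G, of 1] by simp
    then show "\<forall>\<^sub>F n in sequentially. N2 (\<lambda>x. f x - F n x) * N2 (\<lambda>x. g x - G n x) \<le> N2 (\<lambda>x. f x - F n x) * 1"
      by eventually_elim (rule mult_left_mono, auto)
  qed simp
  then have 3: "(\<lambda>n. LINT x|lborel. (f x - F n x) *\<^sub>B (g x - G n x)) \<longlonglongrightarrow> 0"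
    by (rule integral_mult_tendsto_0[rotated 3]) (auto simp: norm_cscale)
  have eq: "(LINT x|lborel. F n x *\<^sub>B G n x) = (LINT x|lborel. f x *\<^sub>B g x) - (LINT x|lborel. (f x - F n x) *\<^sub>B g x)
    - (LINT x|lborel. f x *\<^sub>B (g x - G n x)) + (LINT x|lborel. (f x - F n x) *\<^sub>B (g x - G n x))" for n
  proof -
    have e: "F n x *\<^sub>B G n x = f x *\<^sub>B g x - (f x - F n x) *\<^sub>B g x - f x *\<^sub>B (g x - G n x) + (f x - F n x) *\<^sub>B (g x - G n x)" for x
      by (simp add: cscale.diff_left cscale.diff_right)
    show ?thesis unfolding e using L by (simp add: i L2_diff)
  qed
  have "(\<lambda>n. LINT x|lborel. F n x *\<^sub>B G n x) \<longlonglongrightarrow> (LINT x|lborel. f x *\<^sub>B g x) - 0 - 0 + 0"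
    unfolding eq by (intro tendsto_intros 1 2 3)
  then show ?thesis by simp
qed

lemma N2_trunc_tendsto:
  fixes f :: "real^3 \<Rightarrow> 'b::euclidean_space"
  assumes f: "L2 f" shows "(\<lambda>n. N2 (\<lambda>x. f x - trunc n f x)) \<longlonglongrightarrow> 0"
proof -
  have "(\<lambda>x. f x - trunc n f x) = (\<lambda>x. indicator (- ball 0 (real n)) x *\<^sub>R f x)" for n
    by (auto simp: indicator_def)
  then show ?thesis using N2_truncation_tendsto_0[of f] f by (auto simp: L2_iff)
qed

text \<open>The transform can be moved to the other factor: for truncations this is Fubini's theorem, and both
  sides are continuous in \<open>L\<^sup>2\<close>.\<close>

theorem fourier_multiplication:
  assumes \<phi>: "L2 \<phi>" and g: "L2 g"
  shows "(LINT x|lborel. \<phi> x *\<^sub>B inv_fourier g x) = (LINT k|lborel. dual_ft \<phi> k *\<^sub>B g k)"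
proof -
  have L: "L2 (trunc n \<phi>)" "L2 (trunc n g)" for n
    by (auto intro!: L2_indicator \<phi> g)
  have Lf: "L2 (ft (trunc n \<phi>))" for n
    using N2_ft_le[OF trunc_integrable[OF \<phi>, of n]] L(1)[of n] by (auto simp: L2_iff)
  have "L2 (fourier_integral (trunc n g))" for n
    using N2_fourier_integral_le[OF trunc_integrable[OF g, of n]] L(2)[of n] by (auto simp: L2_iff)
  then have Lg: "L2 (\<lambda>x. fourier_integral (trunc n g) (- x))" for n by (rule L2_reflect)
  have "(\<lambda>n. LINT x|lborel. trunc n \<phi> x *\<^sub>B fourier_integral (trunc n g) (- x)) \<longlonglongrightarrow> (LINT x|lborel. \<phi> x *\<^sub>B inv_fourier g x)"
    by (rule integral_cscale_tendsto[OF \<phi> inv_fourier_L2[OF g] L(1) Lg N2_trunc_tendsto[OF \<phi>] inv_fourier_truncation[OF g]])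
  moreover have "(\<lambda>n. LINT k|lborel. ft (trunc n \<phi>) k *\<^sub>B trunc n g k) \<longlonglongrightarrow> (LINT k|lborel. dual_ft \<phi> k *\<^sub>B g k)"
    by (rule integral_cscale_tendsto[OF dual_ft_L2(1)[OF \<phi>] g Lf L(2) dual_ft_L2(2)[OF \<phi>] N2_trunc_tendsto[OF g]])
  ultimately show ?thesis
    using fourier_multiplication_integrable[OF trunc_integrable[OF \<phi>] trunc_integrable[OF g]] LIMSEQ_unique by auto
qed

section \<open>Biquaternion algebra\<close>

lemma bounded_bilinear_bmult: "bounded_bilinear bmult"
proof -
  have "bilinear bmult"
    unfolding bilinear_def
    by (auto intro!: linearI simp: bmult_def ccross_def vec_eq_iff forall_3 sum_3 prod_eq_iff
        vector_def scaleR_conv_of_real[where 'a=complex] algebra_simps)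
  then show ?thesis by (simp add: bilinear_conv_bounded_bilinear)
qed

interpretation bmult: bounded_bilinear bmult by (rule bounded_bilinear_bmult)

lemma bmult_assoc: "(p \<star> q) \<star> r = p \<star> (q \<star> r)"
  by (simp add: bmult_def ccross_def vec_eq_iff forall_3 sum_3 prod_eq_iff algebra_simps)

lemma bmult_cscale_left: "(c *\<^sub>B p) \<star> q = c *\<^sub>B (p \<star> q)"
  and bmult_cscale_right: "p \<star> (c *\<^sub>B q) = c *\<^sub>B (p \<star> q)"
  by (simp_all add: bmult_def ccross_def vec_eq_iff forall_3 sum_3 prod_eq_iff algebra_simps)

lemma bmult_one_left[simp]: "(1, 0) \<star> p = p"
  by (simp add: bmult_def ccross_def vec_eq_iff forall_3 prod_eq_iff)

lemma bmult_measurable[measurable (raw)]: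
  assumes "f \<in> borel_measurable M" "g \<in> borel_measurable M"
  shows "(\<lambda>x. f x \<star> g x) \<in> borel_measurable M"
  using assms by (rule borel_measurable_continuous_Pair) (intro continuous_intros bmult.continuous_on)

lemma bounded_linear_cvec: "bounded_linear cvec"
proof -
  have "linear cvec"
    by (rule linearI) (simp_all add: cvec_def vec_eq_iff scaleR_conv_of_real[where 'a=complex])
  then show ?thesis by (simp add: linear_conv_bounded_linear)
qed

lemma norm_cvec[simp]: "norm (cvec v) = norm v"
  by (simp add: cvec_def norm_vec_def)

lemma cvec_measurable[measurable (raw)]:
  "f \<in> borel_measurable M \<Longrightarrow> (\<lambda>x. cvec (f x)) \<in> borel_measurable M"
  by (rule borel_measurable_continuous_on[rotated], assumption)
    (intro linear_continuous_on bounded_linear_cvec)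

lemma qexp_measurable[measurable (raw)]:
  assumes [measurable]: "f \<in> borel_measurable M" "g \<in> borel_measurable M"
  shows "(\<lambda>x. qexp (f x) (g x)) \<in> borel_measurable M"
  unfolding qexp_def by (intro borel_measurable_Pair) measurable

lemma qexp_0[simp]: "qexp k 0 = (1, 0)"
  by (simp add: qexp_def cvec_def vec_eq_iff)

lemma norm_qexp_le: "norm (qexp k \<tau>) \<le> 1"
proof -
  have "(norm ((sin (2 * pi * norm k * \<tau>) / norm k) *\<^sub>R k))\<^sup>2 \<le> (sin (2 * pi * norm k * \<tau>))\<^sup>2"
    by (cases "k = 0") (simp_all add: power_mult_distrib power_divide)
  then have "(cos (2 * pi * norm k * \<tau>))\<^sup>2 + (norm ((sin (2 * pi * norm k * \<tau>) / norm k) *\<^sub>R k))\<^sup>2 \<le> 1"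
    using sin_cos_squared_add2[of "2 * pi * norm k * \<tau>"] by linarith
  then show ?thesis
    unfolding qexp_def norm_Pair norm_cvec by (simp only: norm_of_real power2_abs real_sqrt_le_1_iff)
qed

text \<open>The generator \<open>2 \<pi> k\<close>, which is the symbol of \<open>- i D\<close>.\<close>

definition freq :: "real^3 \<Rightarrow> biquat" where
  "freq k = (0, cvec ((2 * pi) *\<^sub>R k))"

lemma freq_measurable[measurable]: "freq \<in> borel_measurable borel"
  unfolding freq_def by (intro borel_measurable_Pair) measurable

text \<open>\<open>qexp k\<close> is the one-parameter group generated by \<open>2 \<pi> k\<close>, because \<open>k \<star> k = - \<bar>k\<bar>\<^sup>2\<close>.\<close>

lemma qexp_has_vector_derivative:
  "((\<lambda>\<tau>. qexp k \<tau>) has_vector_derivative freq k \<star> qexp k \<tau>) (at \<tau> within S)"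
proof -
  define n where "n = norm k"
  have n2: "(k $ 1)\<^sup>2 + (k $ 2)\<^sup>2 + (k $ 3)\<^sup>2 = n\<^sup>2"
    unfolding n_def by (simp add: norm_vec_def L2_set_def sum_3)
  have 1: "((\<lambda>\<tau>. complex_of_real (cos (2 * pi * n * \<tau>))) has_vector_derivative complex_of_real (- sin (2 * pi * n * \<tau>) * (2 * pi * n))) (at \<tau> within S)"
    by (auto intro!: derivative_eq_intros has_vector_derivative_of_real simp flip: has_real_derivative_iff_has_vector_derivative)
  have 2: "((\<lambda>\<tau>. cvec ((sin (2 * pi * n * \<tau>) / n) *\<^sub>R k)) has_vector_derivative cvec ((2 * pi * cos (2 * pi * n * \<tau>)) *\<^sub>R k)) (at \<tau> within S)"
  proof (rule bounded_linear.has_vector_derivative[OF bounded_linear_cvec])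
    show "((\<lambda>\<tau>. (sin (2 * pi * n * \<tau>) / n) *\<^sub>R k) has_vector_derivative (2 * pi * cos (2 * pi * n * \<tau>)) *\<^sub>R k) (at \<tau> within S)"
    proof (cases "k = 0")
      case False
      then have "n \<noteq> 0" by (simp add: n_def)
      then have "((\<lambda>\<tau>. sin (2 * pi * n * \<tau>) / n) has_real_derivative (2 * pi * cos (2 * pi * n * \<tau>))) (at \<tau> within S)"
        by (auto intro!: derivative_eq_intros)
      from has_vector_derivative_scaleR[OF this has_vector_derivative_const, of k] show ?thesis by simp
    qed simp
  qed
  have q: "qexp k = (\<lambda>\<tau>. (complex_of_real (cos (2 * pi * n * \<tau>)), cvec ((sin (2 * pi * n * \<tau>) / n) *\<^sub>R k)))"
    by (simp add: qexp_def n_def fun_eq_iff)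
  have "freq k \<star> qexp k \<tau> = (complex_of_real (- sin (2 * pi * n * \<tau>) * (2 * pi * n)), cvec ((2 * pi * cos (2 * pi * n * \<tau>)) *\<^sub>R k))"
  proof -
    have "2 * pi * (sin (2 * pi * n * \<tau>) / n) * ((k $ 1)\<^sup>2 + (k $ 2)\<^sup>2 + (k $ 3)\<^sup>2) = sin (2 * pi * n * \<tau>) * (2 * pi * n)"
      unfolding n2 by (cases "n = 0") (simp_all add: power2_eq_square)
    then have "complex_of_real (2 * pi * (sin (2 * pi * n * \<tau>) / n) * ((k $ 1)\<^sup>2 + (k $ 2)\<^sup>2 + (k $ 3)\<^sup>2)) = complex_of_real (sin (2 * pi * n * \<tau>) * (2 * pi * n))"
      by (rule arg_cong)
    then show ?thesis
      unfolding q
      by (simp add: freq_def bmult_def ccross_def cvec_def vec_eq_iff forall_3 sum_3 power2_eq_square algebra_simps)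
  qed
  then show ?thesis
    unfolding q using has_vector_derivative_Pair[OF 1 2] by simp
qed

lemma qexp_duhamel:
  assumes "s \<le> t"
  shows "qexp k (t - s) \<star> p = p + (LINT r|lborel. indicator {s..t} r *\<^sub>R (freq k \<star> (qexp k (r - s) \<star> p)))"
proof -
  have "(LINT r|lborel. indicator {s..t} r *\<^sub>R (freq k \<star> (qexp k (r - s) \<star> p))) = qexp k (t - s) \<star> p - qexp k (s - s) \<star> p"
  proof (rule integral_FTC_atLeastAtMost[OF assms])
    fix r
    have 1: "((\<lambda>r. r - s) has_vector_derivative 1) (at r within {s..t})"
      by (auto intro!: derivative_eq_intros)
    have "((\<lambda>r. qexp k (r - s)) has_vector_derivative freq k \<star> qexp k (r - s)) (at r within {s..t})"
      using vector_diff_chain_within[OF 1 qexp_has_vector_derivative] by (simp add: o_def)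
    from bounded_linear.has_vector_derivative[OF bmult.bounded_linear_left this, of p]
    show "((\<lambda>r. qexp k (r - s) \<star> p) has_vector_derivative freq k \<star> (qexp k (r - s) \<star> p)) (at r within {s..t})"
      by (simp add: bmult_assoc)
  next
    have "continuous_on UNIV (qexp k)"
      by (auto simp: continuous_on_eq_continuous_within intro: has_vector_derivative_continuous qexp_has_vector_derivative)
    then have "continuous_on {s..t} (\<lambda>r. qexp k (r - s))"
      by (rule continuous_on_compose2) (auto intro!: continuous_intros)
    then show "continuous_on {s..t} (\<lambda>r. freq k \<star> (qexp k (r - s) \<star> p))"
      by (intro bmult.continuous_on continuous_intros)
  qed
  then show ?thesis by simp
qed

section \<open>Families of square-integrable functions with integrable norms\<close>

lemma ennreal_power2_le:
  assumes "(a::ennreal)\<^sup>2 \<le> ennreal (b\<^sup>2)" "b \<ge> 0"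
  shows "a \<le> ennreal b"
proof (rule ccontr)
  assume "\<not> a \<le> ennreal b"
  then have "ennreal b < a" by simp
  then have "(ennreal b)\<^sup>2 < a\<^sup>2"
    by (cases a) (auto simp: ennreal_power assms(2) ennreal_less_iff power_strict_mono)
  then show False using assms by (simp add: ennreal_power)
qed

text \<open>A function in \<open>L\<^sup>1({0..T}; L\<^sup>2)\<close> that is given by a jointly measurable representative; outside of \<open>{0..T}\<close> it
  vanishes, so that all time integrals can be taken over the real line.\<close>

locale L2_family =
  fixes Y :: "real \<Rightarrow> real^3 \<Rightarrow> biquat" and n :: "real \<Rightarrow> real" and T :: real
  assumes Y_measurable[measurable]: "(\<lambda>p. Y (fst p) (snd p)) \<in> borel_measurable (lborel \<Otimes>\<^sub>M lborel)"
    and Y_support: "\<And>s. s \<notin> {0..T} \<Longrightarrow> Y s = (\<lambda>_. 0)"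
    and Y_N2: "\<And>s. N2 (Y s) \<le> ennreal ((n s)\<^sup>2)"
    and n_nonneg: "\<And>s. n s \<ge> 0"
    and n_integrable: "integrable lborel n"
begin

lemma Y_measurable1[measurable]: "Y s \<in> borel_measurable borel"
proof -
  have "(\<lambda>k. (\<lambda>p. Y (fst p) (snd p)) (s, k)) \<in> borel_measurable borel"
    by (rule measurable_compose[OF _ Y_measurable]) measurable
  then show ?thesis by simp
qed

lemma Y_measurable2[measurable]: "(\<lambda>p. Y (snd p) (fst p)) \<in> borel_measurable (lborel \<Otimes>\<^sub>M lborel)"
proof -
  have "(\<lambda>p. (\<lambda>q. Y (fst q) (snd q)) (snd p, fst p)) \<in> borel_measurable (lborel \<Otimes>\<^sub>M lborel)"
    by (rule measurable_compose[OF _ Y_measurable]) measurable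
  then show ?thesis by simp
qed

text \<open>The Cauchy--Schwarz inequality in space for each time; it justifies the use of Fubini's
  theorem for pairings in which time and frequency are integrated.\<close>

lemma product_integrable:
  fixes \<phi> :: "real^3 \<Rightarrow> 'b::euclidean_space"
  assumes \<phi>: "L2 \<phi>"
  shows "integrable (lborel \<Otimes>\<^sub>M lborel) (\<lambda>p. norm (Y (fst p) (snd p)) * norm (\<phi> (snd p)))"
proof (rule integrableI_bounded)
  have [measurable]: "\<phi> \<in> borel_measurable borel" using \<phi> by (simp add: L2_iff)
  show "(\<lambda>p. norm (Y (fst p) (snd p)) * norm (\<phi> (snd p))) \<in> borel_measurable (lborel \<Otimes>\<^sub>M lborel)"
    by measurable
  obtain c where c: "N2 \<phi> = ennreal (c\<^sup>2)" "c \<ge> 0"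
  proof -
    obtain b where "N2 \<phi> = ennreal b" "b \<ge> 0" using \<phi> by (cases "N2 \<phi>") (auto simp: L2_iff)
    then show ?thesis using that[of "sqrt b"] by simp
  qed
  have b: "(\<integral>\<^sup>+k. ennreal (norm (Y s k) * norm (\<phi> k)) \<partial>lborel) \<le> ennreal (n s * c)" for s
  proof (rule ennreal_power2_le)
    have "(\<integral>\<^sup>+k. ennreal (norm (Y s k) * norm (\<phi> k)) \<partial>lborel)\<^sup>2 \<le> N2 (Y s) * N2 \<phi>"
      by (rule N2_Cauchy_Schwarz) measurable
    also have "\<dots> \<le> ennreal ((n s)\<^sup>2) * ennreal (c\<^sup>2)"
      unfolding c by (intro mult_right_mono Y_N2) simp
    finally show "(\<integral>\<^sup>+k. ennreal (norm (Y s k) * norm (\<phi> k)) \<partial>lborel)\<^sup>2 \<le> ennreal ((n s * c)\<^sup>2)"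
      by (simp add: power_mult_distrib ennreal_mult')
  qed (simp add: n_nonneg c)
  have "(\<integral>\<^sup>+p. ennreal (norm (norm (Y (fst p) (snd p)) * norm (\<phi> (snd p)))) \<partial>(lborel \<Otimes>\<^sub>M lborel))
    = (\<integral>\<^sup>+s. (\<integral>\<^sup>+k. ennreal (norm (Y s k) * norm (\<phi> k)) \<partial>lborel) \<partial>lborel)"
    by (subst lborel.nn_integral_fst[symmetric]) auto
  also have "\<dots> \<le> (\<integral>\<^sup>+s. ennreal (n s * c) \<partial>lborel)"
    by (intro nn_integral_mono b)
  also have "\<dots> = ennreal (LINT s|lborel. n s * c)"
    by (rule nn_integral_eq_integral) (auto simp: n_integrable n_nonneg c)
  finally show "(\<integral>\<^sup>+p. ennreal (norm (norm (Y (fst p) (snd p)) * norm (\<phi> (snd p)))) \<partial>(lborel \<Otimes>\<^sub>M lborel)) < \<infinity>"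
    by (rule le_less_trans) simp
qed

text \<open>Minkowski's integral inequality, in qualitative form: the Cauchy--Schwarz inequality in time with the
  weight \<open>n + 1\<close>, which is bounded below on \<open>{0..T}\<close>.\<close>

lemma minkowski:
  assumes i: "\<And>k. integrable lborel (\<lambda>s. norm (Y s k))"
  shows "L2 (\<lambda>k. LINT s|lborel. norm (Y s k))"
proof -
  have [measurable]: "n \<in> borel_measurable borel" using n_integrable by auto
  define m where "m s = n s + indicator {0..T} s" for s
  have [measurable]: "m \<in> borel_measurable borel" unfolding m_def by measurable
  have m0: "m s \<ge> 0" "n s \<le> m s" for s by (auto simp: m_def n_nonneg indicator_def)
  have mpos: "m s > 0" if "s \<in> {0..T}" for s using that n_nonneg[of s] by (simp add: m_def)
  have mi: "integrable lborel m"
    unfolding m_def by (intro Bochner_Integration.integrable_add n_integrable integrable_real_indicator) (auto simp: emeasure_lborel_Icc_eq)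
  have sq: "ennreal ((LINT s|lborel. norm (Y s k))\<^sup>2) \<le> ennreal (integral\<^sup>L lborel m) * (\<integral>\<^sup>+s. ennreal ((norm (Y s k))\<^sup>2 / m s) \<partial>lborel)" for k
  proof -
    have [measurable]: "(\<lambda>s. Y s k) \<in> borel_measurable borel"
      using measurable_compose[OF _ Y_measurable, of "\<lambda>s. (s, k)" borel] by simp
    have "ennreal ((LINT s|lborel. norm (Y s k))\<^sup>2) = (\<integral>\<^sup>+s. ennreal (norm (Y s k)) \<partial>lborel)\<^sup>2"
      by (subst nn_integral_eq_integral[OF i]) (auto simp: ennreal_power)
    also have "\<dots> = (\<integral>\<^sup>+s. ennreal (sqrt (m s)) * ennreal (norm (Y s k) / sqrt (m s)) \<partial>lborel)\<^sup>2"
    proof -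
      have "ennreal (norm (Y s k)) = ennreal (sqrt (m s)) * ennreal (norm (Y s k) / sqrt (m s))" for s
        using mpos[of s] Y_support[of s] m0[of s] by (cases "s \<in> {0..T}") (auto simp flip: ennreal_mult')
      then show ?thesis by simp
    qed
    also have "\<dots> \<le> (\<integral>\<^sup>+s. (ennreal (sqrt (m s)))\<^sup>2 \<partial>lborel) * (\<integral>\<^sup>+s. (ennreal (norm (Y s k) / sqrt (m s)))\<^sup>2 \<partial>lborel)"
      by (rule Cauchy_Schwarz_nn_integral) measurable
    also have "(\<integral>\<^sup>+s. (ennreal (sqrt (m s)))\<^sup>2 \<partial>lborel) = ennreal (integral\<^sup>L lborel m)"
      by (subst nn_integral_eq_integral[OF mi, symmetric]) (auto simp: ennreal_power m0)
    also have "(\<integral>\<^sup>+s. (ennreal (norm (Y s k) / sqrt (m s)))\<^sup>2 \<partial>lborel) = (\<integral>\<^sup>+s. ennreal ((norm (Y s k))\<^sup>2 / m s) \<partial>lborel)"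
      using m0 by (auto simp: ennreal_power power_divide)
    finally show ?thesis .
  qed
  have "(\<integral>\<^sup>+k. (\<integral>\<^sup>+s. ennreal ((norm (Y s k))\<^sup>2 / m s) \<partial>lborel) \<partial>lborel) = (\<integral>\<^sup>+s. (\<integral>\<^sup>+k. ennreal ((norm (Y s k))\<^sup>2 / m s) \<partial>lborel) \<partial>lborel)"
    by (rule lborel_pair.Fubini') measurable
  also have "\<dots> \<le> (\<integral>\<^sup>+s. ennreal (n s) \<partial>lborel)"
  proof (rule nn_integral_mono)
    fix s
    show "(\<integral>\<^sup>+k. ennreal ((norm (Y s k))\<^sup>2 / m s) \<partial>lborel) \<le> ennreal (n s)"
    proof (cases "s \<in> {0..T}")
      case True
      have "(\<integral>\<^sup>+k. ennreal ((norm (Y s k))\<^sup>2 / m s) \<partial>lborel) = (\<integral>\<^sup>+k. ennreal (1 / m s) * ennreal ((norm (Y s k))\<^sup>2) \<partial>lborel)"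
        using m0 by (simp flip: ennreal_mult')
      also have "\<dots> = ennreal (1 / m s) * N2 (Y s)"
        unfolding N2_def by (rule nn_integral_cmult) measurable
      also have "\<dots> \<le> ennreal (1 / m s) * ennreal ((n s)\<^sup>2)"
        by (intro mult_left_mono Y_N2) simp
      also have "\<dots> = ennreal ((n s)\<^sup>2 / m s)"
        using m0 by (simp flip: ennreal_mult')
      also have "\<dots> \<le> ennreal (n s)"
        using m0[of s] mpos[OF True] n_nonneg[of s]
        by (intro ennreal_leI) (simp add: divide_le_eq power2_eq_square mult_left_mono)
      finally show ?thesis .
    qed (simp add: Y_support)
  qed
  also have "\<dots> = ennreal (integral\<^sup>L lborel n)"
    by (rule nn_integral_eq_integral) (auto simp: n_integrable n_nonneg)
  finally have le: "(\<integral>\<^sup>+k. (\<integral>\<^sup>+s. ennreal ((norm (Y s k))\<^sup>2 / m s) \<partial>lborel) \<partial>lborel) \<le> ennreal (integral\<^sup>L lborel n)" .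
  have "N2 (\<lambda>k. LINT s|lborel. norm (Y s k)) \<le> (\<integral>\<^sup>+k. ennreal (integral\<^sup>L lborel m) * (\<integral>\<^sup>+s. ennreal ((norm (Y s k))\<^sup>2 / m s) \<partial>lborel) \<partial>lborel)"
    unfolding N2_def real_norm_def power2_abs by (intro nn_integral_mono sq)
  also have "\<dots> = ennreal (integral\<^sup>L lborel m) * (\<integral>\<^sup>+k. (\<integral>\<^sup>+s. ennreal ((norm (Y s k))\<^sup>2 / m s) \<partial>lborel) \<partial>lborel)"
    by (rule nn_integral_cmult) measurable
  also have "\<dots> \<le> ennreal (integral\<^sup>L lborel m) * ennreal (integral\<^sup>L lborel n)"
    by (intro mult_left_mono le) simp
  also have "\<dots> < \<infinity>" by (simp add: ennreal_mult_less_top)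
  finally show ?thesis by (auto simp: L2_iff)
qed

end

section \<open>Test functions\<close>

lemma test_fun_differentiable:
  assumes "test_fun \<Omega> \<phi>" shows "\<phi> differentiable (at x)"
proof -
  have "Ck (Suc 0) \<phi>" using assms unfolding test_fun_def by blast
  then show ?thesis by (simp add: differentiable_on_def)
qed

lemma test_fun_has_derivative:
  assumes "test_fun \<Omega> \<phi>" shows "(\<phi> has_derivative frechet_derivative \<phi> (at x)) (at x)"
  using test_fun_differentiable[OF assms] frechet_derivative_works by blast

lemma test_fun_zero: "test_fun \<Omega> \<phi> \<Longrightarrow> x \<notin> closure {x. \<phi> x \<noteq> 0} \<Longrightarrow> \<phi> x = 0"
  using closure_subset[of "{x. \<phi> x \<noteq> 0}"] by auto

lemma partial_deriv_zero:
  assumes "open A" "x \<in> A" "\<And>y. y \<in> A \<Longrightarrow> \<phi> y = 0"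
  shows "partial_deriv m \<phi> x = 0"
proof -
  have "((\<lambda>_. 0) has_derivative (\<lambda>_. 0)) (at x)" by simp
  then have "(\<phi> has_derivative (\<lambda>_. 0)) (at x)"
    by (rule has_derivative_transform_within_open[OF _ assms(1,2)]) (simp add: assms(3))
  then show ?thesis unfolding partial_deriv_def by (metis frechet_derivative_at)
qed

lemma test_fun_partial:
  assumes "test_fun \<Omega> \<phi>" shows "test_fun \<Omega> (partial_deriv m \<phi>)"
proof -
  let ?K = "closure {x. \<phi> x \<noteq> 0}"
  have "Ck n (partial_deriv m \<phi>)" for n
    using assms unfolding test_fun_def by (metis Ck.simps(2))
  moreover have "partial_deriv m \<phi> x = 0" if "x \<notin> ?K" for x
  proof (rule partial_deriv_zero)
    show "open (- ?K)" "x \<in> - ?K" using that by auto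
  qed (rule test_fun_zero[OF assms], simp)
  then have "{x. partial_deriv m \<phi> x \<noteq> 0} \<subseteq> ?K" by auto
  then have s: "closure {x. partial_deriv m \<phi> x \<noteq> 0} \<subseteq> ?K"
    by (rule closure_minimal) simp
  moreover have "compact (closure {x. partial_deriv m \<phi> x \<noteq> 0})"
  proof -
    have "compact (?K \<inter> closure {x. partial_deriv m \<phi> x \<noteq> 0})"
      using assms by (intro compact_Int_closed) (auto simp: test_fun_def)
    then show ?thesis using s by (simp add: Int_absorb1)
  qed
  ultimately show ?thesis using assms unfolding test_fun_def by blast
qed

lemma test_fun_continuous: "test_fun \<Omega> \<phi> \<Longrightarrow> continuous_on UNIV \<phi>"
  unfolding test_fun_def by (metis Ck.simps(1))

lemma test_fun_measurable: "test_fun \<Omega> \<phi> \<Longrightarrow> \<phi> \<in> borel_measurable borel"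
  by (intro borel_measurable_continuous_onI test_fun_continuous)

lemma test_fun_bounded:
  assumes "test_fun \<Omega> \<phi>" obtains M where "\<And>x. \<bar>\<phi> x\<bar> \<le> M"
proof -
  let ?K = "closure {x. \<phi> x \<noteq> 0}"
  have "compact (\<phi> ` ?K)"
    using assms by (intro compact_continuous_image continuous_on_subset[OF test_fun_continuous]) (auto simp: test_fun_def)
  then obtain B where B: "\<And>x. x \<in> ?K \<Longrightarrow> \<bar>\<phi> x\<bar> \<le> B"
    using compact_imp_bounded by (force simp: bounded_iff)
  have "\<bar>\<phi> x\<bar> \<le> max B 0" for x
    using B[of x] test_fun_zero[OF assms, of x] by (cases "x \<in> ?K") auto
  then show ?thesis using that by blast
qed

lemma test_fun_integrable:
  assumes "test_fun \<Omega> \<phi>" shows "integrable lborel \<phi>"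
proof (rule integrable_compact_support)
  show "compact (closure {x. \<phi> x \<noteq> 0})" using assms by (simp add: test_fun_def)
  show "continuous_on (closure {x. \<phi> x \<noteq> 0}) \<phi>"
    by (rule continuous_on_subset[OF test_fun_continuous[OF assms]]) simp
qed (rule test_fun_zero[OF assms])

lemma test_fun_L2:
  assumes "test_fun \<Omega> \<phi>" shows "L2 (\<lambda>x. complex_of_real (\<phi> x))"
proof -
  have "integrable lborel (\<lambda>x. (\<phi> x)\<^sup>2)"
  proof (rule integrable_compact_support)
    show "compact (closure {x. \<phi> x \<noteq> 0})" using assms by (simp add: test_fun_def)
    show "continuous_on (closure {x. \<phi> x \<noteq> 0}) (\<lambda>x. (\<phi> x)\<^sup>2)"
      by (intro continuous_intros continuous_on_subset[OF test_fun_continuous[OF assms]]) simp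
  qed (subst test_fun_zero[OF assms], assumption, simp)
  then show ?thesis using test_fun_measurable[OF assms] by (auto simp: L2_def)
qed

lemma directional_derivative:
  assumes "(\<phi> has_derivative D) (at x)"
  shows "((\<lambda>t. \<phi> (x + t *\<^sub>R v)) has_vector_derivative D v) (at 0)"
proof -
  have 1: "((\<lambda>t::real. x + t *\<^sub>R v) has_derivative (\<lambda>t. t *\<^sub>R v)) (at 0)"
    by (auto intro!: derivative_eq_intros)
  have "(\<phi> has_derivative D) (at (x + 0 *\<^sub>R v))" using assms by simp
  from diff_chain_at[OF 1 this]
  have "((\<lambda>t. \<phi> (x + t *\<^sub>R v)) has_derivative (\<lambda>t. D (t *\<^sub>R v))) (at 0)" by (simp add: o_def)
  moreover have "D (t *\<^sub>R v) = t *\<^sub>R D v" for t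
    using assms by (simp add: has_derivative_def bounded_linear.linear linear_scale)
  ultimately show ?thesis by (simp add: has_vector_derivative_def)
qed

lemma test_fun_directional:
  assumes "test_fun \<Omega> \<phi>"
  shows "((\<lambda>t. \<phi> (x + t *\<^sub>R axis m 1)) has_vector_derivative partial_deriv m \<phi> x) (at 0)"
  unfolding partial_deriv_def by (rule directional_derivative) (rule test_fun_has_derivative[OF assms])

text \<open>The derivative of \<open>wave k x * \<phi> x\<close> along the \<open>m\<close>-th axis has integral zero.\<close>

lemma ft_partial_deriv:
  assumes \<phi>: "test_fun \<Omega> \<phi>"
  shows "ft (\<lambda>x. complex_of_real (partial_deriv m \<phi> x)) k = - 2 * pi * \<i> * k $ m * ft (\<lambda>x. complex_of_real (\<phi> x)) k"
proof -
  define c where "c = 2 * pi * \<i> * k $ m"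
  let ?g = "\<lambda>x. wave k x * complex_of_real (\<phi> x)"
  let ?g' = "\<lambda>x. c * (wave k x * complex_of_real (\<phi> x)) + wave k x * complex_of_real (partial_deriv m \<phi> x)"
  have K: "compact (closure {x. \<phi> x \<noteq> 0})" using \<phi> by (simp add: test_fun_def)
  have wc: "continuous_on UNIV (wave k)"
    unfolding wave_def by (intro continuous_intros)
  have w: "((\<lambda>t. wave k (x + t *\<^sub>R axis m 1)) has_vector_derivative c * wave k x) (at 0)" for x
  proof -
    have "((\<lambda>t. exp (2 * pi * \<i> * (k \<bullet> x) + of_real t * c)) has_vector_derivative (1 * c) * exp (2 * pi * \<i> * (k \<bullet> x) + of_real 0 * c)) (at 0)"
      by (rule has_vector_derivative_real_field) (auto intro!: derivative_eq_intros)
    moreover have "wave k (x + t *\<^sub>R axis m 1) = exp (2 * pi * \<i> * (k \<bullet> x) + of_real t * c)" for t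
      unfolding wave_def c_def by (simp add: inner_add_right inner_axis algebra_simps)
    ultimately show ?thesis by (simp add: wave_def)
  qed
  have "integral\<^sup>L lborel ?g' = 0"
  proof (rule integral_directional_derivative(2)[where g = ?g and v = "axis m 1", OF _ _ _ K])
    show "((\<lambda>t. ?g (x + t *\<^sub>R axis m 1)) has_vector_derivative ?g' x) (at 0)" for x
      using has_vector_derivative_mult[OF w has_vector_derivative_of_real[OF test_fun_directional[OF \<phi>, of x m, folded has_real_derivative_iff_has_vector_derivative]], of x]
      by (simp add: algebra_simps)
    show "continuous_on UNIV ?g"
      by (intro continuous_intros wc test_fun_continuous[OF \<phi>])
    show "continuous_on UNIV ?g'"
      by (intro continuous_intros wc test_fun_continuous[OF \<phi>] test_fun_continuous[OF test_fun_partial[OF \<phi>]])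
  qed (subst test_fun_zero[OF \<phi>], assumption, simp)
  moreover have "integrable lborel (\<lambda>x. wave k x * complex_of_real (\<phi> x))" "integrable lborel (\<lambda>x. wave k x * complex_of_real (partial_deriv m \<phi> x))"
    by (intro integrable_wave integrable_of_real test_fun_integrable[OF \<phi>] test_fun_integrable[OF test_fun_partial[OF \<phi>]])+
  ultimately have "c * ft (\<lambda>x. complex_of_real (\<phi> x)) k + ft (\<lambda>x. complex_of_real (partial_deriv m \<phi> x)) k = 0"
    by (simp add: ft_def)
  then show ?thesis by (simp add: c_def add_eq_0_iff)
qed

section \<open>The evolution of the parabolic Teodorescu transform\<close>

text \<open>The source \<open>w\<close> is extended by zero. Since \<open>\<Omega>\<close> is bounded, its time slices are also integrable, so their
  Fourier transforms are given by the integral and are defined at each frequency.\<close>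

locale square_integrable_source =
  fixes w :: "real^3 \<Rightarrow> real \<Rightarrow> biquat" and \<Omega> :: "(real^3) set"
  assumes \<Omega>_borel[measurable]: "\<Omega> \<in> sets borel" and \<Omega>_bounded: "bounded \<Omega>"
    and w_outside: "\<And>x t. x \<notin> \<Omega> \<Longrightarrow> w x t = 0"
    and w_measurable: "(\<lambda>p. indicator {0..} (fst p) *\<^sub>R w (snd p) (fst p)) \<in> borel_measurable (lborel \<Otimes>\<^sub>M lborel)"
    and w_L1loc_L2: "L1loc_L2 w"
begin

definition src :: "real \<Rightarrow> real \<Rightarrow> real^3 \<Rightarrow> biquat" where
  "src T s x = indicator {0..T} s *\<^sub>R w x s"

definition src_ft :: "real \<Rightarrow> real \<Rightarrow> real^3 \<Rightarrow> biquat" where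
  "src_ft T s = fourier_integral (src T s)"

definition src_norm :: "real \<Rightarrow> real \<Rightarrow> real" where
  "src_norm T s = indicator {0..T} s * sqrt (LINT x|lborel. (norm (w x s))\<^sup>2)"

lemma w_L2: "s \<ge> 0 \<Longrightarrow> L2 (\<lambda>x. w x s)"
  using w_L1loc_L2 by (simp add: L1loc_L2_def)

lemma w_integrable: "s \<ge> 0 \<Longrightarrow> integrable lborel (\<lambda>x. w x s)"
proof -
  assume s: "s \<ge> 0"
  have "(\<lambda>x. indicator \<Omega> x *\<^sub>R w x s) = (\<lambda>x. w x s)"
    using w_outside by (auto simp: indicator_def)
  then show ?thesis
    using L2_truncation_integrable[OF w_L2[OF s] \<Omega>_borel \<Omega>_bounded] by simp
qed

lemma src_integrable: "integrable lborel (src T s)"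
  using w_integrable[of s] by (cases "s \<in> {0..T}") (auto simp: src_def[abs_def])

lemma src_ft_eq: "s \<in> {0..T} \<Longrightarrow> src_ft T s = fourier (\<lambda>x. w x s)"
  using w_integrable[of s] by (auto simp: src_ft_def src_def[abs_def] fourier_def)

lemma src_ft_outside: "s \<notin> {0..T} \<Longrightarrow> src_ft T s = (\<lambda>_. 0)"
  by (auto simp: src_ft_def src_def[abs_def] fourier_integral_eq[abs_def] cscale.zero_right)

lemma src_family: "L2_family (src T) (src_norm T) T"
proof
  have "(\<lambda>p. indicator {..T} (fst p) *\<^sub>R (indicator {0..} (fst p) *\<^sub>R w (snd p) (fst p))) \<in> borel_measurable (lborel \<Otimes>\<^sub>M lborel)"
    by (intro borel_measurable_scaleR w_measurable) measurable
  also have "(\<lambda>p. indicator {..T} (fst p) *\<^sub>R (indicator {0..} (fst p) *\<^sub>R w (snd p) (fst p))) = (\<lambda>p. src T (fst p) (snd p))"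
    by (auto simp: src_def indicator_def)
  finally show "(\<lambda>p. src T (fst p) (snd p)) \<in> borel_measurable (lborel \<Otimes>\<^sub>M lborel)" .
  show "src T s = (\<lambda>_. 0)" if "s \<notin> {0..T}" for s
    using that by (auto simp: src_def)
  show "N2 (src T s) \<le> ennreal ((src_norm T s)\<^sup>2)" for s
  proof (cases "s \<in> {0..T}")
    case True
    then have "integrable lborel (\<lambda>x. (norm (w x s))\<^sup>2)" using w_L2[of s] by (simp add: L2_def)
    then have "N2 (src T s) = ennreal (LINT x|lborel. (norm (w x s))\<^sup>2)"
      using True by (simp add: N2_def src_def nn_integral_eq_integral)
    then show ?thesis using True by (simp add: src_norm_def)
  qed (simp add: src_def N2_def)
  show "src_norm T s \<ge> 0" for s by (simp add: src_norm_def indicator_def)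
  have "set_integrable lborel {0..\<bar>T\<bar> + 1} (\<lambda>s. sqrt (LINT x|lborel. (norm (w x s))\<^sup>2))"
    using w_L1loc_L2 by (simp add: L1loc_L2_def)
  then have "set_integrable lborel {0..T} (\<lambda>s. sqrt (LINT x|lborel. (norm (w x s))\<^sup>2))"
    by (rule set_integrable_subset) auto
  then show "integrable lborel (src_norm T)"
    by (simp add: set_integrable_def src_norm_def[abs_def])
qed

interpretation src: L2_family "src T" "src_norm T" T for T by (rule src_family)

lemma src_ft_family: "L2_family (src_ft T) (src_norm T) T"
proof
  have "(\<lambda>q. wave (- snd (fst q)) (snd q) *\<^sub>B src T (fst (fst q)) (snd q)) \<in> borel_measurable ((lborel \<Otimes>\<^sub>M lborel) \<Otimes>\<^sub>M lborel)"
  proof (intro cscale_measurable)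
    have "(\<lambda>q. (\<lambda>p. src T (fst p) (snd p)) (fst (fst q), snd q)) \<in> borel_measurable ((lborel \<Otimes>\<^sub>M lborel) \<Otimes>\<^sub>M lborel)"
      by (rule measurable_compose[OF _ src.Y_measurable]) measurable
    then show "(\<lambda>q. src T (fst (fst q)) (snd q)) \<in> borel_measurable ((lborel \<Otimes>\<^sub>M lborel) \<Otimes>\<^sub>M lborel)" by simp
  qed measurable
  then have "(\<lambda>p. LINT x|lborel. wave (- snd p) x *\<^sub>B src T (fst p) x) \<in> borel_measurable (lborel \<Otimes>\<^sub>M lborel)"
    by (intro lborel.borel_measurable_lebesgue_integral) (simp add: split_beta')
  then show "(\<lambda>p. src_ft T (fst p) (snd p)) \<in> borel_measurable (lborel \<Otimes>\<^sub>M lborel)"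
    by (simp add: src_ft_def fourier_integral_eq)
  show "src_ft T s = (\<lambda>_. 0)" if "s \<notin> {0..T}" for s
    by (rule src_ft_outside[OF that])
  show "N2 (src_ft T s) \<le> ennreal ((src_norm T s)\<^sup>2)" for s
    unfolding src_ft_def by (rule order_trans[OF N2_fourier_integral_le[OF src_integrable] src.Y_N2])
qed (rule src.n_nonneg src.n_integrable)+

interpretation src_ft: L2_family "src_ft T" "src_norm T" T for T by (rule src_ft_family)

text \<open>The spatial \<open>L\<^sup>1\<close>-norm, which bounds \<open>src_ft\<close> uniformly in frequency. It is integrable in time by the
  Cauchy--Schwarz inequality with the indicator of the bounded set \<open>\<Omega>\<close>.\<close>

definition src_bound :: "real \<Rightarrow> real \<Rightarrow> real" where
  "src_bound T s = (LINT x|lborel. norm (src T s x))"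

lemma src_bound_integrable: "integrable lborel (src_bound T)"
proof -
  have "integrable (lborel \<Otimes>\<^sub>M lborel) (\<lambda>p. norm (src T (fst p) (snd p)) * norm (indicator \<Omega> (snd p) *\<^sub>R (1::real)))"
    by (rule src.product_integrable[OF L2_indicator_bounded[OF \<Omega>_borel \<Omega>_bounded]])
  also have "(\<lambda>p. norm (src T (fst p) (snd p)) * norm (indicator \<Omega> (snd p) *\<^sub>R (1::real))) = (\<lambda>p. norm (src T (fst p) (snd p)))"
    using w_outside by (auto simp: indicator_def src_def fun_eq_iff)
  finally have "integrable (lborel \<Otimes>\<^sub>M lborel) (\<lambda>p. norm (src T (fst p) (snd p)))" .
  from lborel_pair.integrable_fst'[OF this] show ?thesis
    unfolding src_bound_def[abs_def] by simp
qed

lemma norm_src_ft_le: "norm (src_ft T s k) \<le> src_bound T s"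
  unfolding src_ft_def src_bound_def by (rule norm_fourier_integral_le)

lemma src_ft_measurable1[measurable]: "(\<lambda>s. src_ft T s k) \<in> borel_measurable borel"
  using measurable_compose[OF _ src_ft.Y_measurable, of "\<lambda>s. (s, k)" borel] by simp

lemma src_ft_integrable: "integrable lborel (\<lambda>s. src_ft T s k)"
  by (rule Bochner_Integration.integrable_bound[OF src_bound_integrable[of T]])
    (auto intro!: AE_I2 order_trans[OF norm_src_ft_le abs_ge_self])

text \<open>Up to the constant \<open>C\<close>, a bound for \<open>W t\<close> that is uniform in \<open>t \<le> T\<close> (\<open>norm_W_le\<close>).\<close>

definition majorant :: "real \<Rightarrow> real^3 \<Rightarrow> real" where
  "majorant T k = (LINT s|lborel. norm (src_ft T s k))"

lemma majorant_L2: "L2 (majorant T)"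
  unfolding majorant_def[abs_def] by (rule src_ft.minkowski) (intro integrable_norm src_ft_integrable)

text \<open>The norm of biquaternions is submultiplicative only up to a constant.\<close>

definition C where "C = (SOME K. K > 0 \<and> (\<forall>p q. norm (p \<star> q) \<le> norm p * norm q * K))"

lemma C: "C > 0" "norm (p \<star> q) \<le> norm p * norm q * C"
proof -
  have "\<exists>K. K > 0 \<and> (\<forall>p q. norm (p \<star> q) \<le> norm p * norm q * K)"
    using bmult.pos_bounded by blast
  then have "C > 0 \<and> (\<forall>p q. norm (p \<star> q) \<le> norm p * norm q * C)"
    unfolding C_def by (rule someI_ex)
  then show "C > 0" "norm (p \<star> q) \<le> norm p * norm q * C" by blast+
qed

lemma norm_qexp_bmult_le: "norm (qexp k \<tau> \<star> p) \<le> C * norm p"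
proof -
  have "norm (qexp k \<tau> \<star> p) \<le> norm (qexp k \<tau>) * norm p * C" by (rule C)
  also have "\<dots> \<le> 1 * norm p * C"
    using C(1) by (intro mult_right_mono norm_qexp_le) auto
  finally show ?thesis by (simp add: mult.commute)
qed

text \<open>\<open>W t\<close> is the Fourier transform of the parabolic Teodorescu transform at time \<open>t\<close>, in the sense of
  \<open>parabolic_teodorescu_pairing\<close>. As a function it is defined at each frequency, and ordinary calculus in
  the time variable applies to it.\<close>

definition W :: "real \<Rightarrow> real^3 \<Rightarrow> biquat" where
  "W t k = (LINT s|lborel. qexp k (t - s) \<star> src_ft t s k)"

lemma W_integrand_integrable: "integrable lborel (\<lambda>s. qexp k (r - s) \<star> src_ft T s k)"
  by (rule Bochner_Integration.integrable_bound[OF integrable_mult_right[OF integrable_norm[OF src_ft_integrable], of C T k]])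
    (auto intro!: AE_I2 order_trans[OF norm_qexp_bmult_le abs_ge_self])

lemma norm_W_le:
  assumes "t \<le> T" shows "norm (W t k) \<le> C * majorant T k"
proof -
  have "norm (W t k) \<le> (LINT s|lborel. C * norm (src_ft T s k))"
    unfolding W_def
  proof (rule Bochner_Integration.integral_norm_bound_integral[OF W_integrand_integrable])
    show "integrable lborel (\<lambda>s. C * norm (src_ft T s k))"
      by (intro integrable_mult_right integrable_norm src_ft_integrable)
    show "norm (qexp k (t - s) \<star> src_ft t s k) \<le> C * norm (src_ft T s k)" for s
    proof (cases "s \<in> {0..t}")
      case True
      then have "src_ft t s = src_ft T s" using assms by (simp add: src_ft_eq)
      then show ?thesis using norm_qexp_bmult_le by simp
    qed (use C(1) in \<open>simp add: src_ft_outside bmult.zero_right\<close>)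
  qed
  then show ?thesis by (simp add: majorant_def)
qed

lemma W_eq:
  assumes "t \<le> T"
  shows "W t k = (LINT s|lborel. indicator {0..t} s *\<^sub>R (qexp k (t - s) \<star> src_ft T s k))"
proof -
  have "qexp k (t - s) \<star> src_ft t s k = indicator {0..t} s *\<^sub>R (qexp k (t - s) \<star> src_ft T s k)" for s
  proof (cases "s \<in> {0..t}")
    case True
    then have "src_ft t s = src_ft T s" using assms by (simp add: src_ft_eq)
    then show ?thesis using True by simp
  qed (simp add: src_ft_outside bmult.zero_right)
  then show ?thesis unfolding W_def by simp
qed

lemma W_measurable:
  "(\<lambda>p. indicator {..T} (fst p) *\<^sub>R W (fst p) (snd p)) \<in> borel_measurable (lborel \<Otimes>\<^sub>M lborel)"
proof -
  have m: "(\<lambda>q. src_ft T (snd q) (snd (fst q))) \<in> borel_measurable ((lborel \<Otimes>\<^sub>M lborel) \<Otimes>\<^sub>M lborel)"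
  proof -
    have "(\<lambda>q. (\<lambda>p. src_ft T (fst p) (snd p)) (snd q, snd (fst q))) \<in> borel_measurable ((lborel \<Otimes>\<^sub>M lborel) \<Otimes>\<^sub>M lborel)"
      by (rule measurable_compose[OF _ src_ft.Y_measurable]) measurable
    then show ?thesis by simp
  qed
  have i: "(\<lambda>q. indicator {0..fst (fst q)} (snd q) :: real) \<in> borel_measurable ((lborel \<Otimes>\<^sub>M lborel :: (real \<times> (real^3)) measure) \<Otimes>\<^sub>M lborel)"
    unfolding indicator_def atLeastAtMost_iff by measurable
  have "(\<lambda>q. indicator {0..fst (fst q)} (snd q) *\<^sub>R (qexp (snd (fst q)) (fst (fst q) - snd q) \<star> src_ft T (snd q) (snd (fst q)))) \<in> borel_measurable ((lborel \<Otimes>\<^sub>M lborel) \<Otimes>\<^sub>M lborel)"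
    by (intro borel_measurable_scaleR bmult_measurable qexp_measurable m i) measurable
  then have "(\<lambda>p. LINT s|lborel. indicator {0..fst p} s *\<^sub>R (qexp (snd p) (fst p - s) \<star> src_ft T s (snd p))) \<in> borel_measurable (lborel \<Otimes>\<^sub>M lborel)"
    by (intro lborel.borel_measurable_lebesgue_integral) (simp add: split_beta')
  then have "(\<lambda>p. indicator {..T} (fst p) *\<^sub>R (LINT s|lborel. indicator {0..fst p} s *\<^sub>R (qexp (snd p) (fst p - s) \<star> src_ft T s (snd p)))) \<in> borel_measurable (lborel \<Otimes>\<^sub>M lborel)"
    by (rule borel_measurable_scaleR[rotated]) measurable
  also have "(\<lambda>p. indicator {..T} (fst p) *\<^sub>R (LINT s|lborel. indicator {0..fst p} s *\<^sub>R (qexp (snd p) (fst p - s) \<star> src_ft T s (snd p)))) = (\<lambda>p. indicator {..T} (fst p) *\<^sub>R W (fst p) (snd p))"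
  proof
    fix p :: "real \<times> (real^3)"
    show "indicator {..T} (fst p) *\<^sub>R (LINT s|lborel. indicator {0..fst p} s *\<^sub>R (qexp (snd p) (fst p - s) \<star> src_ft T s (snd p))) = indicator {..T} (fst p) *\<^sub>R W (fst p) (snd p)"
      by (cases "fst p \<le> T") (simp_all add: W_eq)
  qed
  finally show ?thesis .
qed

lemma W_measurable1[measurable]: "W t \<in> borel_measurable borel"
  using measurable_compose[OF _ W_measurable[of t], of "\<lambda>k. (t, k)" borel] by simp

lemma W_L2: "L2 (W t)"
  using L2_cmult[OF majorant_L2, of C t]
  by (rule L2_bound) (auto intro: order_trans[OF norm_W_le[OF order_refl] abs_ge_self])

text \<open>The equation \<open>\<partial>\<^sub>t W = F(w) + 2 \<pi> k W\<close> in integrated form. It is obtained by inserting \<open>qexp_duhamel\<close> into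
  the definition of \<open>W\<close> and exchanging the integrations over the triangle \<open>s \<le> r \<le> t\<close>.\<close>

lemma W_evolution:
  assumes "t \<ge> 0"
  shows "W t k = (LINT r|lborel. src_ft t r k) + (LINT r|lborel. indicator {0..t} r *\<^sub>R (freq k \<star> W r k))"
proof -
  define p where "p s = src_ft t s k" for s
  have [measurable]: "p \<in> borel_measurable borel" unfolding p_def by measurable
  define F where "F s r = indicator {s..t} r *\<^sub>R (freq k \<star> (qexp k (r - s) \<star> p s))" for s r
  have p0: "p s = 0" if "s \<notin> {0..t}" for s using that by (simp add: p_def src_ft_outside)
  have pi: "integrable lborel p" unfolding p_def by (rule src_ft_integrable)
  define K where "K = norm (freq k) * C * C"
  have K: "K \<ge> 0" using C(1) by (simp add: K_def)
  have Fb: "norm (F s r) \<le> indicator {0..t} r * (K * norm (p s))" for s r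
  proof (cases "s \<in> {0..t} \<and> r \<in> {s..t}")
    case True
    have "norm (freq k \<star> (qexp k (r - s) \<star> p s)) \<le> norm (freq k) * norm (qexp k (r - s) \<star> p s) * C" by (rule C)
    also have "\<dots> \<le> norm (freq k) * (C * norm (p s)) * C"
      using C(1) by (intro mult_right_mono mult_left_mono norm_qexp_bmult_le) auto
    finally show ?thesis using True by (simp add: F_def K_def mult_ac)
  next
    case False
    then have "F s r = 0" using p0[of s] by (auto simp: F_def bmult.zero_right indicator_def)
    then show ?thesis using K by (simp add: indicator_def)
  qed
  have I: "integrable (lborel \<Otimes>\<^sub>M lborel) (case_prod F)"
  proof (rule Bochner_Integration.integrable_bound)
    have [simp]: "integrable lborel (indicator {0..t} :: real \<Rightarrow> real)"
      by (intro integrable_real_indicator) (auto simp: emeasure_lborel_Icc_eq)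
    show "integrable (lborel \<Otimes>\<^sub>M lborel) (\<lambda>(s, r). indicator {0..t} r * (K * norm (p s)))"
      by (rule lborel_pair.Fubini_integrable) (use K in \<open>auto simp: abs_mult mult_ac intro!: integrable_mult_right integrable_mult_left integrable_norm pi\<close>)
    have "(\<lambda>q. indicator {fst q..t} (snd q) :: real) \<in> borel_measurable (lborel \<Otimes>\<^sub>M lborel)"
      unfolding indicator_def atLeastAtMost_iff by measurable
    moreover have "(\<lambda>q. freq k \<star> (qexp k (snd q - fst q) \<star> p (fst q))) \<in> borel_measurable (lborel \<Otimes>\<^sub>M lborel)"
      by (intro bmult_measurable qexp_measurable) measurable
    ultimately show "case_prod F \<in> borel_measurable (lborel \<Otimes>\<^sub>M lborel)"
      unfolding F_def split_beta' by (rule borel_measurable_scaleR)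
    show "AE q in lborel \<Otimes>\<^sub>M lborel. norm (case_prod F q) \<le> norm (case q of (s, r) \<Rightarrow> indicator {0..t} r * (K * norm (p s)))"
      by (intro AE_I2) (auto intro: order_trans[OF Fb abs_ge_self])
  qed
  have inner: "(LINT s|lborel. F s r) = indicator {0..t} r *\<^sub>R (freq k \<star> W r k)" for r
  proof (cases "r \<in> {0..t}")
    case True
    have "F s r = freq k \<star> (indicator {0..r} s *\<^sub>R (qexp k (r - s) \<star> p s))" for s
      using True p0[of s] by (auto simp: F_def indicator_def bmult.zero_right)
    moreover have "integrable lborel (\<lambda>s. indicator {0..r} s *\<^sub>R (qexp k (r - s) \<star> p s))"
      unfolding p_def by (intro integrable_mult_indicator W_integrand_integrable) simp
    ultimately have "(LINT s|lborel. F s r) = freq k \<star> (LINT s|lborel. indicator {0..r} s *\<^sub>R (qexp k (r - s) \<star> p s))"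
      using integral_bounded_linear[OF bmult.bounded_linear_right] by simp
    then show ?thesis using True W_eq[of r t k] by (simp add: p_def)
  next
    case False
    then have "F s r = 0" for s using p0[of s] by (auto simp: F_def indicator_def bmult.zero_right)
    then show ?thesis using False by simp
  qed
  have "W t k = (LINT s|lborel. p s + (LINT r|lborel. F s r))"
  proof -
    have "qexp k (t - s) \<star> p s = p s + (LINT r|lborel. F s r)" for s
    proof (cases "s \<in> {0..t}")
      case True
      then show ?thesis unfolding F_def by (intro qexp_duhamel) simp
    qed (simp add: p0 F_def bmult.zero_right)
    then show ?thesis unfolding W_def p_def[symmetric] by simp
  qed
  also have "\<dots> = (LINT s|lborel. p s) + (LINT s|lborel. (LINT r|lborel. F s r))"
    using lborel_pair.integrable_fst'[OF I] by (intro Bochner_Integration.integral_add pi) simp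
  also have "(LINT s|lborel. (LINT r|lborel. F s r)) = (LINT r|lborel. (LINT s|lborel. F s r))"
    using lborel_pair.Fubini_integral[OF I] by simp
  finally show ?thesis unfolding inner by (simp add: p_def)
qed

text \<open>The integrand in time that defines the parabolic Teodorescu transform.\<close>

definition slice :: "real \<Rightarrow> real \<Rightarrow> real^3 \<Rightarrow> biquat" where
  "slice t s = inv_fourier (\<lambda>k. qexp k (t - s) \<star> fourier (\<lambda>y. w y s) k)"

lemma parabolic_teodorescu_eq: "parabolic_teodorescu w x t = L2_integral (slice t) t x"
  by (simp add: parabolic_teodorescu_def slice_def[abs_def])

lemma slice_ft_L2: "L2 (\<lambda>k. qexp k (t - s) \<star> src_ft T s k)"
proof -
  have "L2 (src_ft T s)"
    using src_ft.Y_N2[of T s] by (auto simp: L2_iff intro: le_less_trans)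
  then have "L2 (\<lambda>k. C *\<^sub>R src_ft T s k)" by (rule L2_cmult)
  then show ?thesis
    by (rule L2_bound) (use C(1) in \<open>auto simp: norm_qexp_bmult_le\<close>)
qed

lemma slice_eq: "s \<in> {0..t} \<Longrightarrow> slice t s = inv_fourier (\<lambda>k. qexp k (t - s) \<star> src_ft t s k)"
  by (simp add: slice_def src_ft_eq)

lemma slice_pairing_integrable:
  assumes \<psi>: "L2 \<psi>"
  shows "integrable (lborel \<Otimes>\<^sub>M lborel) (\<lambda>(s, k). \<psi> k *\<^sub>B (qexp k (t - s) \<star> src_ft t s k))"
proof (rule Bochner_Integration.integrable_bound)
  have [measurable]: "\<psi> \<in> borel_measurable borel" using \<psi> by (simp add: L2_iff)
  show "integrable (lborel \<Otimes>\<^sub>M lborel) (\<lambda>p. C * (norm (src_ft t (fst p) (snd p)) * norm (\<psi> (snd p))))"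
    by (intro integrable_mult_right src_ft.product_integrable \<psi>)
  show "(\<lambda>(s, k). \<psi> k *\<^sub>B (qexp k (t - s) \<star> src_ft t s k)) \<in> borel_measurable (lborel \<Otimes>\<^sub>M lborel)"
    unfolding split_beta' by (intro cscale_measurable bmult_measurable qexp_measurable src_ft.Y_measurable) measurable
  show "AE p in lborel \<Otimes>\<^sub>M lborel. norm (case p of (s, k) \<Rightarrow> \<psi> k *\<^sub>B (qexp k (t - s) \<star> src_ft t s k)) \<le> norm (C * (norm (src_ft t (fst p) (snd p)) * norm (\<psi> (snd p))))"
  proof (intro AE_I2, clarify)
    fix s k
    have "norm (\<psi> k *\<^sub>B (qexp k (t - s) \<star> src_ft t s k)) \<le> norm (\<psi> k) * (C * norm (src_ft t s k))"
      unfolding norm_cscale by (intro mult_left_mono norm_qexp_bmult_le) simp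
    then show "norm (\<psi> k *\<^sub>B (qexp k (t - s) \<star> src_ft t s k)) \<le> norm (C * (norm (src_ft t (fst (s, k)) (snd (s, k))) * norm (\<psi> (snd (s, k)))))"
      using C(1) by (simp add: abs_mult mult_ac)
  qed
qed

lemma slice_pairing:
  assumes \<phi>: "L2 \<phi>"
  shows "indicator {0..t} s *\<^sub>R (LINT x|lborel. \<phi> x *\<^sub>B slice t s x) = (LINT k|lborel. dual_ft \<phi> k *\<^sub>B (qexp k (t - s) \<star> src_ft t s k))"
proof (cases "s \<in> {0..t}")
  case True
  then show ?thesis by (simp add: slice_eq fourier_multiplication[OF \<phi> slice_ft_L2])
qed (simp add: src_ft_outside bmult.zero_right cscale.zero_right)

text \<open>Moving the inverse transform to the test function turns the time integral of the slices into a double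
  integral over time and frequency, to which Fubini's theorem applies.\<close>

lemma has_L2_integral_slice:
  assumes "t \<ge> 0" shows "has_L2_integral (slice t) (inv_fourier (W t)) t"
  unfolding has_L2_integral_def
proof (intro conjI allI impI)
  show "L2 (inv_fourier (W t))" by (intro inv_fourier_L2 W_L2)
  show "AE s in lborel. s \<in> {0..t} \<longrightarrow> L2 (slice t s)"
    by (intro AE_I2 impI) (simp add: slice_eq inv_fourier_L2 slice_ft_L2)
  fix \<phi> :: "real^3 \<Rightarrow> complex" assume \<phi>: "L2 \<phi>"
  note I = slice_pairing_integrable[OF dual_ft_L2(1)[OF \<phi>], of t]
  show "set_integrable lborel {0..t} (\<lambda>s. LINT x|lborel. \<phi> x *\<^sub>B slice t s x)"
    unfolding set_integrable_def slice_pairing[OF \<phi>] using lborel_pair.integrable_fst'[OF I] by simp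
  have "(LINT x|lborel. \<phi> x *\<^sub>B inv_fourier (W t) x) = (LINT k|lborel. dual_ft \<phi> k *\<^sub>B W t k)"
    by (rule fourier_multiplication[OF \<phi> W_L2])
  also have "\<dots> = (LINT k|lborel. (LINT s|lborel. dual_ft \<phi> k *\<^sub>B (qexp k (t - s) \<star> src_ft t s k)))"
    unfolding W_def using integral_bounded_linear[OF cscale.bounded_linear_right W_integrand_integrable] by simp
  also have "\<dots> = (LINT s|lborel. (LINT k|lborel. dual_ft \<phi> k *\<^sub>B (qexp k (t - s) \<star> src_ft t s k)))"
    by (rule lborel_pair.Fubini_integral[OF I])
  finally show "(LINT x|lborel. \<phi> x *\<^sub>B inv_fourier (W t) x) = (LINT s:{0..t}|lborel. (LINT x|lborel. \<phi> x *\<^sub>B slice t s x))"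
    unfolding set_lebesgue_integral_def slice_pairing[OF \<phi>] .
qed

text \<open>The transform is chosen among all time integrals of the slices, but the pairings do not depend on the
  choice, and the inverse transform of \<open>W t\<close> is one of these integrals.\<close>

lemma parabolic_teodorescu_pairing:
  assumes "t \<ge> 0"
  shows "L2 (\<lambda>x. parabolic_teodorescu w x t)"
    and "L2 \<phi> \<Longrightarrow> (LINT x|lborel. \<phi> x *\<^sub>B parabolic_teodorescu w x t) = (LINT k|lborel. dual_ft \<phi> k *\<^sub>B W t k)"
proof -
  have "\<exists>U. has_L2_integral (slice t) U t" using has_L2_integral_slice[OF assms] by blast
  then have "has_L2_integral (slice t) (L2_integral (slice t) t) t"
    unfolding L2_integral_def by (rule someI_ex)
  then have U: "has_L2_integral (slice t) (\<lambda>x. parabolic_teodorescu w x t) t"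
    by (simp add: parabolic_teodorescu_eq[abs_def])
  then show "L2 (\<lambda>x. parabolic_teodorescu w x t)" by (simp add: has_L2_integral_def)
  assume \<phi>: "L2 \<phi>"
  have "(LINT x|lborel. \<phi> x *\<^sub>B parabolic_teodorescu w x t) = (LINT s:{0..t}|lborel. (LINT x|lborel. \<phi> x *\<^sub>B slice t s x))"
    using U \<phi> by (simp add: has_L2_integral_def)
  also have "\<dots> = (LINT x|lborel. \<phi> x *\<^sub>B inv_fourier (W t) x)"
    using has_L2_integral_slice[OF assms] \<phi> by (simp add: has_L2_integral_def)
  also have "\<dots> = (LINT k|lborel. dual_ft \<phi> k *\<^sub>B W t k)"
    by (rule fourier_multiplication[OF \<phi> W_L2])
  finally show "(LINT x|lborel. \<phi> x *\<^sub>B parabolic_teodorescu w x t) = (LINT k|lborel. dual_ft \<phi> k *\<^sub>B W t k)" .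
qed

definition pairing :: "(real^3 \<Rightarrow> real) \<Rightarrow> real \<Rightarrow> biquat" where
  "pairing \<phi> t = (LINT x|lborel. \<phi> x *\<^sub>R parabolic_teodorescu w x t)"

lemma cscale_one: "1 *\<^sub>B p = p"
  by (simp add: prod_eq_iff vec_eq_iff)

lemma cscale_of_real: "complex_of_real c *\<^sub>B p = c *\<^sub>R p"
  by (simp add: prod_eq_iff vec_eq_iff scaleR_conv_of_real[where 'a=complex])

lemma pairing_eq:
  assumes \<phi>: "test_fun A \<phi>" and t: "t \<ge> 0"
  shows "pairing \<phi> t = (LINT k|lborel. ft (\<lambda>x. complex_of_real (\<phi> x)) k *\<^sub>B W t k)"
  using parabolic_teodorescu_pairing(2)[OF t test_fun_L2[OF \<phi>]]
  unfolding pairing_def cscale_of_real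
  by (simp add: dual_ft_integrable[OF integrable_of_real[OF test_fun_integrable[OF \<phi>]]])

lemma ft_test_fun_L2:
  assumes \<phi>: "test_fun A \<phi>" shows "L2 (ft (\<lambda>x. complex_of_real (\<phi> x)))"
  using dual_ft_L2(1)[OF test_fun_L2[OF \<phi>]]
  by (simp add: dual_ft_integrable[OF integrable_of_real[OF test_fun_integrable[OF \<phi>]]])

definition src_pairing :: "(real^3 \<Rightarrow> real) \<Rightarrow> real \<Rightarrow> biquat" where
  "src_pairing \<phi> s = (LINT x|lborel. \<phi> x *\<^sub>R w x s)"

text \<open>Parseval's identity in each component; here it matters that test functions are continuous.\<close>

lemma src_pairing_eq:
  assumes \<phi>: "test_fun A \<phi>" and s: "s \<in> {0..T}"
  shows "(LINT k|lborel. ft (\<lambda>x. complex_of_real (\<phi> x)) k *\<^sub>B src_ft T s k) = src_pairing \<phi> s"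
proof -
  let ?\<phi> = "\<lambda>x. complex_of_real (\<phi> x)"
  have s0: "s \<ge> 0" using s by simp
  have wi: "integrable lborel (\<lambda>x. w x s)" and wL: "L2 (\<lambda>x. w x s)"
    using w_integrable[OF s0] w_L2[OF s0] by auto
  have [measurable]: "(\<lambda>x. w x s) \<in> borel_measurable borel" using wi by auto
  have \<phi>i: "integrable lborel ?\<phi>" by (intro integrable_of_real test_fun_integrable[OF \<phi>])
  have \<phi>c: "continuous_on UNIV ?\<phi>" by (intro continuous_intros test_fun_continuous[OF \<phi>])
  have [measurable]: "?\<phi> \<in> borel_measurable borel" using \<phi>i by auto
  obtain M where M: "\<And>x. \<bar>\<phi> x\<bar> \<le> M" using test_fun_bounded[OF \<phi>] by blast
  have Mn: "norm (?\<phi> x) \<le> M" for x using M by simp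
  have f: "src_ft T s = fourier_integral (\<lambda>x. w x s)"
    using s by (simp add: src_ft_def src_def[abs_def])
  have L1: "L2 (src_ft T s)"
    using src_ft.Y_N2[of T s] by (auto simp: L2_iff intro: le_less_trans)
  have i1: "integrable lborel (\<lambda>k. ft ?\<phi> k *\<^sub>B src_ft T s k)"
    by (rule L2_mult_integrable[OF ft_test_fun_L2[OF \<phi>] L1]) (auto simp: norm_cscale)
  have i2: "integrable lborel (\<lambda>x. \<phi> x *\<^sub>R w x s)"
    using L2_mult_integrable[OF test_fun_L2[OF \<phi>] wL, of "\<lambda>x. \<phi> x *\<^sub>R w x s"] test_fun_measurable[OF \<phi>] by simp
  show ?thesis
  proof (rule prod_eqI)
    have "Sc (src_ft T s k) = ft (\<lambda>x. Sc (w x s)) (- k)" for k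
      unfolding f fourier_integral_eq ft_def by (subst integral_Sc[OF integrable_wave_cscale[OF wi]]) simp
    then have "Sc (LINT k|lborel. ft ?\<phi> k *\<^sub>B src_ft T s k) = (LINT k|lborel. ft (\<lambda>x. Sc (w x s)) (- k) * ft ?\<phi> k)"
      by (subst integral_Sc[OF i1]) (simp add: mult.commute)
    also have "\<dots> = (LINT x|lborel. Sc (w x s) * ?\<phi> x)"
      by (rule parseval[OF integrable_Sc[OF wi] _ \<phi>i test_fun_L2[OF \<phi>] \<phi>c Mn], rule L2_bound[OF wL]) (auto simp: norm_Sc_le)
    also have "\<dots> = Sc (src_pairing \<phi> s)"
      unfolding src_pairing_def by (subst integral_Sc[OF i2]) (simp add: mult.commute scaleR_conv_of_real[where 'a=complex])
    finally show "Sc (LINT k|lborel. ft ?\<phi> k *\<^sub>B src_ft T s k) = Sc (src_pairing \<phi> s)" .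
    have "Vec (LINT k|lborel. ft ?\<phi> k *\<^sub>B src_ft T s k) $ m = Vec (src_pairing \<phi> s) $ m" for m
    proof -
      have "Vec (src_ft T s k) $ m = ft (\<lambda>x. Vec (w x s) $ m) (- k)" for k
        unfolding f fourier_integral_eq ft_def by (subst integral_Vec[OF integrable_wave_cscale[OF wi]]) simp
      then have "Vec (LINT k|lborel. ft ?\<phi> k *\<^sub>B src_ft T s k) $ m = (LINT k|lborel. ft (\<lambda>x. Vec (w x s) $ m) (- k) * ft ?\<phi> k)"
        by (subst integral_Vec[OF i1]) (simp add: mult.commute)
      also have "\<dots> = (LINT x|lborel. Vec (w x s) $ m * ?\<phi> x)"
        by (rule parseval[OF integrable_Vec[OF wi] _ \<phi>i test_fun_L2[OF \<phi>] \<phi>c Mn], rule L2_bound[OF wL]) (auto simp: norm_Vec_le)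
      also have "\<dots> = Vec (src_pairing \<phi> s) $ m"
        unfolding src_pairing_def by (subst integral_Vec[OF i2]) (simp add: mult.commute scaleR_conv_of_real[where 'a=complex])
      finally show ?thesis .
    qed
    then show "Vec (LINT k|lborel. ft ?\<phi> k *\<^sub>B src_ft T s k) = Vec (src_pairing \<phi> s)"
      by (simp add: vec_eq_iff)
  qed
qed

text \<open>The units \<open>e\<^sub>1, e\<^sub>2, e\<^sub>3\<close>.\<close>

definition unit :: "3 \<Rightarrow> biquat" where
  "unit m = (0, axis m 1)"

lemma freq_eq: "freq k = (\<Sum>m\<in>UNIV. complex_of_real (2 * pi * k $ m) *\<^sub>B unit m)"
  by (simp add: freq_def unit_def cvec_def prod_eq_iff vec_eq_iff sum_3 forall_3 axis_def)

lemma W_pairing_integrable: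
  assumes \<psi>: "L2 \<psi>"
  shows "integrable (lborel \<Otimes>\<^sub>M lborel) (\<lambda>(r, k). indicator {0..t} r *\<^sub>R (\<psi> k *\<^sub>B W r k))"
proof (rule Bochner_Integration.integrable_bound)
  have [measurable]: "\<psi> \<in> borel_measurable borel" using \<psi> by (simp add: L2_iff)
  have [measurable]: "majorant t \<in> borel_measurable borel" using majorant_L2[of t] by (simp add: L2_iff)
  have i: "integrable lborel (\<lambda>k. norm (\<psi> k) * norm (majorant t k))"
    by (rule L2_mult_integrable[OF \<psi> majorant_L2[of t]]) auto
  have [simp]: "integrable lborel (indicator {0..t} :: real \<Rightarrow> real)"
    by (intro integrable_real_indicator) (auto simp: emeasure_lborel_Icc_eq)
  show "integrable (lborel \<Otimes>\<^sub>M lborel) (\<lambda>(r, k). indicator {0..t} r * (C * (norm (\<psi> k) * norm (majorant t k))))"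
    by (rule lborel_pair.Fubini_integrable) (use C(1) i in \<open>auto simp: abs_mult intro!: integrable_mult_right integrable_mult_left\<close>)
  have "(\<lambda>p. indicator {0..t} (fst p) *\<^sub>R (\<psi> (snd p) *\<^sub>B (indicator {..t} (fst p) *\<^sub>R W (fst p) (snd p)))) \<in> borel_measurable (lborel \<Otimes>\<^sub>M lborel)"
    by (rule borel_measurable_scaleR[OF _ cscale_measurable[OF _ W_measurable]]) measurable
  also have "(\<lambda>p. indicator {0..t} (fst p) *\<^sub>R (\<psi> (snd p) *\<^sub>B (indicator {..t} (fst p) *\<^sub>R W (fst p) (snd p)))) = (\<lambda>(r, k). indicator {0..t} r *\<^sub>R (\<psi> k *\<^sub>B W r k))"
    by (auto simp: indicator_def)
  finally show "(\<lambda>(r, k). indicator {0..t} r *\<^sub>R (\<psi> k *\<^sub>B W r k)) \<in> borel_measurable (lborel \<Otimes>\<^sub>M lborel)" .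
  show "AE p in lborel \<Otimes>\<^sub>M lborel. norm (case p of (r, k) \<Rightarrow> indicator {0..t} r *\<^sub>R (\<psi> k *\<^sub>B W r k)) \<le> norm (case p of (r, k) \<Rightarrow> indicator {0..t} r * (C * (norm (\<psi> k) * norm (majorant t k))))"
  proof (intro AE_I2, clarify)
    fix r k
    have "norm (\<psi> k *\<^sub>B W r k) \<le> norm (\<psi> k) * (C * norm (majorant t k))" if "r \<le> t"
      unfolding norm_cscale using norm_W_le[OF that, of k] C(1)
      by (intro mult_left_mono order_trans[OF norm_W_le[OF that]]) auto
    then show "norm (indicator {0..t} r *\<^sub>R (\<psi> k *\<^sub>B W r k)) \<le> norm (indicator {0..t} r * (C * (norm (\<psi> k) * norm (majorant t k))))"
      using C(1) by (auto simp: indicator_def abs_mult mult_ac)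
  qed
qed

lemma src_ft_pairing_integrable:
  assumes \<psi>: "L2 \<psi>"
  shows "integrable (lborel \<Otimes>\<^sub>M lborel) (\<lambda>(s, k). \<psi> k *\<^sub>B src_ft t s k)"
proof (rule Bochner_Integration.integrable_bound[OF src_ft.product_integrable[OF \<psi>, of t]])
  have [measurable]: "\<psi> \<in> borel_measurable borel" using \<psi> by (simp add: L2_iff)
  show "(\<lambda>(s, k). \<psi> k *\<^sub>B src_ft t s k) \<in> borel_measurable (lborel \<Otimes>\<^sub>M lborel)"
    unfolding split_beta' by (intro cscale_measurable src_ft.Y_measurable) measurable
qed (auto simp: norm_cscale mult.commute)

text \<open>The pairing of \<open>w - i D U\<close> with \<open>\<phi>\<close>, the derivatives being moved to the test function.\<close>

definition evolution :: "(real^3 \<Rightarrow> real) \<Rightarrow> real \<Rightarrow> biquat" where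
  "evolution \<phi> r = src_pairing \<phi> r + (\<Sum>m\<in>UNIV. \<i> *\<^sub>B (unit m \<star> pairing (partial_deriv m \<phi>) r))"

text \<open>The weak form of \<open>(\<partial>\<^sub>t + i D) U = w\<close>, integrated in time. Pairing \<open>W_evolution\<close> with the transform of \<open>\<phi>\<close>,
  the multiplier \<open>2 \<pi> k\<close> turns into derivatives of \<open>\<phi>\<close>, whose transforms lie in \<open>L\<^sup>2\<close>; this compensates the growth of \<open>2 \<pi> k\<close>.\<close>

theorem pairing_evolution:
  assumes \<phi>: "test_fun A \<phi>" and t: "t \<ge> 0"
  shows "set_integrable lborel {0..t} (evolution \<phi>)"
    and "pairing \<phi> t = (LINT r:{0..t}|lborel. evolution \<phi> r)"
proof -
  let ?\<phi> = "ft (\<lambda>x. complex_of_real (\<phi> x))"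
  let ?d = "\<lambda>m. ft (\<lambda>x. complex_of_real (partial_deriv m \<phi> x))"
  have L: "L2 ?\<phi>" and Ld: "L2 (?d m)" for m
    by (rule ft_test_fun_L2[OF \<phi>], rule ft_test_fun_L2[OF test_fun_partial[OF \<phi>]])
  have I1: "integrable (lborel \<Otimes>\<^sub>M lborel) (\<lambda>(r, k). ?\<phi> k *\<^sub>B src_ft t r k)"
    by (rule src_ft_pairing_integrable[OF L])
  have I2: "integrable (lborel \<Otimes>\<^sub>M lborel) (\<lambda>(r, k). \<i> *\<^sub>B (unit m \<star> (indicator {0..t} r *\<^sub>R (?d m k *\<^sub>B W r k))))" for m
    using integrable_bounded_linear[OF bounded_linear_compose[OF cscale.bounded_linear_right[of \<i>] bmult.bounded_linear_right[of "unit m"]] W_pairing_integrable[OF Ld[of m], of t]]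
    by (simp add: split_beta')
  define G where "G = (\<lambda>(r, k). ?\<phi> k *\<^sub>B src_ft t r k + (\<Sum>m\<in>UNIV. \<i> *\<^sub>B (unit m \<star> (indicator {0..t} r *\<^sub>R (?d m k *\<^sub>B W r k)))))"
  have G: "integrable (lborel \<Otimes>\<^sub>M lborel) G"
    unfolding G_def split_beta' using I1 I2
    by (intro Bochner_Integration.integrable_add Bochner_Integration.integrable_sum) (simp_all add: split_beta')
  have Wi: "integrable lborel (\<lambda>k. ?d m k *\<^sub>B W r k)" for m r
    by (rule L2_mult_integrable[OF Ld W_L2]) (use Ld[of m] in \<open>auto simp: norm_cscale L2_iff\<close>)
  have Gk: "(LINT k|lborel. G (r, k)) = indicator {0..t} r *\<^sub>R evolution \<phi> r" for r
  proof (cases "r \<in> {0..t}")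
    case True
    have Li: "integrable lborel (\<lambda>k. ?\<phi> k *\<^sub>B src_ft t r k)"
    proof (rule L2_mult_integrable[OF L])
      show "L2 (src_ft t r)" using src_ft.Y_N2[of t r] by (auto simp: L2_iff intro: le_less_trans)
    qed (use L in \<open>auto simp: norm_cscale L2_iff\<close>)
    have b: "bounded_linear (\<lambda>X. \<i> *\<^sub>B (unit m \<star> X))" for m
      by (rule bounded_linear_compose[OF cscale.bounded_linear_right[of \<i>] bmult.bounded_linear_right[of "unit m"]])
    have "(LINT k|lborel. G (r, k)) = (LINT k|lborel. ?\<phi> k *\<^sub>B src_ft t r k) + (\<Sum>m\<in>UNIV. LINT k|lborel. \<i> *\<^sub>B (unit m \<star> (?d m k *\<^sub>B W r k)))"
      unfolding G_def using True Li integrable_bounded_linear[OF b Wi] by (simp add: Bochner_Integration.integral_sum)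
    also have "\<dots> = src_pairing \<phi> r + (\<Sum>m\<in>UNIV. \<i> *\<^sub>B (unit m \<star> (LINT k|lborel. ?d m k *\<^sub>B W r k)))"
      unfolding src_pairing_eq[OF \<phi> True] integral_bounded_linear[OF b Wi] ..
    also have "\<dots> = evolution \<phi> r"
      unfolding evolution_def using True pairing_eq[OF test_fun_partial[OF \<phi>], of r] by simp
    finally show ?thesis using True by simp
  qed (simp add: G_def src_ft_outside cscale.zero_right bmult.zero_right)
  show "set_integrable lborel {0..t} (evolution \<phi>)"
    unfolding set_integrable_def Gk[symmetric] by (rule lborel_pair.integrable_fst'[OF G])
  \<comment> \<open>the integrability of \<open>freq k \<star> W r k\<close> in time is recovered from that of \<open>G\<close>, by dividing by the transform of \<open>\<phi>\<close>\<close>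
  have Gr: "(LINT r|lborel. G (r, k)) = ?\<phi> k *\<^sub>B W t k" if "integrable lborel (\<lambda>r. G (r, k))" for k
  proof -
    have e: "G (r, k) = ?\<phi> k *\<^sub>B (src_ft t r k + indicator {0..t} r *\<^sub>R (freq k \<star> W r k))" for r
    proof -
      have "?d m k = - 2 * pi * \<i> * k $ m * ?\<phi> k" for m by (rule ft_partial_deriv[OF \<phi>])
      then have "\<i> * ?d m k = ?\<phi> k * complex_of_real (2 * pi * k $ m)" for m by (simp add: mult_ac)
      then have "\<i> *\<^sub>B (unit m \<star> (?d m k *\<^sub>B W r k)) = ?\<phi> k *\<^sub>B (complex_of_real (2 * pi * k $ m) *\<^sub>B unit m \<star> W r k)" for m
        by (simp only: bmult_cscale_right bmult_cscale_left cscale_cscale)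
      then have "(\<Sum>m\<in>UNIV. \<i> *\<^sub>B (unit m \<star> (?d m k *\<^sub>B W r k))) = ?\<phi> k *\<^sub>B (freq k \<star> W r k)"
        by (simp only: freq_eq bmult.sum_left cscale.sum_right)
      then show ?thesis
        by (simp add: G_def indicator_def cscale.add_right bmult.zero_right cscale.zero_right)
    qed
    show ?thesis
    proof (cases "?\<phi> k = 0")
      case False
      let ?X = "\<lambda>r. src_ft t r k + indicator {0..t} r *\<^sub>R (freq k \<star> W r k)"
      have X: "?X r = inverse (?\<phi> k) *\<^sub>B G (r, k)" for r
        unfolding e cscale_cscale using False by (simp add: cscale_one)
      have Xi: "integrable lborel ?X"
        unfolding X by (rule integrable_bounded_linear[OF cscale.bounded_linear_right that])
      have "integrable lborel (\<lambda>r. ?X r - src_ft t r k)"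
        by (intro Bochner_Integration.integrable_diff Xi src_ft_integrable)
      then have Yi: "integrable lborel (\<lambda>r. indicator {0..t} r *\<^sub>R (freq k \<star> W r k))" by simp
      have "(LINT r|lborel. G (r, k)) = ?\<phi> k *\<^sub>B integral\<^sup>L lborel ?X"
        unfolding e by (rule integral_bounded_linear[OF cscale.bounded_linear_right Xi])
      also have "integral\<^sup>L lborel ?X = W t k"
        unfolding W_evolution[OF t] by (rule Bochner_Integration.integral_add[OF src_ft_integrable Yi])
      finally show ?thesis .
    qed (simp add: e cscale.zero_left)
  qed
  have "pairing \<phi> t = (LINT k|lborel. ?\<phi> k *\<^sub>B W t k)" by (rule pairing_eq[OF \<phi> t])
  also have "\<dots> = (LINT k|lborel. (LINT r|lborel. G (r, k)))"
  proof (rule integral_cong_AE)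
    have [measurable]: "(\<lambda>(k, r). G (r, k)) \<in> borel_measurable (lborel \<Otimes>\<^sub>M lborel)"
      using lborel_pair.integrable_product_swap[OF G] by auto
    show "(\<lambda>k. LINT r|lborel. G (r, k)) \<in> borel_measurable lborel" by measurable
    show "(\<lambda>k. ?\<phi> k *\<^sub>B W t k) \<in> borel_measurable lborel"
      using L by (intro cscale_measurable) (auto simp: L2_iff)
    have "AE k in lborel. integrable lborel (\<lambda>r. case (k, r) of (k, r) \<Rightarrow> G (r, k))"
      using lborel_pair.AE_integrable_fst'[OF lborel_pair.integrable_product_swap[OF G]] .
    then show "AE k in lborel. ?\<phi> k *\<^sub>B W t k = (LINT r|lborel. G (r, k))"
      by eventually_elim (simp add: Gr)
  qed
  also have "\<dots> = (LINT r|lborel. (LINT k|lborel. G (r, k)))"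
    using lborel_pair.Fubini_integral[of "\<lambda>r k. G (r, k)"] G by simp
  also have "\<dots> = (LINT r:{0..t}|lborel. evolution \<phi> r)"
    unfolding Gk set_lebesgue_integral_def ..
  finally show "pairing \<phi> t = (LINT r:{0..t}|lborel. evolution \<phi> r)" .
qed

end

section \<open>Time derivatives of pairings with test functions\<close>

lemma at_within_atLeast:
  fixes t :: real assumes "t \<ge> 0"
  shows "at t within {0..} = at t within {0..t+1}"
  by (rule at_within_nhd[of t "{..<t+1}"]) auto

text \<open>With the next lemma this gives a bootstrap argument: pairings are integrals of expressions in other
  pairings. Hence they are continuous, so that the integrands are continuous and the pairings are
  continuously differentiable.\<close>

lemma continuous_on_set_lebesgue_integral:
  fixes f :: "real \<Rightarrow> 'a::euclidean_space"
  assumes "\<And>t. t \<ge> 0 \<Longrightarrow> set_integrable lborel {0..t} f"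
    and "\<And>t. t \<ge> 0 \<Longrightarrow> F t = (LINT r:{0..t}|lborel. f r)"
  shows "continuous_on {0..} F"
proof -
  have eq: "F t = integral {0..t} f" if "t \<ge> 0" for t
    using set_borel_integral_eq_integral(2)[OF assms(1)[OF that]] assms(2)[OF that] by simp
  have "continuous_on {0..T} F" for T
  proof (cases "T \<ge> 0")
    case True
    have "f integrable_on {0..T}"
      using set_borel_integral_eq_integral(1)[OF assms(1)[OF True]] .
    then have "continuous_on {0..T} (\<lambda>t. integral {0..t} f)"
      by (rule indefinite_integral_continuous_1)
    then show ?thesis by (rule continuous_on_eq) (simp add: eq)
  qed simp
  then show ?thesis
    unfolding continuous_on_eq_continuous_within
    by (metis at_within_atLeast atLeastAtMost_iff atLeast_iff continuous_within less_add_one order_less_imp_le)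
qed

lemma has_vector_derivative_set_lebesgue_integral:
  fixes f :: "real \<Rightarrow> 'a::euclidean_space"
  assumes F: "\<And>t. t \<ge> 0 \<Longrightarrow> F t = (LINT r:{0..t}|lborel. f r)"
    and c: "continuous_on {0..} f" and t: "t \<ge> 0"
  shows "(F has_vector_derivative f t) (at t within {0..})"
proof -
  have c': "continuous_on {0..T} f" for T
    by (rule continuous_on_subset[OF c]) auto
  have eq: "F s = integral {0..s} f" if "s \<ge> 0" for s
    using set_borel_integral_eq_integral(2)[OF borel_integrable_atLeastAtMost'[OF c'[of s]]] F[OF that] by simp
  have "((\<lambda>u. integral {0..u} f) has_vector_derivative f t) (at t within {0..t+1})"
    by (rule integral_has_vector_derivative[OF c']) (use t in auto)
  then have "(F has_vector_derivative f t) (at t within {0..t+1})"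
    by (rule has_vector_derivative_transform[rotated 2]) (use t eq in auto)
  then show ?thesis using at_within_atLeast[OF t] by simp
qed

lemma loc_integrable_L2:
  fixes f :: "real^3 \<Rightarrow> 'b::euclidean_space"
  assumes "L2 f" shows "loc_integrable A f"
  unfolding loc_integrable_def set_integrable_def
  by (auto intro!: L2_truncation_integrable[OF assms] compact_imp_bounded borel_compact)

lemma test_fun_outside: "test_fun A \<phi> \<Longrightarrow> x \<notin> A \<Longrightarrow> \<phi> x = 0"
  by (rule test_fun_zero) (auto simp: test_fun_def)

lemma dist_of_eq:
  assumes "test_fun A \<phi>"
  shows "dist_of A f \<phi> = (LINT x|lborel. \<phi> x *\<^sub>R f x)"
proof -
  have "indicator A x *\<^sub>R (\<phi> x *\<^sub>R f x) = \<phi> x *\<^sub>R f x" for x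
    using test_fun_outside[OF assms, of x] by (cases "x \<in> A") auto
  then show ?thesis by (simp only: dist_of_def set_lebesgue_integral_def)
qed

lemma test_fun_scaleR_integrable:
  fixes f :: "real^3 \<Rightarrow> 'b::euclidean_space"
  assumes \<phi>: "test_fun A \<phi>" and f: "loc_integrable A f"
  shows "integrable lborel (\<lambda>x. \<phi> x *\<^sub>R f x)"
proof -
  let ?K = "closure {x. \<phi> x \<noteq> 0}"
  have K: "compact ?K" "?K \<subseteq> A" using \<phi> by (auto simp: test_fun_def)
  then have i: "integrable lborel (\<lambda>x. indicator ?K x *\<^sub>R f x)"
    using f by (auto simp: loc_integrable_def set_integrable_def)
  obtain M where M: "\<And>x. \<bar>\<phi> x\<bar> \<le> M" using test_fun_bounded[OF \<phi>] by blast
  have [measurable]: "\<phi> \<in> borel_measurable borel" by (rule test_fun_measurable[OF \<phi>])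
  have eq: "\<phi> x *\<^sub>R f x = \<phi> x *\<^sub>R (indicator ?K x *\<^sub>R f x)" for x
    using test_fun_zero[OF \<phi>, of x] by (cases "x \<in> ?K") auto
  have [measurable]: "(\<lambda>x. indicator ?K x *\<^sub>R f x) \<in> borel_measurable borel" using i by auto
  show ?thesis
    unfolding eq
  proof (rule Bochner_Integration.integrable_bound)
    show "integrable lborel (\<lambda>x. M * norm (indicator ?K x *\<^sub>R f x))"
      by (intro integrable_mult_right integrable_norm i)
    show "AE x in lborel. norm (\<phi> x *\<^sub>R (indicator ?K x *\<^sub>R f x)) \<le> norm (M * norm (indicator ?K x *\<^sub>R f x))"
      using M by (intro AE_I2) (auto simp: abs_mult mult.assoc intro!: mult_right_mono order_trans[OF M abs_ge_self])
  qed measurable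
qed

text \<open>The scalar part of \<open>X\<close> can be recovered from the vector part of \<open>a \<star> X\<close>: its inner product with \<open>a\<close> is
  \<open>\<bar>a\<bar>\<^sup>2 Sc X\<close>, because \<open>a \<times> Vec X\<close> is orthogonal to \<open>a\<close>.\<close>

lemma norm_Sc_mult_le: "norm (Sc X) * norm a \<le> norm ((0, cvec a) \<star> X)"
proof (cases "a = 0")
  case False
  define V where "V = Vec ((0, cvec a) \<star> X)"
  have n: "(a $ 1)\<^sup>2 + (a $ 2)\<^sup>2 + (a $ 3)\<^sup>2 = (norm a)\<^sup>2"
    by (simp add: norm_vec_def L2_set_def sum_3)
  have "(\<Sum>m\<in>UNIV. complex_of_real (a $ m) * V $ m) = Sc X * complex_of_real ((a $ 1)\<^sup>2 + (a $ 2)\<^sup>2 + (a $ 3)\<^sup>2)"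
    unfolding V_def by (simp add: sum_3 bmult_def ccross_def cvec_def algebra_simps power2_eq_square)
  then have "norm (Sc X) * (norm a)\<^sup>2 = norm (\<Sum>m\<in>UNIV. complex_of_real (a $ m) * V $ m)"
    unfolding n by (simp add: norm_mult norm_power)
  also have "\<dots> \<le> (\<Sum>m\<in>UNIV. \<bar>a $ m\<bar> * \<bar>norm (V $ m)\<bar>)"
    by (rule order_trans[OF norm_sum]) (simp add: norm_mult)
  also have "\<dots> \<le> L2_set (\<lambda>m. a $ m) UNIV * L2_set (\<lambda>m. norm (V $ m)) UNIV"
    by (rule L2_set_mult_ineq)
  also have "\<dots> = norm a * norm V"
    by (simp add: norm_vec_def L2_set_def)
  also have "\<dots> \<le> norm a * norm ((0, cvec a) \<star> X)"
    unfolding V_def using norm_snd_le[of "Vec ((0, cvec a) \<star> X)" "Sc ((0, cvec a) \<star> X)"]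
    by (intro mult_left_mono) simp_all
  finally have "norm a * (norm (Sc X) * norm a) \<le> norm a * norm ((0, cvec a) \<star> X)"
    by (simp add: power2_eq_square mult_ac)
  then show ?thesis using False by simp
qed simp

locale continuous_source = square_integrable_source +
  assumes \<Omega>_open: "open \<Omega>" and w_continuous: "continuous_on (\<Omega> \<times> {0..}) (\<lambda>p. w (fst p) (snd p))"
begin

interpretation src_ft: L2_family "src_ft T" "src_norm T" T for T by (rule src_ft_family)

lemma continuous_on_src_pairing:
  assumes \<phi>: "test_fun \<Omega> \<phi>"
  shows "continuous_on {0..} (src_pairing \<phi>)"
  unfolding continuous_on_sequentially
proof (intro allI ballI impI, elim conjE)
  fix s a assume a: "a \<in> {0::real..}" and s: "\<forall>n. s n \<in> {0..}" and l: "s \<longlonglongrightarrow> a"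
  let ?K = "closure {x. \<phi> x \<noteq> 0}"
  have K: "compact ?K" "?K \<subseteq> \<Omega>" using \<phi> by (auto simp: test_fun_def)
  obtain T where T: "\<And>n. \<bar>s n\<bar> \<le> T"
    using convergent_imp_Bseq[OF convergentI[OF l]] by (auto simp: Bseq_def)
  have "compact ((\<lambda>p. w (fst p) (snd p)) ` (?K \<times> {0..T}))"
    by (intro compact_continuous_image continuous_on_subset[OF w_continuous] compact_Times K compact_Icc) (use K in auto)
  then obtain B where B: "\<And>x t. x \<in> ?K \<Longrightarrow> t \<in> {0..T} \<Longrightarrow> norm (w x t) \<le> B"
    using compact_imp_bounded by (force simp: bounded_iff)
  have [measurable]: "\<phi> \<in> borel_measurable borel" by (rule test_fun_measurable[OF \<phi>])
  have wm [measurable]: "(\<lambda>x. w x t) \<in> borel_measurable borel" if "t \<ge> 0" for t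
    using w_integrable[OF that] by auto
  have "(\<lambda>n. LINT x|lborel. \<phi> x *\<^sub>R w x (s n)) \<longlonglongrightarrow> (LINT x|lborel. \<phi> x *\<^sub>R w x a)"
  proof (rule integral_dominated_convergence[where w = "\<lambda>x. \<bar>\<phi> x\<bar> * B"])
    show "(\<lambda>x. \<phi> x *\<^sub>R w x a) \<in> borel_measurable lborel" using a by simp measurable
    show "(\<lambda>x. \<phi> x *\<^sub>R w x (s n)) \<in> borel_measurable lborel" for n using s by simp
    show "integrable lborel (\<lambda>x. \<bar>\<phi> x\<bar> * B)"
      by (intro integrable_mult_left integrable_abs test_fun_integrable[OF \<phi>])
    show "AE x in lborel. (\<lambda>n. \<phi> x *\<^sub>R w x (s n)) \<longlonglongrightarrow> \<phi> x *\<^sub>R w x a"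
    proof (intro AE_I2)
      fix x
      show "(\<lambda>n. \<phi> x *\<^sub>R w x (s n)) \<longlonglongrightarrow> \<phi> x *\<^sub>R w x a"
      proof (cases "x \<in> \<Omega>")
        case True
        have "continuous_on {0..} (\<lambda>t::real. (x, t))"
          by (intro continuous_on_Pair continuous_on_const continuous_on_id)
        from continuous_on_compose2[OF w_continuous this] True
        have "continuous_on {0..} (\<lambda>t. w x t)" by auto
        then have "(\<lambda>n. w x (s n)) \<longlonglongrightarrow> w x a"
          using a s l by (auto simp: continuous_on_sequentially o_def)
        then show ?thesis by (intro tendsto_intros)
      qed (simp add: w_outside)
    qed
    show "AE x in lborel. norm (\<phi> x *\<^sub>R w x (s n)) \<le> \<bar>\<phi> x\<bar> * B" for n
    proof (intro AE_I2)
      fix x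
      show "norm (\<phi> x *\<^sub>R w x (s n)) \<le> \<bar>\<phi> x\<bar> * B"
      proof (cases "x \<in> ?K")
        case True
        have "s n \<in> {0..T}" using s T[of n] by auto
        then show ?thesis using B[OF True] by (simp add: mult_left_mono)
      next
        case False
        then have "\<phi> x = 0" by (rule test_fun_zero[OF \<phi>])
        then show ?thesis by simp
      qed
    qed
  qed
  then show "(src_pairing \<phi> \<circ> s) \<longlonglongrightarrow> src_pairing \<phi> a"
    by (simp add: src_pairing_def o_def)
qed

lemma continuous_on_pairing:
  assumes \<phi>: "test_fun \<Omega> \<phi>"
  shows "continuous_on {0..} (pairing \<phi>)"
  by (rule continuous_on_set_lebesgue_integral[OF pairing_evolution[OF \<phi>]])

lemma continuous_on_evolution:
  assumes \<phi>: "test_fun \<Omega> \<phi>"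
  shows "continuous_on {0..} (evolution \<phi>)"
  unfolding evolution_def
  by (intro continuous_on_add continuous_on_sum cscale.continuous_on bmult.continuous_on continuous_on_const
      continuous_on_src_pairing continuous_on_pairing test_fun_partial \<phi>)

theorem pairing_has_vector_derivative:
  assumes \<phi>: "test_fun \<Omega> \<phi>" and t: "t \<ge> 0"
  shows "(pairing \<phi> has_vector_derivative evolution \<phi> t) (at t within {0..})"
  by (rule has_vector_derivative_set_lebesgue_integral[OF pairing_evolution(2)[OF \<phi>] continuous_on_evolution[OF \<phi>] t])

lemma pairing_0:
  assumes \<phi>: "test_fun \<Omega> \<phi>" shows "pairing \<phi> 0 = 0"
proof -
  have "(LINT r:{0..0}|lborel. evolution \<phi> r) = (LINT r|(lborel :: real measure). 0)"
    unfolding set_lebesgue_integral_def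
  proof (rule integral_cong_AE)
    show "(\<lambda>x. indicat_real {0..0} x *\<^sub>R evolution \<phi> x) \<in> borel_measurable lborel"
      using pairing_evolution(1)[OF \<phi>, of 0] by (auto simp: set_integrable_def)
    show "AE x in lborel. indicat_real {0..0} x *\<^sub>R evolution \<phi> x = 0"
      using AE_lborel_singleton[of 0] by eventually_elim auto
  qed simp
  then show ?thesis using pairing_evolution(2)[OF \<phi>, of 0] by simp
qed

definition u\<^sub>0 :: "real^3 \<Rightarrow> real \<Rightarrow> complex" where
  "u\<^sub>0 x t = Sc (parabolic_teodorescu w x t)"

lemma pairing_integrable:
  assumes \<phi>: "test_fun \<Omega> \<phi>" and t: "t \<ge> 0"
  shows "integrable lborel (\<lambda>x. \<phi> x *\<^sub>R parabolic_teodorescu w x t)"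
  by (rule test_fun_scaleR_integrable[OF \<phi> loc_integrable_L2[OF parabolic_teodorescu_pairing(1)[OF t]]])

lemma dist_of_Sc:
  assumes \<phi>: "test_fun \<Omega> \<phi>" and t: "t \<ge> 0"
  shows "dist_of \<Omega> (\<lambda>x. u\<^sub>0 x t) \<phi> = Sc (pairing \<phi> t)"
  unfolding dist_of_eq[OF \<phi>] pairing_def u\<^sub>0_def by (subst integral_Sc[OF pairing_integrable[OF \<phi> t]]) simp

lemma wgrad_u\<^sub>0:
  assumes \<phi>: "test_fun \<Omega> \<phi>" and t: "t \<ge> 0"
  shows "wgrad \<Omega> (\<lambda>y. u\<^sub>0 y t) \<phi> = (\<chi> m. - Sc (pairing (partial_deriv m \<phi>) t))"
  by (simp add: wgrad_def wpartial_def dist_of_Sc[OF test_fun_partial[OF \<phi>] t])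

lemma wgrad_u\<^sub>0_set_integrable:
  assumes \<phi>: "test_fun \<Omega> \<phi>"
  shows "set_integrable lborel {0..t} (\<lambda>s. wgrad \<Omega> (\<lambda>y. u\<^sub>0 y s) \<phi>)"
proof -
  have c: "continuous_on {0..t} (\<lambda>s. \<chi> m. - Sc (pairing (partial_deriv m \<phi>) s))"
    by (intro continuous_intros continuous_on_subset[OF continuous_on_pairing[OF test_fun_partial[OF \<phi>]]]) auto
  have "set_integrable lborel {0..t} (\<lambda>s. \<chi> m. - Sc (pairing (partial_deriv m \<phi>) s))"
    by (rule borel_integrable_atLeastAtMost'[OF c])
  also have "?this \<longleftrightarrow> ?thesis"
    by (intro set_integrable_cong) (auto simp: wgrad_u\<^sub>0[OF \<phi>])
  finally show ?thesis .
qed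

text \<open>Integration over time gains one derivative: with \<open>X = \<integral> W\<close>, Duhamel's formula bounds \<open>2 \<pi> k X\<close>,
  and hence \<open>\<bar>k\<bar> \<bar>Sc X\<bar>\<close>, by a square-integrable function. The gradient of the time integral is then the
  inverse transform of \<open>2 \<pi> i k Sc X\<close>.\<close>

lemma integral_grad_exists:
  assumes t: "t \<ge> 0"
  shows "\<exists>G. loc_integrable \<Omega> G \<and> (\<forall>\<phi>. test_fun \<Omega> \<phi> \<longrightarrow>
    dist_of \<Omega> G \<phi> = (LINT s:{0..t}|lborel. wgrad \<Omega> (\<lambda>y. u\<^sub>0 y s) \<phi>))"
proof -
  define X where "X k = (LINT r|lborel. indicator {0..t} r *\<^sub>R W r k)" for k
  have Wm: "(\<lambda>p. indicator {0..t} (fst p) *\<^sub>R W (fst p) (snd p)) \<in> borel_measurable (lborel \<Otimes>\<^sub>M lborel)"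
  proof -
    have "(\<lambda>p. indicator {0..t} (fst p) *\<^sub>R (indicator {..t} (fst p) *\<^sub>R W (fst p) (snd p))) \<in> borel_measurable (lborel \<Otimes>\<^sub>M lborel)"
      by (rule borel_measurable_scaleR[OF _ W_measurable]) measurable
    also have "(\<lambda>p. indicator {0..t} (fst p) *\<^sub>R (indicator {..t} (fst p) *\<^sub>R W (fst p) (snd p))) = (\<lambda>p. indicator {0..t} (fst p) *\<^sub>R W (fst p) (snd p))"
      by (auto simp: indicator_def)
    finally show ?thesis .
  qed
  have Wi: "integrable lborel (\<lambda>r. indicator {0..t} r *\<^sub>R W r k)" for k
  proof (rule Bochner_Integration.integrable_bound)
    show "integrable lborel (\<lambda>r. indicator {0..t} r * (C * majorant t k))"
      by (intro integrable_mult_left integrable_real_indicator) (auto simp: emeasure_lborel_Icc_eq)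
    show "(\<lambda>r. indicator {0..t} r *\<^sub>R W r k) \<in> borel_measurable lborel"
      using measurable_compose[OF _ Wm, of "\<lambda>r. (r, k)" borel] by simp
    show "AE r in lborel. norm (indicator {0..t} r *\<^sub>R W r k) \<le> norm (indicator {0..t} r * (C * majorant t k))"
      by (intro AE_I2) (auto simp: indicator_def intro!: order_trans[OF norm_W_le abs_ge_self])
  qed
  have [measurable]: "X \<in> borel_measurable borel"
  proof -
    have "(\<lambda>(k, r). indicator {0..t} r *\<^sub>R W r k) \<in> borel_measurable (lborel \<Otimes>\<^sub>M lborel)"
      using measurable_compose[OF _ Wm, of "\<lambda>q. (snd q, fst q)" "lborel \<Otimes>\<^sub>M lborel"] by (simp add: split_beta')
    then have "(\<lambda>k. LINT r|lborel. indicator {0..t} r *\<^sub>R W r k) \<in> borel_measurable lborel"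
      by (rule lborel.borel_measurable_lebesgue_integral)
    then show ?thesis by (simp add: X_def[abs_def])
  qed
  have Xb: "norm (Sc (X k)) * norm ((2 * pi) *\<^sub>R k) \<le> (C + 1) * majorant t k" for k
  proof -
    have "freq k \<star> X k = (LINT r|lborel. indicator {0..t} r *\<^sub>R (freq k \<star> W r k))"
      unfolding X_def using integral_bounded_linear[OF bmult.bounded_linear_right Wi, of "freq k" k]
      by (simp add: bmult.scaleR_right)
    then have "freq k \<star> X k = W t k - (LINT r|lborel. src_ft t r k)"
      using W_evolution[OF t, of k] by simp
    then have "norm (freq k \<star> X k) \<le> norm (W t k) + norm (LINT r|lborel. src_ft t r k)"
      by (simp only: norm_triangle_ineq4)
    also have "\<dots> \<le> C * majorant t k + majorant t k"
      unfolding majorant_def by (intro add_mono norm_W_le[OF order_refl, unfolded majorant_def] integral_norm_bound)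
    finally show ?thesis
      using norm_Sc_mult_le[of "X k" "(2 * pi) *\<^sub>R k"] by (simp add: freq_def algebra_simps)
  qed
  define H :: "real^3 \<Rightarrow> biquat" where "H k = (0, (\<i> * Sc (X k)) *s cvec ((2 * pi) *\<^sub>R k))" for k
  have nH: "norm (H k) = norm (Sc (X k)) * norm ((2 * pi) *\<^sub>R k)" for k
  proof -
    have "H k = (\<i> * Sc (X k)) *\<^sub>B (0, cvec ((2 * pi) *\<^sub>R k))" by (simp add: H_def cscale_def)
    then show ?thesis by (simp only: norm_cscale norm_mult norm_Pair norm_cvec) simp
  qed
  have [measurable]: "H \<in> borel_measurable borel"
  proof -
    have "H = (\<lambda>k. (\<i> * Sc (X k)) *\<^sub>B freq k)" by (auto simp: H_def freq_def cscale_def)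
    then show ?thesis by simp
  qed
  have HL: "L2 H"
    using L2_cmult[OF majorant_L2, of "C + 1" t]
    by (rule L2_bound) (use Xb in \<open>auto simp: nH intro: order_trans[OF _ abs_ge_self]\<close>)
  let ?G = "\<lambda>x. Vec (inv_fourier H x)"
  have GL: "L2 ?G"
    by (rule L2_bound[OF inv_fourier_L2[OF HL]])
      (use inv_fourier_L2[OF HL] norm_snd_le[of "Vec p" "Sc p" for p] in \<open>auto simp: L2_iff\<close>)
  have "dist_of \<Omega> ?G \<phi> = (LINT s:{0..t}|lborel. wgrad \<Omega> (\<lambda>y. u\<^sub>0 y s) \<phi>)" if \<phi>: "test_fun \<Omega> \<phi>" for \<phi>
  proof -
    let ?\<phi> = "ft (\<lambda>x. complex_of_real (\<phi> x))"
    have L: "L2 ?\<phi>" by (rule ft_test_fun_L2[OF \<phi>])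
    have [measurable]: "?\<phi> \<in> borel_measurable borel" using L by (simp add: L2_iff)
    have i: "integrable lborel (\<lambda>x. \<phi> x *\<^sub>R inv_fourier H x)"
      by (rule test_fun_scaleR_integrable[OF \<phi> loc_integrable_L2[OF inv_fourier_L2[OF HL]]])
    have i': "integrable lborel (\<lambda>k. ?\<phi> k *\<^sub>B H k)"
      by (rule L2_mult_integrable[OF L HL]) (auto simp: norm_cscale)
    have P: "(LINT x|lborel. \<phi> x *\<^sub>R inv_fourier H x) = (LINT k|lborel. ?\<phi> k *\<^sub>B H k)"
      using fourier_multiplication[OF test_fun_L2[OF \<phi>] HL]
      by (simp add: cscale_of_real dual_ft_integrable[OF integrable_of_real[OF test_fun_integrable[OF \<phi>]]])
    have "dist_of \<Omega> ?G \<phi> = Vec (LINT x|lborel. \<phi> x *\<^sub>R inv_fourier H x)"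
      unfolding dist_of_eq[OF \<phi>] using integral_bounded_linear[OF bounded_linear_snd i] by simp
    then have d: "dist_of \<Omega> ?G \<phi> = Vec (LINT k|lborel. ?\<phi> k *\<^sub>B H k)" unfolding P .
    have lhs: "dist_of \<Omega> ?G \<phi> $ m = (LINT k|lborel. ?\<phi> k * (\<i> * Sc (X k) * complex_of_real (2 * pi * k $ m)))" for m
      unfolding d integral_Vec[OF i'] by (simp add: H_def cvec_def mult.assoc)
    have "(LINT s:{0..t}|lborel. wgrad \<Omega> (\<lambda>y. u\<^sub>0 y s) \<phi>) $ m = (LINT k|lborel. ?\<phi> k * (\<i> * Sc (X k) * complex_of_real (2 * pi * k $ m)))" for m
    proof -
      let ?d = "ft (\<lambda>x. complex_of_real (partial_deriv m \<phi> x))"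
      have Ld: "L2 ?d" by (rule ft_test_fun_L2[OF test_fun_partial[OF \<phi>]])
      note I = W_pairing_integrable[OF Ld, of t]
      have "(LINT s:{0..t}|lborel. wgrad \<Omega> (\<lambda>y. u\<^sub>0 y s) \<phi>) $ m = (LINT s|lborel. (indicator {0..t} s *\<^sub>R wgrad \<Omega> (\<lambda>y. u\<^sub>0 y s) \<phi>) $ m)"
        unfolding set_lebesgue_integral_def
        using integral_bounded_linear[OF bounded_linear_vec_nth wgrad_u\<^sub>0_set_integrable[OF \<phi>, of t, unfolded set_integrable_def], of m] by simp
      also have "\<dots> = (LINT s|lborel. - Sc (LINT k|lborel. indicator {0..t} s *\<^sub>R (?d k *\<^sub>B W s k)))"
      proof (rule Bochner_Integration.integral_cong[OF refl])
        fix s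
        show "(indicator {0..t} s *\<^sub>R wgrad \<Omega> (\<lambda>y. u\<^sub>0 y s) \<phi>) $ m = - Sc (LINT k|lborel. indicator {0..t} s *\<^sub>R (?d k *\<^sub>B W s k))"
          by (cases "s \<in> {0..t}") (simp_all add: wgrad_u\<^sub>0[OF \<phi>] pairing_eq[OF test_fun_partial[OF \<phi>]])
      qed
      also have "\<dots> = - Sc (LINT s|lborel. (LINT k|lborel. indicator {0..t} s *\<^sub>R (?d k *\<^sub>B W s k)))"
        using integral_Sc[OF lborel_pair.integrable_fst'[OF I]] by simp
      also have "(LINT s|lborel. (LINT k|lborel. indicator {0..t} s *\<^sub>R (?d k *\<^sub>B W s k))) = (LINT k|lborel. (LINT s|lborel. indicator {0..t} s *\<^sub>R (?d k *\<^sub>B W s k)))"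
        using lborel_pair.Fubini_integral[OF I] by simp
      also have "\<dots> = (LINT k|lborel. ?d k *\<^sub>B X k)"
      proof (rule Bochner_Integration.integral_cong[OF refl])
        fix k
        show "(LINT s|lborel. indicator {0..t} s *\<^sub>R (?d k *\<^sub>B W s k)) = ?d k *\<^sub>B X k"
          unfolding X_def using integral_bounded_linear[OF cscale.bounded_linear_right Wi, of "?d k" k]
          by (simp add: cscale.scaleR_right)
      qed
      also have "- Sc (LINT k|lborel. ?d k *\<^sub>B X k) = (LINT k|lborel. - (?d k * Sc (X k)))"
      proof -
        have "integrable lborel (\<lambda>k. LINT s|lborel. indicator {0..t} s *\<^sub>R (?d k *\<^sub>B W s k))"
          using lborel_pair.integrable_fst'[OF lborel_pair.integrable_product_swap[OF I]] by simp
        moreover have "(LINT s|lborel. indicator {0..t} s *\<^sub>R (?d k *\<^sub>B W s k)) = ?d k *\<^sub>B X k" for k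
          unfolding X_def using integral_bounded_linear[OF cscale.bounded_linear_right Wi, of "?d k" k]
          by (simp add: cscale.scaleR_right)
        ultimately have "integrable lborel (\<lambda>k. ?d k *\<^sub>B X k)" by simp
        from integral_Sc[OF this] show ?thesis by simp
      qed
      also have "\<dots> = (LINT k|lborel. ?\<phi> k * (\<i> * Sc (X k) * complex_of_real (2 * pi * k $ m)))"
        unfolding ft_partial_deriv[OF \<phi>] by (simp add: mult_ac)
      finally show ?thesis .
    qed
    then show ?thesis using lhs by (simp add: vec_eq_iff)
  qed
  then show ?thesis using loc_integrable_L2[OF GL] by blast
qed

lemma integral_grad_pairing:
  assumes t: "t \<ge> 0"
  shows "loc_integrable \<Omega> (\<lambda>x. integral_grad \<Omega> u\<^sub>0 x t)"
    and "test_fun \<Omega> \<phi> \<Longrightarrow> dist_of \<Omega> (\<lambda>x. integral_grad \<Omega> u\<^sub>0 x t) \<phi> = (LINT s:{0..t}|lborel. wgrad \<Omega> (\<lambda>y. u\<^sub>0 y s) \<phi>)"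
proof -
  have "\<exists>G. loc_integrable \<Omega> G \<and>
        (\<forall>\<phi>. test_fun \<Omega> \<phi> \<longrightarrow>
           set_integrable lborel {0..t} (\<lambda>s. wgrad \<Omega> (\<lambda>y. u\<^sub>0 y s) \<phi>) \<and>
           dist_of \<Omega> G \<phi> = (LINT s:{0..t}|lborel. wgrad \<Omega> (\<lambda>y. u\<^sub>0 y s) \<phi>))"
    using integral_grad_exists[OF t] wgrad_u\<^sub>0_set_integrable by blast
  from someI_ex[OF this]
  show "loc_integrable \<Omega> (\<lambda>x. integral_grad \<Omega> u\<^sub>0 x t)"
    and "test_fun \<Omega> \<phi> \<Longrightarrow> dist_of \<Omega> (\<lambda>x. integral_grad \<Omega> u\<^sub>0 x t) \<phi> = (LINT s:{0..t}|lborel. wgrad \<Omega> (\<lambda>y. u\<^sub>0 y s) \<phi>)"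
    unfolding integral_grad_def[abs_def] by blast+
qed

end

section \<open>The fundamental lemma of the calculus of variations\<close>

text \<open>Polynomials in \<open>1 / u\<close> are included so that the class of these functions is closed under derivatives.\<close>

definition flat :: "real poly \<Rightarrow> real \<Rightarrow> real" where
  "flat p u = (if u > 0 then poly p (1 / u) * exp (- (1 / u)) else 0)"

lemma poly_exp_tendsto_0: "((\<lambda>v. poly q v * exp (- v)) \<longlongrightarrow> (0::real)) at_top"
proof -
  have "((\<lambda>v. \<Sum>i\<le>degree q. coeff q i * (v ^ i / exp v)) \<longlongrightarrow> (\<Sum>i\<le>degree q. coeff q i * 0)) at_top"
    by (intro tendsto_intros tendsto_power_div_exp_0)
  moreover have "(\<Sum>i\<le>degree q. coeff q i * (v ^ i / exp v)) = poly q v * exp (- v)" for v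
    by (simp add: poly_altdef sum_distrib_right exp_minus divide_inverse mult.assoc)
  ultimately show ?thesis by simp
qed

text \<open>With \<open>v = 1 / u\<close>, the chain rule gives the factor \<open>- v\<^sup>2\<close> and the product rule the polynomial
  \<open>pderiv p - p\<close>. At \<open>0\<close> the exponential dominates every polynomial in \<open>v\<close>.\<close>

lemma flat_has_derivative:
  "(flat p has_real_derivative flat (monom 1 2 * (p - pderiv p)) u) (at u)"
proof -
  consider "u < 0" | "u = 0" | "u > 0" by linarith
  then show ?thesis
  proof cases
    case 1
    have "((\<lambda>_. 0) has_real_derivative 0) (at u)" by simp
    then have "(flat p has_real_derivative 0) (at u)"
      by (rule has_field_derivative_transform_within_open[of _ _ _ "{..<0}"]) (use 1 in \<open>auto simp: flat_def\<close>)
    then show ?thesis using 1 by (simp add: flat_def)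
  next
    case 2
    have "((\<lambda>v. poly (pCons 0 p) v * exp (- v)) \<longlongrightarrow> 0) at_top"
      by (rule poly_exp_tendsto_0)
    from filterlim_compose[OF this filterlim_inverse_at_top_right]
    have r: "((\<lambda>h. poly (pCons 0 p) (inverse h) * exp (- inverse h)) \<longlongrightarrow> 0) (at_right 0)" .
    have "((\<lambda>h. (flat p (0 + h) - flat p 0) / h) \<longlongrightarrow> 0) (at_right 0)"
    proof (rule tendsto_cong[THEN iffD1, OF _ r])
      show "\<forall>\<^sub>F h in at_right 0. poly (pCons 0 p) (inverse h) * exp (- inverse h) = (flat p (0 + h) - flat p 0) / h"
        using eventually_at_right_less[of "0::real"] by eventually_elim (simp add: flat_def field_simps)
    qed
    moreover have "((\<lambda>h. (flat p (0 + h) - flat p 0) / h) \<longlongrightarrow> 0) (at_left 0)"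
    proof (rule tendsto_eventually)
      have "\<forall>\<^sub>F h in at_left 0. h < (0::real)" by (simp add: eventually_at_left_field) (metis zero_less_one neg_less_0_iff_less)
      then show "\<forall>\<^sub>F h in at_left 0. (flat p (0 + h) - flat p 0) / h = 0"
        by eventually_elim (simp add: flat_def)
    qed
    ultimately have "((\<lambda>h. (flat p (0 + h) - flat p 0) / h) \<longlongrightarrow> 0) (at 0)"
      by (simp add: filterlim_split_at)
    then show ?thesis using 2 by (simp add: DERIV_def flat_def)
  next
    case 3
    have "((\<lambda>u. poly p (1 / u) * exp (- (1 / u))) has_real_derivative
       (poly (pderiv p) (1 / u) * (- 1 / u\<^sup>2)) * exp (- (1 / u)) + poly p (1 / u) * (exp (- (1 / u)) * (1 / u\<^sup>2))) (at u)"
      using 3 by (auto intro!: derivative_eq_intros DERIV_chain'[OF _ poly_DERIV, THEN DERIV_cong] simp: power2_eq_square)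
    then have "(flat p has_real_derivative
       (poly (pderiv p) (1 / u) * (- 1 / u\<^sup>2)) * exp (- (1 / u)) + poly p (1 / u) * (exp (- (1 / u)) * (1 / u\<^sup>2))) (at u)"
      by (rule has_field_derivative_transform_within_open[of _ _ _ "{0<..}"]) (use 3 in \<open>auto simp: flat_def\<close>)
    moreover have "(poly (pderiv p) (1 / u) * (- 1 / u\<^sup>2)) * exp (- (1 / u)) + poly p (1 / u) * (exp (- (1 / u)) * (1 / u\<^sup>2))
       = flat (monom 1 2 * (p - pderiv p)) u"
      using 3 by (simp add: flat_def poly_monom power_divide algebra_simps diff_divide_distrib)
    ultimately show ?thesis by simp
  qed
qed

text \<open>This class contains the functions \<open>bump\<close> and is closed under partial derivatives, so that its elements are
  smooth (\<open>flat_product_Ck\<close>).\<close>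

inductive flat_product :: "(real^3 \<Rightarrow> real) \<Rightarrow> bool" where
  flat: "flat_product (\<lambda>x. flat p (c * x $ m + d))"
| const: "flat_product (\<lambda>_. c)"
| add: "flat_product f \<Longrightarrow> flat_product g \<Longrightarrow> flat_product (\<lambda>x. f x + g x)"
| mult: "flat_product f \<Longrightarrow> flat_product g \<Longrightarrow> flat_product (\<lambda>x. f x * g x)"

lemma partial_deriv_eqI:
  assumes "(f has_derivative D) (at x)"
  shows "partial_deriv m f x = D (axis m 1)"
  unfolding partial_deriv_def using frechet_derivative_at[OF assms] by simp

lemma flat_product_partial:
  assumes "flat_product f"
  shows "(\<forall>x. f differentiable (at x)) \<and> (\<forall>m. flat_product (partial_deriv m f))"
  using assms
proof induction
  case (flat p c n d)
  let ?q = "monom 1 2 * (p - pderiv p)"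
  have D: "((\<lambda>x. flat p (c * x $ n + d)) has_derivative (\<lambda>h. flat ?q (c * x $ n + d) * (c * h $ n))) (at x)" for x :: "real^3"
  proof -
    have 1: "((\<lambda>x::real^3. c * x $ n + d) has_derivative (\<lambda>h. c * h $ n)) (at x)"
      by (auto intro!: derivative_eq_intros bounded_linear.has_derivative[OF bounded_linear_vec_nth])
    have 2: "(flat p has_derivative (\<lambda>h. flat ?q (c * x $ n + d) * h)) (at (c * x $ n + d))"
      using flat_has_derivative by (simp add: has_field_derivative_def)
    show ?thesis using diff_chain_at[OF 1 2] by (simp add: o_def)
  qed
  have "partial_deriv m (\<lambda>x. flat p (c * x $ n + d)) = (\<lambda>x. (if m = n then c else 0) * flat ?q (c * x $ n + d))" for m
    using partial_deriv_eqI[OF D] by (auto simp: fun_eq_iff axis_def)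
  then show ?case using D by (auto simp: differentiable_def intro: flat_product.intros)
next
  case (const c)
  have "partial_deriv m (\<lambda>_. c) = (\<lambda>_. 0)" for m
    using partial_deriv_eqI[OF has_derivative_const] by (auto simp: fun_eq_iff)
  then show ?case by (auto intro: flat_product.const)
next
  case (add f g)
  have "partial_deriv m (\<lambda>x. f x + g x) x = partial_deriv m f x + partial_deriv m g x" for m x
  proof -
    have "(f has_derivative frechet_derivative f (at x)) (at x)" "(g has_derivative frechet_derivative g (at x)) (at x)"
      using add.IH frechet_derivative_works by blast+
    from partial_deriv_eqI[OF has_derivative_add[OF this]] show ?thesis by (simp add: partial_deriv_def)
  qed
  then have "partial_deriv m (\<lambda>x. f x + g x) = (\<lambda>x. partial_deriv m f x + partial_deriv m g x)" for m
    by (simp add: fun_eq_iff)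
  then show ?case using add by (auto intro: flat_product.add differentiable_add)
next
  case (mult f g)
  have "partial_deriv m (\<lambda>x. f x * g x) x = f x * partial_deriv m g x + partial_deriv m f x * g x" for m x
  proof -
    have "(f has_derivative frechet_derivative f (at x)) (at x)" "(g has_derivative frechet_derivative g (at x)) (at x)"
      using mult.IH frechet_derivative_works by blast+
    from partial_deriv_eqI[OF has_derivative_mult[OF this]] show ?thesis by (simp add: partial_deriv_def)
  qed
  then have "partial_deriv m (\<lambda>x. f x * g x) = (\<lambda>x. f x * partial_deriv m g x + partial_deriv m f x * g x)" for m
    by (simp add: fun_eq_iff)
  moreover have "flat_product (\<lambda>x. f x * partial_deriv m g x + partial_deriv m f x * g x)" for m
    by (intro flat_product.add flat_product.mult) (use mult in auto)
  ultimately show ?case using mult by (auto intro: differentiable_mult)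
qed

lemma flat_product_Ck: "flat_product f \<Longrightarrow> Ck n f"
proof (induction n arbitrary: f)
  case 0
  then show ?case
    using flat_product_partial[OF 0] by (auto simp: continuous_on_eq_continuous_at differentiable_imp_continuous_within)
next
  case (Suc n)
  then show ?case
    using flat_product_partial[OF Suc.prems] by (auto simp: differentiable_on_def)
qed

lemma flat_product_prod:
  assumes "finite I" "\<And>i. i \<in> I \<Longrightarrow> flat_product (f i)"
  shows "flat_product (\<lambda>x. \<Prod>i\<in>I. f i x)"
  using assms by (induction I rule: finite_induct) (auto intro: flat_product.intros)

text \<open>The factor \<open>Suc n\<close> steepens the flanks \<open>exp (- 1 / u)\<close>, so that the functions tend to the indicator function
  of the open box.\<close>

definition bump :: "real^3 \<Rightarrow> real^3 \<Rightarrow> nat \<Rightarrow> real^3 \<Rightarrow> real" where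
  "bump a b n x = (\<Prod>m\<in>UNIV. flat 1 (real (Suc n) * (x $ m - a $ m)) * flat 1 (real (Suc n) * (b $ m - x $ m)))"

lemma bump_flat_product: "flat_product (bump a b n)"
proof -
  have "flat_product (\<lambda>x. \<Prod>m\<in>UNIV. flat 1 (real (Suc n) * x $ m + (- real (Suc n) * a $ m)) * flat 1 ((- real (Suc n)) * x $ m + real (Suc n) * b $ m))"
    by (intro flat_product_prod flat_product.mult flat_product.flat) simp
  then show ?thesis by (simp add: bump_def[abs_def] algebra_simps)
qed

lemma flat_1_bounds: "0 \<le> flat 1 u" "flat 1 u \<le> 1" "flat 1 u = 0 \<longleftrightarrow> u \<le> 0"
  by (auto simp: flat_def)

lemma bump_bounds: "0 \<le> bump a b n x" "bump a b n x \<le> 1"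
  unfolding bump_def by (auto intro!: prod_nonneg prod_le_1 mult_le_one simp: flat_1_bounds)

lemma bump_eq_0_iff: "bump a b n x = 0 \<longleftrightarrow> x \<notin> box a b"
  by (auto simp: bump_def flat_1_bounds mem_box_cart not_less mult_le_0_iff)

lemma bump_tendsto: "(\<lambda>n. bump a b n x) \<longlonglongrightarrow> indicator (box a b) x"
proof (cases "x \<in> box a b")
  case True
  have f: "(\<lambda>n. flat 1 (real (Suc n) * d)) \<longlonglongrightarrow> 1" if "d > 0" for d
  proof -
    have "(\<lambda>n. exp (- (inverse (real (Suc n)) * (1 / d)))) \<longlonglongrightarrow> exp (- (0 * (1 / d)))"
      by (intro tendsto_intros LIMSEQ_inverse_real_of_nat)
    then show ?thesis using that by (simp add: flat_def divide_inverse)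
  qed
  have "(\<lambda>n. bump a b n x) \<longlonglongrightarrow> (\<Prod>m\<in>(UNIV::3 set). 1 * 1)"
    unfolding bump_def using True by (intro tendsto_intros f) (auto simp: mem_box_cart)
  then show ?thesis using True by simp
next
  case False
  then show ?thesis using bump_eq_0_iff[of a b _ x] by simp
qed

lemma bump_test_fun:
  assumes "cbox a b \<subseteq> \<Omega>" shows "test_fun \<Omega> (bump a b n)"
proof -
  have s: "closure {x. bump a b n x \<noteq> 0} \<subseteq> cbox a b"
    by (rule closure_minimal) (use box_subset_cbox in \<open>auto simp: bump_eq_0_iff\<close>)
  have "compact (cbox a b \<inter> closure {x. bump a b n x \<noteq> 0})"
    by (intro compact_Int_closed) auto
  then have "compact (closure {x. bump a b n x \<noteq> 0})" using s by (simp add: Int_absorb1)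
  then show ?thesis
    using s assms flat_product_Ck[OF bump_flat_product] by (auto simp: test_fun_def)
qed

lemma dist_of_zero_box:
  fixes h :: "real^3 \<Rightarrow> 'b::euclidean_space"
  assumes h: "loc_integrable \<Omega> h" and z: "\<And>\<phi>. test_fun \<Omega> \<phi> \<Longrightarrow> dist_of \<Omega> h \<phi> = 0" and ab: "cbox a b \<subseteq> \<Omega>"
  shows "(LINT x|lborel. indicator (box a b) x *\<^sub>R h x) = 0"
proof -
  let ?g = "\<lambda>x. indicator (cbox a b) x *\<^sub>R h x"
  have g: "integrable lborel ?g"
    using h ab by (auto simp: loc_integrable_def set_integrable_def)
  have [measurable]: "?g \<in> borel_measurable borel" using g by auto
  have [measurable]: "bump a b n \<in> borel_measurable borel" for n
    by (rule test_fun_measurable[OF bump_test_fun[OF ab]])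
  have lim: "(\<lambda>n. LINT x|lborel. bump a b n x *\<^sub>R ?g x) \<longlonglongrightarrow> (LINT x|lborel. indicator (box a b) x *\<^sub>R ?g x)"
  proof (rule integral_dominated_convergence[where w = "\<lambda>x. norm (?g x)"])
    show "integrable lborel (\<lambda>x. norm (?g x))" using g by (rule integrable_norm)
    show "AE x in lborel. (\<lambda>n. bump a b n x *\<^sub>R ?g x) \<longlonglongrightarrow> indicator (box a b) x *\<^sub>R ?g x"
      by (intro AE_I2 tendsto_intros bump_tendsto)
    show "AE x in lborel. norm (bump a b n x *\<^sub>R ?g x) \<le> norm (?g x)" for n
    proof (intro AE_I2)
      fix x
      have "norm (bump a b n x *\<^sub>R ?g x) = bump a b n x * norm (?g x)"
        by (simp only: norm_scaleR real_norm_def abs_of_nonneg[OF bump_bounds(1)])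
      also have "\<dots> \<le> norm (?g x)"
        by (rule mult_left_le_one_le[OF norm_ge_zero bump_bounds])
      finally show "norm (bump a b n x *\<^sub>R ?g x) \<le> norm (?g x)" .
    qed
    show "(\<lambda>x. indicator (box a b) x *\<^sub>R ?g x) \<in> borel_measurable lborel"
      by (rule borel_measurable_scaleR) (auto simp: borel_measurable_indicator_iff)
  qed measurable
  have zero: "(LINT x|lborel. bump a b n x *\<^sub>R ?g x) = 0" for n
  proof -
    have "bump a b n x *\<^sub>R ?g x = bump a b n x *\<^sub>R h x" for x
      using bump_eq_0_iff[of a b n x] box_subset_cbox[of a b] by (cases "x \<in> cbox a b") auto
    then show ?thesis
      using z[OF bump_test_fun[OF ab], of n] dist_of_eq[OF bump_test_fun[OF ab], of h n] by (simp only:)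
  qed
  have eq: "indicator (box a b) x *\<^sub>R ?g x = indicator (box a b) x *\<^sub>R h x" for x
    using box_subset_cbox[of a b] by (auto simp: indicator_def)
  show ?thesis
    using LIMSEQ_unique[OF lim[unfolded zero eq] tendsto_const] .
qed

text \<open>By \<open>dist_of_zero_box\<close> the integrals of \<open>h\<close> over boxes vanish. Boxes are stable under intersection and
  generate the Borel sets, so the same holds for all Borel subsets of a box in \<open>\<Omega>\<close>, and \<open>h\<close> vanishes
  almost everywhere on it. Countably many boxes cover \<open>\<Omega>\<close>.\<close>

lemma dist_of_zero_imp_AE:
  fixes h :: "real^3 \<Rightarrow> 'b::euclidean_space"
  assumes \<Omega>: "open \<Omega>" and h: "loc_integrable \<Omega> h" and z: "\<And>\<phi>. test_fun \<Omega> \<phi> \<Longrightarrow> dist_of \<Omega> h \<phi> = 0"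
  shows "AE x in lborel. x \<in> \<Omega> \<longrightarrow> h x = 0"
proof -
  have box: "AE x in lborel. x \<in> box a b \<longrightarrow> h x = 0" if ab: "cbox a b \<subseteq> \<Omega>" for a b
  proof -
    let ?f = "\<lambda>x. indicator (box a b) x *\<^sub>R h x"
    have "integrable lborel (\<lambda>x. indicator (box a b) x *\<^sub>R (indicator (cbox a b) x *\<^sub>R h x))"
      using h ab by (intro integrable_mult_indicator[where A = "box a b"]) (auto simp: loc_integrable_def set_integrable_def)
    also have "(\<lambda>x. indicator (box a b) x *\<^sub>R (indicator (cbox a b) x *\<^sub>R h x)) = ?f"
      using box_subset_cbox[of a b] by (auto simp: indicator_def fun_eq_iff)
    finally have f: "integrable lborel ?f" .
    have f0: "integral\<^sup>L lborel ?f = 0" by (rule dist_of_zero_box[OF h z ab])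
    have "(LINT x:A|lborel. ?f x) = 0" if "A \<in> sets lborel" for A
    proof -
      let ?G = "range (\<lambda>(c, d). box c d :: (real^3) set)"
      have A: "A \<in> sigma_sets UNIV ?G"
        using that by (simp add: borel_eq_box)
      have Bs: "B \<in> sets borel" if "B \<in> sigma_sets UNIV ?G" for B
        using that by (simp add: borel_eq_box)
      have "Int_stable ?G"
      proof (rule Int_stableI)
        fix X Y assume "X \<in> ?G" "Y \<in> ?G"
        then obtain c d e g where XY: "X = box c d" "Y = box e g" by auto
        obtain p q where "box c d \<inter> box e g = box p q" using box_Int_box by blast
        then show "X \<inter> Y \<in> ?G"
          using image_eqI[of "X \<inter> Y" "\<lambda>(c, d). box c d" "(p, q)" UNIV] XY by simp
      qed
      from this subset_UNIV[of ?G, unfolded Pow_UNIV[symmetric]] A show ?thesis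
      proof (induction rule: sigma_sets_induct_disjoint)
        case (basic B)
        then obtain c d where B: "B = box c d" by auto
        obtain e g where eg: "box c d \<inter> box a b = box e g" using box_Int_box by blast
        have "(LINT x:B|lborel. ?f x) = (LINT x|lborel. indicator (box e g) x *\<^sub>R h x)"
          unfolding set_lebesgue_integral_def B eg[symmetric] by (intro Bochner_Integration.integral_cong) (auto simp: indicator_def)
        also have "\<dots> = 0"
        proof (cases "box e g = {}")
          case False
          have sub: "box e g \<subseteq> box a b" using eg by auto
          then have ne: "box a b \<noteq> {}" using False by blast
          have "cbox e g \<subseteq> cbox a b"
            using closure_mono[OF sub] unfolding closure_box[OF False] closure_box[OF ne] .
          then show ?thesis by (intro dist_of_zero_box[OF h z]) (use ab in auto)
        qed simp
        finally show ?case .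
      next
        case (compl B)
        have "indicator (UNIV - B) x *\<^sub>R ?f x = ?f x - indicator B x *\<^sub>R ?f x" for x
          by (auto simp: indicator_def)
        moreover have "integrable lborel (\<lambda>x. indicator B x *\<^sub>R ?f x)"
          by (intro integrable_mult_indicator f) (use Bs[OF compl.hyps] in simp)
        ultimately show ?case
          using compl.IH f f0 unfolding set_lebesgue_integral_def by (simp only: Bochner_Integration.integral_diff) simp
      next
        case (union F)
        have Fb: "F i \<in> sets lborel" for i using Bs union.hyps(2) by auto
        have "(LINT x:(\<Union>i. F i)|lborel. ?f x) = (\<Sum>i. (LINT x:(F i)|lborel. ?f x))"
        proof (rule lebesgue_integral_countable_add)
          show "set_integrable lborel (\<Union>i. F i) ?f"
            unfolding set_integrable_def by (intro integrable_mult_indicator f sets.countable_UN) (use Fb in auto)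
        qed (use Fb union.hyps(1) in \<open>auto simp: disjoint_family_on_def\<close>)
        then show ?case using union.IH by simp
      qed (simp add: set_lebesgue_integral_def)
    qed
    from sigma_finite_measure.density_zero[OF lborel.sigma_finite_measure_axioms f this] have "AE x in lborel. ?f x = 0" .
    then show ?thesis by eventually_elim (auto simp: indicator_def split: if_splits)
  qed
  obtain D where D: "countable D" "D \<subseteq> Pow \<Omega>" "\<And>X. X \<in> D \<Longrightarrow> \<exists>a b. X = cbox a b" "\<Union>D = \<Omega>"
    using open_countable_Union_open_cbox[OF \<Omega>] by blast
  have "AE x in lborel. \<forall>X\<in>D. x \<in> X \<longrightarrow> h x = 0"
  proof (subst AE_ball_countable[OF D(1)], intro ballI)
    fix X assume X: "X \<in> D"
    then obtain a b where ab: "X = cbox a b" using D(3) by blast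
    have "cbox a b - box a b \<in> null_sets lborel"
      using negligible_frontier_interval[of a b] by (subst null_sets_completion_iff[symmetric]) (auto simp: negligible_iff_null_sets)
    from AE_not_in[OF this] have n: "AE x in lborel. x \<notin> cbox a b - box a b" .
    have "cbox a b \<subseteq> \<Omega>" using D(2) X unfolding ab by auto
    from n box[OF this] show "AE x in lborel. x \<in> X \<longrightarrow> h x = 0"
      unfolding ab by eventually_elim auto
  qed
  then show ?thesis by eventually_elim (use D(4) in auto)
qed

section \<open>The Teodorescu transform of a scalar function\<close>

lemma power_integrable: "integrable lborel (\<lambda>t::real. indicator {-R..R} t * \<bar>t\<bar> powr (-2/3))"
proof (cases "R \<ge> 0")
  case True
  have "((\<lambda>x. x powr (-2/3)) has_integral (R powr (-2/3 + 1) / (-2/3 + 1))) {0..R}"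
    by (rule has_integral_powr_from_0) (use True in auto)
  then have "(\<lambda>x. x powr (-2/3)) absolutely_integrable_on {0..R}"
    by (intro nonnegative_absolutely_integrable_1) (auto simp: integrable_on_def)
  then have "integrable lebesgue (\<lambda>x. indicator {0..R} x *\<^sub>R x powr (-2/3))"
    by (simp add: set_integrable_def)
  then have i: "integrable lborel (\<lambda>x. indicator {0..R} x *\<^sub>R x powr (-2/3))"
    by (subst (asm) integrable_completion) auto
  have "integrable lborel (\<lambda>x. indicator {0..R} (- x) *\<^sub>R (- x) powr (-2/3))"
    using lborel_integrable_real_affine_iff[of "-1" "\<lambda>x. indicator {0..R} x *\<^sub>R x powr (-2/3)" 0] i by simp
  with i have "integrable lborel (\<lambda>x. indicator {0..R} x *\<^sub>R x powr (-2/3) + indicator {0..R} (- x) *\<^sub>R (- x) powr (-2/3))"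
    by (rule Bochner_Integration.integrable_add)
  also have "(\<lambda>x. indicator {0..R} x *\<^sub>R x powr (-2/3) + indicator {0..R} (- x) *\<^sub>R (- x) powr (-2/3)) = (\<lambda>t. indicator {-R..R} t * \<bar>t\<bar> powr (-2/3))"
    by (auto simp: indicator_def fun_eq_iff)
  finally show ?thesis .
next
  case False
  then have "{-R..R} = {}" by auto
  then show ?thesis by simp
qed

text \<open>The cut-off to a cube makes the function a bound for kernels on bounded sets.\<close>

definition inv_square :: "real \<Rightarrow> real^3 \<Rightarrow> real" where
  "inv_square R z = (if \<forall>m. \<bar>z $ m\<bar> \<le> R then 1 / (norm z)\<^sup>2 else 0)"

lemma inv_square_measurable[measurable]: "inv_square R \<in> borel_measurable borel"
  unfolding inv_square_def by measurable

lemma inv_square_nonneg: "inv_square R z \<ge> 0"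
  by (simp add: inv_square_def)

lemma prod_UNIV_3: "(\<Prod>m\<in>(UNIV::3 set). f m) = f 1 * f 2 * f 3" for f :: "3 \<Rightarrow> real"
  unfolding UNIV_3 by (simp add: ac_simps)

lemma Basis_prod_3: "(\<Prod>b\<in>(Basis :: (real^3) set). g (z \<bullet> b)) = (\<Prod>m\<in>UNIV. g (z $ m))"
proof -
  have B: "(Basis :: (real^3) set) = range (\<lambda>m. axis m 1)" by (auto simp: Basis_vec_def)
  have "inj (\<lambda>m::3. axis m (1::real))" by (auto simp: inj_on_def axis_eq_axis)
  then show ?thesis unfolding B by (simp add: prod.reindex inner_axis)
qed

text \<open>Each factor of \<open>\<bar>z\<bar>\<^sup>2 = \<Prod>\<^sub>m \<bar>z\<bar>\<^bsup>2/3\<^esup>\<close> is at least \<open>\<bar>z\<^sub>m\<bar>\<^bsup>2/3\<^esup>\<close>, which separates the variables.\<close>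

lemma inv_square_integrable: "integrable lborel (inv_square R)"
proof (rule Bochner_Integration.integrable_bound)
  let ?g = "\<lambda>t::real. indicator {-R..R} t * \<bar>t\<bar> powr (-2/3)"
  have "integrable lborel (\<lambda>z::real^3. \<Prod>b\<in>Basis. ?g (z \<bullet> b))"
    by (rule integrable_prod_Basis) (rule power_integrable)
  then show "integrable lborel (\<lambda>z::real^3. \<Prod>m\<in>UNIV. ?g (z $ m))" by (simp only: Basis_prod_3[of ?g])
  have "AE z::real^3 in lborel. z \<bullet> b \<noteq> 0" if b: "b \<in> Basis" for b
  proof -
    have "negligible {z. b \<bullet> z = 0}" using b by (intro negligible_hyperplane) auto
    then have "{z. b \<bullet> z = 0} \<in> null_sets lborel"
      by (subst null_sets_completion_iff[symmetric]) (auto simp: negligible_iff_null_sets)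
    from AE_not_in[OF this] show ?thesis by eventually_elim (simp add: inner_commute)
  qed
  then have "AE z::real^3 in lborel. \<forall>b\<in>Basis. z \<bullet> b \<noteq> 0"
    by (subst AE_ball_countable) (auto intro: countable_finite)
  then show "AE z in lborel. norm (inv_square R z) \<le> norm (\<Prod>m\<in>UNIV. ?g (z $ m))"
  proof eventually_elim
    case (elim z)
    have z: "z $ m \<noteq> 0" for m using elim[rule_format, of "axis m 1"] by (simp add: inner_axis)
    show ?case
    proof (cases "\<forall>m. \<bar>z $ m\<bar> \<le> R")
      case True
      have z0: "norm z > 0" using z[of 1] by auto
      have p: "norm z powr (-2/3) \<le> \<bar>z $ m\<bar> powr (-2/3)" for m
        using component_le_norm_cart[of z m] z[of m] by (intro powr_mono2') auto
      have "1 / (norm z)\<^sup>2 = norm z powr (-2/3) * norm z powr (-2/3) * norm z powr (-2/3)"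
        using z0 by (simp add: powr_add[symmetric] powr_minus_divide)
      also have "\<dots> \<le> \<bar>z $ 1\<bar> powr (-2/3) * \<bar>z $ 2\<bar> powr (-2/3) * \<bar>z $ 3\<bar> powr (-2/3)"
        by (intro mult_mono p) auto
      also have "\<dots> = (\<Prod>m\<in>UNIV. ?g (z $ m))"
        using True by (simp add: prod_UNIV_3 indicator_def abs_le_iff minus_le_iff)
      finally have "1 / (norm z)\<^sup>2 \<le> (\<Prod>m\<in>UNIV. ?g (z $ m))" .
      then show ?thesis using True by (simp add: inv_square_def)
    next
      case False
      then have "inv_square R z = 0" by (auto simp: inv_square_def)
      then show ?thesis by simp
    qed
  qed
qed measurable

text \<open>The second moment of the Gaussian, rescaled by \<open>r\<close>.\<close>

lemma gaussian_subordination: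
  fixes r :: real assumes "r > 0"
  shows "has_bochner_integral lborel (\<lambda>l. indicator {0..} l * (l\<^sup>2 * exp (- l\<^sup>2 * r\<^sup>2))) (sqrt pi / (4 * r ^ 3))"
proof -
  have "has_bochner_integral lborel (\<lambda>x::real. indicator {0..} x *\<^sub>R (exp (-x\<^sup>2)*x^(2 * 1))) ((sqrt pi / 2) * (fact (2 * 1) / (2 ^ (2 * 1) * fact 1)))"
    by (rule gaussian_moment_even_pos)
  then have g: "integrable lborel (\<lambda>x::real. indicator {0..} x *\<^sub>R (exp (-x\<^sup>2)*x\<^sup>2))" "(LINT x|lborel. indicator {0..} x *\<^sub>R (exp (-x\<^sup>2)*x\<^sup>2)) = sqrt pi / 4"
    by (simp_all add: has_bochner_integral_iff)
  have eq: "indicator {0..} (0 + r * l) *\<^sub>R (exp (-(0 + r * l)\<^sup>2)*(0 + r * l)\<^sup>2) = r\<^sup>2 * (indicator {0..} l * (l\<^sup>2 * exp (- l\<^sup>2 * r\<^sup>2)))" for l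
    using assms by (auto simp: indicator_def zero_le_mult_iff power_mult_distrib mult_ac)
  have "integrable lborel (\<lambda>l. r\<^sup>2 * (indicator {0..} l * (l\<^sup>2 * exp (- l\<^sup>2 * r\<^sup>2))))"
    using lborel_integrable_real_affine_iff[of r "\<lambda>x::real. indicator {0..} x *\<^sub>R (exp (-x\<^sup>2)*x\<^sup>2)" 0] g(1) assms unfolding eq by simp
  then have i: "integrable lborel (\<lambda>l. indicator {0..} l * (l\<^sup>2 * exp (- l\<^sup>2 * r\<^sup>2)))"
    using assms integrable_scaleR_iff[of "r\<^sup>2" lborel "\<lambda>l. indicator {0..} l * (l\<^sup>2 * exp (- l\<^sup>2 * r\<^sup>2))"] by simp
  have "sqrt pi / 4 = \<bar>r\<bar> *\<^sub>R (LINT l|lborel. r\<^sup>2 * (indicator {0..} l * (l\<^sup>2 * exp (- l\<^sup>2 * r\<^sup>2))))"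
    using lborel_integral_real_affine[of r "\<lambda>x::real. indicator {0..} x *\<^sub>R (exp (-x\<^sup>2)*x\<^sup>2)" 0] g(2) assms unfolding eq by simp
  also have "\<dots> = r ^ 3 * (LINT l|lborel. indicator {0..} l * (l\<^sup>2 * exp (- l\<^sup>2 * r\<^sup>2)))"
    using assms i by (simp only: integral_mult_right_zero) (simp add: power2_eq_square power3_eq_cube)
  finally show ?thesis using i assms by (simp add: has_bochner_integral_iff field_simps)
qed

definition gaussian :: "real \<Rightarrow> real^3 \<Rightarrow> real" where
  "gaussian l z = exp (- l\<^sup>2 * (norm z)\<^sup>2)"

lemma gaussian_has_vector_derivative:
  "((\<lambda>t. gaussian l (z + t *\<^sub>R axis m 1)) has_vector_derivative (- 2 * l\<^sup>2 * z $ m * gaussian l z)) (at 0)"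
proof -
  have n: "(norm (z + t *\<^sub>R axis m 1))\<^sup>2 = (norm z)\<^sup>2 + 2 * t * z $ m + t\<^sup>2" for t
    unfolding power2_norm_eq_inner by (simp add: inner_add_left inner_add_right inner_axis inner_axis' power2_eq_square algebra_simps)
  have "((\<lambda>t. exp (- l\<^sup>2 * ((norm z)\<^sup>2 + 2 * t * z $ m + t\<^sup>2))) has_real_derivative (- 2 * l\<^sup>2 * z $ m * gaussian l z)) (at 0)"
    by (auto intro!: derivative_eq_intros simp: gaussian_def)
  then show ?thesis
    unfolding gaussian_def n by (simp add: has_real_derivative_iff_has_vector_derivative gaussian_def)
qed

lemma gaussian_continuous: "continuous_on A (gaussian l)"
  unfolding gaussian_def by (intro continuous_intros)

lemma compact_translation: "compact K \<Longrightarrow> compact ((\<lambda>x. x - y) ` K)" for y :: "real^3"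
  by (intro compact_continuous_image continuous_intros)

lemma continuous_shift: "continuous_on UNIV f \<Longrightarrow> continuous_on A (\<lambda>z. f (y + z))" for y :: "real^3"
  by (erule continuous_on_compose2) (auto intro!: continuous_intros)

lemma test_fun_shift_zero:
  assumes "test_fun A \<phi>" "z \<notin> (\<lambda>x. x - y) ` closure {x. \<phi> x \<noteq> 0}"
  shows "\<phi> (y + z) = 0"
proof (rule test_fun_zero[OF assms(1)])
  show "y + z \<notin> closure {x. \<phi> x \<noteq> 0}" using assms(2) by (force simp: image_iff)
qed

lemma gaussian_by_parts:
  assumes \<phi>: "test_fun A \<phi>"
  shows "(LINT z|lborel. z $ n * gaussian l z * partial_deriv m \<phi> (y + z))
    = (LINT z|lborel. (2 * l\<^sup>2 * z $ n * z $ m - (if m = n then 1 else 0)) * gaussian l z * \<phi> (y + z))"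
proof -
  let ?K = "(\<lambda>x. x - y) ` closure {x. \<phi> x \<noteq> 0}"
  let ?K' = "(\<lambda>x. x - y) ` closure {x. partial_deriv m \<phi> x \<noteq> 0}"
  have K: "compact ?K" using \<phi> by (intro compact_translation) (simp add: test_fun_def)
  have K': "compact ?K'" using test_fun_partial[OF \<phi>] by (intro compact_translation) (simp add: test_fun_def)
  note c = continuous_shift[OF test_fun_continuous[OF \<phi>]] continuous_shift[OF test_fun_continuous[OF test_fun_partial[OF \<phi>]]]
  let ?g = "\<lambda>z. z $ n * gaussian l z * \<phi> (y + z)"
  let ?a = "\<lambda>z. z $ n * gaussian l z * partial_deriv m \<phi> (y + z)"
  let ?b = "\<lambda>z. (2 * l\<^sup>2 * z $ n * z $ m - (if m = n then 1 else 0)) * gaussian l z * \<phi> (y + z)"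
  have "(LINT z|lborel. ?a z - ?b z) = 0"
  proof (rule integral_directional_derivative(2)[where g = ?g and v = "axis m 1", OF _ _ _ K])
    fix z :: "real^3"
    have 1: "((\<lambda>t. \<phi> (y + (z + t *\<^sub>R axis m 1))) has_real_derivative partial_deriv m \<phi> (y + z)) (at 0)"
      using test_fun_directional[OF \<phi>, of "y + z" m] by (simp add: has_real_derivative_iff_has_vector_derivative add.assoc)
    have 2: "((\<lambda>t. gaussian l (z + t *\<^sub>R axis m 1)) has_real_derivative (- 2 * l\<^sup>2 * z $ m * gaussian l z)) (at 0)"
      using gaussian_has_vector_derivative[of l z m] by (simp add: has_real_derivative_iff_has_vector_derivative)
    have 3: "((\<lambda>t. (z + t *\<^sub>R axis m 1) $ n) has_real_derivative (if m = n then 1 else 0)) (at 0)"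
      by (auto intro!: derivative_eq_intros simp: axis_def)
    have "((\<lambda>t. (z + t *\<^sub>R axis m 1) $ n * gaussian l (z + t *\<^sub>R axis m 1) * \<phi> (y + (z + t *\<^sub>R axis m 1)))
      has_real_derivative (?a z - ?b z)) (at 0)"
      by (rule DERIV_cong[OF DERIV_mult[OF DERIV_mult[OF 3 2] 1]]) (simp add: algebra_simps)
    then show "((\<lambda>t. ?g (z + t *\<^sub>R axis m 1)) has_vector_derivative (?a z - ?b z)) (at 0)"
      by (simp add: has_real_derivative_iff_has_vector_derivative)
  next
    show "continuous_on UNIV ?g" by (intro continuous_intros gaussian_continuous c)
    show "continuous_on UNIV (\<lambda>z. ?a z - ?b z)" by (intro continuous_intros gaussian_continuous c)
  qed (subst test_fun_shift_zero[OF \<phi>], assumption, simp)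
  moreover have "integrable lborel ?a"
    by (rule integrable_compact_support[OF K'])
      (intro continuous_intros gaussian_continuous c, subst test_fun_shift_zero[OF test_fun_partial[OF \<phi>]], assumption, simp)
  moreover have "integrable lborel ?b"
    by (rule integrable_compact_support[OF K])
      (intro continuous_intros gaussian_continuous c, subst test_fun_shift_zero[OF \<phi>], assumption, simp)
  ultimately show ?thesis by simp
qed

text \<open>The normalisation that makes \<open>l\<^sup>3 exp (- l\<^sup>2 \<bar>z\<bar>\<^sup>2)\<close> an approximate identity as \<open>l\<close> tends to infinity.\<close>

lemma gauss_eq_gaussian:
  assumes "l > 0"
  shows "pi powr (3/2) * gauss (sqrt 2 * l) z = l ^ 3 * gaussian l z"
proof -
  have "gauss (sqrt 2 * l) z = (\<Prod>m\<in>UNIV. (sqrt 2 * l) * std_normal_density ((sqrt 2 * l) * (z $ m)))"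
    unfolding gauss_def by (rule Basis_prod_3)
  also have "\<dots> = (\<Prod>m\<in>UNIV. (l / sqrt pi) * exp (- (l\<^sup>2 * (z $ m)\<^sup>2)))"
  proof (rule prod.cong[OF refl])
    fix m :: 3
    have "sqrt (2 * pi) = sqrt 2 * sqrt pi" by (rule real_sqrt_mult)
    then show "(sqrt 2 * l) * std_normal_density ((sqrt 2 * l) * (z $ m)) = (l / sqrt pi) * exp (- (l\<^sup>2 * (z $ m)\<^sup>2))"
      by (simp add: normal_density_def power_mult_distrib)
  qed
  also have "\<dots> = (l / sqrt pi) ^ 3 * exp (\<Sum>m\<in>UNIV. - (l\<^sup>2 * (z $ m)\<^sup>2))"
    by (simp add: prod.distrib exp_sum del: times_divide_eq_left)
  also have "(\<Sum>m\<in>UNIV. - (l\<^sup>2 * (z $ m)\<^sup>2)) = - l\<^sup>2 * (norm z)\<^sup>2"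
    by (simp add: norm_vec_def L2_set_def sum_nonneg sum_distrib_left sum_negf)
  finally have "gauss (sqrt 2 * l) z = (l / sqrt pi) ^ 3 * gaussian l z" by (simp add: gaussian_def)
  moreover have "pi powr (3/2) = sqrt pi ^ 3"
    by (simp add: powr_half_sqrt[symmetric] powr_realpow[symmetric] powr_powr)
  ultimately show ?thesis by (simp add: power_divide)
qed

text \<open>Up to the factor \<open>- 1 / (4 \<pi>)\<close>, the pairing of the \<open>n\<close>-th component of the Cauchy kernel with pole \<open>y\<close> and
  the \<open>m\<close>-th derivative of \<open>\<phi>\<close>.\<close>

definition kernel_moment :: "(real^3 \<Rightarrow> real) \<Rightarrow> 3 \<Rightarrow> 3 \<Rightarrow> real^3 \<Rightarrow> real" where
  "kernel_moment \<phi> n m y = (LINT z|lborel. z $ n / (norm z) ^ 3 * partial_deriv m \<phi> (y + z))"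

lemma kernel_bound:
  assumes \<phi>: "test_fun A \<phi>"
  obtains R M where "M \<ge> 0" "\<And>z. \<bar>partial_deriv m \<phi> (y + z)\<bar> / (norm z)\<^sup>2 \<le> M * inv_square R z"
proof -
  have d: "test_fun A (partial_deriv m \<phi>)" by (rule test_fun_partial[OF \<phi>])
  let ?K = "(\<lambda>x. x - y) ` closure {x. partial_deriv m \<phi> x \<noteq> 0}"
  have "compact ?K" using d by (intro compact_translation) (simp add: test_fun_def)
  then have "bounded ?K" by (rule compact_imp_bounded)
  then obtain R where R: "\<And>z. z \<in> ?K \<Longrightarrow> norm z \<le> R" unfolding bounded_iff by metis
  obtain M where M: "\<And>x. \<bar>partial_deriv m \<phi> x\<bar> \<le> M" using test_fun_bounded[OF d] by blast
  have "M \<ge> 0" using M[of 0] by linarith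
  moreover have "\<bar>partial_deriv m \<phi> (y + z)\<bar> / (norm z)\<^sup>2 \<le> M * inv_square R z" for z
  proof (cases "z \<in> ?K")
    case True
    then have "\<bar>z $ i\<bar> \<le> R" for i using R[OF True] component_le_norm_cart[of z i] by linarith
    then show ?thesis using M[of "y + z"] by (simp add: inv_square_def divide_right_mono)
  next
    case False
    then have "partial_deriv m \<phi> (y + z) = 0" by (rule test_fun_shift_zero[OF d])
    then show ?thesis using \<open>M \<ge> 0\<close> inv_square_nonneg[of R z] by simp
  qed
  ultimately show ?thesis using that by blast
qed

lemma norm_component_div_le: "\<bar>z $ n / (norm z) ^ 3\<bar> \<le> 1 / (norm z)\<^sup>2" for z :: "real^3"
proof (cases "z = 0")
  case False
  have "\<bar>z $ n\<bar> / (norm z) ^ 3 \<le> norm z / (norm z) ^ 3"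
    by (intro divide_right_mono component_le_norm_cart) simp
  also have "\<dots> = 1 / (norm z)\<^sup>2" using False by (simp add: power2_eq_square power3_eq_cube)
  finally show ?thesis by simp
qed simp

lemma kernel_integrable:
  assumes \<phi>: "test_fun A \<phi>"
  shows "integrable lborel (\<lambda>z. z $ n / (norm z) ^ 3 * partial_deriv m \<phi> (y + z))"
proof -
  obtain R M where M: "M \<ge> 0" and b: "\<And>z. \<bar>partial_deriv m \<phi> (y + z)\<bar> / (norm z)\<^sup>2 \<le> M * inv_square R z"
    using kernel_bound[OF \<phi>] by blast
  have [measurable]: "partial_deriv m \<phi> \<in> borel_measurable borel"
    by (rule test_fun_measurable[OF test_fun_partial[OF \<phi>]])
  show ?thesis
  proof (rule Bochner_Integration.integrable_bound[OF integrable_mult_right[OF inv_square_integrable, of M R]])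
    show "AE z in lborel. norm (z $ n / (norm z) ^ 3 * partial_deriv m \<phi> (y + z)) \<le> norm (M * inv_square R z)"
    proof (intro AE_I2)
      fix z :: "real^3"
      have "norm (z $ n / (norm z) ^ 3 * partial_deriv m \<phi> (y + z)) \<le> 1 / (norm z)\<^sup>2 * \<bar>partial_deriv m \<phi> (y + z)\<bar>"
        unfolding real_norm_def abs_mult by (intro mult_right_mono norm_component_div_le) simp
      also have "\<dots> \<le> M * inv_square R z" using b[of z] by simp
      finally show "norm (z $ n / (norm z) ^ 3 * partial_deriv m \<phi> (y + z)) \<le> norm (M * inv_square R z)" by simp
    qed
  qed measurable
qed

text \<open>By \<open>gaussian_subordination\<close> the kernel \<open>z / \<bar>z\<bar>\<^sup>3\<close> is a superposition of the fields
  \<open>l\<^sup>2 z exp (- l\<^sup>2 \<bar>z\<bar>\<^sup>2)\<close>, to which integration by parts applies. The double integral over \<open>l\<close> and \<open>z\<close> converges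
  absolutely because the integrand does not change sign in \<open>l\<close>.\<close>

lemma kernel_moment_subordination:
  fixes y :: "real^3" and m n :: 3
  assumes \<phi>: "test_fun A \<phi>"
  defines "I \<equiv> \<lambda>l. indicator {0..} l * (l\<^sup>2 * (LINT z|lborel. z $ n * gaussian l z * partial_deriv m \<phi> (y + z)))"
  shows "integrable lborel I" and "kernel_moment \<phi> n m y = 4 / sqrt pi * (LINT l|lborel. I l)"
proof -
  let ?D = "\<lambda>z. partial_deriv m \<phi> (y + z)"
  let ?h = "\<lambda>l. indicator {0..} l * l\<^sup>2 :: real"
  have [measurable]: "partial_deriv m \<phi> \<in> borel_measurable borel"
    by (rule test_fun_measurable[OF test_fun_partial[OF \<phi>]])
  define F where "F = (\<lambda>z l. (z $ n * ?D z) * (indicator {0..} l * (l\<^sup>2 * exp (- l\<^sup>2 * (norm z)\<^sup>2))))"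
  have s: "has_bochner_integral lborel (\<lambda>l. indicator {0..} l * (l\<^sup>2 * exp (- l\<^sup>2 * (norm z)\<^sup>2))) (sqrt pi / (4 * (norm z) ^ 3))" if "z \<noteq> 0" for z :: "real^3"
    using that by (intro gaussian_subordination) simp
  have F0: "F 0 l = 0" for l by (simp add: F_def)
  have Fi: "integrable lborel (F z)" for z
    using s[of z] by (cases "z = 0") (simp_all add: F_def has_bochner_integral_iff)
  have FI: "(LINT l|lborel. F z l) = sqrt pi / 4 * (z $ n / (norm z) ^ 3 * ?D z)" for z
    using s[of z] by (cases "z = 0") (simp_all add: F_def has_bochner_integral_iff)
  have FN: "(LINT l|lborel. norm (F z l)) = sqrt pi / 4 * \<bar>z $ n / (norm z) ^ 3 * ?D z\<bar>" for z
  proof (cases "z = 0")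
    case False
    have "norm (F z l) = \<bar>z $ n * ?D z\<bar> * (indicator {0..} l * (l\<^sup>2 * exp (- l\<^sup>2 * (norm z)\<^sup>2)))" for l
      by (simp add: F_def abs_mult)
    then show ?thesis using s[OF False] by (simp add: has_bochner_integral_iff abs_mult)
  qed (simp add: F0)
  have I: "integrable (lborel \<Otimes>\<^sub>M lborel) (case_prod F)"
  proof (rule lborel_pair.Fubini_integrable)
    show "case_prod F \<in> borel_measurable (lborel \<Otimes>\<^sub>M lborel)" unfolding F_def by measurable
    show "integrable lborel (\<lambda>z. LINT l|lborel. norm (case (z, l) of (z, l) \<Rightarrow> F z l))"
      unfolding prod.case FN by (intro integrable_mult_right integrable_abs kernel_integrable[OF \<phi>])
  qed (simp add: Fi)
  have Iz: "(LINT z|lborel. F z l) = I l" for l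
  proof -
    have "F z l = (indicator {0..} l * l\<^sup>2) * (z $ n * gaussian l z * ?D z)" for z
      by (simp add: F_def gaussian_def mult_ac)
    then show ?thesis unfolding I_def by (simp add: mult.assoc)
  qed
  show "integrable lborel I"
    using lborel_pair.integrable_fst'[OF lborel_pair.integrable_product_swap[OF I]] by (simp add: Iz)
  have "sqrt pi / 4 * kernel_moment \<phi> n m y = (LINT z|lborel. (LINT l|lborel. F z l))"
    unfolding FI kernel_moment_def by (simp only: integral_mult_right_zero)
  also have "\<dots> = (LINT l|lborel. I l)"
    using lborel_pair.Fubini_integral[OF I] by (simp add: Iz)
  finally show "kernel_moment \<phi> n m y = 4 / sqrt pi * (LINT l|lborel. I l)"
    by (simp add: field_simps)
qed

text \<open>The kernel is curl free because the Gaussian fields are: \<open>gaussian_by_parts\<close> yields a symmetric matrix.\<close>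

lemma kernel_moment_symmetric:
  assumes \<phi>: "test_fun A \<phi>"
  shows "kernel_moment \<phi> n m y = kernel_moment \<phi> m n y"
  unfolding kernel_moment_subordination(2)[OF \<phi>] gaussian_by_parts[OF \<phi>] by (simp add: mult_ac eq_commute[of n m])

text \<open>The divergence of \<open>z / \<bar>z\<bar>\<^sup>3\<close> is \<open>4 \<pi>\<close> times the Dirac measure. Indeed, the divergence of
  \<open>l\<^sup>2 z exp (- l\<^sup>2 \<bar>z\<bar>\<^sup>2)\<close> is the derivative of \<open>l\<^sup>3 exp (- l\<^sup>2 \<bar>z\<bar>\<^sup>2)\<close> with respect to \<open>l\<close>. Integrated up to \<open>L\<close> it gives
  \<open>L\<^sup>3 exp (- L\<^sup>2 \<bar>z\<bar>\<^sup>2)\<close>, which is \<open>\<pi>\<^bsup>3/2\<^esup>\<close> times an approximate identity.\<close>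

lemma kernel_moment_trace:
  assumes \<phi>: "test_fun A \<phi>"
  shows "(\<Sum>m\<in>UNIV. kernel_moment \<phi> m m y) = - (4 * pi) * \<phi> y"
proof -
  define I where "I m l = indicator {0..} l * (l\<^sup>2 * (LINT z|lborel. z $ m * gaussian l z * partial_deriv m \<phi> (y + z)))" for m l
  have Ii: "integrable lborel (I m)" for m
    using kernel_moment_subordination(1)[OF \<phi>, of m m y] by (simp add: I_def[abs_def])
  let ?K = "(\<lambda>x. x - y) ` closure {x. \<phi> x \<noteq> 0}"
  have K: "compact ?K" using \<phi> by (intro compact_translation) (simp add: test_fun_def)
  note c = continuous_shift[OF test_fun_continuous[OF \<phi>]]
  have [measurable]: "\<phi> \<in> borel_measurable borel" by (rule test_fun_measurable[OF \<phi>])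
  have [measurable]: "(\<lambda>q. gaussian (fst q) (snd q)) \<in> borel_measurable (lborel \<Otimes>\<^sub>M lborel)"
    unfolding gaussian_def by measurable
  define d where "d l z = (3 * l\<^sup>2 - 2 * l ^ 4 * (norm z)\<^sup>2) * gaussian l z" for l and z :: "real^3"
  \<comment> \<open>the \<open>l\<close>-derivative of \<open>l\<^sup>3 exp (- l\<^sup>2 \<bar>z\<bar>\<^sup>2)\<close>\<close>
  have dint: "(LINT l|lborel. indicator {0..L} l *\<^sub>R d l z) = L ^ 3 * gaussian L z" if L: "L \<ge> 0" for L z
  proof -
    have "(LINT l|lborel. indicator {0..L} l *\<^sub>R d l z) = L ^ 3 * gaussian L z - 0 ^ 3 * gaussian 0 z"
    proof (rule integral_FTC_atLeastAtMost[OF L])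
      fix l
      have "((\<lambda>l. l ^ 3 * gaussian l z) has_real_derivative d l z) (at l)"
        unfolding gaussian_def d_def
        by (auto intro!: derivative_eq_intros simp: algebra_simps power2_eq_square power3_eq_cube power4_eq_xxxx)
      then show "((\<lambda>l. l ^ 3 * gaussian l z) has_vector_derivative d l z) (at l within {0..L})"
        by (simp add: has_real_derivative_iff_has_vector_derivative has_vector_derivative_at_within)
      show "continuous_on {0..L} (\<lambda>l. d l z)"
        unfolding d_def gaussian_def by (intro continuous_intros)
    qed
    then show ?thesis by simp
  qed
  have sum: "(\<Sum>m\<in>UNIV. I m l) = - indicator {0..} l * (LINT z|lborel. d l z * \<phi> (y + z))" for l
  proof -
    have i: "integrable lborel (\<lambda>z. (2 * l\<^sup>2 * z $ m * z $ m - 1) * gaussian l z * \<phi> (y + z))" for m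
      by (rule integrable_compact_support[OF K])
        (intro continuous_intros gaussian_continuous c, subst test_fun_shift_zero[OF \<phi>], assumption, simp)
    have pt: "l\<^sup>2 * (\<Sum>m\<in>UNIV. (2 * l\<^sup>2 * z $ m * z $ m - 1) * gaussian l z * \<phi> (y + z)) = - (d l z * \<phi> (y + z))" for z
    proof -
      have "(norm z)\<^sup>2 = z $ 1 * z $ 1 + z $ 2 * z $ 2 + z $ 3 * z $ 3"
        by (simp add: norm_vec_def L2_set_def sum_3 power2_eq_square)
      then show ?thesis
        unfolding d_def by (simp add: sum_3 algebra_simps power2_eq_square power4_eq_xxxx)
    qed
    have "(\<Sum>m\<in>UNIV. I m l) = indicator {0..} l * (l\<^sup>2 * (LINT z|lborel. (\<Sum>m\<in>UNIV. (2 * l\<^sup>2 * z $ m * z $ m - 1) * gaussian l z * \<phi> (y + z))))"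
      unfolding I_def gaussian_by_parts[OF \<phi>] using i by (simp add: Bochner_Integration.integral_sum sum_distrib_left)
    also have "\<dots> = indicator {0..} l * (LINT z|lborel. l\<^sup>2 * (\<Sum>m\<in>UNIV. (2 * l\<^sup>2 * z $ m * z $ m - 1) * gaussian l z * \<phi> (y + z)))"
      by (simp only: integral_mult_right_zero)
    finally show ?thesis unfolding pt by simp
  qed
  have fub: "(LINT l|lborel. indicator {0..L} l *\<^sub>R (LINT z|lborel. d l z * \<phi> (y + z))) = (LINT z|lborel. L ^ 3 * gaussian L z * \<phi> (y + z))" if L: "L \<ge> 0" for L
  proof -
    define H where "H = (\<lambda>l z. (indicator {0..L} l *\<^sub>R d l z) * \<phi> (y + z))"
    have "integrable lborel (\<lambda>q. indicator ({0..L} \<times> ?K) q *\<^sub>R (d (fst q) (snd q) * \<phi> (y + snd q)))"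
      by (rule borel_integrable_compact)
        (auto intro!: compact_Times K continuous_intros continuous_on_compose2[OF test_fun_continuous[OF \<phi>]] simp: d_def gaussian_def)
    also have "(\<lambda>q. indicator ({0..L} \<times> ?K) q *\<^sub>R (d (fst q) (snd q) * \<phi> (y + snd q))) = case_prod H"
    proof
      fix q :: "real \<times> (real^3)"
      show "indicator ({0..L} \<times> ?K) q *\<^sub>R (d (fst q) (snd q) * \<phi> (y + snd q)) = case_prod H q"
      proof (cases "snd q \<in> ?K")
        case True
        then show ?thesis by (cases q) (simp add: H_def indicator_def)
      next
        case False
        then have "\<phi> (y + snd q) = 0" by (rule test_fun_shift_zero[OF \<phi>])
        then show ?thesis by (cases q) (simp add: H_def)
      qed
    qed
    finally have H: "integrable (lborel \<Otimes>\<^sub>M lborel) (case_prod H)" by (simp add: lborel_prod)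
    have "(LINT l|lborel. indicator {0..L} l *\<^sub>R (LINT z|lborel. d l z * \<phi> (y + z))) = (LINT l|lborel. (LINT z|lborel. H l z))"
      by (simp add: H_def mult.assoc)
    also have "\<dots> = (LINT z|lborel. (LINT l|lborel. H l z))"
      using lborel_pair.Fubini_integral[OF H] by simp
    also have "\<dots> = (LINT z|lborel. L ^ 3 * gaussian L z * \<phi> (y + z))"
      unfolding H_def by (simp only: integral_mult_left_zero dint[OF L])
    finally show ?thesis .
  qed
  \<comment> \<open>chosen such that \<open>gauss_eq_gaussian\<close> yields \<open>gauss\<close> with the integer parameter of \<open>gauss_approximate_identity\<close>\<close>
  define l where "l n = real (Suc n) / sqrt 2" for n
  have l0: "l n > 0" for n by (simp add: l_def)
  let ?S = "\<lambda>x. \<Sum>m\<in>UNIV. I m x"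
  have Si: "integrable lborel ?S" by (intro Bochner_Integration.integrable_sum Ii)
  have "(\<lambda>n. LINT x|lborel. indicator {..l n} x *\<^sub>R ?S x) \<longlonglongrightarrow> (LINT x|lborel. ?S x)"
  proof (rule filterlim_compose[OF tendsto_integral_at_top[OF _ Si]])
    have "filterlim (\<lambda>n. (1 / sqrt 2) * real (Suc n)) at_top sequentially"
      by (intro filterlim_tendsto_pos_mult_at_top[OF tendsto_const] filterlim_compose[OF filterlim_real_sequentially filterlim_Suc]) simp
    then show "filterlim l at_top sequentially" by (simp add: l_def[abs_def])
  qed simp
  moreover have "(LINT x|lborel. indicator {..l n} x *\<^sub>R ?S x) = - (pi powr (3/2) * (LINT z|lborel. gauss (real (Suc n)) z *\<^sub>R \<phi> (y + z)))" for n
  proof -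
    have pt: "(l n) ^ 3 * gaussian (l n) z * \<phi> (y + z) = pi powr (3/2) * (gauss (real (Suc n)) z *\<^sub>R \<phi> (y + z))" for z
      using gauss_eq_gaussian[OF l0[of n], of z] by (simp add: l_def mult.assoc[symmetric])
    have "indicator {..l n} x *\<^sub>R ?S x = - (indicator {0..l n} x *\<^sub>R (LINT z|lborel. d x z * \<phi> (y + z)))" for x
      unfolding sum by (auto simp: indicator_def)
    then have "(LINT x|lborel. indicator {..l n} x *\<^sub>R ?S x) = - (LINT z|lborel. (l n) ^ 3 * gaussian (l n) z * \<phi> (y + z))"
      using fub[of "l n"] l0[of n] by simp
    then show ?thesis unfolding pt by (simp only: integral_mult_right_zero)
  qed
  moreover have "(\<lambda>n. - (pi powr (3/2) * (LINT z|lborel. gauss (real (Suc n)) z *\<^sub>R \<phi> (y + z)))) \<longlonglongrightarrow> - (pi powr (3/2) * \<phi> y)"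
  proof -
    obtain M where "\<And>x. \<bar>\<phi> x\<bar> \<le> M" using test_fun_bounded[OF \<phi>] by blast
    then show ?thesis by (intro tendsto_intros gauss_approximate_identity[OF test_fun_continuous[OF \<phi>]]) auto
  qed
  ultimately have "(LINT x|lborel. ?S x) = - (pi powr (3/2) * \<phi> y)"
    using LIMSEQ_unique by auto
  then have I: "(\<Sum>m\<in>UNIV. LINT x|lborel. I m x) = - (pi powr (3/2) * \<phi> y)"
    using Ii by (simp add: Bochner_Integration.integral_sum)
  have "(\<Sum>m\<in>UNIV. kernel_moment \<phi> m m y) = 4 / sqrt pi * - (pi powr (3/2) * \<phi> y)"
    unfolding kernel_moment_subordination(2)[OF \<phi>] I_def[symmetric] sum_distrib_left[symmetric] I ..
  also have "4 / sqrt pi * - (pi powr (3/2) * \<phi> y) = - (4 * pi) * \<phi> y"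
  proof -
    have "pi powr (3/2) = pi powr (1 + 1/2)" by simp
    also have "\<dots> = pi powr 1 * pi powr (1/2)" by (rule powr_add)
    finally have "pi powr (3/2) = pi powr 1 * pi powr (1/2)" .
    then show ?thesis by (simp add: powr_half_sqrt)
  qed
  finally show ?thesis .
qed

lemma cauchy_kernel_bmult: "cauchy_kernel z \<star> (c, 0) = c *\<^sub>B cauchy_kernel z"
  by (simp add: cauchy_kernel_def bmult_def ccross_def cscale_def vec_eq_iff forall_3 prod_eq_iff)

lemma cauchy_kernel_measurable[measurable]: "cauchy_kernel \<in> borel_measurable borel"
  unfolding cauchy_kernel_def by (intro borel_measurable_Pair cvec_measurable) measurable

lemma norm_cauchy_kernel_le: "norm (cauchy_kernel z) \<le> 1 / (norm z)\<^sup>2"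
proof -
  have "norm (cauchy_kernel z) = 1 / (4 * pi) * (norm z / norm z ^ 3)"
    by (simp add: cauchy_kernel_def norm_Pair)
  also have "norm z / norm z ^ 3 = 1 / (norm z)\<^sup>2"
    by (cases "z = 0") (simp_all add: power2_eq_square power3_eq_cube)
  also have "1 / (4 * pi) * (1 / (norm z)\<^sup>2) \<le> 1 * (1 / (norm z)\<^sup>2)"
    using pi_gt3 by (intro mult_right_mono) auto
  finally show ?thesis by simp
qed

locale teodorescu_scalar =
  fixes \<Omega> :: "(real^3) set" and f :: "real^3 \<Rightarrow> complex"
  assumes \<Omega>_borel[measurable]: "\<Omega> \<in> sets borel" and \<Omega>_bounded: "bounded \<Omega>"
    and f_integrable: "set_integrable lborel \<Omega> f"
begin

definition f\<^sub>0 :: "real^3 \<Rightarrow> complex" where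
  "f\<^sub>0 y = indicator \<Omega> y *\<^sub>R f y"

lemma f\<^sub>0: "integrable lborel f\<^sub>0"
  using f_integrable by (simp add: f\<^sub>0_def[abs_def] set_integrable_def)

lemma f\<^sub>0_measurable[measurable]: "f\<^sub>0 \<in> borel_measurable borel"
  using f\<^sub>0 by auto

lemma teodorescu_eq: "teodorescu \<Omega> (\<lambda>y. (f y, 0)) x = - (LINT y|lborel. f\<^sub>0 y *\<^sub>B cauchy_kernel (y - x))"
  unfolding teodorescu_def set_lebesgue_integral_def cauchy_kernel_bmult f\<^sub>0_def
  by (simp add: cscale.scaleR_left)

text \<open>Integrating over \<open>x\<close> first, the kernel is bounded by a translate of \<open>inv_square\<close> with an integral that is
  independent of \<open>y\<close>.\<close>

lemma product_integrable:
  assumes K: "bounded K" and [measurable]: "\<eta> \<in> borel_measurable borel"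
    and \<eta>: "\<And>x. \<bar>\<eta> x\<bar> \<le> M * indicator K x"
  shows "integrable (lborel \<Otimes>\<^sub>M lborel) (\<lambda>(y, x). \<eta> x *\<^sub>R (f\<^sub>0 y *\<^sub>B cauchy_kernel (y - x)))"
proof -
  obtain a where a: "\<And>x. x \<in> K \<Longrightarrow> norm x \<le> a" using K unfolding bounded_iff by metis
  obtain b where b: "\<And>y. y \<in> \<Omega> \<Longrightarrow> norm y \<le> b" using \<Omega>_bounded unfolding bounded_iff by metis
  let ?R = "a + b"
  have aff: "integrable lborel (\<lambda>x. inv_square ?R (y - x))" "(LINT x|lborel. inv_square ?R (y - x)) = (LINT x|lborel. inv_square ?R x)" for y
    using lborel_integrable_affine[of "-1" "inv_square ?R" y] lborel_integral_affine[of "-1" "inv_square ?R" y] inv_square_integrable by auto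
  have "integrable (lborel \<Otimes>\<^sub>M lborel) (\<lambda>(y, x). M * (norm (f\<^sub>0 y) * inv_square ?R (y - x)))"
  proof (rule lborel_pair.Fubini_integrable)
    show "integrable lborel (\<lambda>y. LINT x|lborel. norm (case (y, x) of (y, x) \<Rightarrow> M * (norm (f\<^sub>0 y) * inv_square ?R (y - x))))"
      using f\<^sub>0 by (simp add: abs_mult inv_square_nonneg aff)
  qed (use aff in auto)
  then show ?thesis
  proof (rule Bochner_Integration.integrable_bound)
    show "AE p in lborel \<Otimes>\<^sub>M lborel. norm (case p of (y, x) \<Rightarrow> \<eta> x *\<^sub>R (f\<^sub>0 y *\<^sub>B cauchy_kernel (y - x))) \<le> norm (case p of (y, x) \<Rightarrow> M * (norm (f\<^sub>0 y) * inv_square ?R (y - x)))"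
    proof (intro AE_I2, clarify)
      fix y x
      show "norm (\<eta> x *\<^sub>R (f\<^sub>0 y *\<^sub>B cauchy_kernel (y - x))) \<le> norm (M * (norm (f\<^sub>0 y) * inv_square ?R (y - x)))"
      proof (cases "x \<in> K \<and> y \<in> \<Omega>")
        case True
        have M: "\<bar>\<eta> x\<bar> \<le> M" using \<eta>[of x] True by simp
        have "\<bar>(y - x) $ m\<bar> \<le> ?R" for m
          using component_le_norm_cart[of "y - x" m] norm_triangle_ineq4[of y x] a[of x] b[of y] True by linarith
        then have "norm (cauchy_kernel (y - x)) \<le> inv_square ?R (y - x)"
          using norm_cauchy_kernel_le[of "y - x"] by (simp add: inv_square_def)
        then have c: "norm (f\<^sub>0 y) * norm (cauchy_kernel (y - x)) \<le> norm (f\<^sub>0 y) * inv_square ?R (y - x)"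
          by (intro mult_left_mono) auto
        have "\<bar>\<eta> x\<bar> * (norm (f\<^sub>0 y) * norm (cauchy_kernel (y - x))) \<le> M * (norm (f\<^sub>0 y) * inv_square ?R (y - x))"
          by (rule mult_mono[OF M c]) (use M in auto)
        then show ?thesis by (simp add: norm_cscale)
      next
        case False
        then have "\<eta> x = 0 \<or> f\<^sub>0 y = 0" using \<eta>[of x] by (auto simp: f\<^sub>0_def indicator_def)
        then show ?thesis by (auto simp: cscale.zero_left)
      qed
    qed
  qed measurable
qed

lemma teodorescu_loc_integrable: "loc_integrable A (teodorescu \<Omega> (\<lambda>y. (f y, 0)))"
  unfolding loc_integrable_def set_integrable_def
proof (intro allI impI, elim conjE)
  fix K :: "(real^3) set" assume K: "compact K"
  have "integrable (lborel \<Otimes>\<^sub>M lborel) (\<lambda>(y, x). indicator K x *\<^sub>R (f\<^sub>0 y *\<^sub>B cauchy_kernel (y - x)))"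
    by (rule product_integrable[where K = K and M = 1]) (use K in \<open>auto intro!: compact_imp_bounded borel_compact borel_measurable_indicator\<close>)
  from lborel_pair.integrable_fst'[OF lborel_pair.integrable_product_swap[OF this]]
  have "integrable lborel (\<lambda>x. - (indicator K x *\<^sub>R (LINT y|lborel. f\<^sub>0 y *\<^sub>B cauchy_kernel (y - x))))"
    by simp
  then show "integrable lborel (\<lambda>x. indicator K x *\<^sub>R teodorescu \<Omega> (\<lambda>y. (f y, 0)) x)"
    by (simp add: teodorescu_eq)
qed

text \<open>Fubini's theorem moves the kernel from \<open>f\<close> to the test function, where the substitution \<open>x = y + z\<close> yields
  \<open>kernel_moment\<close>.\<close>

lemma teodorescu_pairing:
  assumes \<phi>: "test_fun A \<phi>"
  shows "integrable lborel (\<lambda>y. f\<^sub>0 y * kernel_moment \<phi> n m y)"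
    and "dist_of A (\<lambda>x. Vec (teodorescu \<Omega> (\<lambda>y. (f y, 0)) x) $ n) (partial_deriv m \<phi>)
       = - (1 / (4 * pi)) * (LINT y|lborel. f\<^sub>0 y * kernel_moment \<phi> n m y)"
proof -
  let ?\<eta> = "partial_deriv m \<phi>"
  have \<eta>: "test_fun A ?\<eta>" by (rule test_fun_partial[OF \<phi>])
  let ?K = "closure {x. ?\<eta> x \<noteq> 0}"
  obtain M where M: "\<And>x. \<bar>?\<eta> x\<bar> \<le> M" using test_fun_bounded[OF \<eta>] by blast
  have \<eta>m[measurable]: "?\<eta> \<in> borel_measurable borel" by (rule test_fun_measurable[OF \<eta>])
  have K: "bounded ?K" using \<eta> by (auto simp: test_fun_def intro: compact_imp_bounded)
  have Mi: "\<bar>?\<eta> x\<bar> \<le> M * indicator ?K x" for x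
  proof (cases "x \<in> ?K")
    case False
    then have "?\<eta> x = 0" by (rule test_fun_zero[OF \<eta>])
    then show ?thesis using False by simp
  qed (use M in simp)
  define k where "k z = - (z $ n) / (4 * pi * norm z ^ 3)" for z :: "real^3"
  have kV: "Vec (cauchy_kernel z) $ n = complex_of_real (k z)" for z
    by (simp add: cauchy_kernel_def cvec_def k_def)
  let ?G = "\<lambda>(y, x). ?\<eta> x *\<^sub>R (f\<^sub>0 y *\<^sub>B cauchy_kernel (y - x))"
  have G: "integrable (lborel \<Otimes>\<^sub>M lborel) ?G"
    by (rule product_integrable[OF K \<eta>m Mi])
  let ?g = "\<lambda>(y, x). ?\<eta> x *\<^sub>R (f\<^sub>0 y * complex_of_real (k (y - x)))"
  have g: "integrable (lborel \<Otimes>\<^sub>M lborel) ?g"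
    using integrable_Vec[OF G, of n] by (simp add: split_beta' kV)
  have inner: "(LINT x|lborel. ?\<eta> x *\<^sub>R (f\<^sub>0 y * complex_of_real (k (y - x)))) = f\<^sub>0 y * kernel_moment \<phi> n m y * (1 / (4 * pi))" for y
  proof -
    have [measurable]: "(\<lambda>x. ?\<eta> x * k (y - x)) \<in> borel_measurable borel" unfolding k_def by measurable
    have "(LINT x|lborel. ?\<eta> x *\<^sub>R (f\<^sub>0 y * complex_of_real (k (y - x)))) = (LINT x|lborel. f\<^sub>0 y * complex_of_real (?\<eta> x * k (y - x)))"
      by (simp add: scaleR_conv_of_real mult_ac)
    also have "\<dots> = f\<^sub>0 y * complex_of_real (LINT x|lborel. ?\<eta> x * k (y - x))"
      by (simp only: integral_mult_right_zero integral_complex_of_real)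
    also have "(LINT x|lborel. ?\<eta> x * k (y - x)) = (LINT z|lborel. ?\<eta> (y + z) * k (- z))"
      using lborel_integral_affine[of 1 "\<lambda>x. ?\<eta> x * k (y - x)" y] by simp
    also have "\<dots> = (LINT z|lborel. (z $ n / (norm z) ^ 3 * ?\<eta> (y + z)) * (1 / (4 * pi)))"
      by (simp add: k_def field_simps)
    also have "\<dots> = kernel_moment \<phi> n m y * (1 / (4 * pi))"
      unfolding kernel_moment_def by (simp only: integral_mult_left_zero)
    finally show ?thesis by simp
  qed
  have "integrable lborel (\<lambda>y. f\<^sub>0 y * kernel_moment \<phi> n m y * (1 / (4 * pi)))"
    using lborel_pair.integrable_fst'[OF g] by (simp add: inner)
  then have "integrable lborel (\<lambda>y. (f\<^sub>0 y * kernel_moment \<phi> n m y * (1 / (4 * pi))) * (4 * pi))"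
    by (rule integrable_mult_left)
  then show "integrable lborel (\<lambda>y. f\<^sub>0 y * kernel_moment \<phi> n m y)" by simp
  have "dist_of A (\<lambda>x. Vec (teodorescu \<Omega> (\<lambda>y. (f y, 0)) x) $ n) ?\<eta> = (LINT x|lborel. ?\<eta> x *\<^sub>R Vec (teodorescu \<Omega> (\<lambda>y. (f y, 0)) x) $ n)"
    by (rule dist_of_eq[OF \<eta>])
  also have "\<dots> = (LINT x|lborel. - (LINT y|lborel. ?\<eta> x *\<^sub>R (f\<^sub>0 y * complex_of_real (k (y - x)))))"
  proof (rule integral_cong_AE)
    have "integrable lborel (\<lambda>x. Vec (?\<eta> x *\<^sub>R teodorescu \<Omega> (\<lambda>y. (f y, 0)) x) $ n)"
      by (rule integrable_Vec[OF test_fun_scaleR_integrable[OF \<eta> teodorescu_loc_integrable]])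
    then show "(\<lambda>x. ?\<eta> x *\<^sub>R Vec (teodorescu \<Omega> (\<lambda>y. (f y, 0)) x) $ n) \<in> borel_measurable lborel" by auto
    have "integrable lborel (\<lambda>x. LINT y|lborel. ?\<eta> x *\<^sub>R (f\<^sub>0 y * complex_of_real (k (y - x))))"
      using lborel_pair.integrable_fst'[OF lborel_pair.integrable_product_swap[OF g]] by simp
    then show "(\<lambda>x. - (LINT y|lborel. ?\<eta> x *\<^sub>R (f\<^sub>0 y * complex_of_real (k (y - x))))) \<in> borel_measurable lborel" by auto
    have "AE x in lborel. integrable lborel (\<lambda>y. ?\<eta> x *\<^sub>R (f\<^sub>0 y *\<^sub>B cauchy_kernel (y - x)))"
      using lborel_pair.AE_integrable_fst'[OF lborel_pair.integrable_product_swap[OF G]] by simp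
    then show "AE x in lborel. ?\<eta> x *\<^sub>R Vec (teodorescu \<Omega> (\<lambda>y. (f y, 0)) x) $ n = - (LINT y|lborel. ?\<eta> x *\<^sub>R (f\<^sub>0 y * complex_of_real (k (y - x))))"
    proof eventually_elim
      case (elim x)
      have "?\<eta> x *\<^sub>R Vec (teodorescu \<Omega> (\<lambda>y. (f y, 0)) x) $ n = - Vec (LINT y|lborel. ?\<eta> x *\<^sub>R (f\<^sub>0 y *\<^sub>B cauchy_kernel (y - x))) $ n"
        by (simp add: teodorescu_eq)
      also have "Vec (LINT y|lborel. ?\<eta> x *\<^sub>R (f\<^sub>0 y *\<^sub>B cauchy_kernel (y - x))) $ n = (LINT y|lborel. ?\<eta> x *\<^sub>R (f\<^sub>0 y * complex_of_real (k (y - x))))"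
        unfolding integral_Vec[OF elim] by (simp add: kV)
      finally show ?case .
    qed
  qed
  also have "\<dots> = - (LINT y|lborel. (LINT x|lborel. ?\<eta> x *\<^sub>R (f\<^sub>0 y * complex_of_real (k (y - x)))))"
    using lborel_pair.Fubini_integral[OF g] by simp
  also have "\<dots> = - (1 / (4 * pi)) * (LINT y|lborel. f\<^sub>0 y * kernel_moment \<phi> n m y)"
    unfolding inner integral_mult_left_zero by simp
  finally show "dist_of A (\<lambda>x. Vec (teodorescu \<Omega> (\<lambda>y. (f y, 0)) x) $ n) (partial_deriv m \<phi>)
       = - (1 / (4 * pi)) * (LINT y|lborel. f\<^sub>0 y * kernel_moment \<phi> n m y)" .
qed

theorem teodorescu_curl:
  assumes \<phi>: "test_fun A \<phi>"
  shows "dist_of A (\<lambda>x. Vec (teodorescu \<Omega> (\<lambda>y. (f y, 0)) x) $ n) (partial_deriv m \<phi>)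
       = dist_of A (\<lambda>x. Vec (teodorescu \<Omega> (\<lambda>y. (f y, 0)) x) $ m) (partial_deriv n \<phi>)"
  unfolding teodorescu_pairing(2)[OF \<phi>] kernel_moment_symmetric[OF \<phi>, of n m] ..

text \<open>The sign is that of \<open>div T\<^sub>\<Omega>[f] = - f\<close>, the derivatives being moved to the test function.\<close>

theorem teodorescu_div:
  assumes \<phi>: "test_fun \<Omega> \<phi>"
  shows "(\<Sum>m\<in>UNIV. dist_of \<Omega> (\<lambda>x. Vec (teodorescu \<Omega> (\<lambda>y. (f y, 0)) x) $ m) (partial_deriv m \<phi>)) = dist_of \<Omega> f \<phi>"
proof -
  have "(\<Sum>m\<in>UNIV. dist_of \<Omega> (\<lambda>x. Vec (teodorescu \<Omega> (\<lambda>y. (f y, 0)) x) $ m) (partial_deriv m \<phi>))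
    = - (1 / (4 * pi)) * (LINT y|lborel. (\<Sum>m\<in>UNIV. f\<^sub>0 y * kernel_moment \<phi> m m y))"
  proof -
    have s: "(LINT y|lborel. (\<Sum>m\<in>UNIV. f\<^sub>0 y * kernel_moment \<phi> m m y)) = (\<Sum>m\<in>UNIV. LINT y|lborel. f\<^sub>0 y * kernel_moment \<phi> m m y)"
      by (rule Bochner_Integration.integral_sum) (rule teodorescu_pairing(1)[OF \<phi>])
    show ?thesis
      unfolding s teodorescu_pairing(2)[OF \<phi>] by (rule sum_distrib_left[symmetric])
  qed
  also have "(\<lambda>y. \<Sum>m\<in>UNIV. f\<^sub>0 y * kernel_moment \<phi> m m y) = (\<lambda>y. (- (4 * pi)) * (f\<^sub>0 y * \<phi> y))"
  proof
    fix y
    have "(\<Sum>m\<in>UNIV. f\<^sub>0 y * kernel_moment \<phi> m m y) = f\<^sub>0 y * complex_of_real (\<Sum>m\<in>UNIV. kernel_moment \<phi> m m y)"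
      by (simp add: sum_distrib_left)
    then show "(\<Sum>m\<in>UNIV. f\<^sub>0 y * kernel_moment \<phi> m m y) = (- (4 * pi)) * (f\<^sub>0 y * \<phi> y)"
      unfolding kernel_moment_trace[OF \<phi>] by simp
  qed
  also have "- (1 / (4 * pi)) * (LINT y|lborel. (- (4 * pi)) * (f\<^sub>0 y * \<phi> y)) = (LINT y|lborel. f\<^sub>0 y * \<phi> y)"
    unfolding integral_mult_right_zero by simp
  also have "\<dots> = dist_of \<Omega> f \<phi>"
    unfolding dist_of_def set_lebesgue_integral_def f\<^sub>0_def by (simp add: scaleR_conv_of_real mult_ac)
  finally show ?thesis .
qed

end

section \<open>Continuously differentiable functions as distributions\<close>

lemma continuous_on_test_fun_scaleR:
  fixes u :: "real^3 \<Rightarrow> 'b::real_normed_vector"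
  assumes \<phi>: "test_fun A \<phi>" and A: "open A" and u: "continuous_on A u"
  shows "continuous_on UNIV (\<lambda>x. \<phi> x *\<^sub>R u x)"
proof -
  let ?K = "closure {x. \<phi> x \<noteq> 0}"
  have "continuous_on (- ?K) (\<lambda>x. \<phi> x *\<^sub>R u x)"
  proof (rule continuous_on_eq[of _ "\<lambda>_. 0"])
    fix x assume "x \<in> - ?K"
    then have "\<phi> x = 0" using test_fun_zero[OF \<phi>, of x] by blast
    then show "0 = \<phi> x *\<^sub>R u x" by simp
  qed simp
  moreover have "continuous_on A (\<lambda>x. \<phi> x *\<^sub>R u x)"
    by (intro continuous_intros u continuous_on_subset[OF test_fun_continuous[OF \<phi>]]) simp
  moreover have "UNIV = - ?K \<union> A" using \<phi> by (auto simp: test_fun_def)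
  ultimately show ?thesis
    using continuous_on_open_Un[of "- ?K" A "\<lambda>x. \<phi> x *\<^sub>R u x"] A by (simp add: open_Compl)
qed

lemma C1_onD:
  fixes h :: "real^3 \<Rightarrow> real"
  assumes h: "C1_on A h" and A: "open A"
  shows "x \<in> A \<Longrightarrow> ((\<lambda>t. h (x + t *\<^sub>R axis m 1)) has_vector_derivative partial_deriv m h x) (at 0)"
    and "continuous_on A (partial_deriv m h)" and "continuous_on A h"
proof -
  obtain h' :: "real^3 \<Rightarrow> (real^3) \<Rightarrow>\<^sub>L real" where d: "\<And>p. p \<in> A \<Longrightarrow> (h has_derivative blinfun_apply (h' p)) (at p within A)"
    and c: "continuous_on A h'"
    using h unfolding C1_on_def by blast
  have d': "(h has_derivative blinfun_apply (h' p)) (at p)" if "p \<in> A" for p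
    using d[OF that] at_within_open[OF that A] by simp
  have p: "partial_deriv m h p = blinfun_apply (h' p) (axis m 1)" if "p \<in> A" for p
    by (rule partial_deriv_eqI[OF d'[OF that]])
  show "((\<lambda>t. h (x + t *\<^sub>R axis m 1)) has_vector_derivative partial_deriv m h x) (at 0)" if "x \<in> A"
    unfolding p[OF that] by (rule directional_derivative[OF d'[OF that]])
  have "continuous_on A (\<lambda>p. blinfun_apply (h' p) (axis m 1))"
    by (intro continuous_intros c)
  then show "continuous_on A (partial_deriv m h)" by (rule continuous_on_eq) (simp add: p)
  show "continuous_on A h"
    using d by (auto simp: continuous_on_eq_continuous_within intro: has_derivative_continuous)
qed

lemma continuous_loc_integrable:
  fixes u :: "real^3 \<Rightarrow> 'b::euclidean_space"
  assumes "continuous_on A u" shows "loc_integrable A u"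
  unfolding loc_integrable_def set_integrable_def
  by (auto intro!: borel_integrable_compact intro: continuous_on_subset[OF assms])

lemma C1_by_parts:
  fixes h :: "real^3 \<Rightarrow> real"
  assumes h: "C1_on A h" and A: "open A" and \<phi>: "test_fun A \<phi>"
  shows "dist_of A (partial_deriv m h) \<phi> = - dist_of A h (partial_deriv m \<phi>)"
proof -
  let ?K = "closure {x. \<phi> x \<noteq> 0}"
  note hd = C1_onD[OF h A]
  have K: "compact ?K" "?K \<subseteq> A" using \<phi> by (auto simp: test_fun_def)
  have d: "test_fun A (partial_deriv m \<phi>)" by (rule test_fun_partial[OF \<phi>])
  let ?a = "\<lambda>x. \<phi> x *\<^sub>R partial_deriv m h x" and ?b = "\<lambda>x. partial_deriv m \<phi> x *\<^sub>R h x"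
  have "(LINT x|lborel. ?a x + ?b x) = 0"
  proof (rule integral_directional_derivative(2)[where g = "\<lambda>x. \<phi> x *\<^sub>R h x" and v = "axis m 1", OF _ _ _ K(1)])
    fix x
    show "((\<lambda>t. \<phi> (x + t *\<^sub>R axis m 1) *\<^sub>R h (x + t *\<^sub>R axis m 1)) has_vector_derivative (?a x + ?b x)) (at 0)"
    proof (cases "x \<in> A")
      case True
      have 1: "((\<lambda>t. \<phi> (x + t *\<^sub>R axis m 1)) has_real_derivative partial_deriv m \<phi> x) (at 0)"
        using test_fun_directional[OF \<phi>] by (simp add: has_real_derivative_iff_has_vector_derivative)
      show ?thesis
        using has_vector_derivative_scaleR[OF 1 hd(1)[OF True, of m]] by simp
    next
      case False
      then have x: "x \<in> - ?K" using K by auto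
      have o: "open ((\<lambda>t. x + t *\<^sub>R axis m (1::real)) -` (- ?K))"
        by (intro open_vimage continuous_intros open_Compl closed_closure)
      have "((\<lambda>t. 0) has_vector_derivative 0) (at (0::real))" by simp
      then have "((\<lambda>t. \<phi> (x + t *\<^sub>R axis m 1) *\<^sub>R h (x + t *\<^sub>R axis m 1)) has_vector_derivative 0) (at 0)"
      proof (rule has_vector_derivative_transform_within_open[OF _ o])
        fix t assume "t \<in> (\<lambda>t. x + t *\<^sub>R axis m (1::real)) -` (- ?K)"
        then have "\<phi> (x + t *\<^sub>R axis m 1) = 0" using test_fun_zero[OF \<phi>] by blast
        then show "0 = \<phi> (x + t *\<^sub>R axis m 1) *\<^sub>R h (x + t *\<^sub>R axis m 1)" by simp
      qed (use x in simp)
      then show ?thesis using False by (simp add: test_fun_outside[OF \<phi>] test_fun_outside[OF d])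
    qed
  next
    show "continuous_on UNIV (\<lambda>x. \<phi> x *\<^sub>R h x)" by (rule continuous_on_test_fun_scaleR[OF \<phi> A hd(3)])
    show "continuous_on UNIV (\<lambda>x. ?a x + ?b x)"
      by (intro continuous_on_add continuous_on_test_fun_scaleR[OF \<phi> A] continuous_on_test_fun_scaleR[OF d A] hd)
  next
    fix x assume "x \<notin> ?K"
    then have "\<phi> x = 0" by (rule test_fun_zero[OF \<phi>])
    then show "\<phi> x *\<^sub>R h x = 0" by simp
  qed
  moreover have "integrable lborel ?a" "integrable lborel ?b"
    by (rule test_fun_scaleR_integrable[OF \<phi> continuous_loc_integrable[OF hd(2)]],
        rule test_fun_scaleR_integrable[OF d continuous_loc_integrable[OF hd(3)]])
  ultimately show ?thesis
    unfolding dist_of_eq[OF \<phi>] dist_of_eq[OF d] by simp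
qed

text \<open>The two Fourier transforms agree by \<open>ft_partial_deriv\<close>, and Parseval's identity for the difference with
  itself shows that it vanishes almost everywhere.\<close>

lemma AE_partial_deriv_commute:
  assumes \<phi>: "test_fun A \<phi>"
  shows "AE x in lborel. partial_deriv m (partial_deriv n \<phi>) x = partial_deriv n (partial_deriv m \<phi>) x"
proof -
  let ?a = "partial_deriv m (partial_deriv n \<phi>)" and ?b = "partial_deriv n (partial_deriv m \<phi>)"
  have a: "test_fun A ?a" and b: "test_fun A ?b" by (intro test_fun_partial \<phi>)+
  let ?\<psi> = "\<lambda>x. complex_of_real (?a x) - complex_of_real (?b x)"
  have i: "integrable lborel ?\<psi>"
    by (intro Bochner_Integration.integrable_diff integrable_of_real test_fun_integrable[OF a] test_fun_integrable[OF b])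
  have L: "L2 ?\<psi>" by (intro L2_diff test_fun_L2[OF a] test_fun_L2[OF b])
  have c: "continuous_on UNIV ?\<psi>"
    by (intro continuous_intros test_fun_continuous[OF a] test_fun_continuous[OF b])
  obtain M where M: "\<And>x. \<bar>?a x\<bar> \<le> M" using test_fun_bounded[OF a] by blast
  obtain N where N: "\<And>x. \<bar>?b x\<bar> \<le> N" using test_fun_bounded[OF b] by blast
  have bd: "norm (?\<psi> x) \<le> M + N" for x
    using norm_triangle_ineq4[of "complex_of_real (?a x)" "complex_of_real (?b x)"] M[of x] N[of x] by simp
  have ft0: "ft ?\<psi> k = 0" for k
  proof -
    have "ft ?\<psi> k = ft (\<lambda>x. complex_of_real (?a x)) k - ft (\<lambda>x. complex_of_real (?b x)) k"
      unfolding ft_def right_diff_distrib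
      by (intro Bochner_Integration.integral_diff integrable_wave integrable_of_real test_fun_integrable[OF a] test_fun_integrable[OF b])
    also have "\<dots> = 0"
      unfolding ft_partial_deriv[OF test_fun_partial[OF \<phi>]] ft_partial_deriv[OF \<phi>] by simp
    finally show ?thesis .
  qed
  have "(LINT x|lborel. ?\<psi> x * ?\<psi> x) = 0"
    using parseval[OF i L i L c bd] by (simp add: ft0)
  then have "complex_of_real (LINT x|lborel. (?a x - ?b x)\<^sup>2) = 0"
    unfolding integral_complex_of_real[symmetric] by (simp add: power2_eq_square)
  then have z: "(LINT x|lborel. (?a x - ?b x)\<^sup>2) = 0" by simp
  have "integrable lborel (\<lambda>x. (norm (?\<psi> x))\<^sup>2)" using L by (simp add: L2_def)
  then have "integrable lborel (\<lambda>x. (?a x - ?b x)\<^sup>2)" by (simp flip: of_real_diff)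
  from integral_nonneg_eq_0_iff_AE[OF this] z
  have "AE x in lborel. (?a x - ?b x)\<^sup>2 = 0" by simp
  then show ?thesis by eventually_elim simp
qed

lemma dist_of_partial_commute:
  fixes u :: "real^3 \<Rightarrow> 'b::euclidean_space"
  assumes \<phi>: "test_fun A \<phi>" and u: "loc_integrable A u"
  shows "dist_of A u (partial_deriv m (partial_deriv n \<phi>)) = dist_of A u (partial_deriv n (partial_deriv m \<phi>))"
proof -
  have a: "test_fun A (partial_deriv i (partial_deriv j \<phi>))" for i j by (intro test_fun_partial \<phi>)
  note i = test_fun_scaleR_integrable[OF a u]
  show ?thesis
    unfolding dist_of_eq[OF a]
  proof (rule integral_cong_AE)
    show "AE x in lborel. partial_deriv m (partial_deriv n \<phi>) x *\<^sub>R u x = partial_deriv n (partial_deriv m \<phi>) x *\<^sub>R u x"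
      using AE_partial_deriv_commute[OF \<phi>, of m n] by eventually_elim simp
  qed (use i in auto)
qed

text \<open>By integration by parts, \<open>\<nabla> h\<close> is curl free because the second derivatives of \<open>\<phi>\<close> commute, and its
  divergence is the Laplacian of \<open>h\<close>.\<close>

lemma harmonic_grad:
  assumes h: "harmonic_on A h" and A: "open A" and \<phi>: "test_fun A \<phi>"
  shows "dist_of A (partial_deriv n h) (partial_deriv m \<phi>) = dist_of A (partial_deriv m h) (partial_deriv n \<phi>)"
    and "(\<Sum>m\<in>UNIV. dist_of A (partial_deriv m h) (partial_deriv m \<phi>)) = 0"
proof -
  have C: "C1_on A h" "C1_on A (partial_deriv m h)" for m using h by (auto simp: harmonic_on_def)
  show "dist_of A (partial_deriv n h) (partial_deriv m \<phi>) = dist_of A (partial_deriv m h) (partial_deriv n \<phi>)"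
    unfolding C1_by_parts[OF C(1) A test_fun_partial[OF \<phi>]]
    by (subst dist_of_partial_commute[OF \<phi> continuous_loc_integrable[OF C1_onD(3)[OF C(1) A]]]) (rule refl)
  have i: "integrable lborel (\<lambda>x. \<phi> x *\<^sub>R partial_deriv m (partial_deriv m h) x)" for m
    by (rule test_fun_scaleR_integrable[OF \<phi> continuous_loc_integrable[OF C1_onD(2)[OF C(2) A]]])
  have "(\<Sum>m\<in>UNIV. dist_of A (partial_deriv m h) (partial_deriv m \<phi>)) = - (\<Sum>m\<in>UNIV. dist_of A (partial_deriv m (partial_deriv m h)) \<phi>)"
    using C1_by_parts[OF C(2) A \<phi>] by (simp add: sum_negf)
  also have "(\<Sum>m\<in>UNIV. dist_of A (partial_deriv m (partial_deriv m h)) \<phi>) = (LINT x|lborel. \<phi> x *\<^sub>R (\<Sum>m\<in>UNIV. partial_deriv m (partial_deriv m h) x))"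
    unfolding dist_of_eq[OF \<phi>] scaleR_sum_right using i by (subst Bochner_Integration.integral_sum) auto
  also have "\<dots> = 0"
  proof -
    have "\<phi> x *\<^sub>R (\<Sum>m\<in>UNIV. partial_deriv m (partial_deriv m h) x) = 0" for x
      using h test_fun_outside[OF \<phi>, of x] by (cases "x \<in> A") (auto simp: harmonic_on_def)
    then show ?thesis by (simp only: integral_zero)
  qed
  finally show "(\<Sum>m\<in>UNIV. dist_of A (partial_deriv m h) (partial_deriv m \<phi>)) = 0" by simp
qed

text \<open>Exhaustion of \<open>A\<close> by finite unions of boxes.\<close>

lemma loc_integrable_measurable:
  fixes g :: "real^3 \<Rightarrow> 'b::euclidean_space"
  assumes A: "open A" and g: "loc_integrable A g"
  shows "(\<lambda>x. indicator A x *\<^sub>R g x) \<in> borel_measurable borel"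
proof -
  obtain D where D: "countable D" "D \<subseteq> Pow A" "\<And>X. X \<in> D \<Longrightarrow> \<exists>a b. X = cbox a b" "\<Union>D = A"
    using open_countable_Union_open_cbox[OF A] by blast
  show ?thesis
  proof (cases "D = {}")
    case False
    define X where "X = from_nat_into D"
    have X: "range X = D" unfolding X_def by (rule range_from_nat_into[OF False D(1)])
    define U where "U n = (\<Union>i\<le>n. X i)" for n
    have U: "compact (U n)" "U n \<subseteq> A" for n
    proof -
      have "compact (X i)" for i
      proof -
        have "X i \<in> D" using X by blast
        then obtain a b where "X i = cbox a b" using D(3) by blast
        then show ?thesis by simp
      qed
      then show "compact (U n)" unfolding U_def by (intro compact_UN) auto
      show "U n \<subseteq> A" unfolding U_def using X D(2) by blast
    qed
    show ?thesis
    proof (rule borel_measurable_LIMSEQ_metric)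
      show "(\<lambda>x. indicator (U n) x *\<^sub>R g x) \<in> borel_measurable borel" for n
      proof -
        have "integrable lborel (\<lambda>x. indicator (U n) x *\<^sub>R g x)"
          using g U by (auto simp: loc_integrable_def set_integrable_def)
        then show ?thesis by auto
      qed
      show "(\<lambda>n. indicator (U n) x *\<^sub>R g x) \<longlonglongrightarrow> indicator A x *\<^sub>R g x" for x
      proof (cases "x \<in> A")
        case True
        then obtain N where "x \<in> X N" using D(4) X by blast
        then have "\<forall>n\<ge>N. indicator (U n) x *\<^sub>R g x = indicator A x *\<^sub>R g x"
          using True by (auto simp: U_def indicator_def)
        then show ?thesis by (intro tendsto_eventually) (auto simp: eventually_sequentially)
      next
        case False
        then have "indicator (U n) x *\<^sub>R g x = indicator A x *\<^sub>R g x" for n using U(2)[of n] by (auto simp: indicator_def)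
        then show ?thesis by (simp only: tendsto_const)
      qed
    qed
  qed (use D(4) in auto)
qed

section \<open>Maxwell's system\<close>

lemma C1_on_continuous: "C1_on S f \<Longrightarrow> continuous_on S f"
  unfolding C1_on_def by (auto simp: continuous_on_eq_continuous_within intro: has_derivative_continuous)

lemma C1_on_slice:
  fixes j :: "real^3 \<Rightarrow> real \<Rightarrow> real^3"
  assumes j: "C1_on (\<Omega> \<times> {0..}) (\<lambda>(x, t). j x t)" and t: "t \<ge> 0"
  shows "C1_on \<Omega> (\<lambda>x. j x t $ m)"
proof -
  obtain f' :: "(real^3) \<times> real \<Rightarrow> ((real^3) \<times> real) \<Rightarrow>\<^sub>L (real^3)"
    where d: "\<And>p. p \<in> \<Omega> \<times> {0..} \<Longrightarrow> ((\<lambda>(x, t). j x t) has_derivative blinfun_apply (f' p)) (at p within \<Omega> \<times> {0..})"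
      and c: "continuous_on (\<Omega> \<times> {0..}) f'"
    using j unfolding C1_on_def by blast
  have bP: "bounded_linear (\<lambda>h::real^3. (h, 0::real))"
    by (intro bounded_linear_Pair bounded_linear_ident bounded_linear_zero)
  define g where "g x = Blinfun (\<lambda>v::real^3. v $ m) o\<^sub>L (f' (x, t) o\<^sub>L Blinfun (\<lambda>h. (h, 0)))" for x
  have g: "blinfun_apply (g x) h = blinfun_apply (f' (x, t)) (h, 0) $ m" for x h
    by (simp add: g_def bounded_linear_Blinfun_apply bP bounded_linear_vec_nth)
  have gfun: "blinfun_apply (g x) = (\<lambda>h. blinfun_apply (f' (x, t)) (h, 0) $ m)" for x
    by (rule ext) (rule g)
  have "((\<lambda>x. j x t $ m) has_derivative blinfun_apply (g x)) (at x within \<Omega>)" if x: "x \<in> \<Omega>" for x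
  proof -
    have 1: "((\<lambda>y::real^3. (y, t)) has_derivative (\<lambda>h. (h, 0))) (at x within \<Omega>)"
      by (auto intro!: derivative_eq_intros)
    have "((\<lambda>(x, t). j x t) has_derivative blinfun_apply (f' (x, t))) (at (x, t) within (\<lambda>y. (y, t)) ` \<Omega>)"
      by (rule has_derivative_subset[OF d]) (use x t in auto)
    from diff_chain_within[OF 1 this]
    have "((\<lambda>y. j y t) has_derivative (\<lambda>h. blinfun_apply (f' (x, t)) (h, 0))) (at x within \<Omega>)"
      by (simp add: o_def)
    from bounded_linear.has_derivative[OF bounded_linear_vec_nth this]
    show ?thesis unfolding gfun .
  qed
  moreover have "continuous_on \<Omega> g"
    unfolding g_def
    by (intro bounded_bilinear.continuous_on[OF bounded_bilinear_blinfun_compose] continuous_on_const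
        continuous_on_compose2[OF c, of \<Omega> "\<lambda>x. (x, t)"] continuous_on_Pair continuous_on_id) (use t in auto)
  ultimately show ?thesis unfolding C1_on_def by blast
qed

text \<open>Both sides are the integral of \<open>\<phi> \<partial>\<^sub>t \<rho>\<close> over space and time. Integrated over time first it gives the
  increment of \<open>\<rho>\<close>; integrated over space first, the equation \<open>\<partial>\<^sub>t \<rho> = - div j\<close> and integration by parts apply.\<close>

lemma continuity_equation_weak:
  fixes \<rho> :: "real^3 \<Rightarrow> real \<Rightarrow> real" and j :: "real^3 \<Rightarrow> real \<Rightarrow> real^3"
  assumes \<Omega>: "open \<Omega>"
    and \<rho>: "C1_on (\<Omega> \<times> {0..}) (\<lambda>(x, t). \<rho> x t)" and j: "C1_on (\<Omega> \<times> {0..}) (\<lambda>(x, t). j x t)"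
    and eq: "\<And>x t. x \<in> \<Omega> \<Longrightarrow> t > 0 \<Longrightarrow> divergence (\<lambda>y. j y t) x + deriv (\<lambda>s. \<rho> x s) t = 0"
    and \<phi>: "test_fun \<Omega> \<phi>" and t: "t \<ge> 0"
  shows "dist_of \<Omega> (\<lambda>x. \<rho> x t) \<phi> - dist_of \<Omega> (\<lambda>x. \<rho> x 0) \<phi>
    = (LINT s:{0..t}|lborel. (\<Sum>m\<in>UNIV. dist_of \<Omega> (\<lambda>x. j x s $ m) (partial_deriv m \<phi>)))"
proof -
  let ?K = "closure {x. \<phi> x \<noteq> 0}"
  have K: "compact ?K" "?K \<subseteq> \<Omega>" using \<phi> by (auto simp: test_fun_def)
  obtain f' :: "(real^3) \<times> real \<Rightarrow> ((real^3) \<times> real) \<Rightarrow>\<^sub>L real"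
    where f': "\<And>p. p \<in> \<Omega> \<times> {0..} \<Longrightarrow> ((\<lambda>(x, t). \<rho> x t) has_derivative blinfun_apply (f' p)) (at p within \<Omega> \<times> {0..})"
      and cf': "continuous_on (\<Omega> \<times> {0..}) f'"
    using \<rho> unfolding C1_on_def by blast
  define d where "d x s = blinfun_apply (f' (x, s)) (0, 1)" for x s
  have dd: "((\<lambda>s. \<rho> x s) has_vector_derivative d x s) (at s within {0..})" if "x \<in> \<Omega>" "s \<ge> 0" for x s
  proof -
    have 1: "((\<lambda>s::real. (x, s)) has_derivative (\<lambda>h. (0, h))) (at s within {0..})"
      by (auto intro!: derivative_eq_intros)
    have "((\<lambda>(x, t). \<rho> x t) has_derivative blinfun_apply (f' (x, s))) (at (x, s) within (\<lambda>s. (x, s)) ` {0..})"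
      by (rule has_derivative_subset[OF f']) (use that in auto)
    from diff_chain_within[OF 1 this]
    have "((\<lambda>s. \<rho> x s) has_derivative (\<lambda>h. blinfun_apply (f' (x, s)) (0, h))) (at s within {0..})"
      by (simp add: o_def)
    moreover have "blinfun_apply (f' (x, s)) (0, h) = h *\<^sub>R d x s" for h
      unfolding d_def blinfun.scaleR_right[symmetric] by simp
    ultimately show ?thesis by (simp add: has_vector_derivative_def)
  qed
  have cd: "continuous_on (\<Omega> \<times> {0..}) (\<lambda>p. d (fst p) (snd p))"
    unfolding d_def by (intro continuous_intros) (use cf' in simp)
  have dt: "d x s = - divergence (\<lambda>y. j y s) x" if "x \<in> \<Omega>" "s > 0" for x s
  proof -
    have "{0..} \<inter> {0<..} - {s} = UNIV \<inter> {0<..} - {s}" by auto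
    from at_within_nhd[OF _ _ this] that(2) have "at s within {0..} = at s" by simp
    then have "((\<lambda>s. \<rho> x s) has_real_derivative d x s) (at s)"
      using dd[OF that(1), of s] that(2) by (simp add: has_real_derivative_iff_has_vector_derivative)
    then have "deriv (\<lambda>s. \<rho> x s) s = d x s" by (rule DERIV_imp_deriv)
    then show ?thesis using eq[OF that] by simp
  qed
  define F where "F = (\<lambda>s x. indicator {0..t} s *\<^sub>R (\<phi> x * d x s))"
  have "integrable lborel (\<lambda>q. indicator ({0..t} \<times> ?K) q *\<^sub>R (\<phi> (snd q) * d (snd q) (fst q)))"
  proof (rule borel_integrable_compact)
    show "compact ({0..t} \<times> ?K)" by (intro compact_Times K compact_Icc)
    have sw: "continuous_on ({0..t} \<times> ?K) (\<lambda>q. (snd q, fst q))" by (intro continuous_intros)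
    have "continuous_on ({0..t} \<times> ?K) (\<lambda>q. (\<lambda>p. d (fst p) (snd p)) (snd q, fst q))"
      by (rule continuous_on_compose2[OF cd sw]) (use K in auto)
    moreover have "continuous_on ({0..t} \<times> ?K) (\<lambda>q. \<phi> (snd q))"
      by (rule continuous_on_compose2[OF test_fun_continuous[OF \<phi>]]) (auto intro: continuous_intros)
    ultimately show "continuous_on ({0..t} \<times> ?K) (\<lambda>q. \<phi> (snd q) * d (snd q) (fst q))"
      by (intro continuous_on_mult) auto
  qed
  also have "(\<lambda>q. indicator ({0..t} \<times> ?K) q *\<^sub>R (\<phi> (snd q) * d (snd q) (fst q))) = case_prod F"
  proof
    fix q :: "real \<times> (real^3)"
    show "indicator ({0..t} \<times> ?K) q *\<^sub>R (\<phi> (snd q) * d (snd q) (fst q)) = case_prod F q"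
    proof (cases "snd q \<in> ?K")
      case True
      then show ?thesis by (cases q) (simp add: F_def indicator_def)
    next
      case False
      then have "\<phi> (snd q) = 0" by (rule test_fun_zero[OF \<phi>])
      then show ?thesis by (cases q) (simp add: F_def)
    qed
  qed
  finally have F: "integrable (lborel \<Otimes>\<^sub>M lborel) (case_prod F)" by (simp add: lborel_prod)
  have Fs: "(LINT s|lborel. F s x) = \<phi> x *\<^sub>R \<rho> x t - \<phi> x *\<^sub>R \<rho> x 0" for x
  proof (cases "x \<in> \<Omega>")
    case True
    have "(LINT s|lborel. indicator {0..t} s *\<^sub>R (\<phi> x * d x s)) = \<phi> x * \<rho> x t - \<phi> x * \<rho> x 0"
    proof (rule integral_FTC_atLeastAtMost[OF t])
      fix s assume "0 \<le> s" "s \<le> t"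
      have "((\<lambda>s. \<rho> x s) has_vector_derivative d x s) (at s within {0..t})"
        by (rule has_vector_derivative_within_subset[OF dd[OF True \<open>0 \<le> s\<close>]]) auto
      then show "((\<lambda>s. \<phi> x * \<rho> x s) has_vector_derivative \<phi> x * d x s) (at s within {0..t})"
        by (rule has_vector_derivative_mult_right)
    next
      have "continuous_on {0..t} (\<lambda>s. (\<lambda>p. d (fst p) (snd p)) (x, s))"
        by (rule continuous_on_compose2[OF cd]) (use True in \<open>auto intro!: continuous_on_Pair continuous_on_const continuous_on_id\<close>)
      then show "continuous_on {0..t} (\<lambda>s. \<phi> x * d x s)" by (intro continuous_intros) simp
    qed
    then show ?thesis by (simp add: F_def)
  next
    case False
    then show ?thesis using test_fun_outside[OF \<phi>] by (simp add: F_def)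
  qed
  \<comment> \<open>at time \<open>0\<close> the continuity equation is not assumed; a single time is negligible\<close>
  have Fx: "(LINT x|lborel. F s x) = indicator {0..t} s *\<^sub>R (\<Sum>m\<in>UNIV. dist_of \<Omega> (\<lambda>x. j x s $ m) (partial_deriv m \<phi>))" if s: "s \<noteq> 0" for s
  proof (cases "s \<in> {0..t}")
    case True
    then have s0: "s > 0" using s by auto
    have C: "C1_on \<Omega> (\<lambda>x. j x s $ m)" for m by (rule C1_on_slice[OF j]) (use s0 in simp)
    have i: "integrable lborel (\<lambda>x. \<phi> x *\<^sub>R partial_deriv m (\<lambda>y. j y s $ m) x)" for m
      by (rule test_fun_scaleR_integrable[OF \<phi> continuous_loc_integrable[OF C1_onD(2)[OF C \<Omega>]]])
    have "F s x = - (\<Sum>m\<in>UNIV. \<phi> x *\<^sub>R partial_deriv m (\<lambda>y. j y s $ m) x)" for x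
      using True dt[OF _ s0, of x] test_fun_outside[OF \<phi>, of x]
      by (cases "x \<in> \<Omega>") (simp_all add: F_def divergence_def sum_distrib_left)
    then have "(LINT x|lborel. F s x) = - (LINT x|lborel. (\<Sum>m\<in>UNIV. \<phi> x *\<^sub>R partial_deriv m (\<lambda>y. j y s $ m) x))"
      by (simp only: Bochner_Integration.integral_minus)
    also have "(LINT x|lborel. (\<Sum>m\<in>UNIV. \<phi> x *\<^sub>R partial_deriv m (\<lambda>y. j y s $ m) x)) = (\<Sum>m\<in>UNIV. dist_of \<Omega> (partial_deriv m (\<lambda>y. j y s $ m)) \<phi>)"
      unfolding dist_of_eq[OF \<phi>] by (rule Bochner_Integration.integral_sum) (rule i)
    also have "- \<dots> = (\<Sum>m\<in>UNIV. dist_of \<Omega> (\<lambda>x. j x s $ m) (partial_deriv m \<phi>))"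
      unfolding C1_by_parts[OF C \<Omega> \<phi>] sum_negf by simp
    finally show ?thesis using True by simp
  qed (simp add: F_def)
  have i\<rho>: "integrable lborel (\<lambda>x. \<phi> x *\<^sub>R \<rho> x s)" if "s \<ge> 0" for s
  proof (rule test_fun_scaleR_integrable[OF \<phi> continuous_loc_integrable])
    have "continuous_on \<Omega> (\<lambda>x. (\<lambda>(x, t). \<rho> x t) (x, s))"
      by (rule continuous_on_compose2[OF C1_on_continuous[OF \<rho>]]) (use that in \<open>auto intro!: continuous_intros\<close>)
    then show "continuous_on \<Omega> (\<lambda>x. \<rho> x s)" by simp
  qed
  have "dist_of \<Omega> (\<lambda>x. \<rho> x t) \<phi> - dist_of \<Omega> (\<lambda>x. \<rho> x 0) \<phi> = (LINT x|lborel. (LINT s|lborel. F s x))"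
    unfolding dist_of_eq[OF \<phi>] Fs using i\<rho> t by simp
  also have "\<dots> = (LINT s|lborel. (LINT x|lborel. F s x))"
    using lborel_pair.Fubini_integral[OF F] by simp
  also have "\<dots> = (LINT s:{0..t}|lborel. (\<Sum>m\<in>UNIV. dist_of \<Omega> (\<lambda>x. j x s $ m) (partial_deriv m \<phi>)))"
    unfolding set_lebesgue_integral_def
  proof (rule integral_cong_AE)
    show "(\<lambda>s. LINT x|lborel. F s x) \<in> borel_measurable lborel"
      using lborel_pair.integrable_fst'[OF F] by auto
    show ae: "AE s in lborel. (LINT x|lborel. F s x) = indicator {0..t} s *\<^sub>R (\<Sum>m\<in>UNIV. dist_of \<Omega> (\<lambda>x. j x s $ m) (partial_deriv m \<phi>))"
      using AE_lborel_singleton[of 0] by eventually_elim (rule Fx)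
    have "(\<lambda>s. indicator {0..t} s *\<^sub>R (\<Sum>m\<in>UNIV. dist_of \<Omega> (\<lambda>x. j x s $ m) (partial_deriv m \<phi>)))
      = (\<lambda>s. if s = 0 then indicator {0..t} (0::real) *\<^sub>R (\<Sum>m\<in>UNIV. dist_of \<Omega> (\<lambda>x. j x 0 $ m) (partial_deriv m \<phi>)) else (LINT x|lborel. F s x))"
      by (auto simp: Fx)
    then show "(\<lambda>s. indicator {0..t} s *\<^sub>R (\<Sum>m\<in>UNIV. dist_of \<Omega> (\<lambda>x. j x s $ m) (partial_deriv m \<phi>))) \<in> borel_measurable lborel"
      using lborel_pair.integrable_fst'[OF F] by auto
  qed
  finally show ?thesis .
qed

context square_integrable_source
begin

text \<open>This lemma and the next one spell out \<open>D U = - div V + \<nabla> u\<^sub>0 + curl V\<close>.\<close>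

lemma evolution_Sc: "Sc (evolution \<phi> t) = Sc (src_pairing \<phi> t) - \<i> * (\<Sum>m\<in>UNIV. Vec (pairing (partial_deriv m \<phi>) t) $ m)"
  by (simp add: evolution_def unit_def sum_3 bmult_def axis_def algebra_simps)

lemma evolution_Vec:
  "Vec (evolution \<phi> t) $ 1 = Vec (src_pairing \<phi> t) $ 1 + \<i> * (Sc (pairing (partial_deriv 1 \<phi>) t)
     + Vec (pairing (partial_deriv 2 \<phi>) t) $ 3 - Vec (pairing (partial_deriv 3 \<phi>) t) $ 2)"
  "Vec (evolution \<phi> t) $ 2 = Vec (src_pairing \<phi> t) $ 2 + \<i> * (Sc (pairing (partial_deriv 2 \<phi>) t)
     + Vec (pairing (partial_deriv 3 \<phi>) t) $ 1 - Vec (pairing (partial_deriv 1 \<phi>) t) $ 3)"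
  "Vec (evolution \<phi> t) $ 3 = Vec (src_pairing \<phi> t) $ 3 + \<i> * (Sc (pairing (partial_deriv 3 \<phi>) t)
     + Vec (pairing (partial_deriv 1 \<phi>) t) $ 2 - Vec (pairing (partial_deriv 2 \<phi>) t) $ 1)"
  by (simp_all add: evolution_def unit_def sum_3 bmult_def ccross_def axis_def algebra_simps)

lemma pairing_partial_commute:
  assumes \<phi>: "test_fun A \<phi>" and t: "t \<ge> 0"
  shows "pairing (partial_deriv m (partial_deriv n \<phi>)) t = pairing (partial_deriv n (partial_deriv m \<phi>)) t"
proof -
  have "loc_integrable A (\<lambda>x. parabolic_teodorescu w x t)"
    by (rule loc_integrable_L2[OF parabolic_teodorescu_pairing(1)[OF t]])
  from dist_of_partial_commute[OF \<phi> this, of m n] show ?thesis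
    unfolding pairing_def dist_of_eq[OF test_fun_partial[OF test_fun_partial[OF \<phi>]]] .
qed

end

lemma bounded_linear_Re_vec: "bounded_linear Re_vec"
  and bounded_linear_Im_vec: "bounded_linear Im_vec"
proof -
  have "linear Re_vec" "linear Im_vec"
    by (auto intro!: linearI simp: Re_vec_def Im_vec_def vec_eq_iff)
  then show "bounded_linear Re_vec" "bounded_linear Im_vec"
    by (simp_all add: linear_conv_bounded_linear)
qed

lemma Re_vec_nth[simp]: "Re_vec v $ m = Re (v $ m)"
  and Im_vec_nth[simp]: "Im_vec v $ m = Im (v $ m)"
  by (simp_all add: Re_vec_def Im_vec_def)

lemma loc_integrable_add:
  "loc_integrable A f \<Longrightarrow> loc_integrable A g \<Longrightarrow> loc_integrable A (\<lambda>x. f x + g x)"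
  by (auto simp: loc_integrable_def set_integrable_def scaleR_right_distrib)

lemma loc_integrable_diff:
  "loc_integrable A f \<Longrightarrow> loc_integrable A g \<Longrightarrow> loc_integrable A (\<lambda>x. f x - g x)"
  by (auto simp: loc_integrable_def set_integrable_def scaleR_right_diff_distrib)

lemma loc_integrable_bounded_linear:
  fixes f :: "real^3 \<Rightarrow> 'b::euclidean_space" and L :: "'b \<Rightarrow> 'c::euclidean_space"
  assumes L: "bounded_linear L" and f: "loc_integrable A f"
  shows "loc_integrable A (\<lambda>x. L (f x))"
  unfolding loc_integrable_def set_integrable_def
proof (intro allI impI)
  fix K assume "compact K \<and> K \<subseteq> A"
  then have "integrable lborel (\<lambda>x. indicator K x *\<^sub>R f x)"
    using f by (auto simp: loc_integrable_def set_integrable_def)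
  from integrable_bounded_linear[OF L this]
  show "integrable lborel (\<lambda>x. indicator K x *\<^sub>R L (f x))"
    by (simp add: linear_scale[OF bounded_linear.linear[OF L]])
qed

lemma dist_of_bounded_linear:
  fixes f :: "real^3 \<Rightarrow> 'b::euclidean_space" and L :: "'b \<Rightarrow> 'c::euclidean_space"
  assumes \<phi>: "test_fun A \<phi>" and L: "bounded_linear L" and f: "loc_integrable A f"
  shows "dist_of A (\<lambda>x. L (f x)) \<phi> = L (dist_of A f \<phi>)"
  unfolding dist_of_eq[OF \<phi>]
  using integral_bounded_linear[OF L test_fun_scaleR_integrable[OF \<phi> f]]
  by (simp add: linear_scale[OF bounded_linear.linear[OF L]])

lemma dist_of_add:
  assumes \<phi>: "test_fun A \<phi>" and f: "loc_integrable A f" and g: "loc_integrable A g"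
  shows "dist_of A (\<lambda>x. f x + g x) \<phi> = dist_of A f \<phi> + dist_of A g \<phi>"
  unfolding dist_of_eq[OF \<phi>] scaleR_right_distrib
  by (rule Bochner_Integration.integral_add[OF test_fun_scaleR_integrable[OF \<phi> f] test_fun_scaleR_integrable[OF \<phi> g]])

lemma dist_of_diff:
  assumes \<phi>: "test_fun A \<phi>" and f: "loc_integrable A f" and g: "loc_integrable A g"
  shows "dist_of A (\<lambda>x. f x - g x) \<phi> = dist_of A f \<phi> - dist_of A g \<phi>"
  unfolding dist_of_eq[OF \<phi>] scaleR_right_diff_distrib
  by (rule Bochner_Integration.integral_diff[OF test_fun_scaleR_integrable[OF \<phi> f] test_fun_scaleR_integrable[OF \<phi> g]])

lemma harmonic_grad_continuous:
  assumes h: "harmonic_on A h" and A: "open A"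
  shows "continuous_on A (grad h)"
  unfolding grad_def[abs_def] using h C1_onD(2)[OF _ A, of h]
  by (auto simp: harmonic_on_def intro!: continuous_intros)

lemma dist_of_grad_nth:
  assumes h: "harmonic_on A h" and A: "open A" and \<phi>: "test_fun A \<phi>"
  shows "dist_of A (grad h) \<phi> $ m = dist_of A (partial_deriv m h) \<phi>"
  using dist_of_bounded_linear[OF \<phi> bounded_linear_vec_nth continuous_loc_integrable[OF harmonic_grad_continuous[OF h A]], of m]
  by (simp add: grad_def)

lemma wpartial_nth:
  fixes F :: "real^3 \<Rightarrow> real^3"
  assumes "test_fun A \<phi>" "loc_integrable A F"
  shows "wpartial A m (\<lambda>x. F x $ n) \<phi> = - dist_of A F (partial_deriv m \<phi>) $ n"
  unfolding wpartial_def by (subst dist_of_bounded_linear[OF test_fun_partial[OF assms(1)] bounded_linear_vec_nth assms(2)]) simp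

context continuous_source
begin

text \<open>The electric and the magnetic field are of this form, with \<open>P\<close> and \<open>L\<close> real and imaginary parts up to sign and
  with the Teodorescu transform as \<open>S\<close>.\<close>

definition field :: "(complex^3 \<Rightarrow> real^3) \<Rightarrow> (complex^3 \<Rightarrow> real^3) \<Rightarrow> (real^3 \<Rightarrow> complex^3) \<Rightarrow> (real^3 \<Rightarrow> real) \<Rightarrow> real^3 \<Rightarrow> real \<Rightarrow> real^3" where
  "field P L S h x t = P (Vec (parabolic_teodorescu w x t)) + L (integral_grad \<Omega> u\<^sub>0 x t - S x) + grad h x"

lemma field_pairing:
  assumes P: "bounded_linear P" and L: "bounded_linear L" and S: "loc_integrable \<Omega> S"
    and h: "harmonic_on \<Omega> h" and t: "t \<ge> 0"
  shows field_loc_integrable: "loc_integrable \<Omega> (\<lambda>x. field P L S h x t)"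
    and "test_fun \<Omega> \<phi> \<Longrightarrow> dist_of \<Omega> (\<lambda>x. field P L S h x t) \<phi> = P (Vec (pairing \<phi> t))
      + L (dist_of \<Omega> (\<lambda>x. integral_grad \<Omega> u\<^sub>0 x t) \<phi> - dist_of \<Omega> S \<phi>) + dist_of \<Omega> (grad h) \<phi>"
proof -
  have PV: "bounded_linear (\<lambda>p. P (Vec p))" by (rule bounded_linear_compose[OF P bounded_linear_snd])
  have U: "loc_integrable \<Omega> (\<lambda>x. parabolic_teodorescu w x t)"
    by (rule loc_integrable_L2[OF parabolic_teodorescu_pairing(1)[OF t]])
  note a = loc_integrable_bounded_linear[OF PV U]
  note G = integral_grad_pairing(1)[OF t]
  note GS = loc_integrable_diff[OF G S]
  note b = loc_integrable_bounded_linear[OF L GS]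
  note c = continuous_loc_integrable[OF harmonic_grad_continuous[OF h \<Omega>_open]]
  show "loc_integrable \<Omega> (\<lambda>x. field P L S h x t)"
    unfolding field_def by (intro loc_integrable_add a b c)
  assume \<phi>: "test_fun \<Omega> \<phi>"
  have U\<phi>: "dist_of \<Omega> (\<lambda>x. parabolic_teodorescu w x t) \<phi> = pairing \<phi> t"
    unfolding dist_of_eq[OF \<phi>] pairing_def ..
  show "dist_of \<Omega> (\<lambda>x. field P L S h x t) \<phi> = P (Vec (pairing \<phi> t))
      + L (dist_of \<Omega> (\<lambda>x. integral_grad \<Omega> u\<^sub>0 x t) \<phi> - dist_of \<Omega> S \<phi>) + dist_of \<Omega> (grad h) \<phi>"
    unfolding field_def dist_of_add[OF \<phi> loc_integrable_add[OF a b] c] dist_of_add[OF \<phi> a b]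
      dist_of_bounded_linear[OF \<phi> PV U] dist_of_bounded_linear[OF \<phi> L GS] dist_of_diff[OF \<phi> G S] U\<phi> ..
qed

lemma integral_grad_has_vector_derivative:
  assumes \<phi>: "test_fun \<Omega> \<phi>" and t: "t \<ge> 0"
  shows "((\<lambda>s. dist_of \<Omega> (\<lambda>x. integral_grad \<Omega> u\<^sub>0 x s) \<phi>) has_vector_derivative (\<chi> m. - Sc (pairing (partial_deriv m \<phi>) t))) (at t within {0..})"
proof (rule has_vector_derivative_set_lebesgue_integral[OF _ _ t])
  show "continuous_on {0..} (\<lambda>s. \<chi> m. - Sc (pairing (partial_deriv m \<phi>) s))"
    by (intro continuous_intros continuous_on_pairing test_fun_partial \<phi>)
  fix s :: real assume s: "s \<ge> 0"
  show "dist_of \<Omega> (\<lambda>x. integral_grad \<Omega> u\<^sub>0 x s) \<phi> = (LINT r:{0..s}|lborel. (\<chi> m. - Sc (pairing (partial_deriv m \<phi>) r)))"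
    unfolding integral_grad_pairing(2)[OF s \<phi>]
    by (intro set_lebesgue_integral_cong) (auto simp: wgrad_u\<^sub>0[OF \<phi>])
qed

lemma integral_grad_nth:
  assumes \<phi>: "test_fun \<Omega> \<phi>" and t: "t \<ge> 0"
  shows "dist_of \<Omega> (\<lambda>x. integral_grad \<Omega> u\<^sub>0 x t) \<phi> $ m = - (LINT s:{0..t}|lborel. Sc (pairing (partial_deriv m \<phi>) s))"
proof -
  have "dist_of \<Omega> (\<lambda>x. integral_grad \<Omega> u\<^sub>0 x t) \<phi> $ m = (LINT s|lborel. (indicator {0..t} s *\<^sub>R wgrad \<Omega> (\<lambda>y. u\<^sub>0 y s) \<phi>) $ m)"
    unfolding integral_grad_pairing(2)[OF t \<phi>] set_lebesgue_integral_def
    using integral_bounded_linear[OF bounded_linear_vec_nth wgrad_u\<^sub>0_set_integrable[OF \<phi>, of t, unfolded set_integrable_def], of m] by simp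
  also have "\<dots> = (LINT s|lborel. - (indicator {0..t} s *\<^sub>R Sc (pairing (partial_deriv m \<phi>) s)))"
  proof (rule Bochner_Integration.integral_cong[OF refl])
    fix s
    show "(indicator {0..t} s *\<^sub>R wgrad \<Omega> (\<lambda>y. u\<^sub>0 y s) \<phi>) $ m = - (indicator {0..t} s *\<^sub>R Sc (pairing (partial_deriv m \<phi>) s))"
      by (cases "s \<in> {0..t}") (simp_all add: wgrad_u\<^sub>0[OF \<phi>])
  qed
  finally show ?thesis by (simp add: set_lebesgue_integral_def)
qed

lemma integral_grad_curl:
  assumes \<phi>: "test_fun \<Omega> \<phi>" and t: "t \<ge> 0"
  shows "dist_of \<Omega> (\<lambda>x. integral_grad \<Omega> u\<^sub>0 x t) (partial_deriv m \<phi>) $ n = dist_of \<Omega> (\<lambda>x. integral_grad \<Omega> u\<^sub>0 x t) (partial_deriv n \<phi>) $ m"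
  unfolding integral_grad_nth[OF test_fun_partial[OF \<phi>] t]
  by (auto intro!: set_lebesgue_integral_cong simp: pairing_partial_commute[OF \<phi>, of _ n m])

lemma field_has_vector_derivative:
  assumes P: "bounded_linear P" and L: "bounded_linear L" and S: "loc_integrable \<Omega> S"
    and h: "harmonic_on \<Omega> h" and t: "t \<ge> 0" and \<phi>: "test_fun \<Omega> \<phi>"
  shows "((\<lambda>s. dist_of \<Omega> (\<lambda>x. field P L S h x s) \<phi>) has_vector_derivative
    P (Vec (evolution \<phi> t)) + L (\<chi> m. - Sc (pairing (partial_deriv m \<phi>) t))) (at t within {0..})"
proof -
  have PV: "bounded_linear (\<lambda>p. P (Vec p))" by (rule bounded_linear_compose[OF P bounded_linear_snd])
  have "((\<lambda>s. P (Vec (pairing \<phi> s)) + L (dist_of \<Omega> (\<lambda>x. integral_grad \<Omega> u\<^sub>0 x s) \<phi> - dist_of \<Omega> S \<phi>) + dist_of \<Omega> (grad h) \<phi>)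
    has_vector_derivative P (Vec (evolution \<phi> t)) + L ((\<chi> m. - Sc (pairing (partial_deriv m \<phi>) t)) - 0) + 0) (at t within {0..})"
    by (intro has_vector_derivative_add has_vector_derivative_const has_vector_derivative_diff
        bounded_linear.has_vector_derivative[OF PV pairing_has_vector_derivative[OF \<phi> t]]
        bounded_linear.has_vector_derivative[OF L] integral_grad_has_vector_derivative[OF \<phi> t])
  then have "((\<lambda>s. P (Vec (pairing \<phi> s)) + L (dist_of \<Omega> (\<lambda>x. integral_grad \<Omega> u\<^sub>0 x s) \<phi> - dist_of \<Omega> S \<phi>) + dist_of \<Omega> (grad h) \<phi>)
    has_vector_derivative P (Vec (evolution \<phi> t)) + L (\<chi> m. - Sc (pairing (partial_deriv m \<phi>) t))) (at t within {0..})"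
    by simp
  then show ?thesis
    by (rule has_vector_derivative_transform[rotated 2])
      (use t field_pairing(2)[OF P L S h _ \<phi>] in auto)
qed

text \<open>The time integral of \<open>\<nabla> u\<^sub>0\<close>, the field \<open>S\<close> and \<open>\<nabla> h\<close> are curl free, and this is preserved by \<open>L\<close> because \<open>L\<close>
  acts in the same way on each component.\<close>

lemma field_wcurl:
  assumes P: "bounded_linear P" and L: "bounded_linear L" and S: "loc_integrable \<Omega> S"
    and Sc: "\<And>m n. dist_of \<Omega> S (partial_deriv m \<phi>) $ n = dist_of \<Omega> S (partial_deriv n \<phi>) $ m"
    and h: "harmonic_on \<Omega> h" and t: "t \<ge> 0" and \<phi>: "test_fun \<Omega> \<phi>"
    and Lc: "\<And>a b m n. a $ m = b $ n \<Longrightarrow> L a $ m = L b $ n"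
  defines "p \<equiv> \<lambda>m n. P (Vec (pairing (partial_deriv m \<phi>) t)) $ n"
  shows "wcurl \<Omega> (\<lambda>x. field P L S h x t) \<phi> = - vector [p 2 3 - p 3 2, p 3 1 - p 1 3, p 1 2 - p 2 1]"
proof -
  define F where "F m n = dist_of \<Omega> (\<lambda>x. field P L S h x t) (partial_deriv m \<phi>) $ n" for m n
  define r where "r m n = L (dist_of \<Omega> (\<lambda>x. integral_grad \<Omega> u\<^sub>0 x t) (partial_deriv m \<phi>) - dist_of \<Omega> S (partial_deriv m \<phi>)) $ n + dist_of \<Omega> (grad h) (partial_deriv m \<phi>) $ n" for m n
  have F: "F m n = p m n + r m n" for m n
    unfolding F_def p_def r_def field_pairing(2)[OF P L S h t test_fun_partial[OF \<phi>]] by simp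
  have r: "r m n = r n m" for m n
    unfolding r_def
    using integral_grad_curl[OF \<phi> t, of m n] Sc[of m n] harmonic_grad(1)[OF h \<Omega>_open \<phi>, of n m]
    by (intro arg_cong2[where f = "(+)"] Lc) (simp_all add: dist_of_grad_nth[OF h \<Omega>_open test_fun_partial[OF \<phi>]])
  have w: "wpartial \<Omega> m (\<lambda>x. field P L S h x t $ n) \<phi> = - F m n" for m n
    unfolding F_def by (rule wpartial_nth[OF \<phi> field_loc_integrable[OF P L S h t]])
  show ?thesis
    unfolding wcurl_def w F by (simp add: vec_eq_iff forall_3 r[of 2 1] r[of 3 1] r[of 3 2])
qed

end

theorem theorem13:
  fixes \<Omega> :: "(real^3) set"
    and \<rho> :: "real^3 \<Rightarrow> real \<Rightarrow> real"
    and j :: "real^3 \<Rightarrow> real \<Rightarrow> real^3"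
    and h\<^sub>1 h\<^sub>2 :: "real^3 \<Rightarrow> real"
    and w :: "real^3 \<Rightarrow> real \<Rightarrow> biquat"
    and u\<^sub>0 :: "real^3 \<Rightarrow> real \<Rightarrow> complex"
    and E B :: "real^3 \<Rightarrow> real \<Rightarrow> real^3"
  assumes "open \<Omega>" and "connected \<Omega>" and "\<Omega> \<noteq> {}" and "bounded \<Omega>"
    and "C1_on (\<Omega> \<times> {0..}) (\<lambda>(x, t). \<rho> x t)"
    and "C1_on (\<Omega> \<times> {0..}) (\<lambda>(x, t). j x t)"
    and "\<And>x t. x \<in> \<Omega> \<Longrightarrow> t > 0 \<Longrightarrow> divergence (\<lambda>y. j y t) x + deriv (\<lambda>s. \<rho> x s) t = 0"
    and "harmonic_on \<Omega> h\<^sub>1" and "harmonic_on \<Omega> h\<^sub>2"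
    and w_def: "\<And>x t. w x t =
      (if x \<in> \<Omega> then (- 4 * pi * \<i>) *\<^sub>B (complex_of_real (\<rho> x t), - (\<i> *s cvec (j x t))) else 0)"
    and "L1loc_L2 w"
    and u\<^sub>0_def: "\<And>x t. u\<^sub>0 x t = Sc (parabolic_teodorescu w x t)"
    and E_def: "\<And>x t. E x t =
      Re_vec (Vec (parabolic_teodorescu w x t))
      - Im_vec (integral_grad \<Omega> u\<^sub>0 x t - Vec (teodorescu \<Omega> (\<lambda>y. (time_deriv \<Omega> u\<^sub>0 y 0, 0)) x))
      + grad h\<^sub>1 x"
    and B_def: "\<And>x t. B x t =
      Im_vec (Vec (parabolic_teodorescu w x t))
      + Re_vec (integral_grad \<Omega> u\<^sub>0 x t - Vec (teodorescu \<Omega> (\<lambda>y. (time_deriv \<Omega> u\<^sub>0 y 0, 0)) x))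
      + grad h\<^sub>2 x"
  shows "maxwell_solution \<Omega> \<rho> j E B"
proof -
  note \<Omega>_open = \<open>open \<Omega>\<close>
  note \<rho>_C1 = \<open>C1_on (\<Omega> \<times> {0..}) (\<lambda>(x, t). \<rho> x t)\<close> and j_C1 = \<open>C1_on (\<Omega> \<times> {0..}) (\<lambda>(x, t). j x t)\<close>
  note h1 = \<open>harmonic_on \<Omega> h\<^sub>1\<close> and h2 = \<open>harmonic_on \<Omega> h\<^sub>2\<close>
  have wc: "continuous_on (\<Omega> \<times> {0..}) (\<lambda>p. w (fst p) (snd p))"
  proof (rule continuous_on_eq)
    have c: "continuous_on (\<Omega> \<times> {0..}) (\<lambda>p. \<rho> (fst p) (snd p))" "continuous_on (\<Omega> \<times> {0..}) (\<lambda>p. j (fst p) (snd p))"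
      using C1_on_continuous[OF \<rho>_C1] C1_on_continuous[OF j_C1] by (simp_all add: split_beta')
    show "continuous_on (\<Omega> \<times> {0..}) (\<lambda>p. (- 4 * pi * \<i>) *\<^sub>B ((complex_of_real (\<rho> (fst p) (snd p)), 0) - \<i> *\<^sub>B (0, cvec (j (fst p) (snd p)))))"
      by (intro cscale.continuous_on continuous_on_const continuous_on_diff continuous_on_Pair continuous_on_of_real
          bounded_linear.continuous_on[OF bounded_linear_cvec] c)
  qed (auto simp: w_def cscale_def)
  have wm: "(\<lambda>p. indicator {0..} (fst p) *\<^sub>R w (snd p) (fst p)) \<in> borel_measurable (lborel \<Otimes>\<^sub>M lborel)"
  proof -
    have sw: "continuous_on ({0..} \<times> \<Omega>) (\<lambda>q::real \<times> (real^3). (snd q, fst q))" by (intro continuous_intros)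
    have "continuous_on ({0..} \<times> \<Omega>) (\<lambda>q. (\<lambda>p. w (fst p) (snd p)) (snd q, fst q))"
      by (rule continuous_on_compose2[OF wc sw]) auto
    then have "(\<lambda>q. indicator ({0..} \<times> \<Omega>) q *\<^sub>R w (snd q) (fst q)) \<in> borel_measurable borel"
      by (intro borel_measurable_continuous_on_indicator borel_Times) (use \<Omega>_open in auto)
    also have "(\<lambda>q. indicator ({0..} \<times> \<Omega>) q *\<^sub>R w (snd q) (fst q)) = (\<lambda>p. indicator {0..} (fst p) *\<^sub>R w (snd p) (fst p))"
      by (auto simp: indicator_def w_def fun_eq_iff)
    finally show ?thesis by (simp add: lborel_prod)
  qed
  interpret cs: continuous_source w \<Omega>
    by unfold_locales (use \<Omega>_open \<open>bounded \<Omega>\<close> \<open>L1loc_L2 w\<close> wm wc in \<open>auto simp: w_def\<close>)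
  have u\<^sub>0: "u\<^sub>0 = cs.u\<^sub>0" by (simp add: fun_eq_iff u\<^sub>0_def cs.u\<^sub>0_def)

  have w_Sc: "Sc (w x t) = (if x \<in> \<Omega> then - 4 * pi * \<i> * \<rho> x t else 0)" for x t by (simp add: w_def)
  have w_Vec: "Vec (w x t) $ m = (if x \<in> \<Omega> then - 4 * pi * complex_of_real (j x t $ m) else 0)" for x t m
    by (simp add: w_def cvec_def algebra_simps)
  have src_Sc: "Sc (cs.src_pairing \<phi> t) = - 4 * pi * \<i> * dist_of \<Omega> (\<lambda>x. \<rho> x t) \<phi>" if \<phi>: "test_fun \<Omega> \<phi>" and t: "t \<ge> 0" for \<phi> t
  proof -
    have i: "integrable lborel (\<lambda>x. \<phi> x *\<^sub>R w x t)"
      by (rule test_fun_scaleR_integrable[OF \<phi> loc_integrable_L2[OF cs.w_L2[OF t]]])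
    have "Sc (cs.src_pairing \<phi> t) = (LINT x|lborel. (- 4 * pi * \<i>) * complex_of_real (\<phi> x *\<^sub>R \<rho> x t))"
      unfolding cs.src_pairing_def integral_Sc[OF i] using test_fun_outside[OF \<phi>]
      by (intro Bochner_Integration.integral_cong) (auto simp: w_Sc scaleR_conv_of_real)
    also have "\<dots> = (- 4 * pi * \<i>) * complex_of_real (LINT x|lborel. \<phi> x *\<^sub>R \<rho> x t)"
      by (simp only: integral_mult_right_zero integral_complex_of_real)
    finally show ?thesis by (simp add: dist_of_eq[OF \<phi>])
  qed
  have src_Vec: "Vec (cs.src_pairing \<phi> t) $ m = - 4 * pi * complex_of_real (dist_of \<Omega> (\<lambda>x. j x t $ m) \<phi>)" if \<phi>: "test_fun \<Omega> \<phi>" and t: "t \<ge> 0" for \<phi> t m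
  proof -
    have i: "integrable lborel (\<lambda>x. \<phi> x *\<^sub>R w x t)"
      by (rule test_fun_scaleR_integrable[OF \<phi> loc_integrable_L2[OF cs.w_L2[OF t]]])
    have "Vec (cs.src_pairing \<phi> t) $ m = (LINT x|lborel. (- 4 * pi) * complex_of_real (\<phi> x *\<^sub>R (j x t $ m)))"
      unfolding cs.src_pairing_def integral_Vec[OF i] using test_fun_outside[OF \<phi>]
      by (intro Bochner_Integration.integral_cong) (auto simp: w_Vec scaleR_conv_of_real[where 'a=complex])
    also have "\<dots> = (- 4 * pi) * complex_of_real (LINT x|lborel. \<phi> x *\<^sub>R (j x t $ m))"
      by (simp only: integral_mult_right_zero integral_complex_of_real)
    finally show ?thesis by (simp add: dist_of_eq[OF \<phi>])
  qed

  \<comment> \<open>The scalar part of the evolution equation at time \<open>0\<close>, where \<open>U\<close> vanishes, shows that \<open>f\<close> represents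
    \<open>\<partial>\<^sub>t u\<^sub>0(0)\<close>; the representative \<open>g\<close> chosen by \<open>time_deriv\<close> agrees with it almost everywhere.\<close>
  define f where "f x = Sc (w x 0)" for x
  have fi: "integrable lborel f" unfolding f_def by (rule integrable_Sc[OF cs.w_integrable]) simp
  have f\<Omega>: "indicator \<Omega> x *\<^sub>R f x = f x" for x by (simp add: f_def w_Sc)
  have f_loc: "loc_integrable \<Omega> f"
    unfolding f_def by (rule loc_integrable_bounded_linear[OF bounded_linear_fst loc_integrable_L2[OF cs.w_L2]]) simp
  have f_dist: "dist_of \<Omega> f \<phi> = - 4 * pi * \<i> * dist_of \<Omega> (\<lambda>x. \<rho> x 0) \<phi>" if \<phi>: "test_fun \<Omega> \<phi>" for \<phi>
  proof -
    have "dist_of \<Omega> f \<phi> = Sc (cs.src_pairing \<phi> 0)"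
      unfolding f_def dist_of_bounded_linear[OF \<phi> bounded_linear_fst loc_integrable_L2[OF cs.w_L2[OF order_refl]]]
      by (simp add: dist_of_eq[OF \<phi>] cs.src_pairing_def)
    then show ?thesis by (simp add: src_Sc[OF \<phi>])
  qed

  define g where "g x = time_deriv \<Omega> u\<^sub>0 x 0" for x
  have f_deriv: "((\<lambda>s. dist_of \<Omega> (\<lambda>x. u\<^sub>0 x s) \<phi>) has_vector_derivative dist_of \<Omega> f \<phi>) (at 0 within {0..})" if \<phi>: "test_fun \<Omega> \<phi>" for \<phi>
  proof -
    have "Sc (cs.evolution \<phi> 0) = dist_of \<Omega> f \<phi>"
      unfolding cs.evolution_Sc by (simp add: cs.pairing_0[OF test_fun_partial[OF \<phi>]] src_Sc[OF \<phi>] f_dist[OF \<phi>])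
    with bounded_linear.has_vector_derivative[OF bounded_linear_fst cs.pairing_has_vector_derivative[OF \<phi> order_refl]]
    have "((\<lambda>s. Sc (cs.pairing \<phi> s)) has_vector_derivative dist_of \<Omega> f \<phi>) (at 0 within {0..})" by simp
    then show ?thesis
      by (rule has_vector_derivative_transform[rotated 2]) (auto simp: u\<^sub>0 cs.dist_of_Sc[OF \<phi>])
  qed
  have "\<exists>g. loc_integrable \<Omega> g \<and> has_wtime_deriv \<Omega> u\<^sub>0 (dist_of \<Omega> g) 0"
    using f_loc f_deriv by (auto simp: has_wtime_deriv_def)
  from someI_ex[OF this] have g: "loc_integrable \<Omega> g" "has_wtime_deriv \<Omega> u\<^sub>0 (dist_of \<Omega> g) 0"
    unfolding g_def time_deriv_def by auto
  have g_dist: "dist_of \<Omega> g \<phi> = dist_of \<Omega> f \<phi>" if \<phi>: "test_fun \<Omega> \<phi>" for \<phi>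
  proof (rule vector_derivative_unique_within)
    show "at (0::real) within {0..} \<noteq> bot" by (simp add: at_within_Ici_at_right)
    show "((\<lambda>s. dist_of \<Omega> (\<lambda>x. u\<^sub>0 x s) \<phi>) has_vector_derivative dist_of \<Omega> g \<phi>) (at 0 within {0..})"
      using g(2) \<phi> by (simp add: has_wtime_deriv_def)
  qed (rule f_deriv[OF \<phi>])
  have ae: "AE x in lborel. x \<in> \<Omega> \<longrightarrow> g x - f x = 0"
    by (rule dist_of_zero_imp_AE[OF \<Omega>_open loc_integrable_diff[OF g(1) f_loc]])
      (simp add: dist_of_diff[OF _ g(1) f_loc] g_dist)
  have T_eq: "teodorescu \<Omega> (\<lambda>y. (g y, 0)) x = teodorescu \<Omega> (\<lambda>y. (f y, 0)) x" for x
  proof -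
    have m: "(\<lambda>y. indicator \<Omega> y *\<^sub>R g y) \<in> borel_measurable borel" "(\<lambda>y. indicator \<Omega> y *\<^sub>R f y) \<in> borel_measurable borel"
      by (rule loc_integrable_measurable[OF \<Omega>_open g(1)], rule loc_integrable_measurable[OF \<Omega>_open f_loc])
    have eq: "indicator \<Omega> y *\<^sub>R (cauchy_kernel (y - x) \<star> (a y, 0)) = (indicator \<Omega> y *\<^sub>R a y) *\<^sub>B cauchy_kernel (y - x)" for a y
      by (simp add: cauchy_kernel_bmult cscale.scaleR_left)
    show ?thesis
      unfolding teodorescu_def set_lebesgue_integral_def eq
    proof (rule arg_cong[where f = uminus], rule integral_cong_AE)
      show "AE y in lborel. (indicator \<Omega> y *\<^sub>R g y) *\<^sub>B cauchy_kernel (y - x) = (indicator \<Omega> y *\<^sub>R f y) *\<^sub>B cauchy_kernel (y - x)"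
        using ae by eventually_elim (auto simp: indicator_def)
    qed (use m in measurable)
  qed

  interpret ts: teodorescu_scalar \<Omega> f
    by unfold_locales (use \<Omega>_open \<open>bounded \<Omega>\<close> fi f\<Omega> in \<open>auto simp: set_integrable_def\<close>)
  define S where "S x = Vec (teodorescu \<Omega> (\<lambda>y. (f y, 0)) x)" for x
  have S: "loc_integrable \<Omega> S"
    unfolding S_def by (rule loc_integrable_bounded_linear[OF bounded_linear_snd ts.teodorescu_loc_integrable])
  have S_nth: "dist_of \<Omega> S \<phi> $ n = dist_of \<Omega> (\<lambda>x. Vec (teodorescu \<Omega> (\<lambda>y. (f y, 0)) x) $ n) \<phi>" if "test_fun \<Omega> \<phi>" for \<phi> n
    using dist_of_bounded_linear[OF that bounded_linear_vec_nth S, of n] by (simp add: S_def)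
  have S_curl: "dist_of \<Omega> S (partial_deriv m \<phi>) $ n = dist_of \<Omega> S (partial_deriv n \<phi>) $ m" if \<phi>: "test_fun \<Omega> \<phi>" for \<phi> m n
    unfolding S_nth[OF test_fun_partial[OF \<phi>]] by (rule ts.teodorescu_curl[OF \<phi>])
  have S_div: "(\<Sum>m\<in>UNIV. dist_of \<Omega> S (partial_deriv m \<phi>) $ m) = - 4 * pi * \<i> * dist_of \<Omega> (\<lambda>x. \<rho> x 0) \<phi>" if \<phi>: "test_fun \<Omega> \<phi>" for \<phi>
    unfolding S_nth[OF test_fun_partial[OF \<phi>]] ts.teodorescu_div[OF \<phi>] f_dist[OF \<phi>] ..

  have bI: "bounded_linear (\<lambda>v. - Im_vec v)" by (rule bounded_linear_minus[OF bounded_linear_Im_vec])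
  note bR = bounded_linear_Re_vec and bM = bounded_linear_Im_vec
  \<comment> \<open>\<open>E\<close> and \<open>B\<close> are the real and the imaginary part of \<open>V + i (G - S) + \<nabla> h\<^sub>1 + i \<nabla> h\<^sub>2\<close>\<close>
  have E: "E x t = cs.field Re_vec (\<lambda>v. - Im_vec v) S h\<^sub>1 x t" for x t
    unfolding E_def cs.field_def S_def T_eq[symmetric] u\<^sub>0[symmetric] by (simp add: g_def)
  have B: "B x t = cs.field Im_vec Re_vec S h\<^sub>2 x t" for x t
    unfolding B_def cs.field_def S_def T_eq[symmetric] u\<^sub>0[symmetric] by (simp add: g_def)

  \<comment> \<open>\<open>div (V + i G) = 4 \<pi> (\<rho>(t) - \<rho>(0))\<close>: in the divergence of the vector part of the evolution equation the
    curl drops out because second derivatives commute, and \<open>J\<close> is the weak form of \<open>- div j\<close>\<close>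
  have div: "(\<Sum>m\<in>UNIV. Vec (cs.pairing (partial_deriv m \<phi>) t) $ m)
      = - 4 * pi * (dist_of \<Omega> (\<lambda>x. \<rho> x t) \<phi> - dist_of \<Omega> (\<lambda>x. \<rho> x 0) \<phi>)
        - \<i> * (\<Sum>m\<in>UNIV. dist_of \<Omega> (\<lambda>x. integral_grad \<Omega> cs.u\<^sub>0 x t) (partial_deriv m \<phi>) $ m)"
    if \<phi>: "test_fun \<Omega> \<phi>" and t: "t \<ge> 0" for \<phi> t
  proof -
    have d: "test_fun \<Omega> (partial_deriv m \<phi>)" and dd: "test_fun \<Omega> (partial_deriv m (partial_deriv n \<phi>))" for m n
      by (intro test_fun_partial \<phi>)+
    define J where "J s = (\<Sum>m\<in>UNIV. dist_of \<Omega> (\<lambda>x. j x s $ m) (partial_deriv m \<phi>))" for s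
    define Q where "Q s = (\<Sum>m\<in>UNIV. Sc (cs.pairing (partial_deriv m (partial_deriv m \<phi>)) s))" for s
    have ev: "(\<Sum>m\<in>UNIV. Vec (cs.evolution (partial_deriv m \<phi>) s) $ m) = - 4 * pi * complex_of_real (J s) + \<i> * Q s" if "s \<ge> 0" for s
      unfolding sum_3 cs.evolution_Vec src_Vec[OF d that] J_def Q_def
      by (simp add: sum_3 algebra_simps cs.pairing_partial_commute[OF \<phi> that, of 2 1]
          cs.pairing_partial_commute[OF \<phi> that, of 3 1] cs.pairing_partial_commute[OF \<phi> that, of 3 2])
    have Qc: "continuous_on {0..t} Q"
      unfolding Q_def by (intro continuous_intros continuous_on_subset[OF cs.continuous_on_pairing[OF dd]]) auto
    have evc: "continuous_on {0..t} (\<lambda>s. Vec (cs.evolution (partial_deriv m \<phi>) s) $ m)" for m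
      by (intro continuous_intros continuous_on_subset[OF cs.continuous_on_evolution[OF d]]) auto
    have Jc: "continuous_on {0..t} J"
    proof -
      have "continuous_on {0..t} (\<lambda>s. Re ((\<Sum>m\<in>UNIV. Vec (cs.evolution (partial_deriv m \<phi>) s) $ m) - \<i> * Q s) / (- 4 * pi))"
        by (intro continuous_intros evc Qc) auto
      then show ?thesis by (rule continuous_on_eq) (auto simp: ev)
    qed
    have J: "dist_of \<Omega> (\<lambda>x. \<rho> x t) \<phi> - dist_of \<Omega> (\<lambda>x. \<rho> x 0) \<phi> = (LINT s:{0..t}|lborel. J s)"
      unfolding J_def by (rule continuity_equation_weak[OF \<Omega>_open \<rho>_C1 j_C1 _ \<phi> t]) (rule assms(7))
    have Qi: "(\<Sum>m\<in>UNIV. dist_of \<Omega> (\<lambda>x. integral_grad \<Omega> cs.u\<^sub>0 x t) (partial_deriv m \<phi>) $ m) = - (LINT s:{0..t}|lborel. Q s)"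
    proof -
      have "set_integrable lborel {0..t} (\<lambda>s. Sc (cs.pairing (partial_deriv m (partial_deriv m \<phi>)) s))" for m
        by (intro borel_integrable_atLeastAtMost' continuous_intros continuous_on_subset[OF cs.continuous_on_pairing[OF dd]]) auto
      then have "(\<Sum>m\<in>UNIV. LINT s:{0..t}|lborel. Sc (cs.pairing (partial_deriv m (partial_deriv m \<phi>)) s)) = (LINT s:{0..t}|lborel. Q s)"
        unfolding Q_def set_lebesgue_integral_def set_integrable_def scaleR_sum_right
        by (intro Bochner_Integration.integral_sum[symmetric])
      then show ?thesis
        unfolding cs.integral_grad_nth[OF d t] by (simp add: sum_negf)
    qed
    have "(\<Sum>m\<in>UNIV. Vec (cs.pairing (partial_deriv m \<phi>) t) $ m) = (\<Sum>m\<in>UNIV. LINT s:{0..t}|lborel. Vec (cs.evolution (partial_deriv m \<phi>) s) $ m)"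
    proof (rule sum.cong[OF refl])
      fix m
      show "Vec (cs.pairing (partial_deriv m \<phi>) t) $ m = (LINT s:{0..t}|lborel. Vec (cs.evolution (partial_deriv m \<phi>) s) $ m)"
        unfolding cs.pairing_evolution(2)[OF d t] set_lebesgue_integral_def
        using integral_Vec[OF cs.pairing_evolution(1)[OF d t, unfolded set_integrable_def], of m m] by simp
    qed
    also have "\<dots> = (LINT s:{0..t}|lborel. (\<Sum>m\<in>UNIV. Vec (cs.evolution (partial_deriv m \<phi>) s) $ m))"
      unfolding set_lebesgue_integral_def scaleR_sum_right
      by (rule Bochner_Integration.integral_sum[symmetric])
        (use borel_integrable_atLeastAtMost'[OF evc] in \<open>simp add: set_integrable_def\<close>)
    also have "\<dots> = (LINT s:{0..t}|lborel. - 4 * pi * complex_of_real (J s) + \<i> * Q s)"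
      by (intro set_lebesgue_integral_cong) (auto simp: ev)
    also have "\<dots> = (LINT s:{0..t}|lborel. (- 4 * pi) * complex_of_real (J s)) + (LINT s:{0..t}|lborel. \<i> * Q s)"
      by (intro set_integral_add(2) borel_integrable_atLeastAtMost' continuous_intros Jc Qc)
    also have "\<dots> = (- 4 * pi) * complex_of_real (LINT s:{0..t}|lborel. J s) + \<i> * (LINT s:{0..t}|lborel. Q s)"
    proof -
      have 1: "indicator {0..t} s *\<^sub>R ((- 4 * pi) * complex_of_real (J s)) = (- 4 * pi) * complex_of_real (indicator {0..t} s *\<^sub>R J s)" for s
        by (simp add: scaleR_conv_of_real)
      have 2: "indicator {0..t} s *\<^sub>R (\<i> * Q s) = \<i> * (indicator {0..t} s *\<^sub>R Q s)" for s by simp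
      show ?thesis
        unfolding set_lebesgue_integral_def 1 2 by (simp only: integral_mult_right_zero integral_complex_of_real)
    qed
    finally show ?thesis unfolding J Qi by simp
  qed

  show ?thesis
    unfolding maxwell_solution_def
  proof (intro allI impI conjI)
    fix t :: real assume "t > 0"
    then have t: "t \<ge> 0" by simp
    note EL = cs.field_loc_integrable[OF bR bI S h1 t, folded E]
    note BL = cs.field_loc_integrable[OF bM bR S h2 t, folded B]
    show "loc_integrable \<Omega> (\<lambda>x. E x t)" by (rule EL)
    show "loc_integrable \<Omega> (\<lambda>x. B x t)" by (rule BL)
    {
      fix \<phi> assume \<phi>: "test_fun \<Omega> \<phi>"
      have d: "test_fun \<Omega> (partial_deriv m \<phi>)" for m by (rule test_fun_partial[OF \<phi>])
      define p where "p = (\<Sum>m\<in>UNIV. Vec (cs.pairing (partial_deriv m \<phi>) t) $ m)"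
      define q where "q = (\<Sum>m\<in>UNIV. dist_of \<Omega> (\<lambda>x. integral_grad \<Omega> cs.u\<^sub>0 x t) (partial_deriv m \<phi>) $ m)"
      define s where "s = (\<Sum>m\<in>UNIV. dist_of \<Omega> S (partial_deriv m \<phi>) $ m)"
      have h0: "(\<Sum>m\<in>UNIV. dist_of \<Omega> (grad h) (partial_deriv m \<phi>) $ m) = 0" if "harmonic_on \<Omega> h" for h
        unfolding dist_of_grad_nth[OF that \<Omega>_open d] by (rule harmonic_grad(2)[OF that \<Omega>_open \<phi>])
      have p: "p = - 4 * pi * (dist_of \<Omega> (\<lambda>x. \<rho> x t) \<phi> - dist_of \<Omega> (\<lambda>x. \<rho> x 0) \<phi>) - \<i> * q"
        unfolding p_def q_def by (rule div[OF \<phi> t])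
      have s: "s = - 4 * pi * \<i> * dist_of \<Omega> (\<lambda>x. \<rho> x 0) \<phi>" unfolding s_def by (rule S_div[OF \<phi>])
      have "wdiv \<Omega> (\<lambda>x. E x t) \<phi> = - (\<Sum>m\<in>UNIV. dist_of \<Omega> (\<lambda>x. E x t) (partial_deriv m \<phi>) $ m)"
        unfolding wdiv_def wpartial_nth[OF \<phi> EL] by (rule sum_negf)
      also have "\<dots> = - (Re p - (Im q - Im s) + (\<Sum>m\<in>UNIV. dist_of \<Omega> (grad h\<^sub>1) (partial_deriv m \<phi>) $ m))"
        unfolding E cs.field_pairing(2)[OF bR bI S h1 t d] p_def q_def s_def
        by (simp add: sum.distrib sum_subtractf)
      also have "\<dots> = 4 * pi * dist_of \<Omega> (\<lambda>x. \<rho> x t) \<phi>"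
        unfolding h0[OF h1] p s by (simp add: algebra_simps)
      also have "\<dots> = dist_of \<Omega> (\<lambda>x. 4 * pi * \<rho> x t) \<phi>"
        unfolding dist_of_eq[OF \<phi>] by (simp add: mult_ac flip: integral_mult_right_zero)
      finally show "wdiv \<Omega> (\<lambda>x. E x t) \<phi> = dist_of \<Omega> (\<lambda>x. 4 * pi * \<rho> x t) \<phi>" .
      have "wdiv \<Omega> (\<lambda>x. B x t) \<phi> = - (\<Sum>m\<in>UNIV. dist_of \<Omega> (\<lambda>x. B x t) (partial_deriv m \<phi>) $ m)"
        unfolding wdiv_def wpartial_nth[OF \<phi> BL] by (rule sum_negf)
      also have "\<dots> = - (Im p + (Re q - Re s) + (\<Sum>m\<in>UNIV. dist_of \<Omega> (grad h\<^sub>2) (partial_deriv m \<phi>) $ m))"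
        unfolding B cs.field_pairing(2)[OF bM bR S h2 t d] p_def q_def s_def
        by (simp add: sum.distrib sum_subtractf)
      also have "\<dots> = 0"
        unfolding h0[OF h2] p s by simp
      finally show "wdiv \<Omega> (\<lambda>x. B x t) \<phi> = 0" .
    }
    show "has_wtime_deriv \<Omega> B (\<lambda>\<phi>. - wcurl \<Omega> (\<lambda>x. E x t) \<phi>) t"
      unfolding has_wtime_deriv_def
    proof (intro allI impI)
      fix \<phi> assume \<phi>: "test_fun \<Omega> \<phi>"
      have "Im_vec (Vec (cs.evolution \<phi> t)) + Re_vec (\<chi> m. - Sc (cs.pairing (partial_deriv m \<phi>) t)) = - wcurl \<Omega> (\<lambda>x. E x t) \<phi>"
        unfolding E cs.field_wcurl[OF bR bI S S_curl[OF \<phi>] h1 t \<phi>, simplified]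
        by (simp add: vec_eq_iff forall_3 cs.evolution_Vec src_Vec[OF \<phi> t])
      then show "((\<lambda>s. dist_of \<Omega> (\<lambda>x. B x s) \<phi>) has_vector_derivative - wcurl \<Omega> (\<lambda>x. E x t) \<phi>) (at t within {0..})"
        using cs.field_has_vector_derivative[OF bM bR S h2 t \<phi>] unfolding B by simp
    qed
    show "has_wtime_deriv \<Omega> E (\<lambda>\<phi>. wcurl \<Omega> (\<lambda>x. B x t) \<phi> - dist_of \<Omega> (\<lambda>x. (4 * pi) *\<^sub>R j x t) \<phi>) t"
      unfolding has_wtime_deriv_def
    proof (intro allI impI)
      fix \<phi> assume \<phi>: "test_fun \<Omega> \<phi>"
      have jc: "continuous_on \<Omega> (\<lambda>x. j x t)"
      proof -
        have "continuous_on \<Omega> (\<lambda>x. (\<lambda>(x, t). j x t) (x, t))"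
          by (rule continuous_on_compose2[OF C1_on_continuous[OF j_C1]]) (use t in \<open>auto intro!: continuous_intros\<close>)
        then show ?thesis by simp
      qed
      have jl: "dist_of \<Omega> (\<lambda>x. (4 * pi) *\<^sub>R j x t) \<phi> $ m = 4 * pi * dist_of \<Omega> (\<lambda>x. j x t $ m) \<phi>" for m
        using dist_of_bounded_linear[OF \<phi> bounded_linear_scaleR_right continuous_loc_integrable[OF jc], of "4 * pi"]
          dist_of_bounded_linear[OF \<phi> bounded_linear_vec_nth continuous_loc_integrable[OF jc], of m] by simp
      have "Re_vec (Vec (cs.evolution \<phi> t)) + - Im_vec (\<chi> m. - Sc (cs.pairing (partial_deriv m \<phi>) t))
        = wcurl \<Omega> (\<lambda>x. B x t) \<phi> - dist_of \<Omega> (\<lambda>x. (4 * pi) *\<^sub>R j x t) \<phi>"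
        unfolding B cs.field_wcurl[OF bM bR S S_curl[OF \<phi>] h2 t \<phi>, simplified]
        by (simp add: vec_eq_iff forall_3 cs.evolution_Vec src_Vec[OF \<phi> t] jl)
      then show "((\<lambda>s. dist_of \<Omega> (\<lambda>x. E x s) \<phi>) has_vector_derivative wcurl \<Omega> (\<lambda>x. B x t) \<phi> - dist_of \<Omega> (\<lambda>x. (4 * pi) *\<^sub>R j x t) \<phi>) (at t within {0..})"
        using cs.field_has_vector_derivative[OF bR bI S h1 t \<phi>] unfolding E by simp
    qed
  qed
qed

end
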